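(* Let $d\ge2$, $\mathcal{C}>0$, and let $X$ be a $p_n$-ERW in direction $\ell\in\mathbb{S}^{d-1}$ on $\mathbb{Z}^d$ with $p_n=\mathcal{C}n^{-1/2}\wedge1$. Assume that $$\liminf_{n\to\infty}\frac{|\mathcal{R}_n^X|}{n}\ge\pi_d\quad\text{almost surely.}$$ For $n\ge1$ and $t\ge0$ let $$\hat B_t^n=\frac{X_{\lfloor nt\rfloor}}{n^{1/2}}+(nt-\lfloor nt\rfloor)\frac{X_{\lfloor nt\rfloor+1}-X_{\lfloor nt\rfloor}}{n^{1/2}}.$$ Then, as $n\to\infty$, $\{\hat B^n_\cdot\}_{n\ge1}$ converges in distribution, in $C_{\mathbb{R}^d}[0,\infty)$, to $$\big\{W_t+2\,\mathcal{C}\,\pi_d\,\mathbb{E}[\gamma_1]\sqrt{t}\big\}_{t\ge0},$$ where $W_\cdot$ is a Brownian motion in $\mathbb{R}^d$.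
   Context: Definition of the $p_n$-ERW in direction $\ell$ on $\mathbb{Z}^d$. Let $d\ge 2$, let $\ell\in\mathbb{S}^{d-1}$ (the unit sphere of $\mathbb{R}^d$), let $\|\cdot\|$ be the Euclidean norm, and let $\{p_n\}_{n\ge1}\subset(0,1]$. Let $\{\xi_i\}_{i\ge1}$ and $\{\gamma_i\}_{i\ge1}$ be sequences of $\mathbb{Z}^d$-valued random vectors on a probability space $(\Omega,\mathcal{F},\mathbb{P})$, adapted to a filtration $\{\mathcal{F}_n\}_{n\ge0}$ (with $\mathcal{F}_0$ containing all null sets), such that: (i) there is a constant $K>0$ with $\sup_{n}\|\xi_n\|\le K$ and $\sup_n\|\gamma_n\|\le K$ on every realization; (ii) there is a constant $\lambda>0$ such that for all $n\ge1$, $\mathbb{E}[\xi_n\mid\mathcal{F}_{n-1}]=0$ and $\mathbb{E}[\gamma_n\cdot\ell\mid\mathcal{F}_{n-1}]\ge\lambda$; (iii) $\{\xi_i\}$ is i.i.d. with zero mean vector and finite covariance matrix, and $\mathbb{P}[\xi_i\cdot\ell'=0]<1$ for all $\ell'\in\mathbb{S}^{d-1}$; (iv) $\{\gamma_i\}$ is i.i.d., and the sequences $\{\xi_i\}$ and $\{\gamma_i\}$ are independent of each other. Let $\{U_i\}_{i\ge1}$ be i.i.d. uniform on $[0,1]$, independent of $(\{\xi_i\},\{\gamma_i\})$. Set $X_0=0$, $E_0=\emptyset$, and for $n\ge1$ let $E_n=\{\exists k<n:\ X_k=X_n\}$. The process $X=\{X_n\}_{n\ge0}$ is defined by $$X_n=\sum_{i=1}^n\Big(\mathbf{1}_{E_{i-1}}\xi_i+\mathbf{1}_{E_{i-1}^c\cap\{U_i>p_i\}}\xi_i+\mathbf{1}_{E_{i-1}^c\cap\{U_i\le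 p_i\}}\gamma_i\Big),\quad n\ge1.$$ The range is $\mathcal{R}_n^X=\{X_0,X_1,\dots,X_n\}\subset\mathbb{Z}^d$. The constant $\pi_d$ is the probability that the random walk $Y_n=\sum_{i=1}^n\xi_i$, $Y_0=0$, never returns to the origin. $a\wedge b=\min(a,b)$. $C_{\mathbb{R}^d}[0,\infty)$ is the space of continuous functions $[0,\infty)\to\mathbb{R}^d$ with the metric $\rho(f,g)=\sum_{k\ge1}2^{-k}\sup_{0\le t\le k}(\|f(t)-g(t)\|\wedge1)$. "Brownian motion" means a centered Brownian motion started at $0$, with some (not necessarily identity) covariance matrix. *)

theory Defs
  imports "HOL-Probability.Probability"
begin

section \<open>The space of continuous paths on the half-line\<close>

text \<open>A continuous function on \<open>[0,\<infinity>)\<close> is represented by a function on the reals that is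
  continuous on \<open>{0..}\<close> and extensional there, so that equality of paths is equality on \<open>[0,\<infinity>)\<close>.\<close>

typedef (overloaded) 'a cpath =
  "{f :: real \<Rightarrow> 'a::metric_space. continuous_on {0..} f \<and> f \<in> extensional {0..}}"
  morphisms path_apply Abs_cpath
proof -
  have "restrict (\<lambda>_. undefined) {0..} \<in>
      {f :: real \<Rightarrow> 'a. continuous_on {0..} f \<and> f \<in> extensional {0..}}"
    by (auto simp: restrict_def extensional_def)
  then show ?thesis by blast
qed

text \<open>Only meaningful for functions that are continuous on \<open>{0..}\<close>.\<close>

definition mk_cpath :: "(real \<Rightarrow> 'a::metric_space) \<Rightarrow> 'a cpath" where
  "mk_cpath f = Abs_cpath (restrict f {0..})"

lemma path_apply_mk_cpath:
  assumes "continuous_on {0..} f" "0 \<le> t"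
  shows "path_apply (mk_cpath f) t = f t"
proof -
  have "continuous_on {0..} (restrict f {0..})"
    by (rule continuous_on_eq[OF assms(1)]) simp
  then show ?thesis
    unfolding mk_cpath_def using assms(2) by (subst Abs_cpath_inverse) auto
qed

lemma continuous_on_path_apply: "continuous_on {0..} (path_apply f)"
  using path_apply by auto

lemma cpath_eqI:
  assumes "\<And>t. 0 \<le> t \<Longrightarrow> path_apply f t = path_apply g t"
  shows "f = g"
proof -
  have "path_apply f \<in> extensional {0..}" "path_apply g \<in> extensional {0..}"
    using path_apply[of f] path_apply[of g] by auto
  then have "path_apply f = path_apply g"
    by (rule extensionalityI) (use assms in auto)
  then show ?thesis by (simp add: path_apply_inject)
qed

definition sup_dist_upto :: "real \<Rightarrow> 'a::metric_space cpath \<Rightarrow> 'a cpath \<Rightarrow> real" where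
  "sup_dist_upto T f g = (SUP t\<in>{0..T}. min (dist (path_apply f t) (path_apply g t)) 1)"

lemma sup_dist_upto_upper:
  assumes "0 \<le> t" "t \<le> T"
  shows "min (dist (path_apply f t) (path_apply g t)) 1 \<le> sup_dist_upto T f g"
  unfolding sup_dist_upto_def
  by (rule cSUP_upper) (use assms in \<open>auto intro!: bdd_aboveI[of _ 1]\<close>)

lemma sup_dist_upto_le:
  assumes "0 \<le> T" "\<And>t. 0 \<le> t \<Longrightarrow> t \<le> T \<Longrightarrow> min (dist (path_apply f t) (path_apply g t)) 1 \<le> c"
  shows "sup_dist_upto T f g \<le> c"
  unfolding sup_dist_upto_def by (rule cSUP_least) (use assms in auto)

lemma sup_dist_upto_nonneg: "0 \<le> T \<Longrightarrow> 0 \<le> sup_dist_upto T f g"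
  by (rule order_trans[OF _ sup_dist_upto_upper[of 0]]) auto

lemma sup_dist_upto_triangle:
  assumes "0 \<le> T"
  shows "sup_dist_upto T f g \<le> sup_dist_upto T f h + sup_dist_upto T g h"
proof (rule sup_dist_upto_le[OF assms])
  fix t :: real assume t: "0 \<le> t" "t \<le> T"
  have "min (dist (path_apply f t) (path_apply g t)) 1
      \<le> min (dist (path_apply f t) (path_apply h t)) 1 + min (dist (path_apply g t) (path_apply h t)) 1"
    using dist_triangle2[of "path_apply f t" "path_apply g t" "path_apply h t"]
      zero_le_dist[of "path_apply f t" "path_apply h t"]
      zero_le_dist[of "path_apply g t" "path_apply h t"]
    by linarith
  then show "min (dist (path_apply f t) (path_apply g t)) 1
      \<le> sup_dist_upto T f h + sup_dist_upto T g h"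
    using sup_dist_upto_upper[OF t, of f h] sup_dist_upto_upper[OF t, of g h] by linarith
qed

text \<open>The index \<open>k\<close> of the series is shifted by one, since \<open>suminf\<close> starts at \<open>0\<close>.\<close>

instantiation cpath :: (metric_space) metric_space
begin

definition dist_cpath :: "'a cpath \<Rightarrow> 'a cpath \<Rightarrow> real" where
  "dist_cpath f g = (\<Sum>k. (1 / 2) ^ Suc k * sup_dist_upto (real (Suc k)) f g)"

definition uniformity_cpath :: "('a cpath \<times> 'a cpath) filter" where
  "uniformity_cpath = (INF e\<in>{0<..}. principal {(x, y). dist x y < e})"

definition open_cpath :: "'a cpath set \<Rightarrow> bool" where
  "open_cpath S = (\<forall>x\<in>S. \<forall>\<^sub>F (x', y) in uniformity. x' = x \<longrightarrow> y \<in> S)"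

instance
proof
  fix f g h :: "'a cpath"
  have summ: "summable (\<lambda>k. (1 / 2 :: real) ^ Suc k * sup_dist_upto (real (Suc k)) a b)"
    for a b :: "'a cpath"
  proof (rule summable_comparison_test)
    have "sup_dist_upto (real (Suc k)) a b \<le> 1" for k
      by (rule sup_dist_upto_le) auto
    then show "\<exists>N. \<forall>k\<ge>N. norm ((1 / 2 :: real) ^ Suc k * sup_dist_upto (real (Suc k)) a b)
        \<le> (1 / 2) ^ Suc k"
      by (intro exI[of _ 0] allI impI) (auto simp: abs_mult sup_dist_upto_nonneg mult_left_le)
    show "summable (\<lambda>k. (1 / 2 :: real) ^ Suc k)"
      by (subst summable_Suc_iff) (rule summable_geometric, simp)
  qed
  show "dist f g = 0 \<longleftrightarrow> f = g"
  proof
    assume "dist f g = 0"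
    then have *: "(1 / 2 :: real) ^ Suc k * sup_dist_upto (real (Suc k)) f g = 0" for k
      unfolding dist_cpath_def
      by (subst (asm) suminf_eq_zero_iff[OF summ]) (auto simp: sup_dist_upto_nonneg)
    show "f = g"
    proof (rule cpath_eqI)
      fix t :: real assume "0 \<le> t"
      moreover obtain k where "t \<le> real k" using real_arch_simple by blast
      ultimately have "min (dist (path_apply f t) (path_apply g t)) 1 \<le> sup_dist_upto (real (Suc k)) f g"
        by (intro sup_dist_upto_upper) auto
      also have "\<dots> = 0" using *[of k] by simp
      finally have "min (dist (path_apply f t) (path_apply g t)) 1 \<le> 0" .
      then have "dist (path_apply f t) (path_apply g t) \<le> 0"
        by linarith
      then show "path_apply f t = path_apply g t" by simp
    qed
  next
    assume "f = g"
    then show "dist f g = 0" by (simp add: dist_cpath_def sup_dist_upto_def)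
  qed
  show "dist f g \<le> dist f h + dist g h"
    unfolding dist_cpath_def suminf_add[OF summ summ]
    by (rule suminf_le[OF _ summ summable_add[OF summ summ]])
       (simp only: distrib_left[symmetric], intro mult_left_mono sup_dist_upto_triangle, auto)
qed (fact uniformity_cpath_def open_cpath_def)+

end

section \<open>Convergence in distribution and Brownian motion\<close>

text \<open>The limit is allowed to live on a probability space different from that of the sequence.\<close>

definition converges_in_distribution ::
  "'w measure \<Rightarrow> (nat \<Rightarrow> 'w \<Rightarrow> 'c::metric_space) \<Rightarrow> 'v measure \<Rightarrow> ('v \<Rightarrow> 'c) \<Rightarrow> bool" where
  "converges_in_distribution M Z N Y \<longleftrightarrow>
     (\<forall>n. Z n \<in> borel_measurable M) \<and> Y \<in> borel_measurable N \<and>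
     (\<forall>h :: 'c \<Rightarrow> real. continuous_on UNIV h \<and> bounded (range h) \<longrightarrow>
        (\<lambda>n. \<integral>\<omega>. h (Z n \<omega>) \<partial>M) \<longlonglongrightarrow> (\<integral>\<omega>. h (Y \<omega>) \<partial>N))"

definition centered_normal :: "real \<Rightarrow> real measure" where
  "centered_normal v =
     (if v = 0 then return borel 0 else density lborel (normal_density 0 (sqrt v)))"

text \<open>A centered Gaussian vector with covariance matrix \<open>S\<close>, possibly degenerate: each linear
  functional \<open>u\<close> of it is normal with mean \<open>0\<close> and variance \<open>u \<bullet> (S *v u)\<close>.\<close>

definition centered_gaussian :: "'v measure \<Rightarrow> real^'d^'d \<Rightarrow> ('v \<Rightarrow> real^'d) \<Rightarrow> bool" where
  "centered_gaussian N S Z \<longleftrightarrow>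
     Z \<in> borel_measurable N \<and>
     (\<forall>u. distr N borel (\<lambda>\<omega>. u \<bullet> Z \<omega>) = centered_normal (u \<bullet> (S *v u)))"

definition covariance_matrix :: "real^'d^'d \<Rightarrow> bool" where
  "covariance_matrix S \<longleftrightarrow> transpose S = S \<and> (\<forall>u. 0 \<le> u \<bullet> (S *v u))"

text \<open>A centered Brownian motion started at \<open>0\<close>, with covariance matrix \<open>S\<close> at time \<open>1\<close>.\<close>

definition brownian_motion ::
  "'v measure \<Rightarrow> real^'d^'d \<Rightarrow> (real \<Rightarrow> 'v \<Rightarrow> real^'d) \<Rightarrow> bool" where
  "brownian_motion N S W \<longleftrightarrow>
     prob_space N \<and> covariance_matrix S \<and>
     (\<forall>t\<ge>0. W t \<in> borel_measurable N) \<and>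
     (\<forall>\<omega>\<in>space N. W 0 \<omega> = 0 \<and> continuous_on {0..} (\<lambda>t. W t \<omega>)) \<and>
     (\<forall>s t. 0 \<le> s \<and> s < t \<longrightarrow> centered_gaussian N ((t - s) *\<^sub>R S) (\<lambda>\<omega>. W t \<omega> - W s \<omega>)) \<and>
     (\<forall>(n::nat) \<tau>. 0 \<le> \<tau> 0 \<and> mono \<tau> \<longrightarrow>
        prob_space.indep_vars N (\<lambda>_. borel) (\<lambda>i \<omega>. W (\<tau> (Suc i)) \<omega> - W (\<tau> i) \<omega>) {..<n})"

section \<open>The excited random walk\<close>

definition integer_lattice :: "(real^'d) set" where
  "integer_lattice = {x. \<forall>j. x $ j \<in> \<int>}"

text \<open>The sequences \<open>\<xi>\<close>, \<open>\<gamma>\<close>, \<open>U\<close>, \<open>p\<close> are indexed from \<open>1\<close>; their values at index \<open>0\<close> are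
  unconstrained and unused.\<close>

abbreviation seq_space :: "(nat \<Rightarrow> 'a::topological_space) measure" where
  "seq_space \<equiv> PiM {1..} (\<lambda>_. borel)"

definition as_seq :: "(nat \<Rightarrow> 'w \<Rightarrow> 'a) \<Rightarrow> 'w \<Rightarrow> nat \<Rightarrow> 'a" where
  "as_seq Z \<omega> = (\<lambda>i\<in>{1..}. Z i \<omega>)"

definition iid :: "'w measure \<Rightarrow> (nat \<Rightarrow> 'w \<Rightarrow> 'a::topological_space) \<Rightarrow> bool" where
  "iid M Z \<longleftrightarrow> prob_space.indep_vars M (\<lambda>_. borel) Z {1..} \<and>
     (\<forall>i\<ge>1. distr M borel (Z i) = distr M borel (Z 1))"

definition revisit_event :: "'w measure \<Rightarrow> (nat \<Rightarrow> 'w \<Rightarrow> 'a) \<Rightarrow> nat \<Rightarrow> 'w set" where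
  "revisit_event M X n = {\<omega>\<in>space M. \<exists>k<n. X k \<omega> = X n \<omega>}"

text \<open>The \<open>p\<close>-ERW in direction \<open>l\<close>. Independence of \<open>U\<close> from the pair is stated with generated
  \<open>\<sigma>\<close>-algebras because \<open>indep_var\<close> requires both variables to have the same type. The vector-valued conditional expectation of \<open>\<xi> n\<close> is taken
  componentwise.\<close>

locale excited_random_walk = prob_space M + filtration "space M" F
  for M :: "'w measure" and F :: "nat \<Rightarrow> 'w measure" +
  fixes \<xi> \<gamma> :: "nat \<Rightarrow> 'w \<Rightarrow> real^'d"
    and U :: "nat \<Rightarrow> 'w \<Rightarrow> real"
    and p :: "nat \<Rightarrow> real"
    and l :: "real^'d"
    and X :: "nat \<Rightarrow> 'w \<Rightarrow> real^'d"
  assumes direction: "norm l = 1"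
    and p_range: "\<And>n. n \<ge> 1 \<Longrightarrow> 0 < p n \<and> p n \<le> 1"
    and subalgebra_F: "\<And>n. subalgebra M (F n)"
    and null_sets_F: "null_sets M \<subseteq> sets (F 0)"
    and adapted: "\<And>n. n \<ge> 1 \<Longrightarrow> \<xi> n \<in> borel_measurable (F n) \<and> \<gamma> n \<in> borel_measurable (F n)"
    and lattice_valued:
      "\<And>n \<omega>. n \<ge> 1 \<Longrightarrow> \<omega> \<in> space M \<Longrightarrow> \<xi> n \<omega> \<in> integer_lattice \<and> \<gamma> n \<omega> \<in> integer_lattice"
    and bounded_steps:
      "\<exists>K>0. \<forall>\<omega>\<in>space M. \<forall>n\<ge>1. norm (\<xi> n \<omega>) \<le> K \<and> norm (\<gamma> n \<omega>) \<le> K"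
    and drift:
      "\<exists>c>0. \<forall>n\<ge>1.
         (\<forall>j. AE \<omega> in M. real_cond_exp M (F (n - 1)) (\<lambda>\<omega>. \<xi> n \<omega> $ j) \<omega> = 0) \<and>
         (AE \<omega> in M. real_cond_exp M (F (n - 1)) (\<lambda>\<omega>. \<gamma> n \<omega> \<bullet> l) \<omega> \<ge> c)"
    and iid_\<xi>: "iid M \<xi>"
    and mean_\<xi>: "\<And>n. n \<ge> 1 \<Longrightarrow> integrable M (\<xi> n) \<and> expectation (\<xi> n) = 0"
    and finite_covariance_\<xi>: "\<And>n i j. n \<ge> 1 \<Longrightarrow> integrable M (\<lambda>\<omega>. \<xi> n \<omega> $ i * \<xi> n \<omega> $ j)"
    and nondegenerate_\<xi>:
      "\<And>n l'. n \<ge> 1 \<Longrightarrow> norm l' = 1 \<Longrightarrow> \<P>(\<omega> in M. \<xi> n \<omega> \<bullet> l' = 0) < 1"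
    and iid_\<gamma>: "iid M \<gamma>"
    and indep_\<xi>_\<gamma>: "indep_var seq_space (as_seq \<xi>) seq_space (as_seq \<gamma>)"
    and iid_U: "iid M U"
    and uniform_U: "distr M borel (U 1) = uniform_measure lborel {0..1}"
    and indep_U: "indep_set
        (sets (vimage_algebra (space M) (as_seq U) seq_space))
        (sets (vimage_algebra (space M) (\<lambda>\<omega>. (as_seq \<xi> \<omega>, as_seq \<gamma> \<omega>))
          (seq_space \<Otimes>\<^sub>M seq_space)))"
    and X_0: "\<And>\<omega>. \<omega> \<in> space M \<Longrightarrow> X 0 \<omega> = 0"
    and X_n: "\<And>n \<omega>. n \<ge> 1 \<Longrightarrow> \<omega> \<in> space M \<Longrightarrow>
      X n \<omega> = (\<Sum>i=1..n.
          indicat_real (revisit_event M X (i - 1)) \<omega> *\<^sub>R \<xi> i \<omega>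
        + indicat_real ((space M - revisit_event M X (i - 1)) \<inter> {\<omega>. U i \<omega> > p i}) \<omega> *\<^sub>R \<xi> i \<omega>
        + indicat_real ((space M - revisit_event M X (i - 1)) \<inter> {\<omega>. U i \<omega> \<le> p i}) \<omega> *\<^sub>R \<gamma> i \<omega>)"

definition walk_range :: "(nat \<Rightarrow> 'w \<Rightarrow> 'a) \<Rightarrow> nat \<Rightarrow> 'w \<Rightarrow> 'a set" where
  "walk_range X n \<omega> = (\<lambda>k. X k \<omega>) ` {0..n}"

definition no_return_prob :: "'w measure \<Rightarrow> (nat \<Rightarrow> 'w \<Rightarrow> 'a::comm_monoid_add) \<Rightarrow> real" where
  "no_return_prob M \<xi> = \<P>(\<omega> in M. \<forall>n\<ge>1. (\<Sum>i=1..n. \<xi> i \<omega>) \<noteq> 0)"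

section \<open>The rescaled, linearly interpolated walk\<close>

definition rescaled :: "(nat \<Rightarrow> 'w \<Rightarrow> 'a::real_normed_vector) \<Rightarrow> nat \<Rightarrow> 'w \<Rightarrow> real \<Rightarrow> 'a" where
  "rescaled X n \<omega> t =
     X (nat \<lfloor>real n * t\<rfloor>) \<omega> /\<^sub>R sqrt (real n)
     + (real n * t - of_int \<lfloor>real n * t\<rfloor>) *\<^sub>R
         ((X (nat \<lfloor>real n * t\<rfloor> + 1) \<omega> - X (nat \<lfloor>real n * t\<rfloor>) \<omega>) /\<^sub>R sqrt (real n))"

lemma continuous_on_interpolation:
  fixes x :: "nat \<Rightarrow> 'a::real_normed_vector"
  defines "g \<equiv> \<lambda>s::real. x (nat \<lfloor>s\<rfloor>) + (s - of_int \<lfloor>s\<rfloor>) *\<^sub>R (x (nat \<lfloor>s\<rfloor> + 1) - x (nat \<lfloor>s\<rfloor>))"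
  shows "continuous_on {0..} g"
proof -
  have piece: "continuous_on {real k..real (Suc k)} g" for k
  proof -
    have eq: "g s = x k + (s - real k) *\<^sub>R (x (Suc k) - x k)" if "s \<in> {real k..real (Suc k)}" for s
    proof (cases "s = real (Suc k)")
      case True
      have "\<lfloor>s\<rfloor> = int (Suc k)" using True by simp
      then show ?thesis using True by (simp add: g_def nat_add_distrib)
    next
      case False
      then have "\<lfloor>s\<rfloor> = int k" using that by (intro floor_unique) auto
      then show ?thesis by (simp add: g_def)
    qed
    have "continuous_on {real k..real (Suc k)} (\<lambda>s. x k + (s - real k) *\<^sub>R (x (Suc k) - x k))"
      by (intro continuous_intros)
    then show ?thesis by (rule continuous_on_eq) (simp only: eq)
  qed
  have upto: "continuous_on {0..real k} g" for k
  proof (induction k)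
    case (Suc k)
    have "{0..real (Suc k)} = {0..real k} \<union> {real k..real (Suc k)}" by auto
    then show ?case
      using continuous_on_closed_Un[OF _ _ Suc.IH piece[of k]] by simp
  qed simp
  show ?thesis
    unfolding continuous_on_eq_continuous_within
  proof
    fix t :: real assume t: "t \<in> {0..}"
    obtain k :: nat where k: "t < real k" using reals_Archimedean2 by blast
    have "at t within {0..} = at t within {0..real k}"
      by (rule at_within_nhd[of _ "{..<real k}"]) (use k in auto)
    moreover have "continuous (at t within {0..real k}) g"
      using upto[of k] t k by (auto simp: continuous_on_eq_continuous_within)
    ultimately show "continuous (at t within {0..}) g" by (simp add: continuous_within)
  qed
qed

lemma continuous_on_rescaled: "continuous_on {0..} (rescaled X n \<omega>)"
proof -
  let ?x = "\<lambda>k. X k \<omega> /\<^sub>R sqrt (real n)"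
  let ?g = "\<lambda>s::real. ?x (nat \<lfloor>s\<rfloor>) + (s - of_int \<lfloor>s\<rfloor>) *\<^sub>R (?x (nat \<lfloor>s\<rfloor> + 1) - ?x (nat \<lfloor>s\<rfloor>))"
  have "continuous_on {0..} (?g \<circ> (\<lambda>t. real n * t))"
  proof (rule continuous_on_compose)
    show "continuous_on ((\<lambda>t. real n * t) ` {0..}) ?g"
      by (rule continuous_on_subset[OF continuous_on_interpolation[of ?x]]) auto
  qed (intro continuous_intros)
  then show ?thesis
    by (simp add: rescaled_def[abs_def] comp_def scaleR_diff_right)
qed

end

theory Submission
  imports Defs
begin

text \<open>Write \<open>X = Y + D\<close>, where \<open>Y\<close> is the random walk with steps \<open>\<xi>\<close> and the excess \<open>D\<close> is the sum of
  \<open>\<gamma> i - \<xi> i\<close> over the excited steps. By Donsker's theorem the rescaled \<open>Y\<close> converges to a Brownian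
  motion whose covariance is that of one step (\<open>centered_walk.donsker\<close>). It remains to see that the
  excess is close to its deterministic limit, uniformly on bounded time intervals and with high
  probability (\<open>excess_close\<close>); adding a fixed continuous function is an isometry of the path space,
  so the two statements can be added.

  A step is excited if the walk is at a fresh site and its coin succeeds, which happens with
  probability \<open>p i\<close> independently of the past. Replacing each summand of the excess by its conditional
  mean costs a martingale with variance of order \<open>p 1 + \<dots> + p n \<approx> 2 C \<surd>n\<close>, which is negligible against
  \<open>\<surd>n\<close> (\<open>martingale_second_moment\<close>, \<open>excited_sum_L1\<close>). What remains is \<open>E \<gamma> 1\<close> times the sum of \<open>p i\<close>
  over the fresh times. The number of fresh times up to \<open>n\<close> is the size of the range, so if the range
  grows like \<open>\<pi> n\<close>, with \<open>\<pi>\<close> the probability of no return, summation by parts turns this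
  into \<open>\<pi> \<cdot> 2 C \<surd>n\<close> (\<open>fresh_weighted_L1\<close>).

  Only the lower half of this law of large numbers is assumed. The upper half holds in mean
  (\<open>fresh_count_expectation_le\<close>): count each site at its last visit; between time \<open>k\<close> and \<open>k + m\<close> no
  coin succeeds, except with probability at most \<open>m\<close> times \<open>p (k + 1)\<close>, and then not
  returning to the site of time \<open>k\<close> is an event for \<open>Y\<close>, whose probability tends to \<open>\<pi>\<close> as \<open>m\<close> grows.
  A lower bound almost surely and an upper bound in mean give convergence in mean (\<open>fresh_count_L1\<close>).

  For the Brownian limit, the tool is the characteristic functions of finitely many increments: they
  determine laws and their convergence (\<open>char_function_convergence\<close>, by Stone--Weierstrass) and they
  detect independence (\<open>indep_varsI_char_function\<close>). Passing from finitely many times to paths is done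
  by dyadic chaining with fourth moments (\<open>close_to_sample_polygon\<close>): it yields the uniform limit in
  L\'evy's construction of Brownian motion (\<open>brownian_motion_exists\<close>), and its
  bounds, which are uniform in \<open>n\<close>, take the place of tightness in Donsker's theorem. Weak convergence
  is tested on bounded Lipschitz functions only (\<open>converges_in_distributionI_lipschitz\<close>), so that
  replacing a path by a nearby one changes expectations little.\<close>

section \<open>Polygonal paths and the metric of the path space\<close>

definition interpolate :: "(nat \<Rightarrow> 'a::real_normed_vector) \<Rightarrow> real \<Rightarrow> 'a" where
  "interpolate x s = x (nat \<lfloor>s\<rfloor>) + (s - of_int \<lfloor>s\<rfloor>) *\<^sub>R (x (nat \<lfloor>s\<rfloor> + 1) - x (nat \<lfloor>s\<rfloor>))"

lemma continuous_on_interpolate: "continuous_on {0..} (interpolate x)"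
  using continuous_on_interpolation[of x] by (simp add: interpolate_def[abs_def])

lemma interpolate_of_nat [simp]: "interpolate x (real k) = x k"
  by (simp add: interpolate_def)

lemma interpolate_eq:
  assumes "real k \<le> s" "s \<le> real k + 1"
  shows "interpolate x s = x k + (s - real k) *\<^sub>R (x (Suc k) - x k)"
proof (cases "s = real k + 1")
  case True
  then have "s = real (Suc k)" by simp
  then show ?thesis by (simp only: interpolate_of_nat) simp
next
  case False
  then have "\<lfloor>s\<rfloor> = int k" using assms by (intro floor_unique) auto
  then show ?thesis by (simp add: interpolate_def)
qed

lemma interpolate_diff: "interpolate (\<lambda>k. x k - y k) s = interpolate x s - interpolate y s"
  by (simp add: interpolate_def algebra_simps)

lemma interpolate_add: "interpolate (\<lambda>k. x k + y k) s = interpolate x s + interpolate y s"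
  by (simp add: interpolate_def algebra_simps)

lemma interpolate_scaleR: "interpolate (\<lambda>k. c *\<^sub>R x k) s = c *\<^sub>R interpolate x s"
  by (simp add: interpolate_def algebra_simps)

text \<open>An interpolated value is a convex combination of two neighbouring nodes, so any ball that
  contains both nodes contains it.\<close>

lemma interpolate_dist_le:
  assumes "0 \<le> s" "norm (x (nat \<lfloor>s\<rfloor>) - a) \<le> e" "norm (x (nat \<lfloor>s\<rfloor> + 1) - a) \<le> e"
  shows "norm (interpolate x s - a) \<le> e"
proof -
  define \<theta> where "\<theta> = s - of_int \<lfloor>s\<rfloor>"
  define k where "k = nat \<lfloor>s\<rfloor>"
  have t: "0 \<le> \<theta>" "\<theta> \<le> 1"
    unfolding \<theta>_def by linarith+
  have "interpolate x s - a = (1 - \<theta>) *\<^sub>R (x k - a) + \<theta> *\<^sub>R (x (k + 1) - a)"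
    by (simp add: interpolate_def \<theta>_def[symmetric] k_def algebra_simps)
  also have "norm \<dots> \<le> (1 - \<theta>) * norm (x k - a) + \<theta> * norm (x (k + 1) - a)"
    using t by (intro order_trans[OF norm_triangle_ineq]) simp
  also have "\<dots> \<le> (1 - \<theta>) * e + \<theta> * e"
    using assms t by (intro add_mono mult_left_mono) (auto simp: k_def)
  finally show ?thesis by (simp add: algebra_simps)
qed

definition polygon :: "real \<Rightarrow> (nat \<Rightarrow> 'a::real_normed_vector) \<Rightarrow> 'a cpath" where
  "polygon L x = mk_cpath (\<lambda>t. interpolate x (L * t))"

lemma continuous_on_interpolate_scaled:
  "0 \<le> L \<Longrightarrow> continuous_on {0..} (\<lambda>t. interpolate x (L * t))"
  by (rule continuous_on_compose2[OF continuous_on_interpolate]) (auto intro!: continuous_intros)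

lemma path_apply_polygon: "0 \<le> L \<Longrightarrow> 0 \<le> t \<Longrightarrow> path_apply (polygon L x) t = interpolate x (L * t)"
  unfolding polygon_def by (rule path_apply_mk_cpath[OF continuous_on_interpolate_scaled])

lemma rescaled_eq_interpolate:
  "rescaled X n \<omega> t = interpolate (\<lambda>k. X k \<omega> /\<^sub>R sqrt (real n)) (real n * t)"
  by (simp add: rescaled_def interpolate_def scaleR_diff_right)

lemma mk_cpath_rescaled: "mk_cpath (rescaled X n \<omega>) = polygon (real n) (\<lambda>k. X k \<omega> /\<^sub>R sqrt (real n))"
  by (simp add: polygon_def rescaled_eq_interpolate[abs_def])

lemma sup_dist_upto_le_1: "0 \<le> T \<Longrightarrow> sup_dist_upto T f g \<le> 1"
  by (rule sup_dist_upto_le) auto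

lemma summable_cpath_dist:
  "summable (\<lambda>k. (1 / 2 :: real) ^ Suc k * sup_dist_upto (real (Suc k)) f g)"
proof (rule summable_comparison_test)
  show "\<exists>N. \<forall>k\<ge>N. norm ((1 / 2 :: real) ^ Suc k * sup_dist_upto (real (Suc k)) f g) \<le> (1 / 2) ^ Suc k"
    by (intro exI[of _ 0] allI impI)
       (auto simp: abs_mult sup_dist_upto_nonneg sup_dist_upto_le_1 mult_left_le)
  show "summable (\<lambda>k. (1 / 2 :: real) ^ Suc k)"
    by (subst summable_Suc_iff) (rule summable_geometric, simp)
qed

text \<open>Uniform closeness on \<open>[0, K]\<close> controls the metric up to the tail \<open>\<Sum>k\<ge>K. 2^(-k-1) = 2^(-K)\<close>.\<close>

lemma cpath_dist_le:
  assumes "0 \<le> e" "\<And>t. 0 \<le> t \<Longrightarrow> t \<le> real K \<Longrightarrow> dist (path_apply f t) (path_apply g t) \<le> e"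
  shows "dist f g \<le> e + (1 / 2) ^ K"
proof -
  let ?h = "\<lambda>k. (1 / 2 :: real) ^ Suc k"
  let ?b = "\<lambda>k. if k < K then 0 else ?h k"
  have s1: "(\<lambda>k. ?h k * e) sums (1 * e)"
    by (rule sums_mult2) (rule power_half_series)
  have "(\<lambda>k. (1 / 2) ^ K * ?h k) sums ((1 / 2) ^ K * 1)"
    by (rule sums_mult) (rule power_half_series)
  then have "(\<lambda>k. ?b (k + K)) sums ((1 / 2) ^ K)"
    by (simp add: power_add ac_simps)
  then have s2: "?b sums ((1 / 2) ^ K)"
    by (subst (asm) sums_iff_shift) simp
  have le: "?h k * sup_dist_upto (real (Suc k)) f g \<le> ?h k * e + ?b k" for k
  proof (cases "k < K")
    case True
    have "sup_dist_upto (real (Suc k)) f g \<le> e"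
    proof (rule sup_dist_upto_le)
      fix t assume "0 \<le> t" "t \<le> real (Suc k)"
      then show "min (dist (path_apply f t) (path_apply g t)) 1 \<le> e"
        using assms(2)[of t] True by (simp add: min_le_iff_disj)
    qed simp
    then show ?thesis using True by simp
  next
    case False
    have "?h k * sup_dist_upto (real (Suc k)) f g \<le> ?h k * 1"
      by (intro mult_left_mono sup_dist_upto_le_1) auto
    moreover have "0 \<le> ?h k * e" using assms(1) by simp
    ultimately show ?thesis using False by (simp only: if_False)
  qed
  have "dist f g \<le> (\<Sum>k. ?h k * e + ?b k)"
    unfolding dist_cpath_def
    using le sums_add[OF s1 s2] by (intro suminf_le summable_cpath_dist) (auto simp: sums_iff)
  also have "\<dots> = e + (1 / 2) ^ K"
    using sums_add[OF s1 s2] by (simp add: sums_iff)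
  finally show ?thesis .
qed

lemma min_dist_apply_le_cpath_dist:
  assumes "0 \<le> t" "t \<le> real (Suc k)"
  shows "min (dist (path_apply f t) (path_apply g t)) 1 \<le> 2 ^ Suc k * dist f g"
proof -
  have "(1 / 2) ^ Suc k * sup_dist_upto (real (Suc k)) f g
      \<le> (\<Sum>k. (1 / 2) ^ Suc k * sup_dist_upto (real (Suc k)) f g)"
    using sum_le_suminf[OF summable_cpath_dist, of "{k}" f g]
    by (simp add: sup_dist_upto_nonneg del: of_nat_Suc power_Suc)
  then have "sup_dist_upto (real (Suc k)) f g \<le> 2 ^ Suc k * dist f g"
    unfolding dist_cpath_def[symmetric] by (simp add: field_simps del: of_nat_Suc)
  with sup_dist_upto_upper[OF assms, of f g] show ?thesis by linarith
qed

lemma cpath_tendstoI: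
  assumes "\<And>K e. 0 < e \<Longrightarrow>
    eventually (\<lambda>n. \<forall>t. 0 \<le> t \<and> t \<le> real K \<longrightarrow> dist (path_apply (f n) t) (path_apply g t) \<le> e) F"
  shows "(f \<longlongrightarrow> g) F"
proof (rule tendstoI)
  fix e :: real assume e: "0 < e"
  obtain K where K: "(1 / 2 :: real) ^ K < e / 2"
    using real_arch_pow_inv[of "e / 2" "1 / 2"] e by auto
  have "\<forall>\<^sub>F n in F. \<forall>t. 0 \<le> t \<and> t \<le> real K \<longrightarrow> dist (path_apply (f n) t) (path_apply g t) \<le> e / 2"
    by (rule assms) (use e in simp)
  then show "\<forall>\<^sub>F n in F. dist (f n) g < e"
  proof (eventually_elim)
    case (elim n)
    have "dist (f n) g \<le> e / 2 + (1 / 2) ^ K"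
      using e elim by (intro cpath_dist_le) auto
    with K show ?case by linarith
  qed
qed

lemma continuous_on_eval: "0 \<le> t \<Longrightarrow> continuous_on UNIV (\<lambda>f. path_apply f t)"
proof -
  assume t: "0 \<le> t"
  obtain k where k: "t \<le> real (Suc k)"
    by (metis real_arch_simple of_nat_Suc le_add_same_cancel1 order_trans zero_le_one add.commute)
  show ?thesis
    unfolding continuous_on_iff
  proof safe
    fix f :: "'a cpath" and e :: real assume e: "0 < e"
    show "\<exists>d>0. \<forall>g\<in>UNIV. dist g f < d \<longrightarrow> dist (path_apply g t) (path_apply f t) < e"
    proof (intro exI[of _ "min e 1 / 2 ^ Suc k"] conjI ballI impI)
      fix g assume "dist g f < min e 1 / 2 ^ Suc k"
      then have "2 ^ Suc k * dist g f < min e 1"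
        by (simp add: pos_less_divide_eq mult.commute)
      with min_dist_apply_le_cpath_dist[OF t k, of g f]
      show "dist (path_apply g t) (path_apply f t) < e"
        by linarith
    qed (use e in simp)
  qed
qed

lemma measurable_eval: "0 \<le> t \<Longrightarrow> (\<lambda>f. path_apply f t) \<in> borel_measurable borel"
  by (intro borel_measurable_continuous_onI continuous_on_eval)

text \<open>On a bounded time interval a polygon depends on finitely many nodes only, which makes it a
  continuous function of its node sequence for the product topology.\<close>

lemma polygon_nodes_le:
  assumes "0 \<le> L" "0 \<le> e" "\<And>j. real j \<le> L * real K + 1 \<Longrightarrow> norm (x j - y j) \<le> e"
    "0 \<le> t" "t \<le> real K"
  shows "dist (path_apply (polygon L x) t) (path_apply (polygon L y) t) \<le> e"
proof -
  have Lt: "0 \<le> L * t" "L * t \<le> L * real K"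
    using assms by (auto intro: mult_left_mono)
  have "norm (interpolate (\<lambda>k. x k - y k) (L * t) - 0) \<le> e"
  proof (rule interpolate_dist_le[OF Lt(1)])
    have "real (nat \<lfloor>L * t\<rfloor>) \<le> L * t" using Lt by simp
    then have "real (nat \<lfloor>L * t\<rfloor>) \<le> L * real K" "real (nat \<lfloor>L * t\<rfloor> + 1) \<le> L * real K + 1"
      using Lt by linarith+
    then show "norm (x (nat \<lfloor>L * t\<rfloor>) - y (nat \<lfloor>L * t\<rfloor>) - 0) \<le> e"
      "norm (x (nat \<lfloor>L * t\<rfloor> + 1) - y (nat \<lfloor>L * t\<rfloor> + 1) - 0) \<le> e"
      unfolding diff_zero by (auto intro!: assms(3) simp del: of_nat_nat of_nat_Suc)
  qed
  then show ?thesis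
    using assms by (simp add: path_apply_polygon dist_norm interpolate_diff)
qed

lemma continuous_on_polygon:
  assumes "0 \<le> L"
  shows "continuous_on UNIV (\<lambda>x::nat \<Rightarrow> 'a::real_normed_vector. polygon L x)"
proof -
  have "((\<lambda>x. polygon L x) \<longlongrightarrow> polygon L x0) (at x0)" for x0 :: "nat \<Rightarrow> 'a"
  proof (rule cpath_tendstoI)
    fix K :: nat and e :: real assume e: "0 < e"
    have "continuous_on UNIV (\<lambda>x::nat \<Rightarrow> 'a. x j)" for j
      by (rule continuous_on_product_coordinates)
    then have "isCont (\<lambda>x::nat \<Rightarrow> 'a. x j) x0" for j
      by (metis UNIV_I continuous_on_eq_continuous_at open_UNIV)
    then have "\<forall>\<^sub>F x in at x0. dist (x j) (x0 j) < e" for j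
      unfolding isCont_def by (rule tendstoD) (rule e)
    then have "\<forall>\<^sub>F x in at x0. \<forall>j\<in>{..nat \<lceil>L * real K + 1\<rceil>}. dist (x j) (x0 j) < e"
      by (intro eventually_ball_finite) auto
    then show "\<forall>\<^sub>F x in at x0. \<forall>t. 0 \<le> t \<and> t \<le> real K \<longrightarrow>
        dist (path_apply (polygon L x) t) (path_apply (polygon L x0) t) \<le> e"
    proof eventually_elim
      case (elim x)
      have "norm (x j - x0 j) \<le> e" if "real j \<le> L * real K + 1" for j
      proof -
        have "j \<le> nat \<lceil>L * real K + 1\<rceil>" using that by linarith
        then show ?thesis using elim by (auto simp: dist_norm less_imp_le)
      qed
      then show ?case
        by (intro allI impI polygon_nodes_le[where K = K]) (use assms e in auto)
    qed
  qed
  then show ?thesis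
    by (simp add: continuous_on_def)
qed

lemma measurable_polygon:
  fixes Z :: "nat \<Rightarrow> 'w \<Rightarrow> 'a::euclidean_space"
  assumes "0 \<le> L" "\<And>j. Z j \<in> borel_measurable M"
  shows "(\<lambda>\<omega>. polygon L (\<lambda>j. Z j \<omega>)) \<in> borel_measurable M"
proof (rule measurable_compose[where N = borel and g = "polygon L" and f = "\<lambda>\<omega> j. Z j \<omega>"])
  show "(\<lambda>\<omega> j. Z j \<omega>) \<in> borel_measurable M"
    by (rule measurable_coordinatewise_then_product) (rule assms)
  show "polygon L \<in> borel_measurable (borel :: (nat \<Rightarrow> 'a) measure)"
    by (rule borel_measurable_continuous_onI[OF continuous_on_polygon[OF assms(1)]])
qed

definition sample_polygon :: "real \<Rightarrow> 'a::real_normed_vector cpath \<Rightarrow> 'a cpath" where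
  "sample_polygon L f = polygon L (\<lambda>j. path_apply f (real j / L))"

text \<open>A path is uniformly continuous on \<open>[0, K + 1]\<close>, so it is close to the polygons through its
  values on a fine grid.\<close>

lemma sample_polygon_tendsto:
  assumes "filterlim L at_top F"
  shows "((\<lambda>n. sample_polygon (L n) f) \<longlongrightarrow> f) F"
proof (rule cpath_tendstoI)
  fix K :: nat and e :: real assume e: "0 < e"
  have "uniformly_continuous_on {0..real K + 1} (path_apply f)"
    by (intro compact_uniformly_continuous continuous_on_subset[OF continuous_on_path_apply]) auto
  then obtain d where d: "d > 0" "\<And>s t. s \<in> {0..real K + 1} \<Longrightarrow> t \<in> {0..real K + 1} \<Longrightarrow>
      dist s t < d \<Longrightarrow> dist (path_apply f s) (path_apply f t) < e"
    unfolding uniformly_continuous_on_def using e by metis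
  have "\<forall>\<^sub>F n in F. L n > max 1 (1 / d)"
    using assms filterlim_at_top_dense by blast
  then show "\<forall>\<^sub>F n in F. \<forall>t. 0 \<le> t \<and> t \<le> real K \<longrightarrow>
      dist (path_apply (sample_polygon (L n) f) t) (path_apply f t) \<le> e"
  proof (eventually_elim, safe)
    fix n t assume Ln: "max 1 (1 / d) < L n" and t: "0 \<le> t" "t \<le> real K"
    let ?L = "L n"
    have L: "?L > 1" "1 / ?L < d" using Ln d by (auto simp: field_simps)
    let ?k = "nat \<lfloor>?L * t\<rfloor>"
    have "0 \<le> ?L * t" using t L by auto
    then have k: "real ?k \<le> ?L * t" "?L * t < real ?k + 1" by linarith+
    have close: "norm (path_apply f (real j / ?L) - path_apply f t) \<le> e" if "j = ?k \<or> j = ?k + 1" for j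
    proof -
      have "\<bar>real j - ?L * t\<bar> \<le> 1" using that k by (elim disjE) (simp_all only: of_nat_add of_nat_1 abs_le_iff, linarith+)
      then have "\<bar>real j / ?L - t\<bar> \<le> 1 / ?L"
        using L by (simp add: field_simps abs_le_iff)
      then have *: "\<bar>real j / ?L - t\<bar> < d" "\<bar>real j / ?L - t\<bar> \<le> 1" using L by (auto simp: field_simps)
      have "real j / ?L \<in> {0..real K + 1}" using * t L by (auto simp: abs_le_iff)
      then show ?thesis
        using d(2)[of "real j / ?L" t] * t by (auto simp: dist_norm less_imp_le)
    qed
    have "norm (interpolate (\<lambda>j. path_apply f (real j / ?L)) (?L * t) - path_apply f t) \<le> e"
      by (rule interpolate_dist_le) (use close[of ?k] close[of "?k + 1"] t L in \<open>simp_all del: of_nat_nat\<close>)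
    then show "dist (path_apply (sample_polygon ?L f) t) (path_apply f t) \<le> e"
      using t L by (simp add: sample_polygon_def path_apply_polygon dist_norm)
  qed
qed

text \<open>Every path is the limit of polygons through finitely many of its values on bounded intervals, so
  the Borel sets of the path space are generated by the evaluations.\<close>

lemma cpath_measurableI:
  fixes Z :: "'w \<Rightarrow> ('a::euclidean_space) cpath"
  assumes "\<And>t. 0 \<le> t \<Longrightarrow> (\<lambda>\<omega>. path_apply (Z \<omega>) t) \<in> borel_measurable M"
  shows "Z \<in> borel_measurable M"
proof (rule borel_measurable_LIMSEQ_metric)
  show "(\<lambda>\<omega>. sample_polygon (real n) (Z \<omega>)) \<in> borel_measurable M" for n
    unfolding sample_polygon_def by (rule measurable_polygon) (auto intro: assms)
  show "(\<lambda>n. sample_polygon (real n) (Z \<omega>)) \<longlonglongrightarrow> Z \<omega>" for \<omega>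
    by (rule sample_polygon_tendsto) (rule filterlim_real_sequentially)
qed

definition translate :: "(real \<Rightarrow> 'a) \<Rightarrow> 'a::real_normed_vector cpath \<Rightarrow> 'a cpath" where
  "translate e f = mk_cpath (\<lambda>t. path_apply f t + e t)"

lemma path_apply_translate:
  "continuous_on {0..} e \<Longrightarrow> 0 \<le> t \<Longrightarrow> path_apply (translate e f) t = path_apply f t + e t"
  unfolding translate_def
  by (rule path_apply_mk_cpath) (auto intro!: continuous_intros continuous_on_path_apply)

text \<open>Composition with an isometry preserves the Lipschitz test functions.\<close>

lemma dist_translate:
  assumes "continuous_on {0..} e"
  shows "dist (translate e f) (translate e g) = dist f g"
proof -
  have "sup_dist_upto T (translate e f) (translate e g) = sup_dist_upto T f g" for T
    unfolding sup_dist_upto_def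
    by (intro SUP_cong refl) (use assms in \<open>auto simp: path_apply_translate dist_norm\<close>)
  then show ?thesis by (simp add: dist_cpath_def)
qed

lemma continuous_on_translate: "continuous_on {0..} e \<Longrightarrow> continuous_on UNIV (translate e)"
  by (auto simp: continuous_on_iff dist_translate)

section \<open>Weak convergence tested on smaller classes of functions\<close>

lemma (in prob_space) integral_diff_le_off_event:
  fixes f g :: "'a \<Rightarrow> real"
  assumes f: "f \<in> borel_measurable M" "\<And>\<omega>. \<bar>f \<omega>\<bar> \<le> c"
    and g: "g \<in> borel_measurable M" "\<And>\<omega>. \<bar>g \<omega>\<bar> \<le> c'"
    and E: "E \<in> events" and ab: "0 \<le> a" "0 \<le> b"
    and off: "\<And>\<omega>. \<omega> \<in> space M \<Longrightarrow> \<omega> \<notin> E \<Longrightarrow> \<bar>f \<omega> - g \<omega>\<bar> \<le> a"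
    and on: "\<And>\<omega>. \<omega> \<in> E \<Longrightarrow> \<bar>f \<omega> - g \<omega>\<bar> \<le> b"
  shows "\<bar>(\<integral>\<omega>. f \<omega> \<partial>M) - (\<integral>\<omega>. g \<omega> \<partial>M)\<bar> \<le> a + b * prob E"
proof -
  have int: "integrable M f" "integrable M g"
    using integrable_const_bound[of f c] integrable_const_bound[of g c'] f g by auto
  have "\<bar>(\<integral>\<omega>. f \<omega> \<partial>M) - (\<integral>\<omega>. g \<omega> \<partial>M)\<bar> = \<bar>\<integral>\<omega>. f \<omega> - g \<omega> \<partial>M\<bar>"
    using int by simp
  also have "\<dots> \<le> (\<integral>\<omega>. \<bar>f \<omega> - g \<omega>\<bar> \<partial>M)"
    by (rule integral_abs_bound)
  also have "\<dots> \<le> (\<integral>\<omega>. a + b * indicator E \<omega> \<partial>M)"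
  proof (rule integral_mono)
    show "\<bar>f \<omega> - g \<omega>\<bar> \<le> a + b * indicator E \<omega>" if "\<omega> \<in> space M" for \<omega>
      using off[OF that] on[of \<omega>] ab by (cases "\<omega> \<in> E") auto
  qed (use int E in \<open>auto intro!: integrable_add integrable_mult_right integrable_real_indicator
      simp: emeasure_eq_measure\<close>)
  also have "\<dots> = (\<integral>\<omega>. a \<partial>M) + (\<integral>\<omega>. b * indicator E \<omega> \<partial>M)"
    using E by (intro Bochner_Integration.integral_add) (auto intro!: integrable_mult_right integrable_real_indicator
        simp: emeasure_eq_measure)
  also have "\<dots> = a + b * prob E"
    using E by (simp add: prob_space)
  finally show ?thesis .
qed

text \<open>The comparison is through an exceptional event, which need not be the event that the distance
  is large: the latter may fail to be measurable in a nonseparable space.\<close>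

lemma (in prob_space) integral_lipschitz_diff_le:
  fixes A B :: "'a \<Rightarrow> 'c::metric_space" and h :: "'c \<Rightarrow> real"
  assumes "A \<in> borel_measurable M" "B \<in> borel_measurable M"
    and h: "lam-lipschitz_on UNIV h" "\<And>x. \<bar>h x\<bar> \<le> c"
    and E: "E \<in> events" and d: "0 \<le> d"
      "\<And>\<omega>. \<omega> \<in> space M \<Longrightarrow> \<omega> \<notin> E \<Longrightarrow> dist (A \<omega>) (B \<omega>) \<le> d"
  shows "\<bar>(\<integral>\<omega>. h (A \<omega>) \<partial>M) - (\<integral>\<omega>. h (B \<omega>) \<partial>M)\<bar> \<le> lam * d + 2 * c * prob E"
proof -
  have [measurable]: "h \<in> borel_measurable borel"
    by (intro borel_measurable_continuous_onI lipschitz_on_continuous_on[OF h(1)])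
  note [measurable] = assms(1,2)
  have lam: "0 \<le> lam" by (rule lipschitz_on_nonneg[OF h(1)])
  have c: "0 \<le> c" using h(2)[of undefined] by linarith
  show ?thesis
  proof (rule integral_diff_le_off_event)
    show "\<bar>h (A \<omega>) - h (B \<omega>)\<bar> \<le> lam * d" if "\<omega> \<in> space M" "\<omega> \<notin> E" for \<omega>
    proof -
      have "\<bar>h (A \<omega>) - h (B \<omega>)\<bar> \<le> lam * dist (A \<omega>) (B \<omega>)"
        using lipschitz_onD[OF h(1), of "A \<omega>" "B \<omega>"] by (simp add: dist_real_def)
      also have "\<dots> \<le> lam * d" using d(2)[OF that] lam by (rule mult_left_mono)
      finally show ?thesis .
    qed
    show "\<bar>h (A \<omega>) - h (B \<omega>)\<bar> \<le> 2 * c" for \<omega>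
      using h(2)[of "A \<omega>"] h(2)[of "B \<omega>"] by linarith
  qed (use h E d lam c in auto)
qed

text \<open>A bounded continuous \<open>h\<close> is the increasing pointwise limit of its Lipschitz minorants
  \<open>x \<mapsto> inf\<^sub>y (h y + k d(x, y))\<close>. Hence Lipschitz test functions give the lower bound
  \<open>liminf E h(Z\<^sub>n) \<ge> E h(Y)\<close>, and the same bound for \<open>-h\<close> gives convergence.\<close>

definition lipschitz_minorant :: "('c::metric_space \<Rightarrow> real) \<Rightarrow> nat \<Rightarrow> 'c \<Rightarrow> real" where
  "lipschitz_minorant h k x = (INF y. h y + real k * dist x y)"

context
  fixes h :: "'c::metric_space \<Rightarrow> real" and c :: real
  assumes bound: "\<And>x. \<bar>h x\<bar> \<le> c"
begin

lemma minorant_bdd: "bdd_below (range (\<lambda>y. h y + real k * dist x y))"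
proof (rule bdd_belowI2)
  show "- c \<le> h y + real k * dist x y" for y
    using bound[of y] by (smt (verit) mult_nonneg_nonneg of_nat_0_le_iff zero_le_dist)
qed

lemma minorant_le: "lipschitz_minorant h k x \<le> h y + real k * dist x y"
  unfolding lipschitz_minorant_def by (rule cINF_lower[OF minorant_bdd]) simp

lemma minorant_ge:
  "(\<And>y. a \<le> h y + real k * dist x y) \<Longrightarrow> a \<le> lipschitz_minorant h k x"
  unfolding lipschitz_minorant_def by (rule cINF_greatest) auto

lemma minorant_bound: "\<bar>lipschitz_minorant h k x\<bar> \<le> c"
proof -
  have "- c \<le> lipschitz_minorant h k x"
  proof (rule minorant_ge)
    show "- c \<le> h y + real k * dist x y" for y
      using bound[of y] by (smt (verit) mult_nonneg_nonneg of_nat_0_le_iff zero_le_dist)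
  qed
  moreover have "lipschitz_minorant h k x \<le> h x" using minorant_le[of k x x] by simp
  ultimately show ?thesis using bound[of x] by linarith
qed

lemma minorant_lipschitz: "(real k)-lipschitz_on UNIV (lipschitz_minorant h k)"
proof (rule lipschitz_onI)
  have *: "lipschitz_minorant h k x - real k * dist x x' \<le> lipschitz_minorant h k x'" for x x' :: 'c
  proof (rule minorant_ge)
    fix y
    have "real k * dist x y \<le> real k * dist x x' + real k * dist x' y"
      by (metis dist_triangle distrib_left mult_left_mono of_nat_0_le_iff)
    then show "lipschitz_minorant h k x - real k * dist x x' \<le> h y + real k * dist x' y"
      using minorant_le[of k x y] by linarith
  qed
  show "dist (lipschitz_minorant h k x) (lipschitz_minorant h k x') \<le> real k * dist x x'" for x x'
    using *[of x x'] *[of x' x] by (simp add: dist_real_def dist_commute abs_le_iff)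
qed simp

lemma minorant_tendsto:
  assumes "continuous_on UNIV h"
  shows "(\<lambda>k. lipschitz_minorant h k x) \<longlonglongrightarrow> h x"
proof (rule LIMSEQ_I)
  fix e :: real assume e: "0 < e"
  obtain d where d: "d > 0" "\<And>y. dist y x < d \<Longrightarrow> dist (h y) (h x) < e / 2"
    using assms e unfolding continuous_on_iff by (metis UNIV_I half_gt_zero)
  obtain k0 where k0: "2 * c / d < real k0" using reals_Archimedean2 by blast
  have "norm (lipschitz_minorant h k x - h x) < e" if "k0 \<le> k" for k
  proof -
    have "h x - e / 2 \<le> lipschitz_minorant h k x"
    proof (rule minorant_ge)
      fix y
      show "h x - e / 2 \<le> h y + real k * dist x y"
      proof (cases "dist y x < d")
        case True
        from d(2)[OF True] have "h x - e / 2 \<le> h y" by (simp add: dist_real_def abs_if split: if_splits)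
        moreover have "0 \<le> real k * dist x y" by simp
        ultimately show ?thesis by linarith
      next
        case False
        have "2 * c \<le> real k0 * d" using k0 d by (simp add: pos_divide_less_eq)
        also have "\<dots> \<le> real k * dist x y"
          using False that d by (intro mult_mono) (auto simp: dist_commute)
        finally show ?thesis using bound[of x] bound[of y] e by linarith
      qed
    qed
    moreover have "lipschitz_minorant h k x \<le> h x" using minorant_le[of k x x] by simp
    ultimately show ?thesis using e by simp
  qed
  then show "\<exists>k0. \<forall>k\<ge>k0. norm (lipschitz_minorant h k x - h x) < e" by blast
qed

end

lemma converges_in_distributionI_lipschitz:
  fixes Z :: "nat \<Rightarrow> 'w \<Rightarrow> 'c::metric_space" and Y :: "'v \<Rightarrow> 'c"
  assumes "prob_space M" "prob_space N"
    and meas: "\<And>n. Z n \<in> borel_measurable M" "Y \<in> borel_measurable N"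
    and conv: "\<And>(h :: 'c \<Rightarrow> real) lam c. lam-lipschitz_on UNIV h \<Longrightarrow> (\<And>x. \<bar>h x\<bar> \<le> c) \<Longrightarrow>
        (\<lambda>n. \<integral>\<omega>. h (Z n \<omega>) \<partial>M) \<longlonglongrightarrow> (\<integral>\<omega>. h (Y \<omega>) \<partial>N)"
  shows "converges_in_distribution M Z N Y"
  unfolding converges_in_distribution_def
proof (intro conjI allI impI meas; elim conjE)
  interpret M: prob_space M by fact
  interpret N: prob_space N by fact
  note [measurable] = meas
  have lower: "\<forall>\<^sub>F n in sequentially. (\<integral>\<omega>. h (Y \<omega>) \<partial>N) - e < (\<integral>\<omega>. h (Z n \<omega>) \<partial>M)"
    if h: "continuous_on UNIV h" "\<And>x. \<bar>h x\<bar> \<le> c" and e: "0 < e" for h :: "'c \<Rightarrow> real" and c e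
  proof -
    have [measurable]: "h \<in> borel_measurable borel" by (rule borel_measurable_continuous_onI[OF h(1)])
    have hk[measurable]: "lipschitz_minorant h k \<in> borel_measurable borel" for k
      by (intro borel_measurable_continuous_onI lipschitz_on_continuous_on[OF minorant_lipschitz[OF h(2)]])
    have "(\<lambda>k. \<integral>\<omega>. lipschitz_minorant h k (Y \<omega>) \<partial>N) \<longlonglongrightarrow> (\<integral>\<omega>. h (Y \<omega>) \<partial>N)"
      by (rule integral_dominated_convergence[where w = "\<lambda>_. c"])
         (auto intro!: minorant_tendsto[of h c] minorant_bound[of h c] h)
    then have "\<forall>\<^sub>F k in sequentially. (\<integral>\<omega>. h (Y \<omega>) \<partial>N) - e < (\<integral>\<omega>. lipschitz_minorant h k (Y \<omega>) \<partial>N)"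
      by (rule order_tendstoD) (use e in simp)
    then obtain k where k: "(\<integral>\<omega>. h (Y \<omega>) \<partial>N) - e < (\<integral>\<omega>. lipschitz_minorant h k (Y \<omega>) \<partial>N)"
      by (auto simp: eventually_sequentially)
    have "(\<lambda>n. \<integral>\<omega>. lipschitz_minorant h k (Z n \<omega>) \<partial>M) \<longlonglongrightarrow> (\<integral>\<omega>. lipschitz_minorant h k (Y \<omega>) \<partial>N)"
      by (rule conv[OF minorant_lipschitz[OF h(2)] minorant_bound[OF h(2)]])
    then have "\<forall>\<^sub>F n in sequentially.
        (\<integral>\<omega>. h (Y \<omega>) \<partial>N) - e < (\<integral>\<omega>. lipschitz_minorant h k (Z n \<omega>) \<partial>M)"
      by (rule order_tendstoD) (use k in simp)
    then show ?thesis
    proof eventually_elim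
      case (elim n)
      have "(\<integral>\<omega>. lipschitz_minorant h k (Z n \<omega>) \<partial>M) \<le> (\<integral>\<omega>. h (Z n \<omega>) \<partial>M)"
      proof (rule integral_mono)
        show "lipschitz_minorant h k (Z n \<omega>) \<le> h (Z n \<omega>)" for \<omega>
          using minorant_le[of h c k "Z n \<omega>" "Z n \<omega>", OF h(2)] by simp
      qed (auto intro!: M.integrable_const_bound[where B = c] minorant_bound h)
      with elim show ?case by linarith
    qed
  qed
  fix h :: "'c \<Rightarrow> real" assume h: "continuous_on UNIV h" "bounded (range h)"
  then obtain c where c: "\<And>x. \<bar>h x\<bar> \<le> c" by (auto simp: bounded_iff)
  show "(\<lambda>n. \<integral>\<omega>. h (Z n \<omega>) \<partial>M) \<longlonglongrightarrow> (\<integral>\<omega>. h (Y \<omega>) \<partial>N)"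
  proof (rule LIMSEQ_I)
    fix e :: real assume e: "0 < e"
    have "\<forall>\<^sub>F n in sequentially. norm ((\<integral>\<omega>. h (Z n \<omega>) \<partial>M) - (\<integral>\<omega>. h (Y \<omega>) \<partial>N)) < e"
    proof (rule eventually_elim2)
      show "\<forall>\<^sub>F n in sequentially. (\<integral>\<omega>. h (Y \<omega>) \<partial>N) - e < (\<integral>\<omega>. h (Z n \<omega>) \<partial>M)"
        by (rule lower[OF h(1) c e])
      show "\<forall>\<^sub>F n in sequentially. (\<integral>\<omega>. - h (Y \<omega>) \<partial>N) - e < (\<integral>\<omega>. - h (Z n \<omega>) \<partial>M)"
        by (rule lower[of "\<lambda>x. - h x" c e]) (use c e h(1) in \<open>auto intro: continuous_on_minus\<close>)
    qed auto
    then show "\<exists>no. \<forall>n\<ge>no. norm ((\<integral>\<omega>. h (Z n \<omega>) \<partial>M) - (\<integral>\<omega>. h (Y \<omega>) \<partial>N)) < e"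
      by (simp add: eventually_sequentially)
  qed
qed

section \<open>Characteristic functions and laws of random sequences\<close>

text \<open>On a compact set \<open>K\<close> carrying almost all mass, an algebra \<open>R\<close> approximates \<open>g\<close> uniformly by
  some \<open>r\<close>, but \<open>r\<close> may be huge off \<open>K\<close>. A polynomial \<open>q\<close> that is close to the truncation at
  level \<open>c \<ge> |g|\<close> on the whole range of \<open>r\<close> repairs this: \<open>q \<circ> r\<close> is still in \<open>R\<close>, is still
  close to \<open>g\<close> on \<open>K\<close>, and is bounded by about \<open>c\<close> everywhere.\<close>

lemma algebra_approximation:
  fixes R :: "('c::t2_space \<Rightarrow> real) set" and g :: "'c \<Rightarrow> real"
  assumes cont: "\<And>r. r \<in> R \<Longrightarrow> continuous_on UNIV r \<and> bounded (range r)"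
    and const: "\<And>a. (\<lambda>_. a) \<in> R"
    and add: "\<And>r s. r \<in> R \<Longrightarrow> s \<in> R \<Longrightarrow> (\<lambda>x. r x + s x) \<in> R"
    and mult: "\<And>r s. r \<in> R \<Longrightarrow> s \<in> R \<Longrightarrow> (\<lambda>x. r x * s x) \<in> R"
    and sep: "\<And>x y. x \<noteq> y \<Longrightarrow> \<exists>r\<in>R. r x \<noteq> r y"
    and K: "compact K" and g: "continuous_on UNIV g" "\<And>x. \<bar>g x\<bar> \<le> c" and e: "0 < e"
  obtains s where "s \<in> R" "\<And>x. x \<in> K \<Longrightarrow> \<bar>s x - g x\<bar> \<le> e" "\<And>x. \<bar>s x\<bar> \<le> c + e"
proof -
  interpret function_ring_on R K
    using const add mult sep K continuous_on_subset[of UNIV _ K] cont by unfold_locales blast+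
  obtain r where r: "r \<in> R" "\<And>x. x \<in> K \<Longrightarrow> \<bar>g x - r x\<bar> < e / 2"
    using Stone_Weierstrass_basic[of g "e / 2"] continuous_on_subset[OF g(1)] e by auto
  obtain b where b: "\<And>x. \<bar>r x\<bar> \<le> b" using cont[OF r(1)] by (auto simp: bounded_iff)
  let ?clamp = "\<lambda>x. max (- c) (min c x)"
  obtain q where q: "real_polynomial_function q" "\<And>x. x \<in> {- b..b} \<Longrightarrow> \<bar>?clamp x - q x\<bar> < e / 2"
    by (rule Stone_Weierstrass_real_polynomial_function[of "{- b..b}" ?clamp "e / 2"])
       (use e in \<open>auto intro!: continuous_intros\<close>)
  have "(\<lambda>x. q (r x)) \<in> R"
    using q(1)
  proof induction
    case (linear f)
    then interpret bounded_linear f .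
    have "f y = f 1 * y" for y :: real using scaleR[of y 1] by (simp add: mult.commute)
    then have "(\<lambda>x. f (r x)) = (\<lambda>x. f 1 * r x)" by (rule ext)
    moreover have "(\<lambda>x. f 1 * r x) \<in> R" by (rule mult[of "\<lambda>_. f 1" r, OF const r(1)])
    ultimately show ?case by (simp only:)
  next
    case (const a)
    show ?case by (rule assms(2))
  next
    case (add f1 f2)
    show ?case by (rule assms(3)[OF add.IH])
  next
    case (mult f1 f2)
    show ?case by (rule assms(4)[OF mult.IH])
  qed
  moreover have rx: "r x \<in> {- b..b}" for x using b[of x] by auto
  have "0 \<le> c" using g(2)[of undefined] by linarith
  then have "\<bar>q (r x)\<bar> \<le> c + e" for x
    using q(2)[OF rx[of x]] e by linarith
  moreover have "\<bar>q (r x) - g x\<bar> \<le> e" if "x \<in> K" for x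
    using q(2)[OF rx[of x]] r(2)[OF that] g(2)[of x] e by linarith
  ultimately show ?thesis using that[of "\<lambda>x. q (r x)"] by blast
qed

text \<open>Convergence for test functions in a point-separating algebra extends to all bounded continuous
  ones, as tightness supplies the compact set on which the algebra approximates.\<close>

lemma stone_weierstrass_convergence:
  fixes Z :: "nat \<Rightarrow> 'w \<Rightarrow> 'c::t2_space" and Y :: "'v \<Rightarrow> 'c" and g :: "'c \<Rightarrow> real"
    and R :: "('c \<Rightarrow> real) set"
  assumes "prob_space M" "prob_space N"
    and meas: "\<And>n. Z n \<in> borel_measurable M" "Y \<in> borel_measurable N"
    and cont: "\<And>r. r \<in> R \<Longrightarrow> continuous_on UNIV r \<and> bounded (range r)"
    and const: "\<And>a. (\<lambda>_. a) \<in> R"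
    and add: "\<And>r s. r \<in> R \<Longrightarrow> s \<in> R \<Longrightarrow> (\<lambda>x. r x + s x) \<in> R"
    and mult: "\<And>r s. r \<in> R \<Longrightarrow> s \<in> R \<Longrightarrow> (\<lambda>x. r x * s x) \<in> R"
    and sep: "\<And>x y. x \<noteq> y \<Longrightarrow> \<exists>r\<in>R. r x \<noteq> r y"
    and conv: "\<And>r. r \<in> R \<Longrightarrow> (\<lambda>n. \<integral>\<omega>. r (Z n \<omega>) \<partial>M) \<longlonglongrightarrow> (\<integral>\<omega>. r (Y \<omega>) \<partial>N)"
    and tight: "\<And>e::real. 0 < e \<Longrightarrow> \<exists>K. compact K \<and>
        (\<forall>n. \<exists>E\<in>sets M. measure M E \<le> e \<and> (\<forall>\<omega>\<in>space M - E. Z n \<omega> \<in> K)) \<and>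
        (\<exists>E\<in>sets N. measure N E \<le> e \<and> (\<forall>\<omega>\<in>space N - E. Y \<omega> \<in> K))"
    and g: "continuous_on UNIV g" "\<And>x. \<bar>g x\<bar> \<le> c"
  shows "(\<lambda>n. \<integral>\<omega>. g (Z n \<omega>) \<partial>M) \<longlonglongrightarrow> (\<integral>\<omega>. g (Y \<omega>) \<partial>N)"
proof (rule LIMSEQ_I)
  interpret M: prob_space M by fact
  interpret N: prob_space N by fact
  note [measurable] = meas
  have [measurable]: "g \<in> borel_measurable borel" by (rule borel_measurable_continuous_onI[OF g(1)])
  have c: "0 \<le> c" using g(2)[of undefined] by linarith
  fix e0 :: real assume e0: "0 < e0"
  \<comment> \<open>The approximation error \<open>e\<close> on \<open>K\<close> and \<open>(2 c + e) e\<close> off \<open>K\<close> is paid on both sides of the limit.\<close>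
  define e where "e = min 1 (e0 / (2 * (2 * c + 3)))"
  have e: "0 < e" "e \<le> 1" using c e0 by (auto simp: e_def)
  have small: "2 * (e + (2 * c + e) * e) < e0"
  proof -
    have "e + (2 * c + e) * e \<le> (2 * c + 2) * e"
      using e c mult_right_mono[of e 1 e] by (simp add: algebra_simps)
    also have "\<dots> < (2 * c + 3) * e" using e by simp
    also have "\<dots> \<le> (2 * c + 3) * (e0 / (2 * (2 * c + 3)))"
      using c by (intro mult_left_mono) (auto simp: e_def)
    also have "\<dots> = e0 / 2" using c by (simp add: field_simps)
    finally show ?thesis by simp
  qed
  obtain K where K: "compact K"
      "\<And>n. \<exists>E\<in>sets M. measure M E \<le> e \<and> (\<forall>\<omega>\<in>space M - E. Z n \<omega> \<in> K)"
      "\<exists>E\<in>sets N. measure N E \<le> e \<and> (\<forall>\<omega>\<in>space N - E. Y \<omega> \<in> K)"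
    using tight[OF e(1)] by blast
  obtain s where s: "s \<in> R" "\<And>x. x \<in> K \<Longrightarrow> \<bar>s x - g x\<bar> \<le> e" "\<And>x. \<bar>s x\<bar> \<le> c + e"
    using algebra_approximation[OF cont const add mult sep K(1) g e(1)] by blast
  have [measurable]: "s \<in> borel_measurable borel"
    using cont[OF s(1)] by (auto intro: borel_measurable_continuous_onI)
  have sg: "\<bar>s x - g x\<bar> \<le> 2 * c + e" for x using s(3)[of x] g(2)[of x] by linarith
  have approx: "\<bar>(\<integral>\<omega>. s (V \<omega>) \<partial>P) - (\<integral>\<omega>. g (V \<omega>) \<partial>P)\<bar> \<le> e + (2 * c + e) * e"
    if P: "prob_space P" and V[measurable]: "V \<in> borel_measurable P"
      and E: "\<exists>E\<in>sets P. measure P E \<le> e \<and> (\<forall>\<omega>\<in>space P - E. V \<omega> \<in> K)" for P :: "'x measure" and V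
  proof -
    interpret P: prob_space P by fact
    obtain E where E: "E \<in> sets P" "measure P E \<le> e" "\<And>\<omega>. \<omega> \<in> space P \<Longrightarrow> \<omega> \<notin> E \<Longrightarrow> V \<omega> \<in> K"
      using E by auto
    have "\<bar>(\<integral>\<omega>. s (V \<omega>) \<partial>P) - (\<integral>\<omega>. g (V \<omega>) \<partial>P)\<bar> \<le> e + (2 * c + e) * measure P E"
      by (rule P.integral_diff_le_off_event[where c = "c + e" and c' = c])
         (use E s g sg c e in auto)
    also have "\<dots> \<le> e + (2 * c + e) * e"
      using E c e by (intro add_mono mult_left_mono) auto
    finally show ?thesis .
  qed
  have "\<forall>\<^sub>F n in sequentially. norm ((\<integral>\<omega>. s (Z n \<omega>) \<partial>M) - (\<integral>\<omega>. s (Y \<omega>) \<partial>N))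
      < e0 - 2 * (e + (2 * c + e) * e)"
    using tendstoD[OF conv[OF s(1)], of "e0 - 2 * (e + (2 * c + e) * e)"] small by (simp add: dist_norm)
  then obtain n0 where n0: "\<And>n. n0 \<le> n \<Longrightarrow> norm ((\<integral>\<omega>. s (Z n \<omega>) \<partial>M) - (\<integral>\<omega>. s (Y \<omega>) \<partial>N))
      < e0 - 2 * (e + (2 * c + e) * e)"
    by (auto simp: eventually_sequentially)
  have "norm ((\<integral>\<omega>. g (Z n \<omega>) \<partial>M) - (\<integral>\<omega>. g (Y \<omega>) \<partial>N)) < e0" if "n0 \<le> n" for n
  proof -
    have "\<bar>(\<integral>\<omega>. s (Z n \<omega>) \<partial>M) - (\<integral>\<omega>. g (Z n \<omega>) \<partial>M)\<bar> \<le> e + (2 * c + e) * e"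
      using assms(1) meas(1) K(2) by (rule approx)
    moreover have "\<bar>(\<integral>\<omega>. s (Y \<omega>) \<partial>N) - (\<integral>\<omega>. g (Y \<omega>) \<partial>N)\<bar> \<le> e + (2 * c + e) * e"
      using assms(2) meas(2) K(3) by (rule approx)
    moreover define D where "D = e + (2 * c + e) * e"
    ultimately show ?thesis
      using n0[OF that] unfolding real_norm_def D_def[symmetric] by linarith
  qed
  then show "\<exists>n0. \<forall>n\<ge>n0. norm ((\<integral>\<omega>. g (Z n \<omega>) \<partial>M) - (\<integral>\<omega>. g (Y \<omega>) \<partial>N)) < e0" by blast
qed

definition lin_form :: "nat \<Rightarrow> (nat \<Rightarrow> 'a::real_inner) \<Rightarrow> (nat \<Rightarrow> 'a) \<Rightarrow> real" where
  "lin_form k u x = (\<Sum>j<k. u j \<bullet> x j)"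

lemma lin_form_extend: "k \<le> m \<Longrightarrow> lin_form m (\<lambda>j. if j < k then u j else 0) x = lin_form k u x"
  unfolding lin_form_def by (rule sum.mono_neutral_cong_right) auto

lemma lin_form_add: "\<exists>m w. \<forall>x. lin_form k u x + lin_form k' u' x = lin_form m w x"
proof -
  let ?m = "max k k'"
  let ?w = "\<lambda>j. (if j < k then u j else 0) + (if j < k' then u' j else 0)"
  have "lin_form k u x + lin_form k' u' x = lin_form ?m ?w x" for x
  proof -
    have "lin_form k u x + lin_form k' u' x =
        lin_form ?m (\<lambda>j. if j < k then u j else 0) x + lin_form ?m (\<lambda>j. if j < k' then u' j else 0) x"
      by (simp add: lin_form_extend)
    also have "\<dots> = lin_form ?m ?w x"
      unfolding lin_form_def by (simp only: inner_add_left sum.distrib)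
    finally show ?thesis .
  qed
  then show ?thesis by blast
qed

lemma lin_form_diff: "\<exists>m w. \<forall>x. lin_form k u x - lin_form k' u' x = lin_form m w x"
  using lin_form_add[of k u k' "\<lambda>j. - u' j"] by (simp add: lin_form_def sum_negf)

lemma continuous_on_lin_form: "continuous_on UNIV (lin_form k u)"
  unfolding lin_form_def[abs_def]
  by (intro continuous_intros continuous_on_product_coordinates)

inductive_set trig :: "((nat \<Rightarrow> 'a::real_inner) \<Rightarrow> real) set" where
  cos: "(\<lambda>x. cos (lin_form k u x)) \<in> trig"
| sin: "(\<lambda>x. sin (lin_form k u x)) \<in> trig"
| add: "f \<in> trig \<Longrightarrow> g \<in> trig \<Longrightarrow> (\<lambda>x. f x + g x) \<in> trig"
| scale: "f \<in> trig \<Longrightarrow> (\<lambda>x. c * f x) \<in> trig"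

lemma trig_const: "(\<lambda>_. c) \<in> trig"
  using trig.scale[OF trig.cos[of 0], of c] by (simp add: lin_form_def)

lemma trig_lin_form_combination:
  "(\<lambda>x. c * cos (lin_form k u x + lin_form k' u' x) + d * cos (lin_form k u x - lin_form k' u' x)) \<in> trig"
  "(\<lambda>x. c * sin (lin_form k u x + lin_form k' u' x) + d * sin (lin_form k u x - lin_form k' u' x)) \<in> trig"
proof -
  obtain m w m' w' where "\<And>x. lin_form k u x + lin_form k' u' x = lin_form m w x"
    "\<And>x. lin_form k u x - lin_form k' u' x = lin_form m' w' x"
    using lin_form_add[of k u k' u'] lin_form_diff[of k u k' u'] by blast
  then show "(\<lambda>x. c * cos (lin_form k u x + lin_form k' u' x) + d * cos (lin_form k u x - lin_form k' u' x)) \<in> trig"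
    "(\<lambda>x. c * sin (lin_form k u x + lin_form k' u' x) + d * sin (lin_form k u x - lin_form k' u' x)) \<in> trig"
    by (auto intro!: trig.intros)
qed

lemma trig_mult_cos_sin:
  assumes "f \<in> trig"
  shows "(\<lambda>x. f x * cos (lin_form k u x)) \<in> trig \<and> (\<lambda>x. f x * sin (lin_form k u x)) \<in> trig"
  using assms
proof induction
  case (cos k' u')
  show ?case
    using trig_lin_form_combination(1)[of "1/2" k' u' k u "1/2"]
      trig_lin_form_combination(2)[of "1/2" k' u' k u "-1/2"]
    by (simp add: cos_times_cos cos_times_sin diff_divide_distrib add_divide_distrib add.commute)
next
  case (sin k' u')
  show ?case
    using trig_lin_form_combination(2)[of "1/2" k' u' k u "1/2"]
      trig_lin_form_combination(1)[of "-1/2" k' u' k u "1/2"]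
    by (simp add: sin_times_sin sin_times_cos diff_divide_distrib add_divide_distrib)
next
  case (add f g)
  then show ?case by (auto simp: distrib_right intro: trig.add)
next
  case (scale f c)
  then show ?case by (auto simp: mult.assoc intro: trig.scale)
qed

lemma trig_mult:
  assumes "f \<in> trig" "g \<in> trig"
  shows "(\<lambda>x. f x * g x) \<in> trig"
  using assms(2)
proof induction
  case (add g h)
  then show ?case by (auto simp: distrib_left intro: trig.add)
next
  case (scale g c)
  then show ?case using trig.scale[of "\<lambda>x. f x * g x" c] by (simp add: mult.left_commute)
qed (use trig_mult_cos_sin[OF assms(1)] in auto)

lemma trig_bounded_continuous: "f \<in> trig \<Longrightarrow> continuous_on UNIV f \<and> bounded (range f)"
proof (induction rule: trig.induct)
  case (cos k u)
  then show ?case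
    by (auto intro!: continuous_intros continuous_on_lin_form boundedI[of _ 1])
next
  case (sin k u)
  then show ?case
    by (auto intro!: continuous_intros continuous_on_lin_form boundedI[of _ 1])
next
  case (add f g)
  then obtain a b where "\<And>x. norm (f x) \<le> a" "\<And>x. norm (g x) \<le> b"
    by (auto simp: bounded_iff)
  then have "norm (f x + g x) \<le> a + b" for x
    by (meson add_mono norm_triangle_ineq order_trans)
  then show ?case using add by (auto intro!: continuous_on_add boundedI[of _ "a + b"])
next
  case (scale f c)
  then obtain a where "\<And>x. norm (f x) \<le> a" by (auto simp: bounded_iff)
  then have "norm (c * f x) \<le> \<bar>c\<bar> * a" for x by (simp add: abs_mult mult_left_mono)
  then show ?case using scale by (auto intro!: continuous_intros boundedI[of _ "\<bar>c\<bar> * a"])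
qed

text \<open>If \<open>x j - y j = v \<noteq> 0\<close>, the linear form with coefficient \<open>v / |v|\<^sup>2\<close> at \<open>j\<close> has values
  differing by \<open>1\<close> at \<open>x\<close> and \<open>y\<close>, and two numbers at distance \<open>1\<close> have different cosines or
  different sines.\<close>

lemma trig_separates:
  fixes x y :: "nat \<Rightarrow> 'a::real_inner"
  assumes "x \<noteq> y"
  shows "\<exists>f\<in>trig. f x \<noteq> f y"
proof -
  obtain j where j: "x j \<noteq> y j" using assms by blast
  define v where "v = x j - y j"
  define u where "u = (\<lambda>i. if i = j then v /\<^sub>R (v \<bullet> v) else 0)"
  have lf: "lin_form (Suc j) u z = (v \<bullet> z j) / (v \<bullet> v)" for z
    by (simp add: lin_form_def u_def divide_inverse mult.commute)
  have "v \<bullet> v \<noteq> 0" using j by (simp add: v_def)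
  have diff: "lin_form (Suc j) u x = lin_form (Suc j) u y + 1"
  proof -
    have "(v \<bullet> x j) / (v \<bullet> v) - (v \<bullet> y j) / (v \<bullet> v) = (v \<bullet> v) / (v \<bullet> v)"
      by (simp only: diff_divide_distrib[symmetric] inner_diff_right[symmetric] v_def)
    with \<open>v \<bullet> v \<noteq> 0\<close> show ?thesis by (simp add: lf)
  qed
  show ?thesis
  proof (rule ccontr)
    assume "\<not> ?thesis"
    then have "cos (lin_form (Suc j) u x) = cos (lin_form (Suc j) u y)"
      "sin (lin_form (Suc j) u x) = sin (lin_form (Suc j) u y)"
      using trig.cos[of "Suc j" u] trig.sin[of "Suc j" u] by auto
    then have "cos (lin_form (Suc j) u x - lin_form (Suc j) u y) = 1"
      by (simp add: cos_diff flip: power2_eq_square)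
    then have "cos (1::real) = 1" by (simp add: diff)
    moreover have "cos (1::real) < cos 0" by (rule cos_monotone_0_pi) (use pi_gt3 in auto)
    ultimately show False by simp
  qed
qed

lemma (in prob_space) Re_Im_expectation_iexp:
  assumes [measurable]: "f \<in> borel_measurable M"
  shows "Re (\<integral>\<omega>. iexp (f \<omega>) \<partial>M) = (\<integral>\<omega>. cos (f \<omega>) \<partial>M)"
    "Im (\<integral>\<omega>. iexp (f \<omega>) \<partial>M) = (\<integral>\<omega>. sin (f \<omega>) \<partial>M)"
proof -
  have "integrable M (\<lambda>\<omega>. iexp (f \<omega>))" by (intro integrable_const_bound[of _ 1]) auto
  then show "Re (\<integral>\<omega>. iexp (f \<omega>) \<partial>M) = (\<integral>\<omega>. cos (f \<omega>) \<partial>M)"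
    "Im (\<integral>\<omega>. iexp (f \<omega>) \<partial>M) = (\<integral>\<omega>. sin (f \<omega>) \<partial>M)"
    by (simp_all add: integral_Re[symmetric] integral_Im[symmetric] Re_exp Im_exp del: integral_Re integral_Im)
qed

lemma compact_box: "compact {x :: nat \<Rightarrow> 'a::euclidean_space. \<forall>j. norm (x j) \<le> A j}"
proof -
  have "compactin (product_topology (\<lambda>_. euclidean) UNIV) (PiE UNIV (\<lambda>j. cball (0::'a) (A j)))"
    by (subst compactin_PiE) auto
  then have "compact (PiE UNIV (\<lambda>j. cball (0::'a) (A j)))"
    by (simp add: euclidean_product_topology)
  moreover have "PiE UNIV (\<lambda>j. cball (0::'a) (A j)) = {x. \<forall>j. norm (x j) \<le> A j}"
    by (auto simp: PiE_UNIV_domain)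
  ultimately show ?thesis by simp
qed

lemma (in prob_space) sequence_in_box:
  fixes V :: "'a \<Rightarrow> nat \<Rightarrow> 'b::euclidean_space"
  assumes V: "V \<in> borel_measurable M"
    and A: "\<And>j. prob {\<omega>\<in>space M. norm (V \<omega> j) > A j} \<le> e * (1 / 2) ^ Suc j"
  shows "\<exists>E\<in>events. prob E \<le> e \<and> (\<forall>\<omega>\<in>space M - E. V \<omega> \<in> {x. \<forall>j. norm (x j) \<le> A j})"
proof -
  let ?E = "\<lambda>j. {\<omega>\<in>space M. norm (V \<omega> j) > A j}"
  have [measurable]: "(\<lambda>\<omega>. V \<omega> j) \<in> borel_measurable M" for j
    by (rule measurable_product_then_coordinatewise[OF V])
  have ev: "range ?E \<subseteq> events" by auto
  have s: "(\<lambda>j. e * (1 / 2) ^ Suc j) sums (e * 1)" by (rule sums_mult) (rule power_half_series)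
  have sum: "summable (\<lambda>j. prob (?E j))"
    by (rule summable_comparison_test[OF _ sums_summable[OF s]]) (use A in auto)
  have "prob (\<Union>j. ?E j) \<le> (\<Sum>j. prob (?E j))"
    by (rule finite_measure_subadditive_countably[OF ev sum])
  also have "\<dots> \<le> (\<Sum>j. e * (1 / 2) ^ Suc j)"
    by (rule suminf_le[OF A sum sums_summable[OF s]])
  also have "\<dots> = e" using s by (simp add: sums_iff)
  finally show ?thesis
    by (intro bexI[of _ "\<Union>j. ?E j"] conjI) (auto simp: not_less)
qed

lemma (in prob_space) norm_tail_small:
  fixes V :: "'a \<Rightarrow> 'b::real_normed_vector"
  assumes [measurable]: "V \<in> borel_measurable M" and e: "0 < e"
  shows "\<exists>a. prob {\<omega>\<in>space M. norm (V \<omega>) > a} \<le> e"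
proof -
  let ?E = "\<lambda>n::nat. {\<omega>\<in>space M. norm (V \<omega>) > real n}"
  have "(\<lambda>n. prob (?E n)) \<longlonglongrightarrow> prob (\<Inter>n. ?E n)"
    by (rule finite_Lim_measure_decseq) (auto simp: decseq_def)
  moreover have "(\<Inter>n. ?E n) = {}"
  proof -
    have "\<exists>n. \<omega> \<notin> ?E n" for \<omega>
    proof -
      obtain n where "norm (V \<omega>) \<le> real n" using real_arch_simple by blast
      then show ?thesis by (intro exI[of _ n]) auto
    qed
    then show ?thesis by blast
  qed
  ultimately have "(\<lambda>n. prob (?E n)) \<longlonglongrightarrow> 0" by simp
  from order_tendstoD(2)[OF this e] show ?thesis
    by (auto simp: eventually_sequentially intro: less_imp_le)
qed

text \<open>L\'evy's continuity theorem for random sequences of vectors. The tails are assumed to be uniform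
  in \<open>n\<close>, so that boxes serve as the compact sets; the trigonometric functions form the algebra.\<close>

theorem char_function_convergence:
  fixes Z :: "nat \<Rightarrow> 'w \<Rightarrow> nat \<Rightarrow> 'a::euclidean_space" and Y :: "'v \<Rightarrow> nat \<Rightarrow> 'a"
    and g :: "(nat \<Rightarrow> 'a) \<Rightarrow> real"
  assumes "prob_space M" "prob_space N"
    and meas: "\<And>n. Z n \<in> borel_measurable M" "Y \<in> borel_measurable N"
    and conv: "\<And>k u. (\<lambda>n. \<integral>\<omega>. iexp (lin_form k u (Z n \<omega>)) \<partial>M)
        \<longlonglongrightarrow> (\<integral>\<omega>. iexp (lin_form k u (Y \<omega>)) \<partial>N)"
    and tails: "\<And>j e::real. 0 < e \<Longrightarrow> \<exists>a. \<forall>n. measure M {\<omega>\<in>space M. norm (Z n \<omega> j) > a} \<le> e"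
    and g: "continuous_on UNIV g" "\<And>x. \<bar>g x\<bar> \<le> c"
  shows "(\<lambda>n. \<integral>\<omega>. g (Z n \<omega>) \<partial>M) \<longlonglongrightarrow> (\<integral>\<omega>. g (Y \<omega>) \<partial>N)"
proof (rule stone_weierstrass_convergence[where R = trig and c = c and Z = Z and Y = Y and g = g, OF assms(1,2)])
  interpret M: prob_space M by fact
  interpret N: prob_space N by fact
  note [measurable] = meas
  have lf[measurable]: "lin_form k u \<in> borel_measurable borel" for k and u :: "nat \<Rightarrow> 'a"
    by (rule borel_measurable_continuous_onI[OF continuous_on_lin_form])
  show "(\<lambda>n. \<integral>\<omega>. r (Z n \<omega>) \<partial>M) \<longlonglongrightarrow> (\<integral>\<omega>. r (Y \<omega>) \<partial>N)" if "r \<in> trig" for r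
    using that
  proof induction
    case (cos k u)
    show ?case
      using tendsto_Re[OF conv[of k u]] by (simp add: M.Re_Im_expectation_iexp N.Re_Im_expectation_iexp)
  next
    case (sin k u)
    show ?case
      using tendsto_Im[OF conv[of k u]] by (simp add: M.Re_Im_expectation_iexp N.Re_Im_expectation_iexp)
  next
    case (add r s)
    have int: "integrable P (\<lambda>\<omega>. f (V \<omega>))" if "prob_space P" "f \<in> trig" "V \<in> borel_measurable P"
      for P :: "'x measure" and V and f :: "(nat \<Rightarrow> 'a) \<Rightarrow> real"
    proof -
      interpret P: prob_space P by fact
      have f: "continuous_on UNIV f" "bounded (range f)" using trig_bounded_continuous[OF that(2)] by auto
      then have [measurable]: "f \<in> borel_measurable borel" by (auto intro: borel_measurable_continuous_onI)
      obtain b where "\<And>x. norm (f x) \<le> b" using f by (auto simp: bounded_iff)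
      then show ?thesis using that by (intro P.integrable_const_bound[where B = b]) auto
    qed
    show ?case
      using tendsto_add[OF add.IH] add.hyps
      by (simp add: int[OF assms(1) _ meas(1)] int[OF assms(2) _ meas(2)])
  next
    case (scale r c)
    then show ?case by (auto intro: tendsto_mult_left)
  qed
  show "\<exists>K. compact K \<and>
        (\<forall>n. \<exists>E\<in>sets M. measure M E \<le> e \<and> (\<forall>\<omega>\<in>space M - E. Z n \<omega> \<in> K)) \<and>
        (\<exists>E\<in>sets N. measure N E \<le> e \<and> (\<forall>\<omega>\<in>space N - E. Y \<omega> \<in> K))" if "0 < e" for e :: real
  proof -
    have e: "0 < e * (1 / 2) ^ Suc j" for j using that by simp
    have "\<exists>a. \<forall>n. measure M {\<omega>\<in>space M. norm (Z n \<omega> j) > a} \<le> e * (1 / 2) ^ Suc j" for j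
      by (rule tails[OF e])
    then obtain A where A: "\<And>j n. measure M {\<omega>\<in>space M. norm (Z n \<omega> j) > A j} \<le> e * (1 / 2) ^ Suc j"
      by metis
    have "\<exists>a. measure N {\<omega>\<in>space N. norm (Y \<omega> j) > a} \<le> e * (1 / 2) ^ Suc j" for j
      by (rule N.norm_tail_small[OF measurable_product_then_coordinatewise[OF meas(2)] e])
    then obtain B where B: "\<And>j. measure N {\<omega>\<in>space N. norm (Y \<omega> j) > B j} \<le> e * (1 / 2) ^ Suc j"
      by metis
    let ?K = "{x :: nat \<Rightarrow> 'a. \<forall>j. norm (x j) \<le> max (A j) (B j)}"
    have [measurable]: "(\<lambda>\<omega>. Z n \<omega> j) \<in> borel_measurable M" "(\<lambda>\<omega>. Y \<omega> j) \<in> borel_measurable N" for n j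
      by (rule measurable_product_then_coordinatewise, rule meas)+
    have "measure M {\<omega>\<in>space M. norm (Z n \<omega> j) > max (A j) (B j)} \<le> e * (1 / 2) ^ Suc j" for n j
      by (rule order_trans[OF M.finite_measure_mono A]) auto
    moreover have "measure N {\<omega>\<in>space N. norm (Y \<omega> j) > max (A j) (B j)} \<le> e * (1 / 2) ^ Suc j" for j
      by (rule order_trans[OF N.finite_measure_mono B]) auto
    ultimately show ?thesis
      by (intro exI[of _ ?K] conjI allI compact_box M.sequence_in_box N.sequence_in_box meas) auto
  qed
qed (rule meas g trig_bounded_continuous trig_separates trig_const trig.add trig_mult; assumption)+

lemma measure_eqI_continuous_integrals:
  fixes P Q :: "'c::metric_space measure"
  assumes "prob_space P" "prob_space Q" and sets: "sets P = sets borel" "sets Q = sets borel"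
    and eq: "\<And>(g :: 'c \<Rightarrow> real) c. continuous_on UNIV g \<Longrightarrow> (\<And>x. \<bar>g x\<bar> \<le> c) \<Longrightarrow>
        (\<integral>x. g x \<partial>P) = (\<integral>x. g x \<partial>Q)"
  shows "P = Q"
proof (rule measure_eqI_generator_eq[where E = "Collect closed" and \<Omega> = UNIV and A = "\<lambda>_. UNIV"])
  show "sets P = sigma_sets UNIV (Collect closed)" "sets Q = sigma_sets UNIV (Collect closed)"
    by (simp_all add: sets borel_eq_closed)
  interpret P: prob_space P by fact
  interpret Q: prob_space Q by fact
  show "emeasure P F = emeasure Q F" if "F \<in> Collect closed" for F
  proof -
  from that have F: "closed F" by simp
  show ?thesis

  proof (cases "F = {}")
    case False
    let ?g = "\<lambda>(k::nat) x. max 0 (1 - real k * infdist x F)"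
    have cont: "continuous_on UNIV (?g k)" for k by (intro continuous_intros)
    have bd: "\<bar>?g k x\<bar> \<le> 1" for k x by (auto simp: infdist_nonneg max_def)
    have lim: "(\<lambda>k. ?g k x) \<longlonglongrightarrow> indicator F x" for x
    proof (cases "x \<in> F")
      case True
      then show ?thesis by simp
    next
      case notin: False
      then have pos: "0 < infdist x F"
        using F False by (simp add: infdist_pos_not_in_closed)
      obtain k0 where k0: "1 / infdist x F < real k0" using reals_Archimedean2 by blast
      have "?g k x = indicator F x" if "k0 \<le> k" for k
      proof -
        have "1 \<le> real k0 * infdist x F" using k0 pos by (simp add: pos_divide_less_eq)
        also have "\<dots> \<le> real k * infdist x F" using that pos by (intro mult_right_mono) auto
        finally show ?thesis using notin by simp
      qed
      then show ?thesis by (intro tendsto_eventually) (auto simp: eventually_sequentially)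
    qed
    have conv: "(\<lambda>k. \<integral>x. ?g k x \<partial>R) \<longlonglongrightarrow> measure R F"
      if "prob_space R" "sets R = sets borel" for R
    proof -
      interpret R: prob_space R by fact
      have m: "borel_measurable R = (borel_measurable borel :: ('c \<Rightarrow> real) set)"
        using that(2) by (rule measurable_cong_sets) simp
      have Fs: "F \<in> sets R" using F by (simp add: that(2) borel_closed)
      have [measurable]: "(indicator F :: 'c \<Rightarrow> real) \<in> borel_measurable borel"
        using F by (intro borel_measurable_indicator borel_closed)
      have "(\<lambda>k. \<integral>x. ?g k x \<partial>R) \<longlonglongrightarrow> (\<integral>x. indicator F x \<partial>R)"
        by (rule integral_dominated_convergence[where w = "\<lambda>_. 1"])
           (use lim bd Fs borel_measurable_continuous_onI[OF cont] in \<open>auto simp: m\<close>)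
      then show ?thesis using Fs by simp
    qed
    have "measure P F = measure Q F"
      using conv[OF assms(1) sets(1)] conv[OF assms(2) sets(2)] eq[OF cont bd] LIMSEQ_unique by simp
    then show ?thesis by (simp add: P.emeasure_eq_measure Q.emeasure_eq_measure)
  qed simp
  qed
  show "emeasure P UNIV \<noteq> \<infinity>" by simp
qed (auto simp: Int_stable_def)

text \<open>The continuity theorem for a constant sequence: the two laws integrate bounded continuous
  functions alike.\<close>

theorem char_function_uniqueness:
  fixes Z :: "'w \<Rightarrow> nat \<Rightarrow> 'a::euclidean_space" and Y :: "'v \<Rightarrow> nat \<Rightarrow> 'a"
  assumes M: "prob_space M" and N: "prob_space N"
    and meas: "Z \<in> borel_measurable M" "Y \<in> borel_measurable N"
    and eq: "\<And>k u. (\<integral>\<omega>. iexp (lin_form k u (Z \<omega>)) \<partial>M) = (\<integral>\<omega>. iexp (lin_form k u (Y \<omega>)) \<partial>N)"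
  shows "distr M borel Z = distr N borel Y"
proof (rule measure_eqI_continuous_integrals)
  show "prob_space (distr M borel Z)" "prob_space (distr N borel Y)"
    using M N meas by (auto intro: prob_space.prob_space_distr)
  fix g :: "(nat \<Rightarrow> 'a) \<Rightarrow> real" and c assume g: "continuous_on UNIV g" "\<And>x. \<bar>g x\<bar> \<le> c"
  have "(\<lambda>n::nat. \<integral>\<omega>. g (Z \<omega>) \<partial>M) \<longlonglongrightarrow> (\<integral>\<omega>. g (Y \<omega>) \<partial>N)"
  proof (rule char_function_convergence[where Z = "\<lambda>_. Z" and Y = Y and g = g and c = c, OF M N])
    fix j :: nat and e :: real assume "0 < e"
    then show "\<exists>a. \<forall>n::nat. measure M {\<omega>\<in>space M. norm (Z \<omega> j) > a} \<le> e"
      using prob_space.norm_tail_small[OF M measurable_product_then_coordinatewise[OF meas(1)]] by blast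
  qed (use meas eq g in auto)
  then have "(\<integral>\<omega>. g (Z \<omega>) \<partial>M) = (\<integral>\<omega>. g (Y \<omega>) \<partial>N)"
    by (simp add: LIMSEQ_const_iff)
  moreover have "g \<in> borel_measurable borel" by (rule borel_measurable_continuous_onI[OF g(1)])
  ultimately show "(\<integral>x. g x \<partial>distr M borel Z) = (\<integral>x. g x \<partial>distr N borel Y)"
    using meas by (simp add: integral_distr)
qed auto

text \<open>A joint characteristic function that factorizes is that of the product of the marginal laws;
  by uniqueness the joint law is this product.\<close>

theorem (in prob_space) indep_varsI_char_function:
  fixes D :: "nat \<Rightarrow> 'a \<Rightarrow> 'b::euclidean_space"
  assumes rv[measurable]: "\<And>i. D i \<in> borel_measurable M"
    and fac: "\<And>u. (\<integral>\<omega>. iexp (\<Sum>i<n. u i \<bullet> D i \<omega>) \<partial>M) = (\<Prod>i<n. \<integral>\<omega>. iexp (u i \<bullet> D i \<omega>) \<partial>M)"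
  shows "indep_vars (\<lambda>_. borel) D {..<n}"
proof (cases "n = 0")
  case True
  then show ?thesis by (simp add: indep_vars_def indep_sets_def)
next
  case False
  let ?I = "{..<n}" and ?L = "\<lambda>i. distr M borel (D i)"
  let ?P = "PiM ?I ?L" and ?B = "PiM ?I (\<lambda>_. borel :: 'b measure)"
  interpret L: product_prob_space ?L ?I
    by (intro product_prob_spaceI prob_space_distr rv)
  have P: "prob_space ?P" by (intro prob_space_PiM prob_space_distr rv)
  have sets_P: "sets ?P = sets ?B" by (rule sets_PiM_cong) auto
  define pad where "pad = (\<lambda>x::nat \<Rightarrow> 'b. \<lambda>j. if j < n then x j else 0)"
  have pad_meas: "pad \<in> borel_measurable ?P"
    unfolding pad_def
  proof (rule measurable_coordinatewise_then_product)
    show "(\<lambda>x. if j < n then x j else 0) \<in> borel_measurable ?P" for j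
      using measurable_component_singleton[of j ?I ?L] by (cases "j < n") simp_all
  qed
  define Z where "Z = (\<lambda>\<omega>. pad (\<lambda>i. D i \<omega>))"
  have Z_meas: "Z \<in> borel_measurable M"
    unfolding Z_def pad_def by (rule measurable_coordinatewise_then_product) simp
  have "distr M borel Z = distr ?P borel pad"
  proof (rule char_function_uniqueness[OF prob_space_axioms P Z_meas pad_meas])
    fix k and u :: "nat \<Rightarrow> 'b"
    define v where "v = (\<lambda>i. if i < k then u i else 0)"
    have lf: "lin_form k u (pad x) = (\<Sum>i<n. v i \<bullet> x i)" for x
    proof -
      have "lin_form k u (pad x) = (\<Sum>i\<in>{..<k} \<inter> {..<n}. u i \<bullet> x i)"
        unfolding lin_form_def pad_def by (rule sum.mono_neutral_cong_right) auto
      also have "\<dots> = (\<Sum>i<n. v i \<bullet> x i)"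
        unfolding v_def by (rule sum.mono_neutral_cong_left) auto
      finally show ?thesis .
    qed
    have "(\<integral>\<omega>. iexp (lin_form k u (Z \<omega>)) \<partial>M) = (\<Prod>i<n. \<integral>\<omega>. iexp (v i \<bullet> D i \<omega>) \<partial>M)"
      by (simp only: Z_def lf fac)
    also have "\<dots> = (\<Prod>i<n. \<integral>y. iexp (v i \<bullet> y) \<partial>?L i)"
      by (intro prod.cong refl) (simp add: integral_distr)
    also have "\<dots> = (\<integral>x. (\<Prod>i<n. iexp (v i \<bullet> x i)) \<partial>?P)"
    proof (rule L.product_integral_prod[symmetric])
      show "integrable (?L i) (\<lambda>y. iexp (v i \<bullet> y))" for i
      proof -
        have Li: "prob_space (?L i)" by (intro prob_space_distr rv)
        show ?thesis by (rule finite_measure.integrable_const_bound[of _ _ 1]) (use Li in \<open>auto simp: prob_space.finite_measure\<close>)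
      qed
    qed simp
    also have "\<dots> = (\<integral>x. iexp (lin_form k u (pad x)) \<partial>?P)"
      by (simp add: lf exp_sum sum_distrib_left of_real_sum)
    finally show "(\<integral>\<omega>. iexp (lin_form k u (Z \<omega>)) \<partial>M) = (\<integral>x. iexp (lin_form k u (pad x)) \<partial>?P)" .
  qed
  then have eq: "distr (distr M borel Z) ?B (\<lambda>x. restrict x ?I) = distr (distr ?P borel pad) ?B (\<lambda>x. restrict x ?I)"
    by simp
  have res: "(\<lambda>x. restrict x ?I) \<in> measurable borel ?B"
    by (rule measurable_restrict) (simp add: borel_measurable_continuous_onI)
  have "distr M ?B (\<lambda>\<omega>. \<lambda>i\<in>?I. D i \<omega>) = distr (distr M borel Z) ?B (\<lambda>x. restrict x ?I)"
    using res Z_meas by (subst distr_distr) (auto simp: comp_def Z_def pad_def restrict_def fun_eq_iff intro!: arg_cong[where f = "distr M ?B"])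
  also have "\<dots> = distr ?P ?B (\<lambda>x. x)"
    unfolding eq using res pad_meas
    by (subst distr_distr)
       (auto intro!: distr_cong simp: pad_def space_PiM PiE_def extensional_def restrict_def fun_eq_iff)
  also have "\<dots> = ?P" by (rule distr_id2) (simp add: sets_P)
  finally show ?thesis
    using False by (subst indep_vars_iff_distr_eq_PiM) auto
qed

section \<open>Dyadic chaining\<close>

text \<open>Halving the mesh moves the polygon by at most half of a second difference of the finer nodes.\<close>

lemma interpolate_refine:
  assumes coarse: "\<And>j. y (2 * j) = x j"
    and small: "\<And>j. j < 2 * H \<Longrightarrow> norm (y (Suc j) - y j) \<le> e"
    and s: "0 \<le> s" "s < real H"
  shows "norm (interpolate y (2 * s) - interpolate x s) \<le> e"
proof -
  define k where "k = nat \<lfloor>s\<rfloor>"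
  define \<theta> where "\<theta> = s - real k"
  have k: "real k \<le> s" "s < real k + 1" unfolding k_def using s by linarith+
  have \<theta>: "0 \<le> \<theta>" "\<theta> < 1" using k by (auto simp: \<theta>_def)
  have kH: "k < H" using k s by linarith
  define a m b where "a = y (2 * k)" and "m = y (Suc (2 * k))" and "b = y (Suc (Suc (2 * k)))"
  have xa: "x k = a" and xb: "x (Suc k) = b"
    using coarse[of k] coarse[of "Suc k"] by (auto simp: a_def b_def)
  have inc: "norm (m - a) \<le> e" "norm (b - m) \<le> e"
    using small[of "2 * k"] small[of "Suc (2 * k)"] kH by (auto simp: a_def m_def b_def)
  then have inc2: "norm ((m - a) - (b - m)) \<le> 2 * e"
    using norm_triangle_ineq4[of "m - a" "b - m"] by linarith
  have e: "0 \<le> e" using inc(1) norm_ge_zero order_trans by blast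
  have ix: "interpolate x s = a + \<theta> *\<^sub>R (b - a)"
    using interpolate_eq[of k s x] k by (simp add: xa xb \<theta>_def)
  have "\<exists>\<phi>. 0 \<le> \<phi> \<and> \<phi> \<le> 1 / 2 \<and> interpolate y (2 * s) - interpolate x s = \<phi> *\<^sub>R ((m - a) - (b - m))"
  proof (cases "\<theta> \<le> 1 / 2")
    case True
    have "interpolate y (2 * s) = a + (2 * s - real (2 * k)) *\<^sub>R (m - a)"
      using interpolate_eq[of "2 * k" "2 * s" y] True \<theta> by (simp add: a_def m_def \<theta>_def)
    moreover have "2 * s - real (2 * k) = \<theta> + \<theta>" by (simp add: \<theta>_def)
    ultimately have "interpolate y (2 * s) = a + (\<theta> *\<^sub>R (m - a) + \<theta> *\<^sub>R (m - a))"
      by (simp only: scaleR_add_left)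
    then have "interpolate y (2 * s) - interpolate x s = \<theta> *\<^sub>R ((m - a) - (b - m))"
      by (simp add: ix algebra_simps)
    then show ?thesis using \<theta> True by blast
  next
    case False
    have "interpolate y (2 * s) = m + (2 * s - real (Suc (2 * k))) *\<^sub>R (b - m)"
      using interpolate_eq[of "Suc (2 * k)" "2 * s" y] False \<theta> by (simp add: m_def b_def \<theta>_def)
    moreover have "2 * s - real (Suc (2 * k)) = \<theta> - (1 - \<theta>)" by (simp add: \<theta>_def)
    ultimately have "interpolate y (2 * s) = m + (\<theta> *\<^sub>R (b - m) - (1 - \<theta>) *\<^sub>R (b - m))"
      by (simp only: scaleR_diff_left)
    then have "interpolate y (2 * s) - interpolate x s = (1 - \<theta>) *\<^sub>R ((m - a) - (b - m))"
      by (simp add: ix algebra_simps)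
    then show ?thesis using \<theta> False by (intro exI[of _ "1 - \<theta>"]) auto
  qed
  then obtain \<phi> where \<phi>: "0 \<le> \<phi>" "\<phi> \<le> 1 / 2"
    "interpolate y (2 * s) - interpolate x s = \<phi> *\<^sub>R ((m - a) - (b - m))" by blast
  have "norm (interpolate y (2 * s) - interpolate x s) = \<phi> * norm ((m - a) - (b - m))"
    using \<phi> by simp
  also have "\<dots> \<le> 1 / 2 * (2 * e)" using \<phi> inc2 e by (intro mult_mono) auto
  finally show ?thesis by simp
qed

text \<open>The value of a process at time \<open>j / 2^l\<close> is \<open>w l j\<close>. At level \<open>l\<close> the window \<open>[0, l + 1]\<close> is
  inspected; letting it grow with \<open>l\<close> treats all bounded time intervals at once. Any ratio between
  \<open>2 powr (-1/4)\<close> and \<open>1\<close> could replace \<open>7/8\<close>: the thresholds must be summable, and so must the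
  bound \<open>2^l (2^(-l))\<^sup>2 / (7/8)^(4 l)\<close> that fourth moments give for the exceedance probabilities.\<close>

definition large_increment :: "(nat \<Rightarrow> nat \<Rightarrow> 'a::real_normed_vector) \<Rightarrow> nat \<Rightarrow> bool" where
  "large_increment w l \<longleftrightarrow>
     (\<exists>j < 2 * (Suc l * 2 ^ l). norm (w (Suc l) (Suc j) - w (Suc l) j) > (7 / 8) ^ l)"

lemma dyadic_polygons_close:
  assumes cons: "\<And>l j. w (Suc l) (2 * j) = w l j"
    and small: "\<And>l. L \<le> l \<Longrightarrow> \<not> large_increment w l"
    and "L \<le> l" "l \<le> m" and t: "0 \<le> t" "t \<le> real l"
  shows "norm (interpolate (w m) (2 ^ m * t) - interpolate (w l) (2 ^ l * t)) \<le> 8 * (7 / 8) ^ l - 8 * (7 / 8) ^ m"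
  using \<open>l \<le> m\<close>
proof (induction m rule: dec_induct)
  case (step m)
  have "norm (interpolate (w (Suc m)) (2 * (2 ^ m * t)) - interpolate (w m) (2 ^ m * t)) \<le> (7 / 8) ^ m"
  proof (rule interpolate_refine[where H = "Suc m * 2 ^ m"])
    show "norm (w (Suc m) (Suc j) - w (Suc m) j) \<le> (7 / 8) ^ m" if "j < 2 * (Suc m * 2 ^ m)" for j
    proof -
      have "L \<le> m" using step.hyps \<open>L \<le> l\<close> by simp
      from small[OF this] that show ?thesis unfolding large_increment_def by (meson not_less)
    qed
    have "t < real (Suc m)" using t step.hyps by linarith
    then have "2 ^ m * t < 2 ^ m * real (Suc m)" by (intro mult_strict_left_mono) auto
    then show "2 ^ m * t < real (Suc m * 2 ^ m)" by (simp add: algebra_simps)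
  qed (use cons t in auto)
  then have "norm (interpolate (w (Suc m)) (2 ^ Suc m * t) - interpolate (w l) (2 ^ l * t))
      \<le> (7 / 8) ^ m + (8 * (7 / 8) ^ l - 8 * (7 / 8) ^ m)"
    using norm_triangle_ineq[of "interpolate (w (Suc m)) (2 ^ Suc m * t) - interpolate (w m) (2 ^ m * t)"
        "interpolate (w m) (2 ^ m * t) - interpolate (w l) (2 ^ l * t)"] step.IH
    by (simp add: mult.assoc)
  then show ?case by simp
qed simp

text \<open>The ratio \<open>2048/2401\<close> is \<open>(8/7)^4 / 2\<close>: Markov's inequality at level \<open>l\<close> bounds the probability of a
  large increment by the number \<open>2 (l + 1) 2^l\<close> of increments inspected times
  \<open>c 4^(-l-1) / (7/8)^(4 l)\<close>.\<close>

definition chaining_tail :: "nat \<Rightarrow> real" where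
  "chaining_tail L = (\<Sum>i. real (Suc (i + L)) / 2 * (2048 / 2401) ^ (i + L))"

lemma summable_chaining: "summable (\<lambda>l. real (Suc l) / 2 * (2048 / 2401) ^ l)"
proof -
  have "summable (\<lambda>l. real (Suc l) * (2048 / 2401) ^ l)"
    by (rule sums_summable[OF geometric_deriv_sums]) simp
  then have "summable (\<lambda>l. 1 / 2 * (real (Suc l) * (2048 / 2401) ^ l))" by (rule summable_mult)
  then show ?thesis by (simp add: mult.assoc)
qed

lemma chaining_tail_tendsto: "chaining_tail \<longlonglongrightarrow> 0"
proof -
  let ?f = "\<lambda>l. real (Suc l) / 2 * (2048 / 2401 :: real) ^ l"
  have "(\<lambda>L. suminf ?f - (\<Sum>i<L. ?f i)) \<longlonglongrightarrow> suminf ?f - suminf ?f"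
    by (intro tendsto_intros summable_LIMSEQ summable_chaining)
  moreover have *: "chaining_tail L = suminf ?f - (\<Sum>i<L. ?f i)" for L
    unfolding chaining_tail_def by (rule suminf_minus_initial_segment[OF summable_chaining])
  have "chaining_tail = (\<lambda>L. suminf ?f - (\<Sum>i<L. ?f i))" by (rule ext) (rule *)
  ultimately show ?thesis by simp
qed

context prob_space
begin

lemma large_increment_event:
  fixes W :: "nat \<Rightarrow> nat \<Rightarrow> 'a \<Rightarrow> 'b::euclidean_space"
  assumes [measurable]: "\<And>l j. W l j \<in> borel_measurable M"
  shows "{\<omega>\<in>space M. large_increment (\<lambda>l j. W l j \<omega>) l} \<in> events"
proof -
  have "{\<omega>\<in>space M. large_increment (\<lambda>l j. W l j \<omega>) l} =
      (\<Union>j\<in>{..<2 * (Suc l * 2 ^ l)}. {\<omega>\<in>space M. norm (W (Suc l) (Suc j) \<omega> - W (Suc l) j \<omega>) > (7 / 8) ^ l})"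
    by (auto simp: large_increment_def)
  also have "\<dots> \<in> events" by (intro sets.finite_UN) auto
  finally show ?thesis .
qed

lemma prob_large_increment_le:
  fixes W :: "nat \<Rightarrow> nat \<Rightarrow> 'a \<Rightarrow> 'b::euclidean_space"
  assumes W[measurable]: "\<And>l j. W l j \<in> borel_measurable M"
    and mom: "\<And>l j. integrable M (\<lambda>\<omega>. norm (W l (Suc j) \<omega> - W l j \<omega>) ^ 4)"
      "\<And>l j. (\<integral>\<omega>. norm (W l (Suc j) \<omega> - W l j \<omega>) ^ 4 \<partial>M) \<le> c / 4 ^ l"
  shows "prob {\<omega>\<in>space M. large_increment (\<lambda>l j. W l j \<omega>) l} \<le> c * (real (Suc l) / 2 * (2048 / 2401) ^ l)"
proof -
  let ?e = "(7 / 8 :: real) ^ l"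
  let ?E = "\<lambda>j. {\<omega>\<in>space M. norm (W (Suc l) (Suc j) \<omega> - W (Suc l) j \<omega>) > ?e}"
  have single: "prob (?E j) \<le> c / 4 ^ Suc l / ?e ^ 4" for j
  proof -
    let ?u = "\<lambda>\<omega>. norm (W (Suc l) (Suc j) \<omega> - W (Suc l) j \<omega>) ^ 4"
    have "prob (?E j) \<le> prob {\<omega>\<in>space M. ?u \<omega> \<ge> ?e ^ 4}"
      by (rule finite_measure_mono) (auto intro: power_mono)
    also have "\<dots> \<le> (\<integral>\<omega>. ?u \<omega> \<partial>M) / ?e ^ 4"
      by (rule integral_Markov_inequality_measure[OF mom(1), where A = "{}"]) auto
    also have "\<dots> \<le> c / 4 ^ Suc l / ?e ^ 4"
      by (intro divide_right_mono mom(2)) simp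
    finally show ?thesis .
  qed
  have "{\<omega>\<in>space M. large_increment (\<lambda>l j. W l j \<omega>) l} = (\<Union>j\<in>{..<2 * (Suc l * 2 ^ l)}. ?E j)"
    by (auto simp: large_increment_def)
  then have "prob {\<omega>\<in>space M. large_increment (\<lambda>l j. W l j \<omega>) l}
      \<le> (\<Sum>j<2 * (Suc l * 2 ^ l). prob (?E j))"
    by (simp only:) (rule finite_measure_subadditive_finite, auto)
  also have "\<dots> \<le> (\<Sum>j<2 * (Suc l * 2 ^ l). c / 4 ^ Suc l / ?e ^ 4)"
    by (rule sum_mono) (rule single)
  also have "\<dots> = c * (real (Suc l) / 2 * (2 ^ l / 4 ^ l / ?e ^ 4))"
    by (simp add: field_simps)
  also have "(2::real) ^ l / 4 ^ l / ?e ^ 4 = (2048 / 2401) ^ l"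
  proof -
    have "?e ^ 4 = (2401 / 4096) ^ l"
      by (simp add: power_mult[symmetric] mult.commute[of l] ) (simp add: power_mult power_divide)
    then show ?thesis by (simp add: power_divide[symmetric])
  qed
  finally show ?thesis .
qed

lemma prob_large_increment_from_le:
  fixes W :: "nat \<Rightarrow> nat \<Rightarrow> 'a \<Rightarrow> 'b::euclidean_space"
  assumes W: "\<And>l j. W l j \<in> borel_measurable M"
    and mom: "\<And>l j. integrable M (\<lambda>\<omega>. norm (W l (Suc j) \<omega> - W l j \<omega>) ^ 4)"
      "\<And>l j. (\<integral>\<omega>. norm (W l (Suc j) \<omega> - W l j \<omega>) ^ 4 \<partial>M) \<le> c / 4 ^ l"
  shows "{\<omega>\<in>space M. \<exists>l\<ge>L. large_increment (\<lambda>l j. W l j \<omega>) l} \<in> events"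
    "prob {\<omega>\<in>space M. \<exists>l\<ge>L. large_increment (\<lambda>l j. W l j \<omega>) l} \<le> c * chaining_tail L"
proof -
  let ?E = "\<lambda>l. {\<omega>\<in>space M. large_increment (\<lambda>l j. W l j \<omega>) l}"
  have eq: "{\<omega>\<in>space M. \<exists>l\<ge>L. large_increment (\<lambda>l j. W l j \<omega>) l} = (\<Union>i. ?E (i + L))"
    by (auto intro: le_add2) (metis add.commute le_Suc_ex)
  have ev: "range (\<lambda>i. ?E (i + L)) \<subseteq> events" using large_increment_event[where W = W, OF W] by auto
  then show "{\<omega>\<in>space M. \<exists>l\<ge>L. large_increment (\<lambda>l j. W l j \<omega>) l} \<in> events"
    unfolding eq by (intro sets.countable_UN)
  let ?b = "\<lambda>i. c * (real (Suc (i + L)) / 2 * (2048 / 2401) ^ (i + L))"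
  have sb: "summable ?b"
    using summable_ignore_initial_segment[OF summable_chaining, of L] by (rule summable_mult)
  have le: "prob (?E (i + L)) \<le> ?b i" for i by (rule prob_large_increment_le[where W = W, OF W mom])
  have sE: "summable (\<lambda>i. prob (?E (i + L)))"
    by (rule summable_comparison_test[OF _ sb]) (use le in auto)
  have "prob (\<Union>i. ?E (i + L)) \<le> (\<Sum>i. prob (?E (i + L)))"
    by (rule finite_measure_subadditive_countably[OF ev sE])
  also have "\<dots> \<le> (\<Sum>i. ?b i)" by (rule suminf_le[OF le sE sb])
  also have "\<dots> = c * chaining_tail L"
    unfolding chaining_tail_def
    by (rule suminf_mult) (rule summable_ignore_initial_segment[OF summable_chaining, of L])
  finally show "prob {\<omega>\<in>space M. \<exists>l\<ge>L. large_increment (\<lambda>l j. W l j \<omega>) l} \<le> c * chaining_tail L"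
    by (simp only: eq)
qed

text \<open>Kolmogorov's criterion in quantitative form: a process with \<open>E |Z\<^sub>t - Z\<^sub>s|\<^sup>4 \<le> c |t - s|\<^sup>2\<close> is close
  to its dyadic polygon, with bounds depending on \<open>c\<close> and the mesh alone. This uniformity replaces
  tightness for sequences of processes.\<close>

lemma close_to_sample_polygon:
  fixes Z :: "'a \<Rightarrow> ('b::euclidean_space) cpath"
  assumes Z: "Z \<in> borel_measurable M"
    and mom: "\<And>l j. integrable M (\<lambda>\<omega>. norm (path_apply (Z \<omega>) (real (Suc j) / 2 ^ l) - path_apply (Z \<omega>) (real j / 2 ^ l)) ^ 4)"
      "\<And>l j. (\<integral>\<omega>. norm (path_apply (Z \<omega>) (real (Suc j) / 2 ^ l) - path_apply (Z \<omega>) (real j / 2 ^ l)) ^ 4 \<partial>M) \<le> c / 4 ^ l"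
  shows "\<exists>E\<in>events. prob E \<le> c * chaining_tail L \<and>
    (\<forall>\<omega>\<in>space M - E. dist (Z \<omega>) (sample_polygon (2 ^ L) (Z \<omega>)) \<le> 8 * (7 / 8) ^ L + (1 / 2) ^ L)"
proof -
  let ?W = "\<lambda>l j \<omega>. path_apply (Z \<omega>) (real j / 2 ^ l)"
  have W: "?W l j \<in> borel_measurable M" for l j
    by (rule measurable_compose[OF Z measurable_eval]) simp
  let ?E = "{\<omega>\<in>space M. \<exists>l\<ge>L. large_increment (\<lambda>l j. ?W l j \<omega>) l}"
  have "dist (Z \<omega>) (sample_polygon (2 ^ L) (Z \<omega>)) \<le> 8 * (7 / 8) ^ L + (1 / 2) ^ L"
    if \<omega>: "\<omega> \<in> space M - ?E" for \<omega>
  proof (rule cpath_dist_le)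
    fix t :: real assume t: "0 \<le> t" "t \<le> real L"
    let ?f = "Z \<omega>" and ?w = "\<lambda>l j. path_apply (Z \<omega>) (real j / 2 ^ l)"
    have "norm (interpolate (?w m) (2 ^ m * t) - interpolate (?w L) (2 ^ L * t)) \<le> 8 * (7 / 8) ^ L" if "L \<le> m" for m
    proof -
      have "norm (interpolate (?w m) (2 ^ m * t) - interpolate (?w L) (2 ^ L * t)) \<le> 8 * (7 / 8) ^ L - 8 * (7 / 8) ^ m"
        by (rule dyadic_polygons_close[where L = L]) (use \<omega> t that in auto)
      also have "\<dots> \<le> 8 * (7 / 8) ^ L" by simp
      finally show ?thesis .
    qed
    then have "dist (path_apply (sample_polygon (2 ^ m) ?f) t) (path_apply (sample_polygon (2 ^ L) ?f) t)
        \<le> 8 * (7 / 8) ^ L" if "L \<le> m" for m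
      using that t by (simp add: sample_polygon_def path_apply_polygon dist_norm)
    then have bd: "\<forall>\<^sub>F m in sequentially. dist (path_apply (sample_polygon (2 ^ m) ?f) t)
        (path_apply (sample_polygon (2 ^ L) ?f) t) \<le> 8 * (7 / 8) ^ L"
      by (auto simp: eventually_sequentially)
    have "filterlim (\<lambda>m. (2::real) ^ m) at_top sequentially"
      by (rule filterlim_at_top_mono[OF filterlim_real_sequentially])
         (simp add: less_imp_le[OF of_nat_less_two_power])
    then have "(\<lambda>m. sample_polygon (2 ^ m) ?f) \<longlonglongrightarrow> ?f" by (rule sample_polygon_tendsto)
    then have "(\<lambda>m. path_apply (sample_polygon (2 ^ m) ?f) t) \<longlonglongrightarrow> path_apply ?f t"
      by (rule continuous_on_tendsto_compose[OF continuous_on_eval[OF t(1)]]) auto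
    then have "(\<lambda>m. dist (path_apply (sample_polygon (2 ^ m) ?f) t) (path_apply (sample_polygon (2 ^ L) ?f) t))
        \<longlonglongrightarrow> dist (path_apply ?f t) (path_apply (sample_polygon (2 ^ L) ?f) t)"
      by (intro tendsto_dist tendsto_const)
    from tendsto_upperbound[OF this bd]
    show "dist (path_apply ?f t) (path_apply (sample_polygon (2 ^ L) ?f) t) \<le> 8 * (7 / 8) ^ L" by simp
  qed simp
  then show ?thesis
    by (intro bexI[of _ ?E] conjI prob_large_increment_from_le[where W = ?W, OF W mom]) auto
qed

end

section \<open>Gaussian vectors\<close>

definition psd_form :: "('b::euclidean_space \<Rightarrow> 'b \<Rightarrow> real) \<Rightarrow> bool" where
  "psd_form B \<longleftrightarrow> (\<forall>u. linear (B u)) \<and> (\<forall>u v. B u v = B v u) \<and> (\<forall>u. 0 \<le> B u u)"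

lemma psd_form_expand:
  assumes "psd_form B"
  shows "B (u + t *\<^sub>R v) (u + t *\<^sub>R v) = B u u + 2 * t * B u v + t\<^sup>2 * B v v"
proof -
  have lin: "linear (B w)" and sym: "B w x = B x w" for w x
    using assms by (auto simp: psd_form_def)
  have r: "B w (x + t *\<^sub>R y) = B w x + t * B w y" for w x y
    using lin[of w] by (simp add: linear_add linear_scale)
  have "B (u + t *\<^sub>R v) (u + t *\<^sub>R v) = B (u + t *\<^sub>R v) u + t * B (u + t *\<^sub>R v) v"
    by (rule r)
  also have "\<dots> = B u (u + t *\<^sub>R v) + t * B v (u + t *\<^sub>R v)" by (simp only: sym)
  also have "\<dots> = B u u + 2 * t * B u v + t\<^sup>2 * B v v"
    using sym[of v u] by (simp add: r power2_eq_square algebra_simps)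
  finally show ?thesis .
qed

lemma psd_form_Cauchy_Schwarz:
  assumes B: "psd_form B"
  shows "(B u v)\<^sup>2 \<le> B u u * B v v"
proof -
  have pos: "0 \<le> B u u + 2 * t * B u v + t\<^sup>2 * B v v" for t
    using B psd_form_expand[OF B, of u t v] unfolding psd_form_def by metis
  show ?thesis
  proof (cases "B v v = 0")
    case True
    have "B u v = 0"
    proof (rule ccontr)
      assume ne: "B u v \<noteq> 0"
      from pos[of "- (B u u + 1) / (2 * B u v)"] True ne show False by (simp add: field_simps)
    qed
    then show ?thesis using True by simp
  next
    case False
    then have vv: "0 < B v v" using B by (metis psd_form_def less_eq_real_def)
    have "0 \<le> B u u - (B u v)\<^sup>2 / B v v"
      using pos[of "- B u v / B v v"] vv by (simp add: field_simps power2_eq_square)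
    then show ?thesis using vv by (simp add: field_simps)
  qed
qed

text \<open>Gauss's reduction: subtracting the square of \<open>u \<mapsto> B(e, u) / sqrt B(e, e)\<close> leaves a positive
  semidefinite form that vanishes at \<open>e\<close>, and a semidefinite form that vanishes at all basis
  vectors is zero. The coefficient vectors replace a square root of the covariance matrix.\<close>

lemma psd_form_reduction:
  fixes B :: "'b::euclidean_space \<Rightarrow> 'b \<Rightarrow> real"
  assumes B: "psd_form B" and "finite J"
  shows "\<exists>a B'. psd_form B' \<and> (\<forall>u v. B u v = B' u v + (\<Sum>k\<in>J. (a k \<bullet> u) * (a k \<bullet> v))) \<and> (\<forall>k\<in>J. B' k k = 0)"
  using \<open>finite J\<close>
proof induction
  case empty
  then show ?case using B by auto
next
  case (insert e J)
  then obtain a B' where B': "psd_form B'"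
    and eq: "\<And>u v. B u v = B' u v + (\<Sum>k\<in>J. (a k \<bullet> u) * (a k \<bullet> v))"
    and zero: "\<And>k. k \<in> J \<Longrightarrow> B' k k = 0" by blast
  have lin: "linear (B' u)" and sym: "B' u v = B' v u" and nn: "0 \<le> B' u u" for u v
    using B' by (auto simp: psd_form_def)
  \<comment> \<open>The vector that represents the linear functional \<open>u \<mapsto> B'(e, u) / sqrt B'(e, e)\<close>.\<close>
  define b where "b = (if B' e e = 0 then 0 else adjoint (B' e) 1 /\<^sub>R sqrt (B' e e))"
  have b: "b \<bullet> u = (if B' e e = 0 then 0 else B' e u / sqrt (B' e e))" for u
    using adjoint_works[OF lin[of e], of u 1] by (simp add: b_def inner_commute divide_inverse)
  define B'' where "B'' = (\<lambda>u v. B' u v - (b \<bullet> u) * (b \<bullet> v))"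
  have sq: "(b \<bullet> u)\<^sup>2 \<le> B' u u" for u
  proof (cases "B' e e = 0")
    case False
    then have "0 < B' e e" using nn[of e] by simp
    then show ?thesis
      using psd_form_Cauchy_Schwarz[OF B', of e u] by (simp add: b power_divide field_simps)
  qed (simp add: b nn)
  have "psd_form B''"
    unfolding psd_form_def
  proof (intro conjI allI)
    show "linear (B'' u)" for u
      unfolding B''_def
      by (intro linear_compose_sub lin)
         (auto intro!: linearI simp: inner_right_distrib algebra_simps)
    show "B'' u v = B'' v u" for u v by (simp add: B''_def sym mult.commute)
    show "0 \<le> B'' u u" for u using sq[of u] by (simp add: B''_def power2_eq_square)
  qed
  moreover have "B'' k k = 0" if "k \<in> insert e J" for k
  proof (cases "k = e")
    case True
    then show ?thesis using nn[of e] by (simp add: B''_def b)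
  next
    case False
    then have "B' k k = 0" using that zero by simp
    moreover have "(b \<bullet> k)\<^sup>2 \<le> 0" using sq[of k] \<open>B' k k = 0\<close> by simp
    ultimately show ?thesis by (simp add: B''_def)
  qed
  moreover have "B u v = B'' u v + (\<Sum>k\<in>insert e J. ((a(e := b)) k \<bullet> u) * ((a(e := b)) k \<bullet> v))" for u v
  proof -
    have "(\<Sum>k\<in>J. ((a(e := b)) k \<bullet> u) * ((a(e := b)) k \<bullet> v)) = (\<Sum>k\<in>J. (a k \<bullet> u) * (a k \<bullet> v))"
      using insert.hyps by (intro sum.cong) auto
    then show ?thesis using insert.hyps eq[of u v] by (simp add: B''_def)
  qed
  ultimately show ?case by blast
qed

lemma psd_form_sum_of_squares:
  fixes B :: "'b::euclidean_space \<Rightarrow> 'b \<Rightarrow> real"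
  assumes B: "psd_form B"
  obtains a :: "'b \<Rightarrow> 'b" where "\<And>u. B u u = (\<Sum>k\<in>Basis. (a k \<bullet> u)\<^sup>2)"
proof -
  obtain a :: "'b \<Rightarrow> 'b" and B' where B': "psd_form B'"
    and eq: "\<forall>u v. B u v = B' u v + (\<Sum>k\<in>Basis. (a k \<bullet> u) * (a k \<bullet> v))"
    and zero: "\<forall>k\<in>Basis. B' k k = 0"
    using psd_form_reduction[OF B finite_Basis] by (elim exE conjE) (rule that)
  have "B' u u = 0" for u
  proof -
    have basis: "B' u k = 0" if "k \<in> Basis" for k
      using psd_form_Cauchy_Schwarz[OF B', of u k] zero that by simp
    have lin: "linear (B' u)" using B' by (auto simp: psd_form_def)
    have "B' u u = B' u (\<Sum>k\<in>Basis. (u \<bullet> k) *\<^sub>R k)" by (simp add: euclidean_representation)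
    also have "\<dots> = (\<Sum>k\<in>Basis. (u \<bullet> k) * B' u k)" by (simp add: linear_sum[OF lin] linear_scale[OF lin])
    also have "\<dots> = 0" using basis by simp
    finally show ?thesis .
  qed
  then have "B u u = (\<Sum>k\<in>Basis. (a k \<bullet> u)\<^sup>2)" for u by (simp add: eq power2_eq_square)
  then show ?thesis by (rule that)
qed

lemma centered_normal_eq:
  assumes "0 \<le> v"
  shows "centered_normal v = distr std_normal_distribution borel (\<lambda>x. sqrt v * x)"
proof -
  interpret prob_space std_normal_distribution by (rule prob_space_normal_density) simp
  show ?thesis
  proof (cases "v = 0")
    case True
    then show ?thesis
      by (simp add: centered_normal_def distr_const)
  next
    case False
    have "distributed std_normal_distribution lborel (\<lambda>x. x) (normal_density 0 1)"
      by (auto simp: distributed_def intro!: distr_id2)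
    from normal_density_affine[OF this, of "sqrt v" 0] False assms
    have "distributed std_normal_distribution lborel (\<lambda>x. sqrt v * x) (normal_density 0 (sqrt v))" by simp
    then have "distr std_normal_distribution lborel (\<lambda>x. sqrt v * x) = density lborel (normal_density 0 (sqrt v))"
      by (rule distributed_distr_eq_density)
    moreover have "distr std_normal_distribution lborel (\<lambda>x. sqrt v * x) =
        distr std_normal_distribution borel (\<lambda>x. sqrt v * x)"
      by (rule distr_cong) auto
    ultimately show ?thesis using False by (simp add: centered_normal_def)
  qed
qed

lemma char_centered_normal:
  assumes "0 \<le> v"
  shows "char (centered_normal v) t = exp (- (t\<^sup>2 * v) / 2)"
proof -
  have "char (centered_normal v) t = (\<integral>x. iexp (t * (sqrt v * x)) \<partial>std_normal_distribution)"
    unfolding char_def centered_normal_eq[OF assms] by (rule integral_distr) auto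
  also have "\<dots> = char std_normal_distribution (t * sqrt v)"
    by (simp add: char_def mult.assoc)
  also have "\<dots> = exp (- (t\<^sup>2 * v) / 2)"
    using assms by (simp add: char_std_normal_distribution power_mult_distrib)
  finally show ?thesis .
qed

context prob_space
begin

lemma distr_eq_centered_normalI:
  assumes [measurable]: "f \<in> borel_measurable M" and v: "0 \<le> v"
    and ch: "\<And>t. (\<integral>\<omega>. iexp (t * f \<omega>) \<partial>M) = exp (- (t\<^sup>2 * v) / 2)"
  shows "distr M borel f = centered_normal v"
proof (rule Levy_uniqueness)
  show "real_distribution (distr M borel f)" by (rule real_distribution_distr) simp
  interpret N: prob_space std_normal_distribution by (rule prob_space_normal_density) simp
  show "real_distribution (centered_normal v)"
    unfolding centered_normal_eq[OF v] by (rule N.real_distribution_distr) simp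
  show "char (distr M borel f) = char (centered_normal v)"
  proof (rule ext)
    fix t
    have "char (distr M borel f) t = (\<integral>\<omega>. iexp (t * f \<omega>) \<partial>M)"
      unfolding char_def by (rule integral_distr) auto
    then show "char (distr M borel f) t = char (centered_normal v) t"
      by (simp only: ch char_centered_normal[OF v])
  qed
qed

lemma iexp_centered_normal:
  assumes [measurable]: "f \<in> borel_measurable M" and v: "0 \<le> v" and d: "distr M borel f = centered_normal v"
  shows "(\<integral>\<omega>. iexp (f \<omega>) \<partial>M) = exp (- v / 2)"
proof -
  have "(\<integral>\<omega>. iexp (f \<omega>) \<partial>M) = char (distr M borel f) 1"
    unfolding char_def by (subst integral_distr) auto
  then show ?thesis by (simp add: d char_centered_normal[OF v])
qed

lemma fourth_moment_centered_normal:
  assumes [measurable]: "f \<in> borel_measurable M" and v: "0 \<le> v" and d: "distr M borel f = centered_normal v"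
  shows "integrable M (\<lambda>\<omega>. f \<omega> ^ 4)" "(\<integral>\<omega>. f \<omega> ^ 4 \<partial>M) = 3 * v\<^sup>2"
proof -
  have sv: "sqrt v ^ 4 = v\<^sup>2" using v by (simp add: power4_eq_xxxx power2_eq_square)
  have int: "integrable std_normal_distribution (\<lambda>x. (sqrt v * x) ^ 4)"
    using std_normal_distribution_even_moments(2)[of 2] by (simp add: power_mult_distrib)
  then have "integrable (distr M borel f) (\<lambda>x. x ^ 4)"
    by (simp add: d centered_normal_eq[OF v] integrable_distr_eq)
  then show "integrable M (\<lambda>\<omega>. f \<omega> ^ 4)" by (simp add: integrable_distr_eq)
  have "(\<integral>\<omega>. f \<omega> ^ 4 \<partial>M) = (\<integral>x. x ^ 4 \<partial>distr M borel f)" by (simp add: integral_distr)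
  also have "\<dots> = (\<integral>x. (sqrt v * x) ^ 4 \<partial>std_normal_distribution)"
    by (simp add: d centered_normal_eq[OF v] integral_distr)
  also have "\<dots> = 3 * v\<^sup>2"
    using std_normal_distribution_even_moments(1)[of 2]
    by (simp add: power_mult_distrib sv fact_numeral)
  finally show "(\<integral>\<omega>. f \<omega> ^ 4 \<partial>M) = 3 * v\<^sup>2" .
qed

end

lemma norm_power4_le:
  fixes x :: "'b::euclidean_space"
  shows "norm x ^ 4 \<le> real DIM('b) * (\<Sum>b\<in>Basis. (b \<bullet> x) ^ 4)"
proof -
  have "norm x ^ 4 = (norm x ^ 2) ^ 2" by simp
  also have "norm x ^ 2 = (\<Sum>b\<in>Basis. (b \<bullet> x)\<^sup>2)"
    unfolding power2_norm_eq_inner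
    by (subst euclidean_inner) (simp add: power2_eq_square inner_commute)
  also have "(\<Sum>b\<in>Basis. (b \<bullet> x)\<^sup>2)\<^sup>2 \<le> (\<Sum>b\<in>Basis. ((b \<bullet> x)\<^sup>2)\<^sup>2) * real DIM('b)"
    by (rule sum_squared_le_sum_of_squares)
  finally show ?thesis by (simp add: mult.commute)
qed

lemma (in prob_space) fourth_moment_norm:
  fixes Z :: "'a \<Rightarrow> 'b::euclidean_space"
  assumes [measurable]: "Z \<in> borel_measurable M"
    and int: "\<And>b. b \<in> Basis \<Longrightarrow> integrable M (\<lambda>\<omega>. (b \<bullet> Z \<omega>) ^ 4)"
    and le: "\<And>b. b \<in> Basis \<Longrightarrow> (\<integral>\<omega>. (b \<bullet> Z \<omega>) ^ 4 \<partial>M) \<le> c b"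
  shows "integrable M (\<lambda>\<omega>. norm (Z \<omega>) ^ 4)" "(\<integral>\<omega>. norm (Z \<omega>) ^ 4 \<partial>M) \<le> real DIM('b) * (\<Sum>b\<in>Basis. c b)"
proof -
  have int': "integrable M (\<lambda>\<omega>. real DIM('b) * (\<Sum>b\<in>Basis. (b \<bullet> Z \<omega>) ^ 4))"
    by (intro integrable_mult_right Bochner_Integration.integrable_sum int)
  then show I: "integrable M (\<lambda>\<omega>. norm (Z \<omega>) ^ 4)"
    by (rule Bochner_Integration.integrable_bound)
       (auto intro!: AE_I2 simp: norm_power4_le abs_of_nonneg[OF mult_nonneg_nonneg] sum_nonneg)
  have "(\<integral>\<omega>. norm (Z \<omega>) ^ 4 \<partial>M) \<le> (\<integral>\<omega>. real DIM('b) * (\<Sum>b\<in>Basis. (b \<bullet> Z \<omega>) ^ 4) \<partial>M)"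
    by (rule integral_mono[OF I int' norm_power4_le])
  also have "\<dots> = real DIM('b) * (\<Sum>b\<in>Basis. \<integral>\<omega>. (b \<bullet> Z \<omega>) ^ 4 \<partial>M)"
    using int by (simp add: integral_sum)
  also have "\<dots> \<le> real DIM('b) * (\<Sum>b\<in>Basis. c b)"
    by (intro mult_left_mono sum_mono le) auto
  finally show "(\<integral>\<omega>. norm (Z \<omega>) ^ 4 \<partial>M) \<le> real DIM('b) * (\<Sum>b\<in>Basis. c b)" .
qed

lemma (in prob_space) iexp_sum_indep:
  assumes "finite J" and ind: "indep_vars (\<lambda>_. borel) f J"
  shows "(\<integral>\<omega>. iexp (\<Sum>i\<in>J. f i \<omega>) \<partial>M) = (\<Prod>i\<in>J. \<integral>\<omega>. iexp (f i \<omega>) \<partial>M)"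
proof -
  have rv[measurable]: "f i \<in> borel_measurable M" if "i \<in> J" for i
    using ind that by (auto simp: indep_vars_def)
  have "(\<integral>\<omega>. iexp (\<Sum>i\<in>J. f i \<omega>) \<partial>M) = (\<integral>\<omega>. (\<Prod>i\<in>J. iexp (f i \<omega>)) \<partial>M)"
    by (simp add: of_real_sum sum_distrib_left exp_sum \<open>finite J\<close>)
  also have "\<dots> = (\<Prod>i\<in>J. \<integral>\<omega>. iexp (f i \<omega>) \<partial>M)"
  proof (rule indep_vars_lebesgue_integral[OF \<open>finite J\<close>])
    show "indep_vars (\<lambda>_. borel) (\<lambda>i \<omega>. iexp (f i \<omega>)) J"
      by (rule indep_vars_compose2[OF ind]) simp
    show "integrable M (\<lambda>\<omega>. iexp (f i \<omega>))" if "i \<in> J" for i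
      using that by (intro integrable_const_bound[of _ 1]) auto
  qed
  finally show ?thesis .
qed

text \<open>The vectors \<open>g p\<close> are linear images of independent blocks of standard normal variables. Their joint
  characteristic function encodes both independence and laws.\<close>

lemma gaussian_array_exists:
  fixes a :: "'b \<Rightarrow> 'b::euclidean_space"
  defines "Q \<equiv> \<lambda>u. \<Sum>k\<in>Basis. (a k \<bullet> u)\<^sup>2"
  obtains P :: "(((nat \<times> nat) \<times> 'b) \<Rightarrow> real) measure" and g :: "nat \<times> nat \<Rightarrow> (((nat \<times> nat) \<times> 'b) \<Rightarrow> real) \<Rightarrow> 'b"
  where "prob_space P" "\<And>p::nat \<times> nat. g p \<in> borel_measurable P"
    "\<And>I (c :: nat \<times> nat \<Rightarrow> 'b). finite I \<Longrightarrow> (\<integral>\<omega>. iexp (\<Sum>p\<in>I. c p \<bullet> g p \<omega>) \<partial>P) = exp (- (\<Sum>p\<in>I. Q (c p)) / 2)"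
proof -
  let ?P = "PiM UNIV (\<lambda>_::(nat \<times> nat) \<times> 'b. std_normal_distribution)"
  have std: "prob_space std_normal_distribution" by (rule prob_space_normal_density) simp
  interpret P: product_prob_space "\<lambda>_::(nat \<times> nat) \<times> 'b. std_normal_distribution" UNIV
    by (intro product_prob_spaceI std)
  have prob: "prob_space ?P" by (intro prob_space_PiM std)
  have coord[measurable]: "(\<lambda>\<omega>. \<omega> i) \<in> borel_measurable ?P" for i
    using measurable_component_singleton[of i UNIV "\<lambda>_. std_normal_distribution"] by simp
  have distr: "distr ?P borel (\<lambda>\<omega>. \<omega> i) = std_normal_distribution" for i
  proof -
    have "distr ?P borel (\<lambda>\<omega>. \<omega> i) = distr ?P std_normal_distribution (\<lambda>\<omega>. \<omega> i)"
      by (rule distr_cong) auto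
    then show ?thesis using P.PiM_component[of i] by simp
  qed
  have indep: "prob_space.indep_vars ?P (\<lambda>_. borel) (\<lambda>i \<omega>. \<omega> i) UNIV"
  proof (subst prob_space.indep_vars_iff_distr_eq_PiM[OF prob])
    have "distr ?P (PiM UNIV (\<lambda>_. borel)) (\<lambda>x. \<lambda>i\<in>UNIV. x i) = distr ?P (PiM UNIV (\<lambda>_. borel)) (\<lambda>x. x)"
      by (simp add: restrict_UNIV)
    also have "\<dots> = ?P" by (rule distr_id2) (rule sets_PiM_cong, auto)
    finally show "distr ?P (PiM UNIV (\<lambda>_. borel)) (\<lambda>x. \<lambda>i\<in>UNIV. x i) = PiM UNIV (\<lambda>i. distr ?P borel (\<lambda>\<omega>. \<omega> i))"
      by (simp add: distr)
  qed auto
  define g :: "nat \<times> nat \<Rightarrow> (((nat \<times> nat) \<times> 'b) \<Rightarrow> real) \<Rightarrow> 'b"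
    where "g = (\<lambda>p \<omega>. \<Sum>k\<in>Basis. \<omega> (p, k) *\<^sub>R a k)"
  show ?thesis
  proof (rule that[OF prob])
    show "g p \<in> borel_measurable ?P" for p by (simp add: g_def)
    fix I :: "(nat \<times> nat) set" and c :: "nat \<times> nat \<Rightarrow> 'b" assume I: "finite I"
    define d where "d = (\<lambda>i. c (fst i) \<bullet> a (snd i))"
    have "(\<Sum>p\<in>I. c p \<bullet> g p \<omega>) = (\<Sum>p\<in>I. \<Sum>k\<in>Basis. d (p, k) * \<omega> (p, k))" for \<omega>
      by (simp add: g_def d_def inner_sum_right mult.commute)
    then have "(\<Sum>p\<in>I. c p \<bullet> g p \<omega>) = (\<Sum>i\<in>I \<times> Basis. d i * \<omega> i)" for \<omega>
      by (simp add: sum.cartesian_product split_def)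
    then have "(\<integral>\<omega>. iexp (\<Sum>p\<in>I. c p \<bullet> g p \<omega>) \<partial>?P) = (\<integral>\<omega>. iexp (\<Sum>i\<in>I \<times> Basis. d i * \<omega> i) \<partial>?P)"
      by simp
    also have "\<dots> = (\<Prod>i\<in>I \<times> Basis. \<integral>\<omega>. iexp (d i * \<omega> i) \<partial>?P)"
    proof (rule prob_space.iexp_sum_indep[OF prob])
      have "prob_space.indep_vars ?P (\<lambda>_. borel) (\<lambda>i \<omega>. \<omega> i) (I \<times> Basis)"
        by (rule prob_space.indep_vars_subset[OF prob indep subset_UNIV])
      then show "prob_space.indep_vars ?P (\<lambda>_. borel) (\<lambda>i \<omega>. d i * \<omega> i) (I \<times> Basis)"
        by (rule prob_space.indep_vars_compose2[OF prob]) simp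
    qed (use I in simp)
    also have "\<dots> = (\<Prod>i\<in>I \<times> Basis. char (distr ?P borel (\<lambda>\<omega>. \<omega> i)) (d i))"
      by (intro prod.cong refl) (simp add: char_def integral_distr)
    also have "\<dots> = (\<Prod>i\<in>I \<times> Basis. of_real (exp (- ((d i)\<^sup>2) / 2)))"
      by (simp only: distr char_std_normal_distribution)
    also have "\<dots> = of_real (exp (\<Sum>i\<in>I \<times> Basis. - ((d i)\<^sup>2) / 2))"
      using I by (simp add: exp_sum)
    also have "(\<Sum>i\<in>I \<times> Basis. - ((d i)\<^sup>2) / 2) = - (\<Sum>p\<in>I. Q (c p)) / 2"
      by (simp add: Q_def d_def sum.cartesian_product' sum_negf sum_divide_distrib inner_commute)
    finally show "(\<integral>\<omega>. iexp (\<Sum>p\<in>I. c p \<bullet> g p \<omega>) \<partial>?P) = exp (- (\<Sum>p\<in>I. Q (c p)) / 2)" .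
  qed
qed

section \<open>Increments over blocks\<close>

lemma block_coefficients:
  fixes u :: "nat \<Rightarrow> 'b::real_inner"
  assumes "mono m"
  shows "\<exists>v. (\<forall>x. (\<Sum>j<n. u j \<bullet> (\<Sum>i\<in>{m j..<m (Suc j)}. x i)) = (\<Sum>i<m n. v i \<bullet> x i)) \<and>
    (\<forall>\<psi>::'b \<Rightarrow> complex. \<psi> 0 = 1 \<longrightarrow> (\<Prod>i<m n. \<psi> (v i)) = (\<Prod>j<n. \<psi> (u j) ^ (m (Suc j) - m j)))"
proof (induction n)
  case 0
  show ?case by (rule exI[of _ "\<lambda>_. 0"]) simp
next
  case (Suc n)
  then obtain v where v: "\<And>x. (\<Sum>j<n. u j \<bullet> (\<Sum>i\<in>{m j..<m (Suc j)}. x i)) = (\<Sum>i<m n. v i \<bullet> x i)"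
    and p: "\<And>\<psi>::'b \<Rightarrow> complex. \<psi> 0 = 1 \<Longrightarrow> (\<Prod>i<m n. \<psi> (v i)) = (\<Prod>j<n. \<psi> (u j) ^ (m (Suc j) - m j))"
    by blast
  let ?w = "\<lambda>i. if i < m n then v i else u n"
  have le: "m n \<le> m (Suc n)" using assms by (simp add: monoD)
  have split: "{..<m (Suc n)} = {..<m n} \<union> {m n..<m (Suc n)}" using le by auto
  have "(\<Sum>j<Suc n. u j \<bullet> (\<Sum>i\<in>{m j..<m (Suc j)}. x i)) = (\<Sum>i<m (Suc n). ?w i \<bullet> x i)" for x
  proof -
    have "(\<Sum>i<m (Suc n). ?w i \<bullet> x i) = (\<Sum>i<m n. ?w i \<bullet> x i) + (\<Sum>i\<in>{m n..<m (Suc n)}. ?w i \<bullet> x i)"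
      unfolding split by (rule sum.union_disjoint) auto
    also have "\<dots> = (\<Sum>i<m n. v i \<bullet> x i) + (\<Sum>i\<in>{m n..<m (Suc n)}. u n \<bullet> x i)"
      by (intro arg_cong2[where f = "(+)"] sum.cong) auto
    finally show ?thesis by (simp add: v[symmetric] inner_sum_right)
  qed
  moreover have "(\<Prod>i<m (Suc n). \<psi> (?w i)) = (\<Prod>j<Suc n. \<psi> (u j) ^ (m (Suc j) - m j))"
    if "\<psi> 0 = 1" for \<psi> :: "'b \<Rightarrow> complex"
  proof -
    have "(\<Prod>i<m (Suc n). \<psi> (?w i)) = (\<Prod>i<m n. \<psi> (?w i)) * (\<Prod>i\<in>{m n..<m (Suc n)}. \<psi> (?w i))"
      unfolding split by (rule prod.union_disjoint) auto
    also have "\<dots> = (\<Prod>i<m n. \<psi> (v i)) * (\<Prod>i\<in>{m n..<m (Suc n)}. \<psi> (u n))"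
      by (intro arg_cong2[where f = "(*)"] prod.cong) auto
    finally show ?thesis by (simp add: p[of \<psi>, OF that])
  qed
  ultimately show ?case by (intro exI[of _ ?w] conjI allI impI)
qed

lemma (in prob_space) char_function_blocks:
  fixes D :: "nat \<Rightarrow> 'a \<Rightarrow> 'b::euclidean_space" and \<psi> :: "'b \<Rightarrow> complex"
  assumes prod: "\<And>k v. (\<integral>\<omega>. iexp (\<Sum>i<k. v i \<bullet> D i \<omega>) \<partial>M) = (\<Prod>i<k. \<psi> (v i))"
    and "\<psi> 0 = 1" and m: "mono m"
  shows "(\<integral>\<omega>. iexp (\<Sum>j<n. u j \<bullet> ((\<Sum>i<m (Suc j). D i \<omega>) - (\<Sum>i<m j. D i \<omega>))) \<partial>M)
    = (\<Prod>j<n. \<psi> (u j) ^ (m (Suc j) - m j))"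
proof -
  obtain v where v: "\<And>x. (\<Sum>j<n. u j \<bullet> (\<Sum>i\<in>{m j..<m (Suc j)}. x i)) = (\<Sum>i<m n. v i \<bullet> x i)"
    and p: "(\<Prod>i<m n. \<psi> (v i)) = (\<Prod>j<n. \<psi> (u j) ^ (m (Suc j) - m j))"
    using block_coefficients[OF m, where n = n and u = u] \<open>\<psi> 0 = 1\<close> by blast
  have "(\<Sum>i<m (Suc j). D i \<omega>) - (\<Sum>i<m j. D i \<omega>) = (\<Sum>i\<in>{m j..<m (Suc j)}. D i \<omega>)" for j \<omega>
  proof -
    have "m j \<le> m (Suc j)" using m by (simp add: monoD)
    then have "(\<Sum>i<m (Suc j). D i \<omega>) = (\<Sum>i<m j. D i \<omega>) + (\<Sum>i\<in>{m j..<m (Suc j)}. D i \<omega>)"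
      by (subst sum.union_disjoint[symmetric]) (auto intro!: sum.cong)
    then show ?thesis by simp
  qed
  then show ?thesis by (simp only: v prod p)
qed

section \<open>L\'evy's construction of Brownian motion\<close>

text \<open>Increments over the dyadic intervals of length \<open>2^(-l)\<close>. Splitting an interval halves its
  increment and moves the half by an independent Gaussian with a quarter of the variance, added on
  the left and subtracted on the right: the two halves come out independent.\<close>

primrec levy_increment :: "(nat \<times> nat \<Rightarrow> 'b::real_vector) \<Rightarrow> nat \<Rightarrow> nat \<Rightarrow> 'b" where
  "levy_increment g 0 j = g (0, j)"
| "levy_increment g (Suc l) j = (1 / 2) *\<^sub>R levy_increment g l (j div 2)
     + ((if even j then 1 else - 1) * (sqrt ((1 / 2) ^ l) / 2)) *\<^sub>R g (Suc l, j div 2)"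

lemma sum_pairs: "(\<Sum>j<2 * k. f j) = (\<Sum>i<k. f (2 * i) + f (Suc (2 * i)) :: 'a::comm_monoid_add)"
  by (induction k) (simp_all add: ac_simps)

lemma levy_increment_split:
  "levy_increment g (Suc l) (2 * i) + levy_increment g (Suc l) (Suc (2 * i)) = levy_increment g l i"
  using scaleR_half_double[of "levy_increment g l i"] by (simp add: scaleR_add_right[symmetric] del: scaleR_half_double)

lemma sum_row_union:
  fixes F :: "'b \<Rightarrow> nat \<times> nat \<Rightarrow> real"
  assumes "finite I" "\<And>p. p \<in> I \<Longrightarrow> m < fst p"
  shows "(\<Sum>p\<in>I \<union> {m} \<times> {..<k}. F (if fst p = m then v (snd p) else c p) p)
    = (\<Sum>j<k. F (v j) (m, j)) + (\<Sum>p\<in>I. F (c p) p)"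
proof -
  let ?h = "\<lambda>p. F (if fst p = m then v (snd p) else c p) p"
  have "(\<Sum>p\<in>I \<union> {m} \<times> {..<k}. ?h p) = (\<Sum>p\<in>I. ?h p) + (\<Sum>p\<in>{m} \<times> {..<k}. ?h p)"
    by (rule sum.union_disjoint) (use assms in force)+
  also have "(\<Sum>p\<in>I. ?h p) = (\<Sum>p\<in>I. F (c p) p)"
    by (rule sum.cong) (use assms(2) in force)+
  also have "(\<Sum>p\<in>{m} \<times> {..<k}. ?h p) = (\<Sum>i\<in>{m}. \<Sum>j<k. ?h (i, j))"
    by (simp only: sum.cartesian_product split_def prod.collapse)
  finally show ?thesis by (simp add: add.commute)
qed

text \<open>The Gaussians of the levels above \<open>l\<close> are carried along: the step from \<open>l\<close> to \<open>l + 1\<close> then is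
  only a regrouping of coefficients, by the parallelogram law for \<open>Q\<close>.\<close>

lemma (in prob_space) levy_increment_char:
  fixes g :: "nat \<times> nat \<Rightarrow> 'a \<Rightarrow> 'b::euclidean_space" and Q :: "'b \<Rightarrow> real"
  assumes gauss: "\<And>I c. finite I \<Longrightarrow> (\<integral>\<omega>. iexp (\<Sum>p\<in>I. c p \<bullet> g p \<omega>) \<partial>M) = exp (- (\<Sum>p\<in>I. Q (c p)) / 2)"
    and par: "\<And>x y. Q (x + y) + Q (x - y) = 2 * Q x + 2 * Q y"
    and hom: "\<And>r x. Q (r *\<^sub>R x) = r\<^sup>2 * Q x"
    and "finite I" "\<And>p. p \<in> I \<Longrightarrow> l < fst p"
  shows "(\<integral>\<omega>. iexp ((\<Sum>j<k. v j \<bullet> levy_increment (\<lambda>p. g p \<omega>) l j) + (\<Sum>p\<in>I. c p \<bullet> g p \<omega>)) \<partial>M)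
    = exp (- ((1 / 2) ^ l * (\<Sum>j<k. Q (v j)) + (\<Sum>p\<in>I. Q (c p))) / 2)"
  using assms(4,5)
proof (induction l arbitrary: k v I c)
  case 0
  let ?c = "\<lambda>p. if fst p = 0 then v (snd p) else c p"
  have "(\<Sum>j<k. v j \<bullet> levy_increment (\<lambda>p. g p \<omega>) 0 j) + (\<Sum>p\<in>I. c p \<bullet> g p \<omega>)
      = (\<Sum>p\<in>I \<union> {0} \<times> {..<k}. ?c p \<bullet> g p \<omega>)" for \<omega>
    using sum_row_union[OF 0, of "\<lambda>x p. x \<bullet> g p \<omega>" v c k] by simp
  moreover have "(1 / 2) ^ 0 * (\<Sum>j<k. Q (v j)) + (\<Sum>p\<in>I. Q (c p)) = (\<Sum>p\<in>I \<union> {0} \<times> {..<k}. Q (?c p))"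
    using sum_row_union[OF 0, of "\<lambda>x p. Q x" v c k] by simp
  ultimately show ?case using gauss[of "I \<union> {0} \<times> {..<k}" ?c] 0 by simp
next
  case (Suc l)
  define w where "w = (\<lambda>j. if j < k then v j else 0)"
  define s where "s = sqrt ((1 / 2) ^ l) / 2"
  define a where "a = (\<lambda>i. (1 / 2) *\<^sub>R (w (2 * i) + w (Suc (2 * i))))"
  define b where "b = (\<lambda>i. s *\<^sub>R (w (2 * i) - w (Suc (2 * i))))"
  let ?c = "\<lambda>p. if fst p = Suc l then b (snd p) else c p"
  let ?I = "I \<union> {Suc l} \<times> {..<k}"
  have s2: "s\<^sup>2 = (1 / 2) ^ l / 4" by (simp add: s_def power_divide)
  have Q0: "Q 0 = 0" using hom[of 0 0] by simp
  have pad: "(\<Sum>j<2 * k. f (w j) j) = (\<Sum>j<k. f (v j) j)" if "\<And>j. f 0 j = 0" for f :: "'b \<Rightarrow> nat \<Rightarrow> real"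
    by (rule sum.mono_neutral_cong_right) (auto simp: w_def that)
  have "(\<Sum>j<k. v j \<bullet> levy_increment (\<lambda>p. g p \<omega>) (Suc l) j) + (\<Sum>p\<in>I. c p \<bullet> g p \<omega>)
      = (\<Sum>i<k. a i \<bullet> levy_increment (\<lambda>p. g p \<omega>) l i) + (\<Sum>p\<in>?I. ?c p \<bullet> g p \<omega>)" for \<omega>
  proof -
    let ?D = "levy_increment (\<lambda>p. g p \<omega>)"
    have "(\<Sum>j<k. v j \<bullet> ?D (Suc l) j) = (\<Sum>j<2 * k. w j \<bullet> ?D (Suc l) j)"
      by (rule pad[of "\<lambda>x j. x \<bullet> ?D (Suc l) j", symmetric]) simp
    also have "\<dots> = (\<Sum>i<k. w (2 * i) \<bullet> ?D (Suc l) (2 * i) + w (Suc (2 * i)) \<bullet> ?D (Suc l) (Suc (2 * i)))"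
      by (rule sum_pairs)
    also have "\<dots> = (\<Sum>i<k. a i \<bullet> ?D l i + b i \<bullet> g (Suc l, i) \<omega>)"
    proof (rule sum.cong)
      fix i
      have D: "?D (Suc l) (2 * i) = (1 / 2) *\<^sub>R ?D l i + s *\<^sub>R g (Suc l, i) \<omega>"
        "?D (Suc l) (Suc (2 * i)) = (1 / 2) *\<^sub>R ?D l i - s *\<^sub>R g (Suc l, i) \<omega>"
        by (simp_all add: s_def)
      show "w (2 * i) \<bullet> ?D (Suc l) (2 * i) + w (Suc (2 * i)) \<bullet> ?D (Suc l) (Suc (2 * i))
          = a i \<bullet> ?D l i + b i \<bullet> g (Suc l, i) \<omega>"
        unfolding D a_def b_def
        by (simp add: inner_add_left inner_add_right inner_diff_left inner_diff_right algebra_simps)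
    qed simp
    finally show ?thesis
      using sum_row_union[OF Suc.prems(1), of "Suc l" "\<lambda>x p. x \<bullet> g p \<omega>" b c k] Suc.prems(2)
      by (simp add: sum.distrib)
  qed
  moreover have "(1 / 2) ^ Suc l * (\<Sum>j<k. Q (v j)) + (\<Sum>p\<in>I. Q (c p))
      = (1 / 2) ^ l * (\<Sum>i<k. Q (a i)) + (\<Sum>p\<in>?I. Q (?c p))"
  proof -
    have "(\<Sum>j<k. Q (v j)) = (\<Sum>i<k. Q (w (2 * i)) + Q (w (Suc (2 * i))))"
      using pad[of "\<lambda>x j. Q x"] by (simp add: Q0 sum_pairs)
    then have "(1 / 2) ^ Suc l * (\<Sum>j<k. Q (v j))
        = (\<Sum>i<k. (1 / 2) ^ Suc l * (Q (w (2 * i)) + Q (w (Suc (2 * i)))))"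
      by (simp only: sum_distrib_left)
    also have "\<dots> = (\<Sum>i<k. (1 / 2) ^ l * Q (a i) + Q (b i))"
    proof (rule sum.cong)
      fix i
      have "Q (a i) = Q (w (2 * i) + w (Suc (2 * i))) / 4"
        "Q (b i) = (1 / 2) ^ l / 4 * Q (w (2 * i) - w (Suc (2 * i)))"
        by (simp_all only: a_def b_def hom s2) (simp_all add: power2_eq_square)
      then have "(1 / 2) ^ l * Q (a i) + Q (b i)
          = (1 / 2) ^ l / 4 * (Q (w (2 * i) + w (Suc (2 * i))) + Q (w (2 * i) - w (Suc (2 * i))))"
        by (simp only: distrib_left)
      then show "(1 / 2) ^ Suc l * (Q (w (2 * i)) + Q (w (Suc (2 * i)))) = (1 / 2) ^ l * Q (a i) + Q (b i)"
        unfolding par by (simp add: algebra_simps)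
    qed simp
    finally show ?thesis
      using sum_row_union[OF Suc.prems(1), of "Suc l" "\<lambda>x p. Q x" b c k] Suc.prems(2)
      by (simp add: sum.distrib sum_distrib_left)
  qed
  moreover have "(\<integral>\<omega>. iexp ((\<Sum>i<k. a i \<bullet> levy_increment (\<lambda>p. g p \<omega>) l i) + (\<Sum>p\<in>?I. ?c p \<bullet> g p \<omega>)) \<partial>M)
      = exp (- ((1 / 2) ^ l * (\<Sum>i<k. Q (a i)) + (\<Sum>p\<in>?I. Q (?c p))) / 2)"
    by (rule Suc.IH) (use Suc.prems in \<open>auto dest: Suc_lessD\<close>)
  ultimately show ?case by simp
qed

lemma dyadic_polygons_converge:
  fixes w :: "nat \<Rightarrow> nat \<Rightarrow> 'b::euclidean_space"
  assumes cons: "\<And>l j. w (Suc l) (2 * j) = w l j"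
    and small: "\<And>l. L \<le> l \<Longrightarrow> \<not> large_increment w l"
  shows "convergent (\<lambda>l. polygon (2 ^ l) (w l))"
proof -
  let ?p = "\<lambda>l t. interpolate (w l) (2 ^ l * t)"
  define F where "F = (\<lambda>t. lim (\<lambda>l. ?p l t))"
  have unif: "uniform_limit {0..real H} ?p F sequentially" for H
    unfolding F_def uniformly_convergent_uniform_limit_iff[symmetric]
  proof (rule Cauchy_uniformly_convergent, unfold uniformly_Cauchy_on_def, intro allI impI)
    fix e :: real assume "0 < e"
    then obtain l0 where l0: "(7 / 8 :: real) ^ l0 < e / 16"
      using real_arch_pow_inv[of "e / 16" "7 / 8"] by auto
    define l where "l = max l0 (max L H)"
    have small_l: "16 * (7 / 8 :: real) ^ l < e"
    proof -
      have "l0 \<le> l" by (simp add: l_def)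
      then have "(7 / 8 :: real) ^ l \<le> (7 / 8) ^ l0" by (intro power_decreasing) auto
      with l0 show ?thesis by linarith
    qed
    have near: "dist (?p m t) (?p l t) \<le> 8 * (7 / 8) ^ l" if "t \<in> {0..real H}" "l \<le> m" for m t
    proof -
      have "norm (?p m t - ?p l t) \<le> 8 * (7 / 8) ^ l - 8 * (7 / 8) ^ m"
        by (rule dyadic_polygons_close[where L = L]) (use cons small that in \<open>auto simp: l_def\<close>)
      also have "\<dots> \<le> 8 * (7 / 8) ^ l" by simp
      finally show ?thesis by (simp add: dist_norm)
    qed
    show "\<exists>l. \<forall>t\<in>{0..real H}. \<forall>m\<ge>l. \<forall>n\<ge>l. dist (?p m t) (?p n t) < e"
    proof (intro exI[of _ l] ballI allI impI)
      fix t m n assume "t \<in> {0..real H}" "l \<le> m" "l \<le> n"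
      then have "dist (?p m t) (?p l t) + dist (?p n t) (?p l t) \<le> 16 * (7 / 8) ^ l"
        using near[of t m] near[of t n] by simp
      then show "dist (?p m t) (?p n t) < e"
        using dist_triangle2[of "?p m t" "?p n t" "?p l t"] small_l by linarith
    qed
  qed
  have cont_H: "continuous_on {0..real H} F" for H
    by (rule uniform_limit_theorem[OF _ unif])
       (auto intro!: always_eventually continuous_on_subset[OF continuous_on_interpolate_scaled])
  have cont: "continuous_on {0..} F"
    unfolding continuous_on_eq_continuous_within
  proof
    fix t :: real assume t: "t \<in> {0..}"
    obtain k :: nat where k: "t < real k" using reals_Archimedean2 by blast
    have "at t within {0..} = at t within {0..real k}"
      by (rule at_within_nhd[of _ "{..<real k}"]) (use k in auto)
    moreover have "continuous (at t within {0..real k}) F"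
      using cont_H[of k] t k by (auto simp: continuous_on_eq_continuous_within)
    ultimately show "continuous (at t within {0..}) F" by (simp add: continuous_within)
  qed
  have "(\<lambda>l. polygon (2 ^ l) (w l)) \<longlonglongrightarrow> mk_cpath F"
  proof (rule cpath_tendstoI)
    fix K :: nat and e :: real assume "0 < e"
    with unif[of K] have "\<forall>\<^sub>F l in sequentially. \<forall>t\<in>{0..real K}. dist (?p l t) (F t) < e"
      by (auto simp: uniform_limit_iff)
    then show "\<forall>\<^sub>F l in sequentially. \<forall>t. 0 \<le> t \<and> t \<le> real K \<longrightarrow>
        dist (path_apply (polygon (2 ^ l) (w l)) t) (path_apply (mk_cpath F) t) \<le> e"
      by eventually_elim (auto simp: path_apply_polygon path_apply_mk_cpath[OF cont] intro: less_imp_le)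
  qed
  then show ?thesis by (auto simp: convergent_def)
qed

text \<open>The limit of the dyadic polygons, on the almost sure event where they converge.\<close>

lemma (in prob_space) random_dyadic_path:
  fixes W :: "nat \<Rightarrow> nat \<Rightarrow> 'a \<Rightarrow> 'b::euclidean_space"
  assumes W: "\<And>l j. W l j \<in> borel_measurable M"
    and cons: "\<And>l j \<omega>. W (Suc l) (2 * j) \<omega> = W l j \<omega>"
    and mom: "\<And>l j. integrable M (\<lambda>\<omega>. norm (W l (Suc j) \<omega> - W l j \<omega>) ^ 4)"
      "\<And>l j. (\<integral>\<omega>. norm (W l (Suc j) \<omega> - W l j \<omega>) ^ 4 \<partial>M) \<le> c / 4 ^ l"
  obtains B where "B \<in> borel_measurable M"
    "AE \<omega> in M. \<forall>l j. path_apply (B \<omega>) (real j / 2 ^ l) = W l j \<omega>"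
proof -
  define w where "w = (\<lambda>\<omega> l j. W l j \<omega>)"
  define bad where "bad = (\<lambda>L. {\<omega>\<in>space M. \<exists>l\<ge>L. large_increment (w \<omega>) l})"
  have bad[measurable]: "bad L \<in> events" for L
    unfolding bad_def w_def by (rule prob_large_increment_from_le(1)[where W = W, OF W mom])
  have bad_le: "prob (bad L) \<le> c * chaining_tail L" for L
    unfolding bad_def w_def by (rule prob_large_increment_from_le(2)[where W = W, OF W mom])
  \<comment> \<open>The good event: large increments occur at finitely many levels only.\<close>
  define G where "G = space M - (\<Inter>L. bad L)"
  have [measurable]: "G \<in> events" by (simp add: G_def)
  have "prob (\<Inter>L. bad L) \<le> c * chaining_tail L" for L
    by (rule order_trans[OF finite_measure_mono bad_le]) auto
  moreover have "(\<lambda>L. c * chaining_tail L) \<longlonglongrightarrow> c * 0"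
    by (intro tendsto_mult tendsto_const chaining_tail_tendsto)
  ultimately have "prob (\<Inter>L. bad L) \<le> c * 0"
    by (intro LIMSEQ_le_const) auto
  then have "prob (\<Inter>L. bad L) \<le> 0" by simp
  then have "prob (\<Inter>L. bad L) = 0" using measure_nonneg[of M] by (simp add: antisym)
  then have "(\<Inter>L. bad L) \<in> null_sets M" by (intro null_setsI) (auto simp: emeasure_eq_measure)
  then have AE_G: "AE \<omega> in M. \<omega> \<in> G"
    by (rule AE_I') (auto simp: G_def)
  define B where "B = (\<lambda>\<omega>. if \<omega> \<in> G then lim (\<lambda>l. polygon (2 ^ l) (w \<omega> l)) else polygon 1 (\<lambda>_. 0))"
  have conv: "(\<lambda>l. polygon (2 ^ l) (w \<omega> l)) \<longlonglongrightarrow> B \<omega>" if \<omega>: "\<omega> \<in> G" for \<omega>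
  proof -
    obtain L where "\<omega> \<in> space M" "\<omega> \<notin> bad L" using \<omega> by (auto simp: G_def)
    then have L: "\<And>l. L \<le> l \<Longrightarrow> \<not> large_increment (w \<omega>) l" by (auto simp: bad_def)
    have "convergent (\<lambda>l. polygon (2 ^ l) (w \<omega> l))"
      by (rule dyadic_polygons_converge[OF _ L]) (simp_all add: w_def cons)
    then show ?thesis using \<omega> by (simp add: B_def convergent_LIMSEQ_iff)
  qed
  have "B \<in> borel_measurable M"
  proof (rule borel_measurable_LIMSEQ_metric)
    fix l
    have [measurable]: "(\<lambda>\<omega>. polygon (2 ^ l) (w \<omega> l)) \<in> borel_measurable M"
      using measurable_polygon[of "2 ^ l" "W l" M] W by (simp add: w_def)
    show "(\<lambda>\<omega>. if \<omega> \<in> G then polygon (2 ^ l) (w \<omega> l) else polygon 1 (\<lambda>_. 0)) \<in> borel_measurable M"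
      by measurable
  next
    show "(\<lambda>l. if \<omega> \<in> G then polygon (2 ^ l) (w \<omega> l) else polygon 1 (\<lambda>_. 0)) \<longlonglongrightarrow> B \<omega>" for \<omega>
      using conv[of \<omega>] by (cases "\<omega> \<in> G") (auto simp: B_def)
  qed
  moreover have "AE \<omega> in M. \<forall>l j. path_apply (B \<omega>) (real j / 2 ^ l) = W l j \<omega>"
    using AE_G
  proof eventually_elim
    case (elim \<omega>)
    show ?case
    proof (intro allI)
      fix l j
      have lift: "W (l + n) (2 ^ n * j) \<omega> = W l j \<omega>" for n
        by (induction n) (use cons in \<open>simp_all add: mult.assoc\<close>)
      have node: "path_apply (polygon (2 ^ (n + l)) (w \<omega> (n + l))) (real j / 2 ^ l) = W l j \<omega>" for n
      proof -
        have "path_apply (polygon (2 ^ (n + l)) (w \<omega> (n + l))) (real j / 2 ^ l)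
            = interpolate (w \<omega> (n + l)) (2 ^ (n + l) * (real j / 2 ^ l))"
          by (rule path_apply_polygon) auto
        also have "2 ^ (n + l) * (real j / 2 ^ l) = real (2 ^ n * j)" by (simp add: power_add)
        also have "interpolate (w \<omega> (n + l)) (real (2 ^ n * j)) = w \<omega> (n + l) (2 ^ n * j)"
          by (rule interpolate_of_nat)
        also have "\<dots> = W l j \<omega>" using lift[of n] by (simp add: w_def add.commute)
        finally show ?thesis .
      qed
      have "(\<lambda>n. path_apply (polygon (2 ^ (n + l)) (w \<omega> (n + l))) (real j / 2 ^ l))
          \<longlonglongrightarrow> path_apply (B \<omega>) (real j / 2 ^ l)"
        by (rule continuous_on_tendsto_compose[OF continuous_on_eval LIMSEQ_ignore_initial_segment[OF conv[OF elim]]])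
           auto
      then show "path_apply (B \<omega>) (real j / 2 ^ l) = W l j \<omega>"
        unfolding node by (simp add: LIMSEQ_const_iff)
    qed
  qed
  ultimately show ?thesis by (rule that)
qed

lemma covariance_matrix_psd_form:
  assumes "covariance_matrix S"
  shows "psd_form (\<lambda>u v. u \<bullet> (S *v v))"
  unfolding psd_form_def
proof (intro conjI allI)
  show "linear (\<lambda>v. u \<bullet> (S *v v))" for u
    by (auto intro!: linearI simp: matrix_vector_right_distrib inner_add_right matrix_vector_mult_scaleR)
  show "u \<bullet> (S *v v) = v \<bullet> (S *v u)" for u v
    using assms by (metis covariance_matrix_def dot_lmul_matrix inner_commute transpose_matrix_vector)
  show "0 \<le> u \<bullet> (S *v u)" for u using assms by (simp add: covariance_matrix_def)
qed

lemma dyadic_floor_tendsto: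
  assumes "0 \<le> t"
  shows "(\<lambda>l. real (nat \<lfloor>2 ^ l * t\<rfloor>) / 2 ^ l) \<longlonglongrightarrow> t"
proof (rule real_tendsto_sandwich)
  have "(\<lambda>l. t - (1 / 2) ^ l) \<longlonglongrightarrow> t - 0"
    by (intro tendsto_intros LIMSEQ_realpow_zero) auto
  then show "(\<lambda>l. t - (1 / 2) ^ l) \<longlonglongrightarrow> t" by simp
  have "t - (1 / 2) ^ l \<le> real (nat \<lfloor>2 ^ l * t\<rfloor>) / 2 ^ l" for l
  proof -
    have "2 ^ l * t - 1 \<le> real (nat \<lfloor>2 ^ l * t\<rfloor>)" using assms by linarith
    then have "(2 ^ l * t - 1) / 2 ^ l \<le> real (nat \<lfloor>2 ^ l * t\<rfloor>) / 2 ^ l"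
      by (rule divide_right_mono) simp
    then show ?thesis by (simp add: diff_divide_distrib power_one_over)
  qed
  then show "\<forall>\<^sub>F l in sequentially. t - (1 / 2) ^ l \<le> real (nat \<lfloor>2 ^ l * t\<rfloor>) / 2 ^ l" by simp
  have "real (nat \<lfloor>2 ^ l * t\<rfloor>) / 2 ^ l \<le> t" for l
  proof -
    have "0 \<le> 2 ^ l * t" using assms by simp
    then have "real (nat \<lfloor>2 ^ l * t\<rfloor>) \<le> 2 ^ l * t" by linarith
    then show ?thesis by (simp add: field_simps)
  qed
  then show "\<forall>\<^sub>F l in sequentially. real (nat \<lfloor>2 ^ l * t\<rfloor>) / 2 ^ l \<le> t" by simp
qed simp

text \<open>Characteristic functions of the increments over the dyadic approximations
  \<open>\<lfloor>2^l \<tau>\<rfloor> / 2^l\<close> of the times \<open>\<tau>\<close> are explicit, and path continuity passes to the limit.\<close>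

theorem brownian_motion_exists:
  fixes S :: "real^'d^'d"
  assumes S: "covariance_matrix S"
  obtains N :: "(real^'d) cpath measure" and W where "brownian_motion N S W"
proof -
  define Q where "Q = (\<lambda>u. u \<bullet> (S *v u))"
  obtain a :: "real^'d \<Rightarrow> real^'d" where a: "\<And>u. Q u = (\<Sum>k\<in>Basis. (a k \<bullet> u)\<^sup>2)"
    using psd_form_sum_of_squares[OF covariance_matrix_psd_form[OF S]] unfolding Q_def by metis
  have Qnn: "0 \<le> Q u" for u by (simp add: a sum_nonneg)
  have hom: "Q (r *\<^sub>R u) = r\<^sup>2 * Q u" for r u
    by (simp add: a power_mult_distrib sum_distrib_left)
  have par: "Q (x + y) + Q (x - y) = 2 * Q x + 2 * Q y" for x y
    by (simp add: a inner_add_right inner_diff_right power2_eq_square algebra_simps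
        flip: sum.distrib sum_distrib_left)
       (simp add: sum_distrib_left sum.distrib[symmetric] algebra_simps)
  obtain P :: "(((nat \<times> nat) \<times> (real^'d)) \<Rightarrow> real) measure" and g
    where P: "prob_space P" and g[measurable]: "\<And>p::nat \<times> nat. g p \<in> borel_measurable P"
      and gauss: "\<And>I (c :: nat \<times> nat \<Rightarrow> real^'d). finite I \<Longrightarrow>
        (\<integral>\<omega>. iexp (\<Sum>p\<in>I. c p \<bullet> g p \<omega>) \<partial>P) = exp (- (\<Sum>p\<in>I. Q (c p)) / 2)"
    using gaussian_array_exists[of a] unfolding a by blast
  interpret P: prob_space P by fact
  define D where "D = (\<lambda>l j \<omega>. levy_increment (\<lambda>p. g p \<omega>) l j)"
  define V where "V = (\<lambda>l j \<omega>. \<Sum>i<j. D l i \<omega>)"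
  have D[measurable]: "D l j \<in> borel_measurable P" for l j
    unfolding D_def by (induction l arbitrary: j) auto
  have V[measurable]: "V l j \<in> borel_measurable P" for l j
    unfolding V_def by simp
  have char_D: "(\<integral>\<omega>. iexp (\<Sum>j<k. v j \<bullet> D l j \<omega>) \<partial>P) = (\<Prod>j<k. of_real (exp (- ((1 / 2) ^ l * Q (v j)) / 2)))"
    for l k v
  proof -
    have "(\<integral>\<omega>. iexp (\<Sum>j<k. v j \<bullet> D l j \<omega>) \<partial>P) = of_real (exp (- ((1 / 2) ^ l * (\<Sum>j<k. Q (v j))) / 2))"
      using P.levy_increment_char[OF gauss par hom, of "{}" l v k] by (simp add: D_def)
    also have "- ((1 / 2) ^ l * (\<Sum>j<k. Q (v j))) / 2 = (\<Sum>j<k. - ((1 / 2) ^ l * Q (v j)) / 2)"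
      by (simp add: sum_distrib_left sum_divide_distrib sum_negf)
    finally show ?thesis by (simp add: exp_sum)
  qed
  have cons: "V (Suc l) (2 * j) \<omega> = V l j \<omega>" for l j \<omega>
    unfolding V_def D_def by (simp only: sum_pairs levy_increment_split)
  define c where "c = real DIM(real^'d) * (\<Sum>b\<in>Basis. 3 * (Q b)\<^sup>2)"
  have mom: "integrable P (\<lambda>\<omega>. norm (V l (Suc j) \<omega> - V l j \<omega>) ^ 4)"
    "(\<integral>\<omega>. norm (V l (Suc j) \<omega> - V l j \<omega>) ^ 4 \<partial>P) \<le> c / 4 ^ l" for l j
  proof -
    have VD: "V l (Suc j) \<omega> - V l j \<omega> = D l j \<omega>" for \<omega> by (simp add: V_def)
    have law: "distr P borel (\<lambda>\<omega>. b \<bullet> D l j \<omega>) = centered_normal ((1 / 2) ^ l * Q b)" for b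
    proof (rule P.distr_eq_centered_normalI)
      fix t :: real
      define v where "v = (\<lambda>i. if i = j then t *\<^sub>R b else 0)"
      have c: "(\<integral>\<omega>. iexp (\<Sum>i<Suc j. v i \<bullet> D l i \<omega>) \<partial>P)
          = (\<Prod>i<Suc j. of_real (exp (- ((1 / 2) ^ l * Q (v i)) / 2)))"
        by (rule char_D)
      have "(\<Sum>i<Suc j. v i \<bullet> D l i \<omega>) = t * (b \<bullet> D l j \<omega>)" for \<omega>
        by (simp add: v_def)
      moreover have "(\<Prod>i<Suc j. of_real (exp (- ((1 / 2) ^ l * Q (v i)) / 2)) :: complex)
          = of_real (exp (- (t\<^sup>2 * ((1 / 2) ^ l * Q b)) / 2))"
      proof -
        have "Q 0 = 0" using hom[of 0 0] by simp
        then show ?thesis by (simp add: v_def hom mult.left_commute)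
      qed
      ultimately show "(\<integral>\<omega>. iexp (t * (b \<bullet> D l j \<omega>)) \<partial>P) = exp (- (t\<^sup>2 * ((1 / 2) ^ l * Q b)) / 2)"
        using c by (simp only:)
    qed (use Qnn in auto)
    have nn: "0 \<le> (1 / 2) ^ l * Q b" for b using Qnn by simp
    have int: "integrable P (\<lambda>\<omega>. (b \<bullet> D l j \<omega>) ^ 4)" for b
      by (rule P.fourth_moment_centered_normal(1)[OF _ nn law]) simp
    have le: "(\<integral>\<omega>. (b \<bullet> D l j \<omega>) ^ 4 \<partial>P) \<le> 3 * ((1 / 2) ^ l * Q b)\<^sup>2" for b
      by (rule eq_refl, rule P.fourth_moment_centered_normal(2)[OF _ nn law]) simp
    show "integrable P (\<lambda>\<omega>. norm (V l (Suc j) \<omega> - V l j \<omega>) ^ 4)"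
      unfolding VD by (rule P.fourth_moment_norm(1)[OF D int le])
    have "(\<integral>\<omega>. norm (V l (Suc j) \<omega> - V l j \<omega>) ^ 4 \<partial>P)
        \<le> real DIM(real^'d) * (\<Sum>b\<in>Basis. 3 * ((1 / 2) ^ l * Q b)\<^sup>2)"
      unfolding VD by (rule P.fourth_moment_norm(2)[OF D int le])
    also have "\<dots> = c / 4 ^ l"
    proof -
      have "((1 / 2) ^ l)\<^sup>2 = (1 / 4 ^ l :: real)"
        by (simp add: power_divide power2_eq_square flip: power_mult_distrib)
      then show ?thesis
        by (simp add: c_def power_mult_distrib sum_distrib_left sum_divide_distrib ac_simps)
    qed
    finally show "(\<integral>\<omega>. norm (V l (Suc j) \<omega> - V l j \<omega>) ^ 4 \<partial>P) \<le> c / 4 ^ l" .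
  qed
  obtain B where B[measurable]: "B \<in> borel_measurable P"
    and BV: "AE \<omega> in P. \<forall>l j. path_apply (B \<omega>) (real j / 2 ^ l) = V l j \<omega>"
    using P.random_dyadic_path[OF V cons mom] by blast
  have eval[measurable]: "(\<lambda>f. path_apply f t) \<in> borel_measurable borel" if "0 \<le> t"
    for t and f :: "(real^'d) cpath" using that by (rule measurable_eval)
  have char_B: "(\<integral>\<omega>. iexp (\<Sum>j<n. u j \<bullet> (path_apply (B \<omega>) (\<tau> (Suc j)) - path_apply (B \<omega>) (\<tau> j))) \<partial>P)
      = of_real (\<Prod>j<n. exp (- ((\<tau> (Suc j) - \<tau> j) * Q (u j)) / 2))"
    if \<tau>: "0 \<le> \<tau> 0" "mono \<tau>" for \<tau> :: "nat \<Rightarrow> real" and u n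
  proof -
    have \<tau>0: "0 \<le> \<tau> j" for j using \<tau> by (meson le0 monoD order_trans)
    define m where "m = (\<lambda>l j. nat \<lfloor>2 ^ l * \<tau> j\<rfloor>)"
    have m: "mono (m l)" for l
      unfolding m_def using \<tau>(2) by (auto simp: mono_def intro!: nat_mono floor_mono mult_left_mono)
    have lim_m: "(\<lambda>l. real (m l j) / 2 ^ l) \<longlonglongrightarrow> \<tau> j" for j
      unfolding m_def by (rule dyadic_floor_tendsto[OF \<tau>0])
    let ?\<Delta> = "\<lambda>l \<omega>. \<Sum>j<n. u j \<bullet> (path_apply (B \<omega>) (real (m l (Suc j)) / 2 ^ l) - path_apply (B \<omega>) (real (m l j) / 2 ^ l))"
    let ?\<psi> = "\<lambda>l v. of_real (exp (- ((1 / 2) ^ l * Q v) / 2)) :: complex"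
    have meas[measurable]: "(\<lambda>\<omega>. path_apply (B \<omega>) t) \<in> borel_measurable P" if "0 \<le> t" for t
      by (rule measurable_compose[OF B measurable_eval[OF that]])
    have Q0: "Q 0 = 0" using hom[of 0 0] by simp
    have approx: "(\<integral>\<omega>. iexp (?\<Delta> l \<omega>) \<partial>P) = (\<Prod>j<n. ?\<psi> l (u j) ^ (m l (Suc j) - m l j))" for l
    proof -
      have "(\<integral>\<omega>. iexp (?\<Delta> l \<omega>) \<partial>P)
          = (\<integral>\<omega>. iexp (\<Sum>j<n. u j \<bullet> ((\<Sum>i<m l (Suc j). D l i \<omega>) - (\<Sum>i<m l j. D l i \<omega>))) \<partial>P)"
      proof (rule integral_cong_AE)
        show "AE \<omega> in P. iexp (?\<Delta> l \<omega>)
            = iexp (\<Sum>j<n. u j \<bullet> ((\<Sum>i<m l (Suc j). D l i \<omega>) - (\<Sum>i<m l j. D l i \<omega>)))"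
          using BV by eventually_elim (simp add: V_def)
      qed auto
      also have "\<dots> = (\<Prod>j<n. ?\<psi> l (u j) ^ (m l (Suc j) - m l j))"
        by (rule P.char_function_blocks[where \<psi> = "?\<psi> l", OF char_D _ m]) (simp add: Q0)
      finally show ?thesis .
    qed
    have "(\<lambda>l. \<integral>\<omega>. iexp (?\<Delta> l \<omega>) \<partial>P)
        \<longlonglongrightarrow> (\<integral>\<omega>. iexp (\<Sum>j<n. u j \<bullet> (path_apply (B \<omega>) (\<tau> (Suc j)) - path_apply (B \<omega>) (\<tau> j))) \<partial>P)"
    proof (rule integral_dominated_convergence[where w = "\<lambda>_. 1"])
      have "(\<lambda>l. path_apply (B \<omega>) (real (m l j) / 2 ^ l)) \<longlonglongrightarrow> path_apply (B \<omega>) (\<tau> j)" for \<omega> j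
        by (rule continuous_on_tendsto_compose[OF continuous_on_path_apply lim_m]) (use \<tau>0 in auto)
      then show "AE \<omega> in P. (\<lambda>l. iexp (?\<Delta> l \<omega>))
          \<longlonglongrightarrow> iexp (\<Sum>j<n. u j \<bullet> (path_apply (B \<omega>) (\<tau> (Suc j)) - path_apply (B \<omega>) (\<tau> j)))"
        by (intro AE_I2 tendsto_intros)
    qed (use \<tau>0 in auto)
    moreover have "(\<lambda>l. \<integral>\<omega>. iexp (?\<Delta> l \<omega>) \<partial>P) \<longlonglongrightarrow> of_real (\<Prod>j<n. exp (- ((\<tau> (Suc j) - \<tau> j) * Q (u j)) / 2))"
    proof -
      have "?\<psi> l (u j) ^ (m l (Suc j) - m l j)
          = of_real (exp (- ((real (m l (Suc j)) / 2 ^ l - real (m l j) / 2 ^ l) * Q (u j)) / 2))" for l j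
      proof -
        have "m l j \<le> m l (Suc j)" using m[of l] by (simp add: monoD)
        then have "real (m l (Suc j) - m l j) * (- ((1 / 2) ^ l * Q (u j)) / 2)
            = - ((real (m l (Suc j)) / 2 ^ l - real (m l j) / 2 ^ l) * Q (u j)) / 2"
          by (simp add: of_nat_diff power_divide field_simps)
        then show ?thesis by (simp only: of_real_power[symmetric] exp_of_nat_mult[symmetric])
      qed
      then show ?thesis
        unfolding approx of_real_prod by (simp only:) (intro tendsto_intros lim_m, simp_all)
    qed
    ultimately show ?thesis by (rule LIMSEQ_unique)
  qed
  \<comment> \<open>The law of the path is taken as the probability space. Subtracting the value at \<open>0\<close> makes the motion
    start at \<open>0\<close> everywhere and not just almost surely.\<close>
  define N where "N = distr P borel B"
  define W where "W = (\<lambda>t (f :: (real^'d) cpath). path_apply f t - path_apply f 0)"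
  have N: "prob_space N" unfolding N_def by (rule P.prob_space_distr) simp
  interpret N: prob_space N by fact
  have W[measurable]: "W t \<in> borel_measurable N" if "0 \<le> t" for t
    unfolding W_def N_def measurable_distr_eq1 by (intro borel_measurable_diff measurable_eval that order_refl)
  have char_W: "(\<integral>f. iexp (\<Sum>j<n. u j \<bullet> (W (\<tau> (Suc j)) f - W (\<tau> j) f)) \<partial>N)
      = of_real (\<Prod>j<n. exp (- ((\<tau> (Suc j) - \<tau> j) * Q (u j)) / 2))"
    if \<tau>: "0 \<le> \<tau> 0" "mono \<tau>" for \<tau> :: "nat \<Rightarrow> real" and u n
  proof -
    have [measurable]: "(\<lambda>f :: (real^'d) cpath. path_apply f (\<tau> j)) \<in> borel_measurable borel" for j
      by (rule measurable_eval) (use \<tau> in \<open>meson le0 monoD order_trans\<close>)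
    have "(\<integral>f. iexp (\<Sum>j<n. u j \<bullet> (W (\<tau> (Suc j)) f - W (\<tau> j) f)) \<partial>N)
        = (\<integral>f. iexp (\<Sum>j<n. u j \<bullet> (path_apply f (\<tau> (Suc j)) - path_apply f (\<tau> j))) \<partial>N)"
      by (simp add: W_def)
    also have "\<dots> = (\<integral>\<omega>. iexp (\<Sum>j<n. u j \<bullet> (path_apply (B \<omega>) (\<tau> (Suc j)) - path_apply (B \<omega>) (\<tau> j))) \<partial>P)"
      unfolding N_def by (rule integral_distr) auto
    finally show ?thesis by (simp only: char_B[OF \<tau>])
  qed
  have law: "distr N borel (\<lambda>f. u \<bullet> (W t f - W s f)) = centered_normal ((t - s) * Q u)"
    if st: "0 \<le> s" "s \<le> t" for u s t
  proof (rule N.distr_eq_centered_normalI)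
    fix r :: real
    have "(\<integral>f. iexp (\<Sum>j<1. (r *\<^sub>R u) \<bullet> (W (if Suc j = 0 then s else t) f - W (if j = 0 then s else t) f)) \<partial>N)
        = of_real (\<Prod>j<1. exp (- (((if Suc j = 0 then s else t) - (if j = 0 then s else t)) * Q (r *\<^sub>R u)) / 2))"
      by (rule char_W) (use st in \<open>auto simp: mono_def\<close>)
    then show "(\<integral>f. iexp (r * (u \<bullet> (W t f - W s f))) \<partial>N) = exp (- (r\<^sup>2 * ((t - s) * Q u)) / 2)"
      by (simp add: hom mult.left_commute)
  qed (use st Qnn in auto)
  have "brownian_motion N S W"
    unfolding brownian_motion_def
  proof (intro conjI allI impI ballI; (elim conjE)?)
    show "W t \<in> borel_measurable N" if "0 \<le> t" for t using that by simp
    show "W 0 f = 0" for f by (simp add: W_def)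
    show "continuous_on {0..} (\<lambda>t. W t f)" for f
      unfolding W_def by (intro continuous_intros continuous_on_path_apply)
    fix s t :: real assume st: "0 \<le> s" "s < t"
    show "centered_gaussian N ((t - s) *\<^sub>R S) (\<lambda>f. W t f - W s f)"
      unfolding centered_gaussian_def
    proof (intro conjI allI)
      show "(\<lambda>f. W t f - W s f) \<in> borel_measurable N" using st by simp
      show "distr N borel (\<lambda>f. u \<bullet> (W t f - W s f)) = centered_normal (u \<bullet> ((t - s) *\<^sub>R S *v u))" for u
        using law[of s t u] st by (simp add: Q_def scaleR_matrix_vector_assoc[symmetric])
    qed
  next
    fix n :: nat and \<tau> :: "nat \<Rightarrow> real" assume \<tau>: "0 \<le> \<tau> 0" "mono \<tau>"
    have \<tau>0: "0 \<le> \<tau> j" for j using \<tau> by (meson le0 monoD order_trans)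
    show "N.indep_vars (\<lambda>_. borel) (\<lambda>i f. W (\<tau> (Suc i)) f - W (\<tau> i) f) {..<n}"
    proof (rule N.indep_varsI_char_function)
      fix u :: "nat \<Rightarrow> real^'d"
      have "(\<integral>f. iexp (u i \<bullet> (W (\<tau> (Suc i)) f - W (\<tau> i) f)) \<partial>N) = exp (- ((\<tau> (Suc i) - \<tau> i) * Q (u i)) / 2)" for i
      proof (rule N.iexp_centered_normal)
        have "\<tau> i \<le> \<tau> (Suc i)" using \<tau>(2) by (simp add: monoD)
        then show "0 \<le> (\<tau> (Suc i) - \<tau> i) * Q (u i)"
          "distr N borel (\<lambda>f. u i \<bullet> (W (\<tau> (Suc i)) f - W (\<tau> i) f)) = centered_normal ((\<tau> (Suc i) - \<tau> i) * Q (u i))"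
          using Qnn \<tau>0 by (auto intro: law)
      qed (use \<tau>0 in simp)
      then show "(\<integral>f. iexp (\<Sum>i<n. u i \<bullet> (W (\<tau> (Suc i)) f - W (\<tau> i) f)) \<partial>N)
          = (\<Prod>i<n. \<integral>f. iexp (u i \<bullet> (W (\<tau> (Suc i)) f - W (\<tau> i) f)) \<partial>N)"
        by (simp only: char_W[OF \<tau>] of_real_prod)
    qed (use \<tau>0 in simp)
  qed (use S N in auto)
  then show ?thesis by (rule that)
qed

section \<open>Moments of weighted sums\<close>

context prob_space
begin

lemma integrable_bounded:
  fixes f :: "'a \<Rightarrow> 'b::{banach, second_countable_topology}"
  assumes "f \<in> borel_measurable M" "\<And>\<omega>. \<omega> \<in> space M \<Longrightarrow> norm (f \<omega>) \<le> B"
  shows "integrable M f"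
  using assms by (intro integrable_const_bound[of _ B]) auto

text \<open>The mixed moments of odd order in the new term vanish by independence; the remaining terms
  reproduce the square of \<open>\<Sum>i. a\<^sub>i\<^sup>2\<close>.\<close>

lemma weighted_sum_moments:
  fixes y :: "nat \<Rightarrow> 'a \<Rightarrow> real"
  assumes ind: "indep_vars (\<lambda>_. borel) y {..<m}"
    and bd: "\<And>i \<omega>. i < m \<Longrightarrow> \<omega> \<in> space M \<Longrightarrow> \<bar>y i \<omega>\<bar> \<le> K"
    and mean: "\<And>i. i < m \<Longrightarrow> expectation (y i) = 0"
  shows "expectation (\<lambda>\<omega>. \<Sum>i<m. a i * y i \<omega>) = 0"
    "expectation (\<lambda>\<omega>. (\<Sum>i<m. a i * y i \<omega>)\<^sup>2) \<le> K\<^sup>2 * (\<Sum>i<m. (a i)\<^sup>2)"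
    "expectation (\<lambda>\<omega>. (\<Sum>i<m. a i * y i \<omega>) ^ 4) \<le> 3 * K ^ 4 * (\<Sum>i<m. (a i)\<^sup>2)\<^sup>2"
proof -
  have rv: "y i \<in> borel_measurable M" if "i < m" for i
    using ind that by (auto simp: indep_vars_def)
  have "expectation (\<lambda>\<omega>. \<Sum>i<k. a i * y i \<omega>) = 0 \<and>
    expectation (\<lambda>\<omega>. (\<Sum>i<k. a i * y i \<omega>)\<^sup>2) \<le> K\<^sup>2 * (\<Sum>i<k. (a i)\<^sup>2) \<and>
    expectation (\<lambda>\<omega>. (\<Sum>i<k. a i * y i \<omega>) ^ 4) \<le> 3 * K ^ 4 * (\<Sum>i<k. (a i)\<^sup>2)\<^sup>2" if "k \<le> m" for k
    using that
  proof (induction k)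
    case (Suc k)
    then have k: "k < m" by simp
    define T where "T = (\<lambda>\<omega>. \<Sum>i<k. a i * y i \<omega>)"
    define Y where "Y = y k"
    define s where "s = (\<Sum>i<k. (a i)\<^sup>2)"
    have IH: "expectation T = 0" "expectation (\<lambda>\<omega>. (T \<omega>)\<^sup>2) \<le> K\<^sup>2 * s"
      "expectation (\<lambda>\<omega>. T \<omega> ^ 4) \<le> 3 * K ^ 4 * s\<^sup>2"
      using Suc by (auto simp: T_def s_def)
    have s: "0 \<le> s" by (simp add: s_def sum_nonneg)
    have [measurable]: "y i \<in> borel_measurable M" if "i \<in> {..<k}" for i using rv that k by simp
    have T[measurable]: "T \<in> borel_measurable M" unfolding T_def by measurable
    have Y[measurable]: "Y \<in> borel_measurable M" unfolding Y_def by (rule rv[OF k])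
    have bY: "\<bar>Y \<omega>\<bar> \<le> K" if "\<omega> \<in> space M" for \<omega> using bd[OF k that] by (simp add: Y_def)
    have bT: "\<bar>T \<omega>\<bar> \<le> (\<Sum>i<k. \<bar>a i\<bar> * K)" if "\<omega> \<in> space M" for \<omega>
      unfolding T_def using that k
      by (intro order_trans[OF sum_abs] sum_mono) (auto simp: abs_mult intro!: mult_left_mono bd)
    have int: "integrable M (\<lambda>\<omega>. T \<omega> ^ p * Y \<omega> ^ q)" for p q
    proof (rule integrable_bounded)
      show "norm (T \<omega> ^ p * Y \<omega> ^ q) \<le> (\<Sum>i<k. \<bar>a i\<bar> * K) ^ p * K ^ q" if "\<omega> \<in> space M" for \<omega>
        using bT[OF that] bY[OF that]
        by (auto simp: abs_mult power_abs intro!: mult_mono power_mono)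
    qed measurable
    have indep: "indep_var borel Y borel T"
    proof -
      have "indep_vars (\<lambda>_. borel) (\<lambda>i \<omega>. (if i = k then 1 else a i) * y i \<omega>) (insert k {..<k})"
        by (rule indep_vars_compose2[OF indep_vars_subset[OF ind]]) (use k in auto)
      then have "indep_var borel (\<lambda>\<omega>. (if k = k then 1 else a k) * y k \<omega>) borel
          (\<lambda>\<omega>. \<Sum>i<k. (if i = k then 1 else a i) * y i \<omega>)"
        by (rule indep_vars_sum[rotated 2]) auto
      moreover have "(\<lambda>\<omega>. \<Sum>i<k. (if i = k then 1 else a i) * y i \<omega>) = T"
        unfolding T_def by (intro ext sum.cong) auto
      ultimately show ?thesis by (simp add: Y_def)
    qed
    have prod: "expectation (\<lambda>\<omega>. T \<omega> ^ p * Y \<omega> ^ q) = expectation (\<lambda>\<omega>. T \<omega> ^ p) * expectation (\<lambda>\<omega>. Y \<omega> ^ q)" for p q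
    proof -
      have "indep_var borel ((\<lambda>x. x ^ q) \<circ> Y) borel ((\<lambda>x. x ^ p) \<circ> T)"
        by (rule indep_var_compose[OF indep]) auto
      from indep_var_lebesgue_integral[OF this] show ?thesis
        using int[of p 0] int[of 0 q] by (simp add: comp_def mult.commute)
    qed
    have EY: "expectation Y = 0" using mean[OF k] by (simp add: Y_def)
    have Y2: "(Y \<omega>)\<^sup>2 \<le> K\<^sup>2" if "\<omega> \<in> space M" for \<omega>
      using bY[OF that] by (metis abs_ge_zero power2_abs power_mono)
    have step: "(\<Sum>i<Suc k. a i * y i \<omega>) = T \<omega> + a k * Y \<omega>" for \<omega> by (simp add: T_def Y_def)
    have s': "(\<Sum>i<Suc k. (a i)\<^sup>2) = s + (a k)\<^sup>2" by (simp add: s_def)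
    have i1: "integrable M T" using int[of 1 0] by simp
    have i2: "integrable M Y" using int[of 0 1] by simp
    have "expectation (\<lambda>\<omega>. T \<omega> + a k * Y \<omega>) = 0"
      using i1 i2 IH EY by simp
    moreover have "expectation (\<lambda>\<omega>. (T \<omega> + a k * Y \<omega>)\<^sup>2) \<le> K\<^sup>2 * (s + (a k)\<^sup>2)"
    proof -
      have TY: "expectation (\<lambda>\<omega>. T \<omega> * Y \<omega>) = 0" using prod[of 1 1] EY by simp
      have square: "(T \<omega> + a k * Y \<omega>)\<^sup>2 = (T \<omega>)\<^sup>2 + 2 * a k * (T \<omega> * Y \<omega>) + (a k)\<^sup>2 * (Y \<omega>)\<^sup>2" for \<omega>
        by (simp add: power2_eq_square algebra_simps)
      have "expectation (\<lambda>\<omega>. (T \<omega> + a k * Y \<omega>)\<^sup>2)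
          \<le> expectation (\<lambda>\<omega>. (T \<omega>)\<^sup>2 + 2 * a k * (T \<omega> * Y \<omega>) + (a k)\<^sup>2 * K\<^sup>2)"
      proof (rule integral_mono)
        show "integrable M (\<lambda>\<omega>. (T \<omega> + a k * Y \<omega>)\<^sup>2)"
          unfolding square using int[of 2 0] int[of 1 1] int[of 0 2] by simp
        show "(T \<omega> + a k * Y \<omega>)\<^sup>2 \<le> (T \<omega>)\<^sup>2 + 2 * a k * (T \<omega> * Y \<omega>) + (a k)\<^sup>2 * K\<^sup>2"
          if "\<omega> \<in> space M" for \<omega>
          unfolding square using mult_left_mono[OF Y2[OF that], of "(a k)\<^sup>2"] by simp
      qed (use int[of 2 0] int[of 1 1] in simp)
      also have "\<dots> = expectation (\<lambda>\<omega>. (T \<omega>)\<^sup>2) + (a k)\<^sup>2 * K\<^sup>2"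
        using int[of 2 0] int[of 1 1] TY by (simp add: prob_space)
      finally show ?thesis using IH by (simp add: algebra_simps)
    qed
    moreover have "expectation (\<lambda>\<omega>. (T \<omega> + a k * Y \<omega>) ^ 4) \<le> 3 * K ^ 4 * (s + (a k)\<^sup>2)\<^sup>2"
    proof -
      have TY: "expectation (\<lambda>\<omega>. T \<omega> ^ 3 * Y \<omega>) = 0" "expectation (\<lambda>\<omega>. T \<omega> * Y \<omega> ^ 3) = 0"
        using prod[of 3 1] prod[of 1 3] EY IH by simp_all
      let ?b = "\<lambda>\<omega>. T \<omega> ^ 4 + 4 * a k * (T \<omega> ^ 3 * Y \<omega>) + 6 * (a k)\<^sup>2 * K\<^sup>2 * (T \<omega>)\<^sup>2
          + 4 * a k ^ 3 * (T \<omega> * Y \<omega> ^ 3) + a k ^ 4 * K ^ 4"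
      have binom: "(T \<omega> + a k * Y \<omega>) ^ 4 = T \<omega> ^ 4 + 4 * a k * (T \<omega> ^ 3 * Y \<omega>) + 6 * (a k)\<^sup>2 * ((T \<omega>)\<^sup>2 * (Y \<omega>)\<^sup>2)
          + 4 * a k ^ 3 * (T \<omega> * Y \<omega> ^ 3) + a k ^ 4 * Y \<omega> ^ 4" for \<omega>
        by (simp add: power4_eq_xxxx power3_eq_cube power2_eq_square algebra_simps)
      have "expectation (\<lambda>\<omega>. (T \<omega> + a k * Y \<omega>) ^ 4) \<le> expectation ?b"
      proof (rule integral_mono)
        show "integrable M (\<lambda>\<omega>. (T \<omega> + a k * Y \<omega>) ^ 4)"
          unfolding binom
          using int[of 4 0] int[of 3 1] int[of 2 2] int[of 1 3] int[of 0 4] by simp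
        show "integrable M ?b"
          using int[of 4 0] int[of 3 1] int[of 2 0] int[of 1 3] by simp
        show "(T \<omega> + a k * Y \<omega>) ^ 4 \<le> ?b \<omega>" if "\<omega> \<in> space M" for \<omega>
        proof -
          have "6 * (a k)\<^sup>2 * ((T \<omega>)\<^sup>2 * (Y \<omega>)\<^sup>2) \<le> 6 * (a k)\<^sup>2 * ((T \<omega>)\<^sup>2 * K\<^sup>2)"
            using Y2[OF that] by (intro mult_left_mono) auto
          moreover have "a k ^ 4 * Y \<omega> ^ 4 \<le> a k ^ 4 * K ^ 4"
          proof (rule mult_left_mono)
            have "((Y \<omega>)\<^sup>2)\<^sup>2 \<le> (K\<^sup>2)\<^sup>2" by (rule power_mono[OF Y2[OF that]]) simp
            moreover have "((Y \<omega>)\<^sup>2)\<^sup>2 = Y \<omega> ^ 4" "(K\<^sup>2)\<^sup>2 = K ^ 4" by simp_all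
            ultimately show "Y \<omega> ^ 4 \<le> K ^ 4" by (simp only:)
          qed (simp add: zero_le_even_power)
          ultimately show ?thesis unfolding binom by (simp add: ac_simps)
        qed
      qed
      also have "\<dots> = expectation (\<lambda>\<omega>. T \<omega> ^ 4) + 6 * (a k)\<^sup>2 * K\<^sup>2 * expectation (\<lambda>\<omega>. (T \<omega>)\<^sup>2) + a k ^ 4 * K ^ 4"
        using int[of 4 0] int[of 3 1] int[of 2 0] int[of 1 3] TY by (simp add: prob_space)
      also have "\<dots> \<le> 3 * K ^ 4 * s\<^sup>2 + 6 * (a k)\<^sup>2 * K\<^sup>2 * (K\<^sup>2 * s) + a k ^ 4 * K ^ 4"
        using IH by (intro add_mono mult_left_mono) auto
      also have "\<dots> \<le> 3 * K ^ 4 * s\<^sup>2 + 6 * (a k)\<^sup>2 * K\<^sup>2 * (K\<^sup>2 * s) + 3 * (a k ^ 4 * K ^ 4)"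
        by (simp add: zero_le_even_power)
      also have "\<dots> = 3 * K ^ 4 * (s + (a k)\<^sup>2)\<^sup>2"
        by (simp add: power4_eq_xxxx power2_eq_square algebra_simps)
      finally show ?thesis .
    qed
    ultimately show ?case unfolding step s' by simp
  qed simp
  from this[of m] show "expectation (\<lambda>\<omega>. \<Sum>i<m. a i * y i \<omega>) = 0"
    "expectation (\<lambda>\<omega>. (\<Sum>i<m. a i * y i \<omega>)\<^sup>2) \<le> K\<^sup>2 * (\<Sum>i<m. (a i)\<^sup>2)"
    "expectation (\<lambda>\<omega>. (\<Sum>i<m. a i * y i \<omega>) ^ 4) \<le> 3 * K ^ 4 * (\<Sum>i<m. (a i)\<^sup>2)\<^sup>2"
    by auto
qed

end

section \<open>Donsker's invariance principle\<close>

definition clamp01 :: "real \<Rightarrow> real" where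
  "clamp01 r = max 0 (min 1 r)"

text \<open>Between two times the interpolated walk moves by a weighted sum of the steps, whose weights lie
  in \<open>[0, 1]\<close> and add up to the elapsed time. Fourth moments of increments follow without
  distinguishing whether the times lie in one cell of the grid.\<close>

lemma interpolate_partial_sums:
  fixes x :: "nat \<Rightarrow> 'b::real_normed_vector"
  assumes s: "0 \<le> s" "s < real m"
  shows "interpolate (\<lambda>k. \<Sum>i<k. x i) s = (\<Sum>i<m. clamp01 (s - real i) *\<^sub>R x i)"
proof -
  define k where "k = nat \<lfloor>s\<rfloor>"
  have k: "real k \<le> s" "s < real k + 1" unfolding k_def using s by linarith+
  have km: "k < m" using k s by linarith
  have "interpolate (\<lambda>k. \<Sum>i<k. x i) s = (\<Sum>i<k. x i) + (s - real k) *\<^sub>R x k"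
    using interpolate_eq[of k s "\<lambda>k. \<Sum>i<k. x i"] k by simp
  also have "\<dots> = (\<Sum>i<Suc k. clamp01 (s - real i) *\<^sub>R x i)"
  proof -
    have "clamp01 (s - real i) = 1" if "i < k" for i
    proof -
      have "real i + 1 \<le> real k" using that by linarith
      then show ?thesis using k unfolding clamp01_def by linarith
    qed
    moreover have "clamp01 (s - real k) = s - real k" using k unfolding clamp01_def by linarith
    ultimately show ?thesis by simp
  qed
  also have "\<dots> = (\<Sum>i<m. clamp01 (s - real i) *\<^sub>R x i)"
  proof (rule sum.mono_neutral_left)
    show "\<forall>i\<in>{..<m} - {..<Suc k}. clamp01 (s - real i) *\<^sub>R x i = 0"
    proof
      fix i assume "i \<in> {..<m} - {..<Suc k}"
      then have "real k + 1 \<le> real i" by (auto simp: not_less)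
      then show "clamp01 (s - real i) *\<^sub>R x i = 0" using k by (simp add: clamp01_def)
    qed
  qed (use km in auto)
  finally show ?thesis .
qed

lemma interpolate_increment_weights:
  assumes "0 \<le> s" "s \<le> t"
  obtains m \<theta> where "\<And>x :: nat \<Rightarrow> 'b::real_normed_vector. interpolate (\<lambda>k. \<Sum>i<k. x i) t - interpolate (\<lambda>k. \<Sum>i<k. x i) s
      = (\<Sum>i<m. \<theta> i *\<^sub>R x i)" "(\<Sum>i<m. (\<theta> i)\<^sup>2) \<le> t - s"
proof -
  obtain m :: nat where m: "t < real m" using reals_Archimedean2 by blast
  define \<theta> where "\<theta> = (\<lambda>i. clamp01 (t - real i) - clamp01 (s - real i))"
  have \<theta>: "0 \<le> \<theta> i" "\<theta> i \<le> 1" for i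
    unfolding \<theta>_def clamp01_def using assms by linarith+
  have eq: "interpolate (\<lambda>k. \<Sum>i<k. x i) t - interpolate (\<lambda>k. \<Sum>i<k. x i) s = (\<Sum>i<m. \<theta> i *\<^sub>R x i)"
    for x :: "nat \<Rightarrow> 'c::real_normed_vector"
    using interpolate_partial_sums[of t m x] interpolate_partial_sums[of s m x] assms m
    by (simp add: \<theta>_def scaleR_diff_left sum_subtractf)
  have id: "interpolate real r = r" if "0 \<le> r" for r
    using that by (simp add: interpolate_def)
  have "(\<Sum>i<m. (\<theta> i)\<^sup>2) \<le> (\<Sum>i<m. \<theta> i)"
  proof (rule sum_mono)
    show "(\<theta> i)\<^sup>2 \<le> \<theta> i" for i
      using mult_left_mono[OF \<theta>(2)[of i] \<theta>(1)[of i]] by (simp add: power2_eq_square)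
  qed
  also have "\<dots> = t - s"
    using eq[of "\<lambda>_. 1 :: real"] assms by (simp add: id)
  finally show ?thesis using eq that by blast
qed

text \<open>One factor of the characteristic function of the walk, compared with \<open>exp (- \<sigma>\<^sup>2 / (2 n))\<close>
  up to \<open>O(n powr (-3/2))\<close>.\<close>

lemma (in prob_space) char_power_tendsto:
  fixes y :: "'a \<Rightarrow> real" and p :: "nat \<Rightarrow> nat"
  assumes y[measurable]: "y \<in> borel_measurable M" and bd: "\<And>\<omega>. \<omega> \<in> space M \<Longrightarrow> \<bar>y \<omega>\<bar> \<le> K"
    and mean: "expectation y = 0" and var: "expectation (\<lambda>\<omega>. (y \<omega>)\<^sup>2) = v"
    and p: "(\<lambda>n. real (p n) / real n) \<longlonglongrightarrow> a"
  shows "(\<lambda>n. (\<integral>\<omega>. iexp (y \<omega> / sqrt (real n)) \<partial>M) ^ p n) \<longlonglongrightarrow> exp (- (a * v) / 2)"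
proof -
  define \<psi> where "\<psi> = (\<lambda>n::nat. \<integral>\<omega>. iexp (y \<omega> / sqrt (real n)) \<partial>M)"
  define \<beta> where "\<beta> = (\<lambda>n::nat. complex_of_real (exp (- v / (2 * real n))))"
  define err where "err = (\<lambda>n::nat. K ^ 3 / (6 * sqrt (real n)) + v\<^sup>2 / (4 * real n))"
  have v: "0 \<le> v" unfolding var[symmetric] by (rule integral_nonneg_AE) auto
  have "\<bar>y \<omega>\<bar>\<^sup>2 \<le> K\<^sup>2" if "\<omega> \<in> space M" for \<omega>
    by (rule power_mono[OF bd[OF that]]) simp
  then have inty: "integrable M (\<lambda>\<omega>. y \<omega>)" "integrable M (\<lambda>\<omega>. (y \<omega>)\<^sup>2)"
    using integrable_bounded[of y K] integrable_bounded[of "\<lambda>\<omega>. (y \<omega>)\<^sup>2" "K\<^sup>2"] bd by auto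
  have approx: "cmod (\<psi> n - \<beta> n) \<le> err n / real n" if n: "1 \<le> n" for n
  proof -
    let ?t = "1 / sqrt (real n)"
    have K3: "0 \<le> K" using bd[of "SOME \<omega>. \<omega> \<in> space M"] not_empty
      by (meson abs_ge_zero bd order_trans ex_in_conv)
    have int_iexp: "integrable M (\<lambda>\<omega>. iexp (y \<omega> / sqrt (real n)))"
      by (intro integrable_bounded[of _ 1]) auto
    let ?q = "\<lambda>\<omega>. 1 + \<i> * of_real (y \<omega> / sqrt (real n)) - of_real ((y \<omega>)\<^sup>2 / (2 * real n))"
    have int_q: "integrable M ?q"
      using inty by (intro Bochner_Integration.integrable_diff Bochner_Integration.integrable_add
          integrable_mult_right integrable_of_real) auto
    have q: "(\<integral>\<omega>. ?q \<omega> \<partial>M) = of_real (1 - v / (2 * real n))"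
    proof -
      define A B where "A = (\<lambda>\<omega>. y \<omega> / sqrt (real n))" and "B = (\<lambda>\<omega>. (y \<omega>)\<^sup>2 / (2 * real n))"
      have "integrable M A" "integrable M B" using inty by (simp_all add: A_def B_def)
      then have "(\<integral>\<omega>. 1 + \<i> * of_real (A \<omega>) - of_real (B \<omega>) \<partial>M)
          = 1 + \<i> * of_real (expectation A) - of_real (expectation B)"
        by (simp add: prob_space)
      moreover have "expectation A = 0" "expectation B = v / (2 * real n)"
        using mean var by (simp_all add: A_def B_def)
      ultimately have "(\<integral>\<omega>. 1 + \<i> * of_real (A \<omega>) - of_real (B \<omega>) \<partial>M) = of_real (1 - v / (2 * real n))"
        by simp
      then show ?thesis by (simp only: A_def B_def)
    qed
    have pt: "cmod (iexp (y \<omega> / sqrt (real n)) - ?q \<omega>) \<le> K ^ 3 / (6 * (real n * sqrt (real n)))"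
      if "\<omega> \<in> space M" for \<omega>
    proof -
      let ?x = "y \<omega> / sqrt (real n)"
      have x2: "?x\<^sup>2 = (y \<omega>)\<^sup>2 / real n" by (simp add: power_divide)
      have "(\<Sum>k\<le>2. (\<i> * ?x) ^ k / fact k) = ?q \<omega>"
      proof -
        have taylor: "(\<Sum>k\<le>2. (\<i> * of_real r) ^ k / fact k) = 1 + \<i> * of_real r - of_real (r\<^sup>2 / 2)" for r :: real
          by (simp add: numeral_2_eq_2 atMost_Suc power_mult_distrib)
        have half: "?x\<^sup>2 / 2 = (y \<omega>)\<^sup>2 / (2 * real n)" by (simp add: x2)
        show ?thesis by (simp only: taylor half)
      qed
      then have "cmod (iexp ?x - ?q \<omega>) \<le> \<bar>?x\<bar> ^ 3 / 6"
        using iexp_approx1[of ?x 2] by (simp add: numeral_3_eq_3 fact_numeral)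
      also have "\<dots> \<le> (K / sqrt (real n)) ^ 3 / 6"
        using bd[OF that] by (intro divide_right_mono power_mono) (auto simp: divide_right_mono)
      also have "\<dots> = K ^ 3 / (6 * (real n * sqrt (real n)))"
        by (simp add: power_divide power3_eq_cube)
      finally show ?thesis .
    qed
    have int_d: "integrable M (\<lambda>\<omega>. iexp (y \<omega> / sqrt (real n)) - ?q \<omega>)"
      by (rule Bochner_Integration.integrable_diff[OF int_iexp int_q])
    have diff: "\<psi> n - of_real (1 - v / (2 * real n)) = (\<integral>\<omega>. iexp (y \<omega> / sqrt (real n)) - ?q \<omega> \<partial>M)"
      using Bochner_Integration.integral_diff[OF int_iexp int_q] unfolding \<psi>_def q by (rule sym)
    define \<kappa> where "\<kappa> = K ^ 3 / (6 * (real n * sqrt (real n)))"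
    have "(\<integral>\<omega>. cmod (iexp (y \<omega> / sqrt (real n)) - ?q \<omega>) \<partial>M) \<le> (\<integral>\<omega>. \<kappa> \<partial>M)"
    proof (rule integral_mono)
      show "integrable M (\<lambda>\<omega>. cmod (iexp (y \<omega> / sqrt (real n)) - ?q \<omega>))"
        by (rule integrable_norm[OF int_d])
      show "integrable M (\<lambda>\<omega>. \<kappa>)" by (rule integrable_const)
    qed (unfold \<kappa>_def, rule pt)
    moreover have "(\<integral>\<omega>. \<kappa> \<partial>M) = \<kappa>" by (simp add: prob_space)
    moreover have "cmod (\<psi> n - of_real (1 - v / (2 * real n)))
        \<le> (\<integral>\<omega>. cmod (iexp (y \<omega> / sqrt (real n)) - ?q \<omega>) \<partial>M)"
      unfolding diff by (rule integral_norm_bound)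
    ultimately have 1: "cmod (\<psi> n - of_real (1 - v / (2 * real n))) \<le> K ^ 3 / (6 * (real n * sqrt (real n)))"
      unfolding \<kappa>_def by linarith
    have 2: "cmod (of_real (1 - v / (2 * real n)) - \<beta> n) \<le> (v / (2 * real n))\<^sup>2"
    proof -
      define x where "x = v / (2 * real n)"
      have x: "0 \<le> x" using v by (simp add: x_def)
      have lo: "1 - x \<le> exp (- x)" using exp_ge_add_one_self[of "- x"] by simp
      have "1 \<le> (1 - x + x\<^sup>2) * (1 + x)"
        using x by (simp add: algebra_simps power2_eq_square)
      also have "\<dots> \<le> (1 - x + x\<^sup>2) * exp x"
      proof (rule mult_left_mono[OF exp_ge_add_one_self])
        have "0 \<le> (1 - x / 2)\<^sup>2 + (3 / 4) * x\<^sup>2" by simp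
        then show "0 \<le> 1 - x + x\<^sup>2" by (simp add: power2_eq_square algebra_simps)
      qed
      finally have "exp (- x) \<le> 1 - x + x\<^sup>2" by (simp add: exp_minus field_simps)
      then have "\<bar>1 - x - exp (- x)\<bar> \<le> x\<^sup>2" using lo by (simp add: abs_le_iff)
      then show ?thesis
        unfolding \<beta>_def x_def minus_divide_left[symmetric] by (simp only: of_real_diff[symmetric] norm_of_real)
    qed
    have "cmod (\<psi> n - \<beta> n) \<le> K ^ 3 / (6 * (real n * sqrt (real n))) + (v / (2 * real n))\<^sup>2"
      using norm_triangle_ineq[of "\<psi> n - of_real (1 - v / (2 * real n))" "of_real (1 - v / (2 * real n)) - \<beta> n"] 1 2
      by simp
    also have "\<dots> = err n / real n"
      using n by (simp add: err_def power_divide field_simps power2_eq_square)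
    finally show ?thesis .
  qed
  have power_diff: "cmod (\<psi> n ^ p n - \<beta> n ^ p n) \<le> real (p n) / real n * err n" if n: "1 \<le> n" for n
  proof -
    have "cmod (\<psi> n) \<le> (\<integral>\<omega>. cmod (iexp (y \<omega> / sqrt (real n))) \<partial>M)"
      unfolding \<psi>_def by (rule integral_norm_bound)
    then have "cmod (\<psi> n) \<le> 1" by (simp add: prob_space)
    moreover have "cmod (\<beta> n) \<le> 1" using v n by (simp add: \<beta>_def)
    ultimately have "cmod (\<psi> n ^ p n - \<beta> n ^ p n) \<le> real (p n) * cmod (\<psi> n - \<beta> n)"
      by (rule norm_power_diff)
    also have "\<dots> \<le> real (p n) * (err n / real n)"
      by (rule mult_left_mono[OF approx[OF n]]) simp
    finally show ?thesis by simp
  qed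
  have "(\<lambda>n. real (p n) / real n * err n) \<longlonglongrightarrow> a * 0"
  proof (rule tendsto_mult[OF p])
    have "(\<lambda>n. 1 / sqrt (real n)) \<longlonglongrightarrow> 0"
      by (rule tendsto_divide_0[OF tendsto_const])
         (rule filterlim_at_top_imp_at_infinity[OF filterlim_compose[OF sqrt_at_top filterlim_real_sequentially]])
    then have "(\<lambda>n. K ^ 3 / 6 * (1 / sqrt (real n)) + v\<^sup>2 / 4 * (1 / real n)) \<longlonglongrightarrow> K ^ 3 / 6 * 0 + v\<^sup>2 / 4 * 0"
      by (rule tendsto_add[OF tendsto_mult_left tendsto_mult_left[OF lim_1_over_n]])
    then show "err \<longlonglongrightarrow> 0" by (simp add: err_def)
  qed
  then have err_lim: "(\<lambda>n. real (p n) / real n * err n) \<longlonglongrightarrow> 0" by simp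
  have "(\<lambda>n. \<psi> n ^ p n - \<beta> n ^ p n) \<longlonglongrightarrow> 0"
  proof (rule Lim_null_comparison[OF _ err_lim])
    show "\<forall>\<^sub>F n in sequentially. cmod (\<psi> n ^ p n - \<beta> n ^ p n) \<le> real (p n) / real n * err n"
      by (rule eventually_sequentiallyI[of 1]) (rule power_diff)
  qed
  moreover have "(\<lambda>n. \<beta> n ^ p n) \<longlonglongrightarrow> exp (- (a * v) / 2)"
  proof -
    have "\<beta> n ^ p n = of_real (exp (- (real (p n) / real n * v) / 2))" for n
    proof -
      have "real (p n) * (- v / (2 * real n)) = - (real (p n) / real n * v) / 2" by simp
      then show ?thesis
        unfolding \<beta>_def by (simp only: of_real_power[symmetric] exp_of_nat_mult[symmetric])
    qed
    then show ?thesis by (simp only:) (intro tendsto_intros p, simp_all)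
  qed
  ultimately have "(\<lambda>n. (\<psi> n ^ p n - \<beta> n ^ p n) + \<beta> n ^ p n) \<longlonglongrightarrow> 0 + complex_of_real (exp (- (a * v) / 2))"
    by (rule tendsto_add)
  then show ?thesis by (simp add: \<psi>_def)
qed

lemma brownian_increment_law:
  fixes W :: "real \<Rightarrow> 'v \<Rightarrow> real^'d"
  assumes W: "brownian_motion N S W" and st: "0 \<le> s" "s < t"
  shows "distr N borel (\<lambda>\<omega>. u \<bullet> (W t \<omega> - W s \<omega>)) = centered_normal ((t - s) * (u \<bullet> (S *v u)))"
    "0 \<le> (t - s) * (u \<bullet> (S *v u))"
proof -
  have "centered_gaussian N ((t - s) *\<^sub>R S) (\<lambda>\<omega>. W t \<omega> - W s \<omega>)"
    using W st by (simp add: brownian_motion_def)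
  then show "distr N borel (\<lambda>\<omega>. u \<bullet> (W t \<omega> - W s \<omega>)) = centered_normal ((t - s) * (u \<bullet> (S *v u)))"
    by (simp add: centered_gaussian_def scaleR_matrix_vector_assoc[symmetric])
  show "0 \<le> (t - s) * (u \<bullet> (S *v u))"
    using W st by (simp add: brownian_motion_def covariance_matrix_def)
qed

lemma brownian_fourth_moment:
  fixes W :: "real \<Rightarrow> 'v \<Rightarrow> real^'d"
  assumes W: "brownian_motion N S W" and st: "0 \<le> s" "s < t"
  shows "integrable N (\<lambda>\<omega>. norm (W t \<omega> - W s \<omega>) ^ 4)"
    "(\<integral>\<omega>. norm (W t \<omega> - W s \<omega>) ^ 4 \<partial>N)
      \<le> real DIM(real^'d) * (\<Sum>b\<in>Basis. 3 * ((t - s) * (b \<bullet> (S *v b)))\<^sup>2)"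
proof -
  interpret N: prob_space N using W by (simp add: brownian_motion_def)
  have [measurable]: "W t \<in> borel_measurable N" "W s \<in> borel_measurable N"
    using W st by (auto simp: brownian_motion_def)
  note law = brownian_increment_law[OF W st]
  have int: "integrable N (\<lambda>\<omega>. (b \<bullet> (W t \<omega> - W s \<omega>)) ^ 4)" for b
    by (rule N.fourth_moment_centered_normal(1)[OF _ law(2,1)]) simp
  have le: "(\<integral>\<omega>. (b \<bullet> (W t \<omega> - W s \<omega>)) ^ 4 \<partial>N) \<le> 3 * ((t - s) * (b \<bullet> (S *v b)))\<^sup>2" for b
    by (rule eq_refl, rule N.fourth_moment_centered_normal(2)[OF _ law(2,1)]) simp
  show "integrable N (\<lambda>\<omega>. norm (W t \<omega> - W s \<omega>) ^ 4)"
    by (rule N.fourth_moment_norm(1)[OF _ int le]) simp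
  show "(\<integral>\<omega>. norm (W t \<omega> - W s \<omega>) ^ 4 \<partial>N)
      \<le> real DIM(real^'d) * (\<Sum>b\<in>Basis. 3 * ((t - s) * (b \<bullet> (S *v b)))\<^sup>2)"
    by (rule N.fourth_moment_norm(2)[OF _ int le]) simp
qed

lemma brownian_grid_char:
  fixes W :: "real \<Rightarrow> 'v \<Rightarrow> real^'d"
  assumes W: "brownian_motion N S W" and L: "0 < L"
  shows "(\<integral>\<omega>. iexp (\<Sum>j<k. u j \<bullet> (W (real (Suc j) / L) \<omega> - W (real j / L) \<omega>)) \<partial>N)
    = (\<Prod>j<k. of_real (exp (- (1 / L * (u j \<bullet> (S *v u j))) / 2)))"
proof -
  interpret N: prob_space N using W by (simp add: brownian_motion_def)
  let ?D = "\<lambda>j \<omega>. W (real (Suc j) / L) \<omega> - W (real j / L) \<omega>"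
  have meas[measurable]: "W t \<in> borel_measurable N" if "0 \<le> t" for t
    using W that by (simp add: brownian_motion_def)
  have nn: "0 \<le> real j / L" for j using L by simp
  have brownian_indep: "\<forall>n \<tau>. 0 \<le> \<tau> (0::nat) \<and> mono \<tau> \<longrightarrow>
      N.indep_vars (\<lambda>_. borel) (\<lambda>i \<omega>. W (\<tau> (Suc i)) \<omega> - W (\<tau> i) \<omega>) {..<n}"
    using W unfolding brownian_motion_def by (elim conjE)
  have "0 \<le> real 0 / L \<and> mono (\<lambda>j. real j / L)"
    using L by (auto simp: mono_def divide_right_mono)
  then have "N.indep_vars (\<lambda>_. borel) ?D {..<k}"
    using brownian_indep[rule_format, of "\<lambda>j. real j / L" k] by blast
  then have "N.indep_vars (\<lambda>_. borel) (\<lambda>j \<omega>. u j \<bullet> ?D j \<omega>) {..<k}"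
    by (rule N.indep_vars_compose2) simp
  then have "(\<integral>\<omega>. iexp (\<Sum>j<k. u j \<bullet> ?D j \<omega>) \<partial>N) = (\<Prod>j<k. \<integral>\<omega>. iexp (u j \<bullet> ?D j \<omega>) \<partial>N)"
    by (intro N.iexp_sum_indep) auto
  also have "\<dots> = (\<Prod>j<k. of_real (exp (- (1 / L * (u j \<bullet> (S *v u j))) / 2)))"
  proof (rule prod.cong)
    fix j
    have "real j / L < real (Suc j) / L" using L by (simp add: divide_strict_right_mono)
    note law = brownian_increment_law[OF W nn this, of "u j"]
    have d: "real (Suc j) / L - real j / L = 1 / L" by (simp add: diff_divide_distrib[symmetric])
    show "(\<integral>\<omega>. iexp (u j \<bullet> ?D j \<omega>) \<partial>N) = of_real (exp (- (1 / L * (u j \<bullet> (S *v u j))) / 2))"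
      by (rule N.iexp_centered_normal[OF _ law(2,1)[unfolded d]])
         (use nn[of j] nn[of "Suc j"] in \<open>simp del: of_nat_Suc\<close>)
  qed simp
  finally show ?thesis .
qed

text \<open>The index of the last step before the grid time \<open>j / 2^l\<close>. The time unit is \<open>1 / (n + 1)\<close>, since
  \<open>1 / n\<close> has no meaning for \<open>n = 0\<close>.\<close>

definition grid_index :: "nat \<Rightarrow> nat \<Rightarrow> nat \<Rightarrow> nat" where
  "grid_index l n j = nat \<lfloor>real (Suc n) * (real j / 2 ^ l)\<rfloor>"

lemma grid_step: "real (Suc j) / 2 ^ l - real j / 2 ^ l = 1 / 2 ^ l"
  by (simp add: diff_divide_distrib[symmetric])

lemma grid_index_mono: "mono (grid_index l n)"
  unfolding grid_index_def
  by (auto simp: mono_def intro!: nat_mono floor_mono mult_left_mono divide_right_mono)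

lemma grid_index_bounds:
  "real (grid_index l n j) \<le> real (Suc n) * (real j / 2 ^ l)" "real (Suc n) * (real j / 2 ^ l) < real (grid_index l n j) + 1"
proof -
  have "0 \<le> real (Suc n) * (real j / 2 ^ l)" by simp
  then show "real (grid_index l n j) \<le> real (Suc n) * (real j / 2 ^ l)" "real (Suc n) * (real j / 2 ^ l) < real (grid_index l n j) + 1"
    unfolding grid_index_def by linarith+
qed

lemma grid_index_lim: "(\<lambda>n. real (grid_index l n (Suc j) - grid_index l n j) / real (Suc n)) \<longlonglongrightarrow> 1 / 2 ^ l"
proof -
  have lim: "(\<lambda>n. real (grid_index l n i) / real (Suc n)) \<longlonglongrightarrow> real i / 2 ^ l" for i
  proof (rule real_tendsto_sandwich)
    have "(\<lambda>n. real i / 2 ^ l - 1 / real (Suc n)) \<longlonglongrightarrow> real i / 2 ^ l - 0"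
      by (intro tendsto_intros LIMSEQ_Suc[OF lim_1_over_n])
    then show "(\<lambda>n. real i / 2 ^ l - 1 / real (Suc n)) \<longlonglongrightarrow> real i / 2 ^ l" by simp
    have "real i / 2 ^ l - 1 / real (Suc n) \<le> real (grid_index l n i) / real (Suc n)" for n
    proof -
      have "(real (Suc n) * (real i / 2 ^ l) - 1) / real (Suc n) \<le> real (grid_index l n i) / real (Suc n)"
        using grid_index_bounds(2)[of n i l] by (intro divide_right_mono) auto
      then show ?thesis by (simp add: diff_divide_distrib del: of_nat_Suc)
    qed
    then show "\<forall>\<^sub>F n in sequentially. real i / 2 ^ l - 1 / real (Suc n) \<le> real (grid_index l n i) / real (Suc n)" by simp
    have "real (grid_index l n i) / real (Suc n) \<le> real i / 2 ^ l" for n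
      using divide_right_mono[OF grid_index_bounds(1)[of l n i], of "real (Suc n)"] by (simp del: of_nat_Suc)
    then show "\<forall>\<^sub>F n in sequentially. real (grid_index l n i) / real (Suc n) \<le> real i / 2 ^ l" by simp
  qed simp
  have "(\<lambda>n. real (grid_index l n (Suc j)) / real (Suc n) - real (grid_index l n j) / real (Suc n))
      \<longlonglongrightarrow> real (Suc j) / 2 ^ l - real j / 2 ^ l"
    by (intro tendsto_diff lim)
  moreover have "grid_index l n j \<le> grid_index l n (Suc j)" for n using grid_index_mono[of l n] by (simp add: monoD)
  ultimately show ?thesis by (simp add: of_nat_diff diff_divide_distrib grid_step del: of_nat_Suc)
qed
text \<open>Bounded steps have the fourth moments that chaining needs.\<close>

locale centered_walk = prob_space M for M :: "'w measure" +
  fixes x :: "nat \<Rightarrow> 'w \<Rightarrow> real^'d" and K :: real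
  assumes ind: "indep_vars (\<lambda>_. borel) x UNIV"
    and ident: "\<And>i. distr M borel (x i) = distr M borel (x 0)"
    and bd: "\<And>i \<omega>. \<omega> \<in> space M \<Longrightarrow> norm (x i \<omega>) \<le> K"
    and mean: "\<And>u. (\<integral>\<omega>. u \<bullet> x 0 \<omega> \<partial>M) = 0"
begin

definition walk_sum :: "nat \<Rightarrow> 'w \<Rightarrow> real^'d" where
  "walk_sum k \<omega> = (\<Sum>i<k. x i \<omega>)"

definition walk_path :: "nat \<Rightarrow> 'w \<Rightarrow> (real^'d) cpath" where
  "walk_path n \<omega> = polygon (real n) (\<lambda>k. walk_sum k \<omega> /\<^sub>R sqrt (real n))"

definition moment_const :: real where
  "moment_const = real DIM(real^'d) * (\<Sum>b\<in>(Basis :: (real^'d) set). 3 * K ^ 4)"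

lemma step_measurable [measurable]: "x i \<in> borel_measurable M"
  using ind by (auto simp: indep_vars_def)

lemma K_nonneg: "0 \<le> K"
proof -
  obtain \<omega> where "\<omega> \<in> space M" using not_empty by blast
  from order_trans[OF norm_ge_zero bd[OF this]] show ?thesis .
qed

lemma moment_const_nonneg: "0 \<le> moment_const"
  using K_nonneg by (simp add: moment_const_def)

lemma walk_sum_measurable [measurable]: "walk_sum k \<in> borel_measurable M"
  unfolding walk_sum_def by measurable

lemma walk_path_measurable [measurable]: "walk_path n \<in> borel_measurable M"
  unfolding walk_path_def by (rule measurable_polygon) auto

lemma weighted_steps_moment:
  fixes a :: "nat \<Rightarrow> real"
  shows "integrable M (\<lambda>\<omega>. norm (\<Sum>i<m. a i *\<^sub>R x i \<omega>) ^ 4)"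
  "(\<integral>\<omega>. norm (\<Sum>i<m. a i *\<^sub>R x i \<omega>) ^ 4 \<partial>M) \<le> moment_const * (\<Sum>i<m. (a i)\<^sup>2)\<^sup>2"
proof -
  have inner: "b \<bullet> (\<Sum>i<m. a i *\<^sub>R x i \<omega>) = (\<Sum>i<m. a i * (b \<bullet> x i \<omega>))" for b \<omega>
    by (simp add: inner_sum_right)
  have bdb: "\<bar>b \<bullet> x i \<omega>\<bar> \<le> K" if "b \<in> Basis" "\<omega> \<in> space M" for b i \<omega>
    using Basis_le_norm[OF that(1), of "x i \<omega>"] bd[OF that(2), of i] inner_commute[of b "x i \<omega>"] by linarith
  have le: "(\<integral>\<omega>. (b \<bullet> (\<Sum>i<m. a i *\<^sub>R x i \<omega>)) ^ 4 \<partial>M) \<le> 3 * K ^ 4 * (\<Sum>i<m. (a i)\<^sup>2)\<^sup>2"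
    if b: "b \<in> Basis" for b
    unfolding inner
  proof (rule weighted_sum_moments(3))
    show "indep_vars (\<lambda>_. borel) (\<lambda>i \<omega>. b \<bullet> x i \<omega>) {..<m}"
      by (rule indep_vars_compose2[OF indep_vars_subset[OF ind subset_UNIV]]) simp
    show "expectation (\<lambda>\<omega>. b \<bullet> x i \<omega>) = 0" for i
    proof -
      have "expectation (\<lambda>\<omega>. b \<bullet> x i \<omega>) = (\<integral>y. b \<bullet> y \<partial>distr M borel (x i))"
        by (simp add: integral_distr)
      also have "\<dots> = expectation (\<lambda>\<omega>. b \<bullet> x 0 \<omega>)"
        unfolding ident[of i] by (simp add: integral_distr)
      finally show ?thesis by (simp add: mean)
    qed
    show "\<bar>b \<bullet> x i \<omega>\<bar> \<le> K" if "\<omega> \<in> space M" for i \<omega> by (rule bdb[OF b that])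
  qed
  have int: "integrable M (\<lambda>\<omega>. (b \<bullet> (\<Sum>i<m. a i *\<^sub>R x i \<omega>)) ^ 4)" if b: "b \<in> Basis" for b
  proof (rule integrable_bounded)
    fix \<omega> assume \<omega>: "\<omega> \<in> space M"
    have "\<bar>\<Sum>i<m. a i * (b \<bullet> x i \<omega>)\<bar> \<le> (\<Sum>i<m. \<bar>a i\<bar> * K)"
      by (rule order_trans[OF sum_abs], rule sum_mono) (simp only: abs_mult, rule mult_left_mono[OF bdb[OF b \<omega>]], simp)
    then show "norm ((b \<bullet> (\<Sum>i<m. a i *\<^sub>R x i \<omega>)) ^ 4) \<le> (\<Sum>i<m. \<bar>a i\<bar> * K) ^ 4"
      unfolding inner real_norm_def power_abs by (intro power_mono) auto
  qed measurable
  have meas: "(\<lambda>\<omega>. \<Sum>i<m. a i *\<^sub>R x i \<omega>) \<in> borel_measurable M" by measurable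
  show "integrable M (\<lambda>\<omega>. norm (\<Sum>i<m. a i *\<^sub>R x i \<omega>) ^ 4)"
    by (rule fourth_moment_norm(1)[OF meas int le])
  have "real DIM(real^'d) * (\<Sum>b\<in>(Basis :: (real^'d) set). 3 * K ^ 4 * (\<Sum>i<m. (a i)\<^sup>2)\<^sup>2)
      = moment_const * (\<Sum>i<m. (a i)\<^sup>2)\<^sup>2"
    by (simp only: moment_const_def sum_distrib_right mult.assoc)
  with fourth_moment_norm(2)[OF meas int le]
  show "(\<integral>\<omega>. norm (\<Sum>i<m. a i *\<^sub>R x i \<omega>) ^ 4 \<partial>M) \<le> moment_const * (\<Sum>i<m. (a i)\<^sup>2)\<^sup>2"
    by (simp only:)
qed

lemma walk_path_moment:
  assumes n: "1 \<le> n" and st: "0 \<le> s" "s \<le> t"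
  shows "integrable M (\<lambda>\<omega>. norm (path_apply (walk_path n \<omega>) t - path_apply (walk_path n \<omega>) s) ^ 4)"
  "(\<integral>\<omega>. norm (path_apply (walk_path n \<omega>) t - path_apply (walk_path n \<omega>) s) ^ 4 \<partial>M) \<le> moment_const * (t - s)\<^sup>2"
proof -
  have pos: "0 < real n" using n by simp
  let ?n = "real n"
  have a: "0 \<le> ?n * s" and b: "?n * s \<le> ?n * t" using st by (auto intro: mult_left_mono)
  obtain m \<theta> where \<theta>: "\<And>y :: nat \<Rightarrow> real^'d. interpolate (\<lambda>k. \<Sum>i<k. y i) (?n * t)
      - interpolate (\<lambda>k. \<Sum>i<k. y i) (?n * s) = (\<Sum>i<m. \<theta> i *\<^sub>R y i)"
    "(\<Sum>i<m. (\<theta> i)\<^sup>2) \<le> ?n * t - ?n * s"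
    using a b by (rule interpolate_increment_weights) (rule that)
  let ?a = "\<lambda>i. \<theta> i / sqrt ?n"
  have eq: "path_apply (walk_path n \<omega>) t - path_apply (walk_path n \<omega>) s = (\<Sum>i<m. ?a i *\<^sub>R x i \<omega>)" for \<omega>
  proof -
    have "path_apply (walk_path n \<omega>) t - path_apply (walk_path n \<omega>) s
        = (interpolate (\<lambda>k. walk_sum k \<omega>) (?n * t) - interpolate (\<lambda>k. walk_sum k \<omega>) (?n * s)) /\<^sub>R sqrt ?n"
      using st by (simp add: walk_path_def path_apply_polygon interpolate_scaleR scaleR_diff_right)
    also have "\<dots> = (\<Sum>i<m. \<theta> i *\<^sub>R x i \<omega>) /\<^sub>R sqrt ?n"
      unfolding walk_sum_def by (simp only: \<theta>(1))
    also have "\<dots> = (\<Sum>i<m. ?a i *\<^sub>R x i \<omega>)"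
      by (simp add: scaleR_sum_right divide_inverse mult.commute)
    finally show ?thesis .
  qed
  show "integrable M (\<lambda>\<omega>. norm (path_apply (walk_path n \<omega>) t - path_apply (walk_path n \<omega>) s) ^ 4)"
    unfolding eq by (rule weighted_steps_moment)
  have "(\<Sum>i<m. (?a i)\<^sup>2) = (\<Sum>i<m. (\<theta> i)\<^sup>2) / ?n"
    by (simp add: power_divide sum_divide_distrib)
  also have "\<dots> \<le> (?n * t - ?n * s) / ?n" using \<theta>(2) by (rule divide_right_mono) simp
  also have "\<dots> = t - s" using pos by (simp add: diff_divide_distrib)
  finally have "(\<Sum>i<m. (?a i)\<^sup>2)\<^sup>2 \<le> (t - s)\<^sup>2" by (intro power_mono sum_nonneg) auto
  then have "moment_const * (\<Sum>i<m. (?a i)\<^sup>2)\<^sup>2 \<le> moment_const * (t - s)\<^sup>2" using moment_const_nonneg by (rule mult_left_mono)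
  moreover have "(\<integral>\<omega>. norm (\<Sum>i<m. ?a i *\<^sub>R x i \<omega>) ^ 4 \<partial>M) \<le> moment_const * (\<Sum>i<m. (?a i)\<^sup>2)\<^sup>2"
    by (rule weighted_steps_moment)
  ultimately show "(\<integral>\<omega>. norm (path_apply (walk_path n \<omega>) t - path_apply (walk_path n \<omega>) s) ^ 4 \<partial>M) \<le> moment_const * (t - s)\<^sup>2"
    unfolding eq by linarith
qed

definition grid_increment :: "nat \<Rightarrow> nat \<Rightarrow> 'w \<Rightarrow> nat \<Rightarrow> real^'d" where
  "grid_increment l n \<omega> j =
     (walk_sum (grid_index l n (Suc j)) \<omega> - walk_sum (grid_index l n j) \<omega>) /\<^sub>R sqrt (real (Suc n))"

lemma grid_increment_moment:
  "integrable M (\<lambda>\<omega>. norm (grid_increment l n \<omega> j) ^ 4)"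
  "(\<integral>\<omega>. norm (grid_increment l n \<omega> j) ^ 4 \<partial>M) \<le> moment_const * (1 / 2 ^ l + 1)\<^sup>2"
proof -
  let ?a = "\<lambda>i. if i < grid_index l n j then 0 else 1 / sqrt (real (Suc n))"
  have le: "grid_index l n j \<le> grid_index l n (Suc j)" using grid_index_mono[of l n] by (simp add: monoD)
  have split: "{..<grid_index l n (Suc j)} = {..<grid_index l n j} \<union> {grid_index l n j..<grid_index l n (Suc j)}" using le by auto
  have eq: "grid_increment l n \<omega> j = (\<Sum>i<grid_index l n (Suc j). ?a i *\<^sub>R x i \<omega>)" for \<omega>
  proof -
    have "walk_sum (grid_index l n (Suc j)) \<omega> - walk_sum (grid_index l n j) \<omega> = (\<Sum>i\<in>{grid_index l n j..<grid_index l n (Suc j)}. x i \<omega>)"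
      unfolding walk_sum_def split by (subst sum.union_disjoint) auto
    moreover have "(\<Sum>i<grid_index l n (Suc j). ?a i *\<^sub>R x i \<omega>)
        = (\<Sum>i<grid_index l n j. ?a i *\<^sub>R x i \<omega>) + (\<Sum>i\<in>{grid_index l n j..<grid_index l n (Suc j)}. ?a i *\<^sub>R x i \<omega>)"
      unfolding split by (rule sum.union_disjoint) auto
    moreover have "(\<Sum>i<grid_index l n j. ?a i *\<^sub>R x i \<omega>) = 0" by simp
    moreover have "(\<Sum>i\<in>{grid_index l n j..<grid_index l n (Suc j)}. ?a i *\<^sub>R x i \<omega>)
        = (\<Sum>i\<in>{grid_index l n j..<grid_index l n (Suc j)}. x i \<omega>) /\<^sub>R sqrt (real (Suc n))"
      unfolding scaleR_sum_right by (rule sum.cong) (auto simp: divide_inverse)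
    ultimately show ?thesis by (simp add: grid_increment_def)
  qed
  have "(\<Sum>i<grid_index l n (Suc j). (?a i)\<^sup>2) = (\<Sum>i\<in>{grid_index l n j..<grid_index l n (Suc j)}. 1 / real (Suc n))"
  proof -
    have "(\<Sum>i<grid_index l n (Suc j). (?a i)\<^sup>2)
        = (\<Sum>i<grid_index l n j. (?a i)\<^sup>2) + (\<Sum>i\<in>{grid_index l n j..<grid_index l n (Suc j)}. (?a i)\<^sup>2)"
      unfolding split by (rule sum.union_disjoint) auto
    moreover have "(\<Sum>i\<in>{grid_index l n j..<grid_index l n (Suc j)}. (?a i)\<^sup>2) = (\<Sum>i\<in>{grid_index l n j..<grid_index l n (Suc j)}. 1 / real (Suc n))"
      by (rule sum.cong) (auto simp: power_divide)
    ultimately show ?thesis by simp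
  qed
  also have "\<dots> = (real (grid_index l n (Suc j)) - real (grid_index l n j)) / real (Suc n)"
    using le by (simp add: of_nat_diff del: of_nat_Suc)
  also have "\<dots> \<le> (real (Suc n) * (1 / 2 ^ l) + 1) / real (Suc n)"
  proof (rule divide_right_mono)
    have "real (Suc n) * (real (Suc j) / 2 ^ l) - real (Suc n) * (real j / 2 ^ l) = real (Suc n) * (1 / 2 ^ l)"
      by (simp only: right_diff_distrib[symmetric] grid_step)
    then show "real (grid_index l n (Suc j)) - real (grid_index l n j) \<le> real (Suc n) * (1 / 2 ^ l) + 1"
      using grid_index_bounds(1)[of l n "Suc j"] grid_index_bounds(2)[of n j l] by linarith
  qed simp
  also have "\<dots> \<le> 1 / 2 ^ l + 1" by (simp add: add_divide_distrib del: of_nat_Suc)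
  finally have "(\<Sum>i<grid_index l n (Suc j). (?a i)\<^sup>2)\<^sup>2 \<le> (1 / 2 ^ l + 1)\<^sup>2"
    by (intro power_mono sum_nonneg) auto
  then have le_b: "moment_const * (\<Sum>i<grid_index l n (Suc j). (?a i)\<^sup>2)\<^sup>2 \<le> moment_const * (1 / 2 ^ l + 1)\<^sup>2"
    using moment_const_nonneg by (rule mult_left_mono)
  show "integrable M (\<lambda>\<omega>. norm (grid_increment l n \<omega> j) ^ 4)" unfolding eq by (rule weighted_steps_moment)
  show "(\<integral>\<omega>. norm (grid_increment l n \<omega> j) ^ 4 \<partial>M) \<le> moment_const * (1 / 2 ^ l + 1)\<^sup>2"
    unfolding eq by (rule order_trans[OF weighted_steps_moment(2) le_b])
qed

end

context centered_walk
begin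

lemma grid_increment_measurable [measurable]: "grid_increment l n \<in> borel_measurable M"
  by (rule measurable_coordinatewise_then_product) (simp add: grid_increment_def)

text \<open>On a fixed grid the increments of the walk are independent sums of identically distributed
  steps; their joint characteristic function converges to that of the Brownian increments.\<close>

lemma grid_convergence:
  fixes W :: "real \<Rightarrow> 'v \<Rightarrow> real^'d" and h :: "(real^'d) cpath \<Rightarrow> real"
  assumes W: "brownian_motion N S W"
    and cov: "\<And>u. (\<integral>\<omega>. (u \<bullet> x 0 \<omega>)\<^sup>2 \<partial>M) = u \<bullet> (S *v u)"
    and h: "continuous_on UNIV h" "\<And>f. \<bar>h f\<bar> \<le> c"
  shows "(\<lambda>n. \<integral>\<omega>. h (polygon (2 ^ l) (\<lambda>j. walk_sum (grid_index l n j) \<omega> /\<^sub>R sqrt (real (Suc n)))) \<partial>M)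
    \<longlonglongrightarrow> (\<integral>\<omega>. h (polygon (2 ^ l) (\<lambda>j. W (real j / 2 ^ l) \<omega>)) \<partial>N)"
proof -
  have prob_N: "prob_space N" using W by (simp add: brownian_motion_def)
  have W_meas[measurable]: "W t \<in> borel_measurable N" if "0 \<le> t" for t
    using W that by (simp add: brownian_motion_def)
  have W_0: "W 0 \<omega> = 0" if "\<omega> \<in> space N" for \<omega>
    using W that by (simp add: brownian_motion_def)
  let ?Y = "\<lambda>\<omega> j. W (real (Suc j) / 2 ^ l) \<omega> - W (real j / 2 ^ l) \<omega>"
  let ?g = "\<lambda>\<delta> :: nat \<Rightarrow> real^'d. h (polygon (2 ^ l) (\<lambda>j. \<Sum>i<j. \<delta> i))"
  have g_cont: "continuous_on UNIV ?g"
  proof (rule continuous_on_compose2[OF h(1)])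
    have "continuous_on UNIV (\<lambda>(\<delta> :: nat \<Rightarrow> real^'d) j. \<Sum>i<j. \<delta> i)"
      by (intro continuous_on_coordinatewise_then_product continuous_on_sum continuous_on_product_coordinates)
    then show "continuous_on UNIV (\<lambda>\<delta> :: nat \<Rightarrow> real^'d. polygon (2 ^ l) (\<lambda>j. \<Sum>i<j. \<delta> i))"
      by (rule continuous_on_compose2[OF continuous_on_polygon[OF zero_le_power[OF zero_le_numeral]]]) auto
  qed auto
  have "(\<lambda>n. \<integral>\<omega>. ?g (grid_increment l n \<omega>) \<partial>M) \<longlonglongrightarrow> (\<integral>\<omega>. ?g (?Y \<omega>) \<partial>N)"
  proof (rule char_function_convergence[where Z = "grid_increment l" and Y = ?Y and g = ?g and c = c, OF prob_space_axioms prob_N])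
    show "grid_increment l n \<in> borel_measurable M" for n
      by (rule grid_increment_measurable)
    show "?Y \<in> borel_measurable N"
      by (rule measurable_coordinatewise_then_product) (auto intro!: borel_measurable_diff W_meas)
    fix k and u :: "nat \<Rightarrow> real^'d"
    let ?\<psi> = "\<lambda>n v. \<integral>\<omega>. iexp ((v \<bullet> x 0 \<omega>) / sqrt (real (Suc n))) \<partial>M"
    have walk: "(\<integral>\<omega>. iexp (lin_form k u (grid_increment l n \<omega>)) \<partial>M) = (\<Prod>j<k. ?\<psi> n (u j) ^ (grid_index l n (Suc j) - grid_index l n j))" for n
    proof -
      let ?D = "\<lambda>i \<omega>. x i \<omega> /\<^sub>R sqrt (real (Suc n))"
      have "(\<integral>\<omega>. iexp (\<Sum>j<k. u j \<bullet> ((\<Sum>i<grid_index l n (Suc j). ?D i \<omega>) - (\<Sum>i<grid_index l n j. ?D i \<omega>))) \<partial>M)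
          = (\<Prod>j<k. ?\<psi> n (u j) ^ (grid_index l n (Suc j) - grid_index l n j))"
      proof (rule char_function_blocks[where \<psi> = "?\<psi> n"])
        fix k' and v :: "nat \<Rightarrow> real^'d"
        have "indep_vars (\<lambda>_. borel) (\<lambda>i \<omega>. v i \<bullet> ?D i \<omega>) {..<k'}"
          by (rule indep_vars_compose2[OF indep_vars_subset[OF ind subset_UNIV]]) simp
        then have "(\<integral>\<omega>. iexp (\<Sum>i<k'. v i \<bullet> ?D i \<omega>) \<partial>M) = (\<Prod>i<k'. \<integral>\<omega>. iexp (v i \<bullet> ?D i \<omega>) \<partial>M)"
          by (intro iexp_sum_indep) auto
        also have "\<dots> = (\<Prod>i<k'. ?\<psi> n (v i))"
        proof (rule prod.cong)
          fix i
          have "(\<integral>\<omega>. iexp (v i \<bullet> ?D i \<omega>) \<partial>M)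
              = (\<integral>y. iexp ((v i \<bullet> y) / sqrt (real (Suc n))) \<partial>distr M borel (x i))"
            by (subst integral_distr) (auto simp: divide_inverse mult.commute)
          also have "\<dots> = ?\<psi> n (v i)"
            unfolding ident[of i] by (subst integral_distr) auto
          finally show "(\<integral>\<omega>. iexp (v i \<bullet> ?D i \<omega>) \<partial>M) = ?\<psi> n (v i)" .
        qed simp
        finally show "(\<integral>\<omega>. iexp (\<Sum>i<k'. v i \<bullet> ?D i \<omega>) \<partial>M) = (\<Prod>i<k'. ?\<psi> n (v i))" .
      next
        show "?\<psi> n 0 = 1" by (simp add: prob_space)
      qed (rule grid_index_mono)
      moreover have "lin_form k u (grid_increment l n \<omega>) = (\<Sum>j<k. u j \<bullet> ((\<Sum>i<grid_index l n (Suc j). ?D i \<omega>) - (\<Sum>i<grid_index l n j. ?D i \<omega>)))" for \<omega>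
        by (simp only: lin_form_def grid_increment_def walk_sum_def scaleR_sum_right[symmetric] scaleR_diff_right)
      ultimately show ?thesis by (simp only:)
    qed
    have factor: "(\<lambda>n. ?\<psi> n v ^ (grid_index l n (Suc j) - grid_index l n j)) \<longlonglongrightarrow> of_real (exp (- (1 / 2 ^ l * (v \<bullet> (S *v v))) / 2))" for v j
    proof -
      \<comment> \<open>The walk is indexed by \<open>n + 1\<close> here, and by \<open>n\<close> in the limit theorem for powers.\<close>
      define p where "p = (\<lambda>n. grid_index l (n - 1) (Suc j) - grid_index l (n - 1) j)"
      have "(\<lambda>n. real (p (Suc n)) / real (Suc n)) \<longlonglongrightarrow> 1 / 2 ^ l"
        using grid_index_lim[of l j] by (simp add: p_def del: of_nat_Suc)
      then have p: "(\<lambda>n. real (p n) / real n) \<longlonglongrightarrow> 1 / 2 ^ l" by (rule LIMSEQ_imp_Suc)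
      have "(\<lambda>n. (\<integral>\<omega>. iexp ((v \<bullet> x 0 \<omega>) / sqrt (real n)) \<partial>M) ^ p n)
          \<longlonglongrightarrow> exp (- (1 / 2 ^ l * (v \<bullet> (S *v v))) / 2)"
      proof (rule char_power_tendsto[OF _ _ mean cov p])
        show "\<bar>v \<bullet> x 0 \<omega>\<bar> \<le> norm v * K" if "\<omega> \<in> space M" for \<omega>
          using bd[OF that, of 0] by (intro order_trans[OF Cauchy_Schwarz_ineq2]) (simp add: mult_left_mono)
      qed measurable
      from LIMSEQ_Suc[OF this] show ?thesis by (simp add: p_def del: of_nat_Suc)
    qed
    have brown: "(\<integral>\<omega>. iexp (lin_form k u (?Y \<omega>)) \<partial>N)
        = (\<Prod>j<k. of_real (exp (- (1 / 2 ^ l * (u j \<bullet> (S *v u j))) / 2)))"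
      unfolding lin_form_def by (rule brownian_grid_char[OF W]) simp
    show "(\<lambda>n. \<integral>\<omega>. iexp (lin_form k u (grid_increment l n \<omega>)) \<partial>M) \<longlonglongrightarrow> (\<integral>\<omega>. iexp (lin_form k u (?Y \<omega>)) \<partial>N)"
      unfolding walk brown by (rule tendsto_prod) (rule factor)
  next
    fix j :: nat and e :: real assume e: "0 < e"
    define b where "b = moment_const * (1 / 2 ^ l + 1)\<^sup>2"
    have b: "0 \<le> b" using moment_const_nonneg by (simp add: b_def)
    note mom = grid_increment_moment[of l _ j, folded b_def]
    have [measurable]: "(\<lambda>\<omega>. grid_increment l n \<omega> j) \<in> borel_measurable M" for n
      by (rule measurable_product_then_coordinatewise) (rule grid_increment_measurable)
    define a where "a = max 1 (b / e)"
    have a: "1 \<le> a" "b / e \<le> a" by (simp_all add: a_def)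
    show "\<exists>a. \<forall>n. prob {\<omega>\<in>space M. norm (grid_increment l n \<omega> j) > a} \<le> e"
    proof (intro exI allI)
      fix n
      have "prob {\<omega>\<in>space M. norm (grid_increment l n \<omega> j) > a} \<le> prob {\<omega>\<in>space M. norm (grid_increment l n \<omega> j) ^ 4 \<ge> a}"
      proof (rule finite_measure_mono)
        show "{\<omega>\<in>space M. norm (grid_increment l n \<omega> j) > a} \<subseteq> {\<omega>\<in>space M. norm (grid_increment l n \<omega> j) ^ 4 \<ge> a}"
        proof safe
          fix \<omega> assume "norm (grid_increment l n \<omega> j) > a"
          then have "a \<le> norm (grid_increment l n \<omega> j) ^ 1" "1 \<le> norm (grid_increment l n \<omega> j)" using a by simp_all
          then show "a \<le> norm (grid_increment l n \<omega> j) ^ 4"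
            using power_increasing[of 1 4 "norm (grid_increment l n \<omega> j)"] by linarith
        qed
      qed measurable
      also have "\<dots> \<le> (\<integral>\<omega>. norm (grid_increment l n \<omega> j) ^ 4 \<partial>M) / a"
        by (rule integral_Markov_inequality_measure[OF mom(1), where A = "{}"]) (use a in auto)
      also have "\<dots> \<le> b / a" using mom(2) a by (intro divide_right_mono) auto
      also have "\<dots> \<le> e" using a e by (simp add: pos_divide_le_eq mult.commute)
      finally show "prob {\<omega>\<in>space M. norm (grid_increment l n \<omega> j) > a} \<le> e" .
    qed
  qed (use g_cont h(2) in auto)
  moreover have "(\<Sum>i<j. grid_increment l n \<omega> i) = walk_sum (grid_index l n j) \<omega> /\<^sub>R sqrt (real (Suc n))" for n j \<omega>
  proof -
    have "grid_index l n 0 = 0" by (simp add: grid_index_def)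
    then have "(\<Sum>i<j. walk_sum (grid_index l n (Suc i)) \<omega> - walk_sum (grid_index l n i) \<omega>) = walk_sum (grid_index l n j) \<omega>"
      by (subst sum_lessThan_telescope) (simp add: walk_sum_def)
    then show ?thesis by (simp only: grid_increment_def scaleR_sum_right[symmetric])
  qed
  moreover have "(\<integral>\<omega>. ?g (?Y \<omega>) \<partial>N) = (\<integral>\<omega>. h (polygon (2 ^ l) (\<lambda>j. W (real j / 2 ^ l) \<omega>)) \<partial>N)"
  proof (rule Bochner_Integration.integral_cong)
    fix \<omega> assume \<omega>: "\<omega> \<in> space N"
    have "(\<Sum>i<j. ?Y \<omega> i) = W (real j / 2 ^ l) \<omega>" for j
      by (subst sum_lessThan_telescope) (simp add: W_0[OF \<omega>])
    then show "?g (?Y \<omega>) = h (polygon (2 ^ l) (\<lambda>j. W (real j / 2 ^ l) \<omega>))" by simp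
  qed simp
  ultimately show ?thesis by (simp only:)
qed

text \<open>The paths are compared with their polygons on the grid of mesh \<open>2^(-l)\<close>, uniformly in \<open>n\<close>
  for the walk; for fixed \<open>l\<close> only finitely many increments matter on bounded time intervals, and these
  converge.\<close>

theorem donsker:
  fixes W :: "real \<Rightarrow> 'v \<Rightarrow> real^'d" and h :: "(real^'d) cpath \<Rightarrow> real"
  assumes W: "brownian_motion N S W"
    and cov: "\<And>u. (\<integral>\<omega>. (u \<bullet> x 0 \<omega>)\<^sup>2 \<partial>M) = u \<bullet> (S *v u)"
    and h: "lam-lipschitz_on UNIV h" "\<And>f. \<bar>h f\<bar> \<le> c"
  shows "(\<lambda>n. \<integral>\<omega>. h (walk_path n \<omega>) \<partial>M) \<longlonglongrightarrow> (\<integral>\<omega>. h (mk_cpath (\<lambda>t. W t \<omega>)) \<partial>N)"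
proof -
  interpret N: prob_space N using W by (simp add: brownian_motion_def)
  have W_meas[measurable]: "W t \<in> borel_measurable N" if "0 \<le> t" for t
    using W that by (simp add: brownian_motion_def)
  have W_cont: "continuous_on {0..} (\<lambda>t. W t \<omega>)" if "\<omega> \<in> space N" for \<omega>
    using W that by (auto simp: brownian_motion_def)
  have lam: "0 \<le> lam" by (rule lipschitz_on_nonneg[OF h(1)])
  have c: "0 \<le> c" using h(2)[of undefined] by linarith
  define Z where "Z = (\<lambda>n. walk_path (Suc n))"
  define B where "B = (\<lambda>\<omega>. mk_cpath (\<lambda>t. W t \<omega>))"
  have Z[measurable]: "Z n \<in> borel_measurable M" for n unfolding Z_def by measurable
  have B_apply: "path_apply (B \<omega>) t = W t \<omega>" if "\<omega> \<in> space N" "0 \<le> t" for \<omega> t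
    unfolding B_def by (rule path_apply_mk_cpath[OF W_cont]) (use that in auto)
  have B[measurable]: "B \<in> borel_measurable N"
  proof (rule cpath_measurableI)
    show "(\<lambda>\<omega>. path_apply (B \<omega>) t) \<in> borel_measurable N" if "0 \<le> t" for t
      using W_meas[OF that] by (rule measurable_cong[THEN iffD1, rotated]) (simp add: B_apply that)
  qed
  define cW where "cW = real DIM(real^'d) * (\<Sum>b\<in>Basis. 3 * (b \<bullet> (S *v b))\<^sup>2)"
  have cW: "0 \<le> cW" by (simp add: cW_def sum_nonneg)
  have sq: "(1 / 2 ^ l)\<^sup>2 = (1 / 4 ^ l :: real)" for l
    by (simp add: power_divide power2_eq_square flip: power_mult_distrib)
  have Z_close: "\<exists>E\<in>events. prob E \<le> moment_const * chaining_tail l \<and> (\<forall>\<omega>\<in>space M - E.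
      dist (Z n \<omega>) (sample_polygon (2 ^ l) (Z n \<omega>)) \<le> 8 * (7 / 8) ^ l + (1 / 2) ^ l)" for n l
  proof (rule close_to_sample_polygon[OF Z])
    fix l j
    have "0 \<le> real j / 2 ^ l" "real j / 2 ^ l \<le> real (Suc j) / 2 ^ l" by (simp_all add: divide_right_mono)
    note m = walk_path_moment[of "Suc n", OF _ this, folded Z_def]
    show "integrable M (\<lambda>\<omega>. norm (path_apply (Z n \<omega>) (real (Suc j) / 2 ^ l) - path_apply (Z n \<omega>) (real j / 2 ^ l)) ^ 4)"
      unfolding Z_def by (rule m) simp
    have "(\<integral>\<omega>. norm (path_apply (Z n \<omega>) (real (Suc j) / 2 ^ l) - path_apply (Z n \<omega>) (real j / 2 ^ l)) ^ 4 \<partial>M)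
        \<le> moment_const * (real (Suc j) / 2 ^ l - real j / 2 ^ l)\<^sup>2"
      unfolding Z_def by (rule m) simp
    then show "(\<integral>\<omega>. norm (path_apply (Z n \<omega>) (real (Suc j) / 2 ^ l) - path_apply (Z n \<omega>) (real j / 2 ^ l)) ^ 4 \<partial>M)
        \<le> moment_const / 4 ^ l"
      unfolding grid_step sq by simp
  qed
  have W_close: "\<exists>E\<in>sets N. measure N E \<le> cW * chaining_tail l \<and> (\<forall>\<omega>\<in>space N - E.
      dist (B \<omega>) (sample_polygon (2 ^ l) (B \<omega>)) \<le> 8 * (7 / 8) ^ l + (1 / 2) ^ l)" for l
  proof (rule N.close_to_sample_polygon[OF B])
    fix l j
    have st: "0 \<le> real j / 2 ^ l" "real j / 2 ^ l < real (Suc j) / 2 ^ l" "0 \<le> real (Suc j) / 2 ^ l"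
      by (simp_all add: divide_strict_right_mono)
    note m = brownian_fourth_moment[OF W st(1,2)]
    show "integrable N (\<lambda>\<omega>. norm (path_apply (B \<omega>) (real (Suc j) / 2 ^ l) - path_apply (B \<omega>) (real j / 2 ^ l)) ^ 4)"
      using m(1) by (rule Bochner_Integration.integrable_cong[THEN iffD1, rotated 2]) (auto simp: B_apply st)
    have "(\<integral>\<omega>. norm (path_apply (B \<omega>) (real (Suc j) / 2 ^ l) - path_apply (B \<omega>) (real j / 2 ^ l)) ^ 4 \<partial>N)
        = (\<integral>\<omega>. norm (W (real (Suc j) / 2 ^ l) \<omega> - W (real j / 2 ^ l) \<omega>) ^ 4 \<partial>N)"
      by (rule Bochner_Integration.integral_cong) (auto simp: B_apply st)
    also have "\<dots> \<le> real DIM(real^'d) * (\<Sum>b\<in>Basis. 3 * (1 / 2 ^ l * (b \<bullet> (S *v b)))\<^sup>2)"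
      using m(2) unfolding grid_step .
    also have "\<dots> = cW / 4 ^ l"
      unfolding power_mult_distrib sq by (simp add: cW_def sum_distrib_left sum_divide_distrib ac_simps)
    finally show "(\<integral>\<omega>. norm (path_apply (B \<omega>) (real (Suc j) / 2 ^ l) - path_apply (B \<omega>) (real j / 2 ^ l)) ^ 4 \<partial>N) \<le> cW / 4 ^ l" .
  qed
  define G where "G = (\<lambda>l n \<omega>. polygon (2 ^ l) (\<lambda>j. walk_sum (grid_index l n j) \<omega> /\<^sub>R sqrt (real (Suc n))))"
  have grid: "(\<lambda>n. \<integral>\<omega>. h (G l n \<omega>) \<partial>M) \<longlonglongrightarrow> (\<integral>\<omega>. h (sample_polygon (2 ^ l) (B \<omega>)) \<partial>N)" for l
  proof -
    have "(\<integral>\<omega>. h (sample_polygon (2 ^ l) (B \<omega>)) \<partial>N) = (\<integral>\<omega>. h (polygon (2 ^ l) (\<lambda>j. W (real j / 2 ^ l) \<omega>)) \<partial>N)"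
      by (rule Bochner_Integration.integral_cong) (simp_all add: sample_polygon_def B_apply)
    then show ?thesis
      unfolding G_def using grid_convergence[OF W cov lipschitz_on_continuous_on[OF h(1)] h(2)] by (simp only:)
  qed
  have G_meas: "G l n \<in> borel_measurable M" for l n
    unfolding G_def by (rule measurable_polygon) auto
  have sp_meas: "(\<lambda>\<omega>. sample_polygon (2 ^ l) (V \<omega>)) \<in> borel_measurable P"
    if "V \<in> borel_measurable P" for l and P :: "'x measure" and V :: "'x \<Rightarrow> (real^'d) cpath"
    unfolding sample_polygon_def
    by (rule measurable_polygon) (auto intro: measurable_compose[OF that measurable_eval])
  have G_close: "dist (sample_polygon (2 ^ l) (Z n \<omega>)) (G l n \<omega>) \<le> K / sqrt (real (Suc n)) + (1 / 2) ^ n"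
    if \<omega>: "\<omega> \<in> space M" for l n \<omega>
  proof (rule cpath_dist_le)
    show "0 \<le> K / sqrt (real (Suc n))" using K_nonneg by simp
    fix t :: real assume t: "0 \<le> t" "t \<le> real n"
    show "dist (path_apply (sample_polygon (2 ^ l) (Z n \<omega>)) t) (path_apply (G l n \<omega>) t) \<le> K / sqrt (real (Suc n))"
      unfolding sample_polygon_def G_def
    proof (rule polygon_nodes_le[OF _ _ _ t])
      fix j
      let ?s = "real (Suc n) * (real j / 2 ^ l)"
      have "path_apply (Z n \<omega>) (real j / 2 ^ l) = interpolate (\<lambda>k. walk_sum k \<omega>) ?s /\<^sub>R sqrt (real (Suc n))"
        by (simp add: Z_def walk_path_def path_apply_polygon interpolate_scaleR del: of_nat_Suc)
      also have "interpolate (\<lambda>k. walk_sum k \<omega>) ?s = walk_sum (grid_index l n j) \<omega> + (?s - real (grid_index l n j)) *\<^sub>R x (grid_index l n j) \<omega>"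
        using interpolate_eq[of "grid_index l n j" ?s "\<lambda>k. walk_sum k \<omega>"] grid_index_bounds[of l n j] grid_index_bounds(2)[of n j l]
        by (simp add: walk_sum_def del: of_nat_Suc)
      finally have "path_apply (Z n \<omega>) (real j / 2 ^ l) - walk_sum (grid_index l n j) \<omega> /\<^sub>R sqrt (real (Suc n))
          = ((?s - real (grid_index l n j)) *\<^sub>R x (grid_index l n j) \<omega>) /\<^sub>R sqrt (real (Suc n))"
        by (simp add: scaleR_add_right del: of_nat_Suc)
      also have "norm \<dots> = (?s - real (grid_index l n j)) * norm (x (grid_index l n j) \<omega>) / sqrt (real (Suc n))"
        using grid_index_bounds(1)[of l n j] by (simp add: divide_inverse mult.commute del: of_nat_Suc)
      also have "\<dots> \<le> 1 * K / sqrt (real (Suc n))"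
        using grid_index_bounds(1)[of l n j] grid_index_bounds(2)[of n j l] bd[OF \<omega>] by (intro divide_right_mono mult_mono) auto
      finally show "norm (path_apply (Z n \<omega>) (real j / 2 ^ l) - walk_sum (grid_index l n j) \<omega> /\<^sub>R sqrt (real (Suc n)))
          \<le> K / sqrt (real (Suc n))" by simp
    qed (use K_nonneg in auto)
  qed
  define r where "r = (\<lambda>l. lam * (8 * (7 / 8) ^ l + (1 / 2) ^ l) + 2 * c * ((moment_const + cW) * chaining_tail l))"
  have tail: "0 \<le> chaining_tail l" for l
    unfolding chaining_tail_def
    by (rule suminf_nonneg[OF summable_ignore_initial_segment[OF summable_chaining]]) simp
  have r_lim: "r \<longlonglongrightarrow> 0"
  proof -
    have "r \<longlonglongrightarrow> lam * (8 * 0 + 0) + 2 * c * ((moment_const + cW) * 0)"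
      unfolding r_def by (intro tendsto_intros chaining_tail_tendsto LIMSEQ_realpow_zero) auto
    then show ?thesis by simp
  qed
  have Z_diff: "\<bar>(\<integral>\<omega>. h (Z n \<omega>) \<partial>M) - (\<integral>\<omega>. h (sample_polygon (2 ^ l) (Z n \<omega>)) \<partial>M)\<bar> \<le> r l" for n l
  proof -
    obtain E where E: "E \<in> events" "prob E \<le> moment_const * chaining_tail l"
      "\<And>\<omega>. \<omega> \<in> space M \<Longrightarrow> \<omega> \<notin> E \<Longrightarrow> dist (Z n \<omega>) (sample_polygon (2 ^ l) (Z n \<omega>)) \<le> 8 * (7 / 8) ^ l + (1 / 2) ^ l"
      using Z_close[of l n] by auto
    have "\<bar>(\<integral>\<omega>. h (Z n \<omega>) \<partial>M) - (\<integral>\<omega>. h (sample_polygon (2 ^ l) (Z n \<omega>)) \<partial>M)\<bar>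
        \<le> lam * (8 * (7 / 8) ^ l + (1 / 2) ^ l) + 2 * c * prob E"
      by (rule integral_lipschitz_diff_le[OF Z sp_meas[OF Z] h E(1) _ E(3)]) auto
    also have "\<dots> \<le> r l"
      unfolding r_def using E(2) c cW tail[of l]
      by (intro add_mono mult_left_mono order_refl) (auto simp: distrib_right intro: order_trans)
    finally show ?thesis .
  qed
  have W_diff: "\<bar>(\<integral>\<omega>. h (B \<omega>) \<partial>N) - (\<integral>\<omega>. h (sample_polygon (2 ^ l) (B \<omega>)) \<partial>N)\<bar> \<le> r l" for l
  proof -
    obtain E where E: "E \<in> sets N" "measure N E \<le> cW * chaining_tail l"
      "\<And>\<omega>. \<omega> \<in> space N \<Longrightarrow> \<omega> \<notin> E \<Longrightarrow> dist (B \<omega>) (sample_polygon (2 ^ l) (B \<omega>)) \<le> 8 * (7 / 8) ^ l + (1 / 2) ^ l"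
      using W_close[of l] by auto
    have "\<bar>(\<integral>\<omega>. h (B \<omega>) \<partial>N) - (\<integral>\<omega>. h (sample_polygon (2 ^ l) (B \<omega>)) \<partial>N)\<bar>
        \<le> lam * (8 * (7 / 8) ^ l + (1 / 2) ^ l) + 2 * c * measure N E"
      by (rule N.integral_lipschitz_diff_le[OF B sp_meas[OF B] h E(1) _ E(3)]) auto
    also have "\<dots> \<le> r l"
      unfolding r_def using E(2) c moment_const_nonneg tail[of l]
      by (intro add_mono mult_left_mono order_refl) (auto simp: distrib_right intro: order_trans)
    finally show ?thesis .
  qed
  define q where "q = (\<lambda>n. lam * (K / sqrt (real (Suc n)) + (1 / 2) ^ n))"
  have q_lim: "q \<longlonglongrightarrow> 0"
  proof -
    have "(\<lambda>n. K / sqrt (real n)) \<longlonglongrightarrow> 0"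
      by (rule tendsto_divide_0[OF tendsto_const])
         (rule filterlim_at_top_imp_at_infinity[OF filterlim_compose[OF sqrt_at_top filterlim_real_sequentially]])
    then have "(\<lambda>n. K / sqrt (real (Suc n))) \<longlonglongrightarrow> 0" by (rule LIMSEQ_Suc)
    moreover have "(\<lambda>n. (1 / 2 :: real) ^ n) \<longlonglongrightarrow> 0" by (rule LIMSEQ_realpow_zero) auto
    ultimately have "q \<longlonglongrightarrow> lam * (0 + 0)"
      unfolding q_def by (intro tendsto_mult tendsto_add tendsto_const)
    then show ?thesis by simp
  qed
  have G_diff: "\<bar>(\<integral>\<omega>. h (sample_polygon (2 ^ l) (Z n \<omega>)) \<partial>M) - (\<integral>\<omega>. h (G l n \<omega>) \<partial>M)\<bar> \<le> q n" for n l
  proof -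
    have "\<bar>(\<integral>\<omega>. h (sample_polygon (2 ^ l) (Z n \<omega>)) \<partial>M) - (\<integral>\<omega>. h (G l n \<omega>) \<partial>M)\<bar>
        \<le> lam * (K / sqrt (real (Suc n)) + (1 / 2) ^ n) + 2 * c * prob {}"
      by (rule integral_lipschitz_diff_le[OF sp_meas[OF Z] G_meas h _ _ G_close]) (use K_nonneg in auto)
    then show ?thesis by (simp add: q_def)
  qed
  have "(\<lambda>n. \<integral>\<omega>. h (Z n \<omega>) \<partial>M) \<longlonglongrightarrow> (\<integral>\<omega>. h (B \<omega>) \<partial>N)"
  proof (rule LIMSEQ_I)
    fix e :: real assume e: "0 < e"
    have "\<forall>\<^sub>F l in sequentially. r l < e / 4" by (rule order_tendstoD(2)[OF r_lim]) (use e in simp)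
    then obtain l where l: "r l < e / 4" by (auto simp: eventually_sequentially)
    have "\<forall>\<^sub>F n in sequentially. q n < e / 4" by (rule order_tendstoD(2)[OF q_lim]) (use e in simp)
    moreover have "\<forall>\<^sub>F n in sequentially. dist (\<integral>\<omega>. h (G l n \<omega>) \<partial>M) (\<integral>\<omega>. h (sample_polygon (2 ^ l) (B \<omega>)) \<partial>N) < e / 4"
      by (rule tendstoD[OF grid]) (use e in simp)
    ultimately have "\<forall>\<^sub>F n in sequentially. norm ((\<integral>\<omega>. h (Z n \<omega>) \<partial>M) - (\<integral>\<omega>. h (B \<omega>) \<partial>N)) < e"
    proof eventually_elim
      case (elim n)
      then show ?case
        using Z_diff[of n l] W_diff[of l] G_diff[of l n] l unfolding dist_real_def real_norm_def by linarith
    qed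
    then show "\<exists>n0. \<forall>n\<ge>n0. norm ((\<integral>\<omega>. h (Z n \<omega>) \<partial>M) - (\<integral>\<omega>. h (B \<omega>) \<partial>N)) < e"
      by (simp add: eventually_sequentially)
  qed
  then show ?thesis unfolding Z_def B_def by (rule LIMSEQ_imp_Suc)
qed

end

section \<open>The randomness of the excited walk, step by step\<close>

context excited_random_walk
begin

text \<open>All sources of randomness in one independent family of vectors: \<open>(i, 0)\<close>, \<open>(i, 1)\<close> and
  \<open>(i, 2)\<close> index \<open>\<xi> i\<close>, \<open>\<gamma> i\<close> and \<open>U i\<close>, the last one as a multiple of the unit vector \<open>l\<close>,
  from which it is recovered as an inner product.\<close>

definition noise :: "nat \<times> nat \<Rightarrow> 'w \<Rightarrow> real^'d" where
  "noise q = (if snd q = 0 then \<xi> (fst q) else if snd q = 1 then \<gamma> (fst q) else (\<lambda>\<omega>. U (fst q) \<omega> *\<^sub>R l))"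

lemmas indep_\<xi> = iid_\<xi>[unfolded iid_def, THEN conjunct1]
  and indep_\<gamma> = iid_\<gamma>[unfolded iid_def, THEN conjunct1]
  and indep_U' = iid_U[unfolded iid_def, THEN conjunct1]

lemma \<xi>_rv: "1 \<le> i \<Longrightarrow> \<xi> i \<in> borel_measurable M"
  by (rule bspec[OF conjunct1[OF indep_\<xi>[unfolded indep_vars_def]]]) simp

lemma \<gamma>_rv: "1 \<le> i \<Longrightarrow> \<gamma> i \<in> borel_measurable M"
  by (rule bspec[OF conjunct1[OF indep_\<gamma>[unfolded indep_vars_def]]]) simp

lemma U_rv: "1 \<le> i \<Longrightarrow> U i \<in> borel_measurable M"
  by (rule bspec[OF conjunct1[OF indep_U'[unfolded indep_vars_def]]]) simp

lemma noise_rv: "1 \<le> fst q \<Longrightarrow> noise q \<in> borel_measurable M"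
  by (simp add: noise_def \<xi>_rv \<gamma>_rv U_rv borel_measurable_scaleR)

lemma prob_sequence_rectangle:
  fixes Z :: "nat \<Rightarrow> 'w \<Rightarrow> 'b::topological_space" and J :: "(nat \<times> nat) set"
  assumes Z: "indep_vars (\<lambda>_. borel) Z {1..}" and J: "finite J" "\<And>q. q \<in> J \<Longrightarrow> 1 \<le> fst q \<and> snd q = c"
    and B: "\<And>q. q \<in> J \<Longrightarrow> B q \<in> sets borel"
  shows "prob {\<omega>\<in>space M. \<forall>q\<in>J. Z (fst q) \<omega> \<in> B q} = (\<Prod>q\<in>J. prob (Z (fst q) -` B q \<inter> space M))"
proof (cases "J = {}")
  case True
  then show ?thesis by (simp add: prob_space)
next
  case False
  have eta: "(fst q, c) = q" if "q \<in> J" for q using J(2)[OF that] by (metis prod.collapse)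
  have inj: "inj_on fst J"
  proof (rule inj_onI)
    fix q q' assume "q \<in> J" "q' \<in> J" "fst q = fst q'"
    then show "q = q'" by (metis eta)
  qed
  have "{\<omega>\<in>space M. \<forall>q\<in>J. Z (fst q) \<omega> \<in> B q} = (\<Inter>i\<in>fst ` J. Z i -` B (i, c) \<inter> space M)"
  proof (intro set_eqI iffI)
    fix \<omega> assume \<omega>: "\<omega> \<in> {\<omega>\<in>space M. \<forall>q\<in>J. Z (fst q) \<omega> \<in> B q}"
    show "\<omega> \<in> (\<Inter>i\<in>fst ` J. Z i -` B (i, c) \<inter> space M)"
    proof (rule INT_I)
      fix i assume "i \<in> fst ` J"
      then obtain q where q: "q \<in> J" "i = fst q" by blast
      then have "Z i \<omega> \<in> B (i, c)" using \<omega> unfolding q(2) eta[OF q(1)] by blast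
      then show "\<omega> \<in> Z i -` B (i, c) \<inter> space M" using \<omega> by blast
    qed
  next
    fix \<omega> assume \<omega>: "\<omega> \<in> (\<Inter>i\<in>fst ` J. Z i -` B (i, c) \<inter> space M)"
    have "Z (fst q) \<omega> \<in> B q" if "q \<in> J" for q
    proof -
      have "Z (fst q) \<omega> \<in> B (fst q, c)" using \<omega> that by blast
      then show ?thesis unfolding eta[OF that] .
    qed
    then show "\<omega> \<in> {\<omega>\<in>space M. \<forall>q\<in>J. Z (fst q) \<omega> \<in> B q}" using \<omega> False by blast
  qed
  also have "prob \<dots> = (\<Prod>i\<in>fst ` J. prob (Z i -` B (i, c) \<inter> space M))"
  proof (rule indep_varsD[OF Z])
    show "B (i, c) \<in> sets borel" if i: "i \<in> fst ` J" for i
    proof -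
      obtain q where "q \<in> J" "i = fst q" using i by blast
      then show ?thesis using B[of q] by (simp only: eta)
    qed
  qed (use J False in auto)
  also have "\<dots> = (\<Prod>q\<in>J. prob (Z (fst q) -` B q \<inter> space M))"
    unfolding prod.reindex[OF inj] comp_def by (rule prod.cong) (simp_all only: eta)
  finally show ?thesis .
qed

lemma sequence_rectangle_sets:
  fixes f :: "'b::topological_space \<Rightarrow> 'c::topological_space" and J :: "(nat \<times> nat) set"
  assumes "finite J" "\<And>q. q \<in> J \<Longrightarrow> 1 \<le> fst q" "\<And>q. q \<in> J \<Longrightarrow> B q \<in> sets borel"
    and [measurable]: "f \<in> borel_measurable borel"
  shows "{z\<in>space seq_space. \<forall>q\<in>J. f (z (fst q)) \<in> B q} \<in> sets seq_space"
proof (rule sets.sets_Collect_finite_All[OF _ assms(1)])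
  fix q assume q: "q \<in> J"
  have [measurable]: "B q \<in> sets borel" by (rule assms(3)[OF q])
  have "(\<lambda>z. z (fst q)) \<in> measurable (seq_space :: (nat \<Rightarrow> 'b) measure) borel"
    by (rule measurable_component_singleton) (use assms(2)[OF q] in simp)
  then have "(\<lambda>z. f (z (fst q))) \<in> measurable (seq_space :: (nat \<Rightarrow> 'b) measure) borel"
    by measurable
  from measurable_sets[OF this assms(3)[OF q]]
  have "(\<lambda>z. f (z (fst q))) -` B q \<inter> space seq_space \<in> sets (seq_space :: (nat \<Rightarrow> 'b) measure)" .
  moreover have "(\<lambda>z. f (z (fst q))) -` B q \<inter> space seq_space = {z\<in>space seq_space. f (z (fst q)) \<in> B q}"
    by blast
  ultimately show "{z\<in>space seq_space. f (z (fst q)) \<in> B q} \<in> sets (seq_space :: (nat \<Rightarrow> 'b) measure)"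
    by (simp only:)
qed

text \<open>On finite rectangles the probability factorizes in three stages: \<open>U\<close> is split off the pair, then
  \<open>\<xi>\<close> from \<open>\<gamma>\<close>, and last the terms of each sequence.\<close>

lemma indep_noise: "indep_vars (\<lambda>_. borel) noise ({1..} \<times> {..<3})"
  unfolding indep_vars_def2 indep_sets_def
proof (intro conjI ballI allI impI)
  show "noise q \<in> borel_measurable M" if "q \<in> {1..} \<times> {..<3}" for q
    using that by (intro noise_rv) auto
  show "{noise q -` A \<inter> space M |A. A \<in> sets borel} \<subseteq> events" if "q \<in> {1..} \<times> {..<3}" for q
    using that noise_rv[of q] by (auto intro: measurable_sets)
  fix J A assume J: "J \<subseteq> {1..} \<times> {..<3::nat}" "J \<noteq> {}" "finite J"
    and A: "A \<in> (\<Pi> q\<in>J. {noise q -` A \<inter> space M |A. A \<in> sets borel})"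
  then have "\<forall>q\<in>J. \<exists>B. B \<in> sets borel \<and> A q = noise q -` B \<inter> space M" by (auto simp: Pi_iff)
  then obtain B where B: "\<And>q. q \<in> J \<Longrightarrow> B q \<in> sets borel" "\<And>q. q \<in> J \<Longrightarrow> A q = noise q -` B q \<inter> space M"
    by metis
  define Jc where "Jc = (\<lambda>c. {q\<in>J. snd q = c})"
  have Jc: "finite (Jc c)" "\<And>q. q \<in> Jc c \<Longrightarrow> 1 \<le> fst q \<and> snd q = c" "\<And>q. q \<in> Jc c \<Longrightarrow> q \<in> J" for c
    using J by (auto simp: Jc_def)
  define E where "E = (\<lambda>c. {\<omega>\<in>space M. \<forall>q\<in>Jc c. noise q \<omega> \<in> B q})"
  have E0: "E 0 = as_seq \<xi> -` {z\<in>space seq_space. \<forall>q\<in>Jc 0. z (fst q) \<in> B q} \<inter> space M"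
    and E1: "E 1 = as_seq \<gamma> -` {z\<in>space seq_space. \<forall>q\<in>Jc 1. z (fst q) \<in> B q} \<inter> space M"
    and E2: "E 2 = as_seq U -` {z\<in>space seq_space. \<forall>q\<in>Jc 2. z (fst q) *\<^sub>R l \<in> B q} \<inter> space M"
    using Jc(2) by (auto simp: E_def noise_def as_seq_def space_PiM PiE_iff)
  have S0: "{z\<in>space seq_space. \<forall>q\<in>Jc 0. z (fst q) \<in> B q} \<in> sets seq_space"
    using sequence_rectangle_sets[of "Jc 0" B "\<lambda>x. x"] Jc B by auto
  have S1: "{z\<in>space seq_space. \<forall>q\<in>Jc 1. z (fst q) \<in> B q} \<in> sets seq_space"
    using sequence_rectangle_sets[of "Jc 1" B "\<lambda>x. x"] Jc B by auto
  have S2: "{z\<in>space seq_space. \<forall>q\<in>Jc 2. z (fst q) *\<^sub>R l \<in> B q} \<in> sets seq_space"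
    using sequence_rectangle_sets[of "Jc 2" B "\<lambda>x. x *\<^sub>R l"] Jc B by auto
  have "prob (E 2 \<inter> (E 0 \<inter> E 1)) = prob (E 2) * prob (E 0 \<inter> E 1)"
  proof (rule indep_setD[OF indep_U])
    show "E 2 \<in> sets (vimage_algebra (space M) (as_seq U) seq_space)"
      unfolding E2 by (rule in_vimage_algebra[OF S2])
    have "E 0 \<inter> E 1 = (\<lambda>\<omega>. (as_seq \<xi> \<omega>, as_seq \<gamma> \<omega>)) -`
        ({z\<in>space seq_space. \<forall>q\<in>Jc 0. z (fst q) \<in> B q} \<times> {z\<in>space seq_space. \<forall>q\<in>Jc 1. z (fst q) \<in> B q}) \<inter> space M"
      unfolding E0 E1 by auto
    then show "E 0 \<inter> E 1 \<in> sets (vimage_algebra (space M) (\<lambda>\<omega>. (as_seq \<xi> \<omega>, as_seq \<gamma> \<omega>)) (seq_space \<Otimes>\<^sub>M seq_space))"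
      by (simp only:) (rule in_vimage_algebra[OF pair_measureI[OF S0 S1]])
  qed
  also have "prob (E 0 \<inter> E 1) = prob (E 0) * prob (E 1)"
  proof -
    have "E 0 \<inter> E 1 = (\<lambda>\<omega>. (as_seq \<xi> \<omega>, as_seq \<gamma> \<omega>)) -`
        ({z\<in>space seq_space. \<forall>q\<in>Jc 0. z (fst q) \<in> B q} \<times> {z\<in>space seq_space. \<forall>q\<in>Jc 1. z (fst q) \<in> B q}) \<inter> space M"
      unfolding E0 E1 by auto
    then show ?thesis
      unfolding E0 E1 using indep_varD[OF indep_\<xi>_\<gamma> S0 S1] by (simp only:)
  qed
  finally have split: "prob (E 2 \<inter> (E 0 \<inter> E 1)) = prob (E 2) * (prob (E 0) * prob (E 1))" .
  have single: "prob (E c) = (\<Prod>q\<in>Jc c. prob (A q))" if "c < 3" for c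
  proof -
    have "indep_vars (\<lambda>_. borel) (\<lambda>i. noise (i, c)) {1..}"
    proof -
      have "indep_vars (\<lambda>_. borel) (\<lambda>i \<omega>. U i \<omega> *\<^sub>R l) {1..}"
        by (rule indep_vars_compose2[OF indep_U']) simp
      then show ?thesis using indep_\<xi> indep_\<gamma> by (cases "c = 0"; cases "c = 1") (simp_all add: noise_def)
    qed
    then have "prob {\<omega>\<in>space M. \<forall>q\<in>Jc c. noise (fst q, c) \<omega> \<in> B q} = (\<Prod>q\<in>Jc c. prob (noise (fst q, c) -` B q \<inter> space M))"
      by (rule prob_sequence_rectangle[where c = c]) (use Jc B(1) in blast)+
    moreover have "noise (fst q, c) = noise q" if "q \<in> Jc c" for q
      using Jc(2)[OF that] by (metis prod.collapse)
    moreover have "A q = noise q -` B q \<inter> space M" if "q \<in> Jc c" for q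
      using B(2) Jc(3) that by blast
    ultimately show ?thesis
      by (simp add: E_def cong: prod.cong ball_cong)
  qed
  have "(\<Inter>q\<in>J. A q) = E 2 \<inter> (E 0 \<inter> E 1)"
  proof -
    have "J = Jc 0 \<union> Jc 1 \<union> Jc 2" using J by (auto simp: Jc_def)
    moreover have "(\<Inter>q\<in>J. A q) = {\<omega>\<in>space M. \<forall>q\<in>J. noise q \<omega> \<in> B q}"
      using J(2) B(2) by auto
    ultimately show ?thesis unfolding E_def by auto
  qed
  then have "prob (\<Inter>q\<in>J. A q) = (\<Prod>q\<in>Jc 2. prob (A q)) * ((\<Prod>q\<in>Jc 0. prob (A q)) * (\<Prod>q\<in>Jc 1. prob (A q)))"
    using single[of 0] single[of 1] single[of 2] by (simp only: split)
  also have "\<dots> = (\<Prod>c<3. \<Prod>q\<in>Jc c. prob (A q))"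
    by (simp add: numeral_3_eq_3 lessThan_Suc numeral_2_eq_2 ac_simps)
  also have "\<dots> = (\<Prod>q\<in>J. prob (A q))"
    unfolding Jc_def by (rule prod.group) (use J in auto)
  finally show "prob (\<Inter>q\<in>J. A q) = (\<Prod>q\<in>J. prob (A q))" .
qed

text \<open>Past and future of the walk are measurable with respect to the \<open>\<sigma>\<close>-algebras of disjoint sets of
  sources, hence independent.\<close>

definition info :: "(nat \<times> nat) set \<Rightarrow> 'w measure" where
  "info I = vimage_algebra (space M) (\<lambda>\<omega>. \<lambda>q\<in>I. noise q \<omega>) (PiM I (\<lambda>_. borel))"

definition steps :: "nat set \<Rightarrow> (nat \<times> nat) set" where
  "steps T = T \<times> {..<3}"

lemma space_info [simp]: "space (info I) = space M"
  by (simp add: info_def)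

lemma noise_info: "q \<in> I \<Longrightarrow> noise q \<in> borel_measurable (info I)"
proof -
  assume q: "q \<in> I"
  have f: "(\<lambda>\<omega>. \<lambda>q\<in>I. noise q \<omega>) \<in> space M \<rightarrow> space (PiM I (\<lambda>_. borel :: (real^'d) measure))"
    by (auto simp: space_PiM)
  have "(\<lambda>\<omega>. (\<lambda>q\<in>I. noise q \<omega>) q) \<in> borel_measurable (info I)"
    unfolding info_def
    by (rule measurable_compose[OF measurable_vimage_algebra1[OF f] measurable_component_singleton[OF q]])
  then show ?thesis using q by simp
qed

lemma info_measurable:
  assumes "i \<in> T"
  shows "\<xi> i \<in> borel_measurable (info (steps T))" "\<gamma> i \<in> borel_measurable (info (steps T))"
    "U i \<in> borel_measurable (info (steps T))"
proof -
  have q: "(i, 0) \<in> steps T" "(i, 1) \<in> steps T" "(i, 2) \<in> steps T" using assms by (auto simp: steps_def)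
  show "\<xi> i \<in> borel_measurable (info (steps T))" using noise_info[OF q(1)] by (simp add: noise_def)
  show "\<gamma> i \<in> borel_measurable (info (steps T))" using noise_info[OF q(2)] by (simp add: noise_def)
  have "(\<lambda>\<omega>. noise (i, 2) \<omega> \<bullet> l) \<in> borel_measurable (info (steps T))"
    using noise_info[OF q(3)] by measurable
  moreover have "l \<bullet> l = 1" using direction by (simp add: norm_eq_1)
  ultimately show "U i \<in> borel_measurable (info (steps T))" by (simp add: noise_def)
qed

lemma info_indep:
  fixes f :: "'w \<Rightarrow> 'b::topological_space" and g :: "'w \<Rightarrow> 'c::topological_space"
  assumes I: "I \<subseteq> {1..} \<times> {..<3}" "I' \<subseteq> {1..} \<times> {..<3}" "I \<inter> I' = {}"
    and f: "f \<in> borel_measurable (info I)" and g: "g \<in> borel_measurable (info I')"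
  shows "indep_set {f -` A \<inter> space M |A. A \<in> sets borel} {g -` A \<inter> space M |A. A \<in> sets borel}"
proof -
  have "indep_var (PiM I (\<lambda>_. borel)) (\<lambda>\<omega>. \<lambda>q\<in>I. noise q \<omega>) (PiM I' (\<lambda>_. borel)) (\<lambda>\<omega>. \<lambda>q\<in>I'. noise q \<omega>)"
    by (rule indep_var_restrict[OF indep_noise I(3,1,2)])
  then have base: "indep_set
      (sigma_sets (space M) {(\<lambda>\<omega>. \<lambda>q\<in>I. noise q \<omega>) -` A \<inter> space M |A. A \<in> sets (PiM I (\<lambda>_. borel))})
      (sigma_sets (space M) {(\<lambda>\<omega>. \<lambda>q\<in>I'. noise q \<omega>) -` A \<inter> space M |A. A \<in> sets (PiM I' (\<lambda>_. borel))})"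
    unfolding indep_var_eq by blast
  have f_sub: "{f -` A \<inter> space M |A. A \<in> sets borel}
      \<subseteq> sigma_sets (space M) {(\<lambda>\<omega>. \<lambda>q\<in>I. noise q \<omega>) -` A \<inter> space M |A. A \<in> sets (PiM I (\<lambda>_. borel))}"
    using measurable_sets[OF f] by (auto simp: info_def sets_vimage_algebra)
  have g_sub: "{g -` A \<inter> space M |A. A \<in> sets borel}
      \<subseteq> sigma_sets (space M) {(\<lambda>\<omega>. \<lambda>q\<in>I'. noise q \<omega>) -` A \<inter> space M |A. A \<in> sets (PiM I' (\<lambda>_. borel))}"
    using measurable_sets[OF g] by (auto simp: info_def sets_vimage_algebra)
  show ?thesis
    unfolding indep_set_def
    by (rule indep_sets_mono_sets[OF base[unfolded indep_set_def]]) (use f_sub g_sub in \<open>simp split: bool.split\<close>)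
qed

lemma info_le_events: "I \<subseteq> {1..} \<times> {..<3} \<Longrightarrow> f \<in> borel_measurable (info I) \<Longrightarrow> f \<in> borel_measurable M"
proof -
  assume I: "I \<subseteq> {1..} \<times> {..<3}" and f: "f \<in> borel_measurable (info I)"
  have "(\<lambda>\<omega>. \<lambda>q\<in>I. noise q \<omega>) \<in> measurable M (PiM I (\<lambda>_. borel))"
    by (rule measurable_restrict) (use I noise_rv in auto)
  then have "sets (info I) \<subseteq> events"
    unfolding info_def by (auto simp: sets_vimage_algebra2 space_PiM PiE_iff measurable_sets)
  then show ?thesis
    using measurable_mono[of borel borel "info I" M] f by auto
qed

lemma info_product_expectation:
  fixes f g :: "'w \<Rightarrow> real"
  assumes I: "I \<subseteq> {1..} \<times> {..<3}" "I' \<subseteq> {1..} \<times> {..<3}" "I \<inter> I' = {}"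
    and f: "f \<in> borel_measurable (info I)" "integrable M f"
    and g: "g \<in> borel_measurable (info I')" "integrable M g"
  shows "expectation (\<lambda>\<omega>. f \<omega> * g \<omega>) = expectation f * expectation g" "integrable M (\<lambda>\<omega>. f \<omega> * g \<omega>)"
proof -
  have "indep_var borel f borel g"
    unfolding indep_var_def indep_vars_def2
  proof
    show "\<forall>b\<in>UNIV. random_variable (case_bool borel borel b) (case_bool f g b)"
      using info_le_events[OF I(1) f(1)] info_le_events[OF I(2) g(1)] by (simp split: bool.split)
    show "indep_sets (\<lambda>b. {case_bool f g b -` A \<inter> space M |A. A \<in> sets (case_bool borel borel b)}) UNIV"
      by (rule indep_sets_mono_sets[OF info_indep[OF I f(1) g(1), unfolded indep_set_def]])
         (simp split: bool.split)
  qed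
  then show "expectation (\<lambda>\<omega>. f \<omega> * g \<omega>) = expectation f * expectation g" "integrable M (\<lambda>\<omega>. f \<omega> * g \<omega>)"
    using f g by (auto intro: indep_var_lebesgue_integral indep_var_integrable)
qed

end

context excited_random_walk
begin

lemma info_mono:
  assumes "I \<subseteq> I'" "f \<in> borel_measurable (info I)"
  shows "f \<in> borel_measurable (info I')"
proof -
  have "(\<lambda>\<omega>. \<lambda>q\<in>I. noise q \<omega>) \<in> measurable (info I') (PiM I (\<lambda>_. borel))"
    by (rule measurable_restrict) (use assms(1) noise_info in blast)
  from measurable_sets[OF this] have "sets (info I) \<subseteq> sets (info I')"
    by (auto simp: info_def[of I] sets_vimage_algebra2 space_PiM PiE_iff)
  then show ?thesis
    using measurable_mono[of borel borel "info I" "info I'"] assms(2) by auto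
qed

lemma steps_subset: "T \<subseteq> {1..} \<Longrightarrow> steps T \<subseteq> {1..} \<times> {..<3}"
  by (auto simp: steps_def)

lemma steps_mono: "T \<subseteq> T' \<Longrightarrow> steps T \<subseteq> steps T'"
  by (auto simp: steps_def)

lemma steps_disjoint: "T \<inter> T' = {} \<Longrightarrow> steps T \<inter> steps T' = {}"
  by (auto simp: steps_def)

section \<open>Fresh sites and the decomposition of the walk\<close>

definition fresh :: "nat \<Rightarrow> 'w \<Rightarrow> bool" where
  "fresh n \<omega> \<longleftrightarrow> (\<forall>k<n. X k \<omega> \<noteq> X n \<omega>)"

lemma X_Suc:
  assumes "\<omega> \<in> space M"
  shows "X (Suc n) \<omega> = X n \<omega> + (if fresh n \<omega> \<and> U (Suc n) \<omega> \<le> p (Suc n) then \<gamma> (Suc n) \<omega> else \<xi> (Suc n) \<omega>)"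
proof -
  let ?t = "\<lambda>i. indicat_real (revisit_event M X (i - 1)) \<omega> *\<^sub>R \<xi> i \<omega>
        + indicat_real ((space M - revisit_event M X (i - 1)) \<inter> {\<omega>. U i \<omega> > p i}) \<omega> *\<^sub>R \<xi> i \<omega>
        + indicat_real ((space M - revisit_event M X (i - 1)) \<inter> {\<omega>. U i \<omega> \<le> p i}) \<omega> *\<^sub>R \<gamma> i \<omega>"
  have sum: "X n \<omega> = (\<Sum>i=1..n. ?t i)" for n
    using X_n[of n \<omega>] X_0[of \<omega>] assms by (cases "n = 0") simp_all
  have rev: "\<omega> \<in> revisit_event M X n \<longleftrightarrow> \<not> fresh n \<omega>"
    using assms by (auto simp: revisit_event_def fresh_def)
  have "X (Suc n) \<omega> = X n \<omega> + ?t (Suc n)"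
    unfolding sum[of "Suc n"] sum[of n] by simp
  also have "?t (Suc n) = (if fresh n \<omega> \<and> U (Suc n) \<omega> \<le> p (Suc n) then \<gamma> (Suc n) \<omega> else \<xi> (Suc n) \<omega>)"
    using assms rev by (cases "fresh n \<omega>"; cases "U (Suc n) \<omega> \<le> p (Suc n)") (simp_all add: indicator_def)
  finally show ?thesis .
qed

text \<open>The walk at time \<open>k\<close> is a function of the first \<open>k\<close> steps of the noise, by recursion.\<close>

lemma X_info: "j \<le> k \<Longrightarrow> X j \<in> borel_measurable (info (steps {1..k}))"
proof (induction j rule: less_induct)
  case (less j)
  show ?case
  proof (cases j)
    case 0
    have "(\<lambda>\<omega>. 0) \<in> borel_measurable (info (steps {1..k}))" by simp
    then show ?thesis
      unfolding 0 by (rule measurable_cong[THEN iffD1, rotated]) (simp add: X_0)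
  next
    case (Suc n)
    have X[measurable]: "X i \<in> borel_measurable (info (steps {1..k}))" if "i \<in> {..n}" for i
      using less that Suc by simp
    have [measurable]: "X n \<in> borel_measurable (info (steps {1..k}))" by (rule X) simp
    have step: "Suc n \<in> {1..k}" using less.prems Suc by simp
    note [measurable] = info_measurable[OF step]
    have fr: "{\<omega>\<in>space (info (steps {1..k})). fresh n \<omega>} \<in> sets (info (steps {1..k}))"
    proof -
      have "{\<omega>\<in>space (info (steps {1..k})). fresh n \<omega>}
          = {\<omega>\<in>space (info (steps {1..k})). \<forall>i\<in>{..<n}. X i \<omega> \<noteq> X n \<omega>}"
        by (auto simp: fresh_def)
      also have "\<dots> \<in> sets (info (steps {1..k}))"
      proof (rule sets.sets_Collect_finite_All)
        fix i assume "i \<in> {..<n}"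
        then have [measurable]: "X i \<in> borel_measurable (info (steps {1..k}))" by (intro X) simp
        show "{\<omega>\<in>space (info (steps {1..k})). X i \<omega> \<noteq> X n \<omega>} \<in> sets (info (steps {1..k}))" by measurable
      qed simp
      finally show ?thesis .
    qed
    have [measurable]: "Measurable.pred (info (steps {1..k})) (fresh n)"
      using fr by (simp add: pred_def)
    have "(\<lambda>\<omega>. X n \<omega> + (if fresh n \<omega> \<and> U (Suc n) \<omega> \<le> p (Suc n) then \<gamma> (Suc n) \<omega> else \<xi> (Suc n) \<omega>))
        \<in> borel_measurable (info (steps {1..k}))"
      by measurable
    then show ?thesis
      unfolding Suc by (rule measurable_cong[THEN iffD1, rotated]) (simp add: X_Suc)
  qed
qed

lemma X_rv: "X j \<in> borel_measurable M"
  by (rule info_le_events[OF steps_subset X_info[OF order_refl]]) auto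

definition fresh_ind :: "nat \<Rightarrow> 'w \<Rightarrow> real" where
  "fresh_ind n \<omega> = of_bool (fresh n \<omega>)"

lemma fresh_ind_bounds: "0 \<le> fresh_ind n \<omega>" "fresh_ind n \<omega> \<le> 1"
  by (simp_all add: fresh_ind_def)

lemma fresh_ind_info: "fresh_ind n \<in> borel_measurable (info (steps {1..n}))"
proof -
  have [measurable]: "X n \<in> borel_measurable (info (steps {1..n}))" by (rule X_info) simp
  have eq: "fresh_ind n \<omega> = (\<Prod>i\<in>{..<n}. of_bool (X i \<omega> \<noteq> X n \<omega>))" for \<omega>
    by (auto simp: fresh_ind_def fresh_def)
  have "(\<lambda>\<omega>. of_bool (X i \<omega> \<noteq> X n \<omega>) :: real) \<in> borel_measurable (info (steps {1..n}))" if "i \<in> {..<n}" for i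
  proof -
    have [measurable]: "X i \<in> borel_measurable (info (steps {1..n}))" using that by (intro X_info) simp
    have "(\<lambda>\<omega>. if X i \<omega> \<noteq> X n \<omega> then 1 else 0 :: real) \<in> borel_measurable (info (steps {1..n}))" by measurable
    then show ?thesis by (simp add: of_bool_def)
  qed
  then show ?thesis
    unfolding eq[abs_def] by (rule borel_measurable_prod)
qed

lemma fresh_ind_rv: "fresh_ind n \<in> borel_measurable M"
  by (rule info_le_events[OF steps_subset fresh_ind_info]) auto

text \<open>The coin of step \<open>i + 1\<close>, which is tossed in any case; the step uses \<open>\<gamma>\<close> only if the site at
  time \<open>i\<close> is fresh as well.\<close>

definition excited :: "nat \<Rightarrow> 'w \<Rightarrow> real" where
  "excited i \<omega> = of_bool (U (Suc i) \<omega> \<le> p (Suc i))"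

lemma excited_bounds: "0 \<le> excited i \<omega>" "excited i \<omega> \<le> 1"
  by (simp_all add: excited_def)

definition base_sum :: "nat \<Rightarrow> 'w \<Rightarrow> real^'d" where
  "base_sum n \<omega> = (\<Sum>i<n. \<xi> (Suc i) \<omega>)"

definition excess :: "nat \<Rightarrow> 'w \<Rightarrow> real^'d" where
  "excess n \<omega> = (\<Sum>i<n. (fresh_ind i \<omega> * excited i \<omega>) *\<^sub>R (\<gamma> (Suc i) \<omega> - \<xi> (Suc i) \<omega>))"

lemma X_decomposition: "\<omega> \<in> space M \<Longrightarrow> X n \<omega> = base_sum n \<omega> + excess n \<omega>"
proof (induction n)
  case 0
  then show ?case by (simp add: base_sum_def excess_def X_0)
next
  case (Suc n)
  have "base_sum (Suc n) \<omega> = base_sum n \<omega> + \<xi> (Suc n) \<omega>"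
    "excess (Suc n) \<omega> = excess n \<omega> + (fresh_ind n \<omega> * excited n \<omega>) *\<^sub>R (\<gamma> (Suc n) \<omega> - \<xi> (Suc n) \<omega>)"
    by (simp_all add: base_sum_def excess_def)
  then show ?case
    using Suc by (simp add: X_Suc fresh_ind_def excited_def)
qed

section \<open>Sums over excited steps\<close>

text \<open>The centered summands are orthogonal: the weight \<open>a i\<close> and everything before step \<open>i + 1\<close> are
  functions of the past, the variable \<open>\<eta> i\<close> is a function of step \<open>i + 1\<close> alone.\<close>

lemma martingale_second_moment:
  fixes a \<eta> :: "nat \<Rightarrow> 'w \<Rightarrow> real"
  assumes a: "\<And>i. a i \<in> borel_measurable (info (steps {1..i}))" "\<And>i \<omega>. \<bar>a i \<omega>\<bar> \<le> 1"
    and \<eta>: "\<And>i. \<eta> i \<in> borel_measurable (info (steps {Suc i}))" "\<And>i \<omega>. \<omega> \<in> space M \<Longrightarrow> \<bar>\<eta> i \<omega>\<bar> \<le> B"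
  defines "T \<equiv> \<lambda>n \<omega>. \<Sum>i<n. a i \<omega> * (\<eta> i \<omega> - expectation (\<eta> i))"
  shows "integrable M (\<lambda>\<omega>. (T n \<omega>)\<^sup>2)" "expectation (\<lambda>\<omega>. (T n \<omega>)\<^sup>2) \<le> (\<Sum>i<n. expectation (\<lambda>\<omega>. (\<eta> i \<omega>)\<^sup>2))"
proof -
  have rv_a: "a i \<in> borel_measurable M" for i by (rule info_le_events[OF steps_subset a(1)]) auto
  have rv_\<eta>: "\<eta> i \<in> borel_measurable M" for i by (rule info_le_events[OF steps_subset \<eta>(1)]) auto
  define \<zeta> where "\<zeta> = (\<lambda>i \<omega>. \<eta> i \<omega> - expectation (\<eta> i))"
  have int_\<eta>: "integrable M (\<eta> i)" for i
    using \<eta>(2) by (intro integrable_bounded[OF rv_\<eta>]) simp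
  have \<eta>2: "integrable M (\<lambda>\<omega>. (\<eta> i \<omega>)\<^sup>2)" for i
  proof (rule integrable_bounded)
    show "(\<lambda>\<omega>. (\<eta> i \<omega>)\<^sup>2) \<in> borel_measurable M" using rv_\<eta> by simp
    show "norm ((\<eta> i \<omega>)\<^sup>2) \<le> B\<^sup>2" if "\<omega> \<in> space M" for \<omega>
      using power_mono[OF \<eta>(2)[OF that, of i], of 2] by simp
  qed
  have \<zeta>_info: "\<zeta> i \<in> borel_measurable (info (steps {Suc i}))" for i
    unfolding \<zeta>_def using \<eta>(1) by simp
  have rv_\<zeta>: "\<zeta> i \<in> borel_measurable M" for i using rv_\<eta> by (simp add: \<zeta>_def)
  have \<zeta>_bd: "\<bar>\<zeta> i \<omega>\<bar> \<le> B + \<bar>expectation (\<eta> i)\<bar>" if "\<omega> \<in> space M" for i \<omega>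
    using \<eta>(2)[OF that, of i] unfolding \<zeta>_def by linarith
  have int_\<zeta>: "integrable M (\<zeta> i)" for i using int_\<eta> by (simp add: \<zeta>_def)
  have E\<zeta>: "expectation (\<zeta> i) = 0" for i using int_\<eta> by (simp add: \<zeta>_def prob_space)
  have E\<zeta>2: "expectation (\<lambda>\<omega>. (\<zeta> i \<omega>)\<^sup>2) \<le> expectation (\<lambda>\<omega>. (\<eta> i \<omega>)\<^sup>2)" for i
    unfolding \<zeta>_def using variance_eq[OF int_\<eta> \<eta>2] by simp
  have T_info: "T n \<in> borel_measurable (info (steps {1..n}))" for n
    unfolding T_def
  proof (rule borel_measurable_sum)
    fix i assume i: "i \<in> {..<n}"
    have "a i \<in> borel_measurable (info (steps {1..n}))"
      by (rule info_mono[OF steps_mono a(1)]) (use i in auto)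
    moreover have "\<eta> i \<in> borel_measurable (info (steps {1..n}))"
      by (rule info_mono[OF steps_mono \<eta>(1)]) (use i in auto)
    ultimately show "(\<lambda>\<omega>. a i \<omega> * (\<eta> i \<omega> - expectation (\<eta> i))) \<in> borel_measurable (info (steps {1..n}))" by simp
  qed
  have rv_T: "T n \<in> borel_measurable M" for n by (rule info_le_events[OF steps_subset T_info]) auto
  define c where "c = (\<lambda>n. \<Sum>i<n. B + \<bar>expectation (\<eta> i)\<bar>)"
  have T_bd: "\<bar>T n \<omega>\<bar> \<le> c n" if "\<omega> \<in> space M" for n \<omega>
    unfolding T_def c_def
  proof (rule order_trans[OF sum_abs], rule sum_mono)
    fix i
    have "\<bar>a i \<omega> * \<zeta> i \<omega>\<bar> \<le> 1 * (B + \<bar>expectation (\<eta> i)\<bar>)"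
      unfolding abs_mult by (rule mult_mono[OF a(2) \<zeta>_bd[OF that]]) auto
    then show "\<bar>a i \<omega> * (\<eta> i \<omega> - expectation (\<eta> i))\<bar> \<le> B + \<bar>expectation (\<eta> i)\<bar>" by (simp add: \<zeta>_def)
  qed
  have int_T2: "integrable M (\<lambda>\<omega>. (T n \<omega>)\<^sup>2)" for n
  proof (rule integrable_bounded)
    show "(\<lambda>\<omega>. (T n \<omega>)\<^sup>2) \<in> borel_measurable M" using rv_T by simp
    show "norm ((T n \<omega>)\<^sup>2) \<le> (c n)\<^sup>2" if "\<omega> \<in> space M" for \<omega>
      using power_mono[OF T_bd[OF that, of n], of 2] by simp
  qed
  then show "integrable M (\<lambda>\<omega>. (T n \<omega>)\<^sup>2)" .
  show "expectation (\<lambda>\<omega>. (T n \<omega>)\<^sup>2) \<le> (\<Sum>i<n. expectation (\<lambda>\<omega>. (\<eta> i \<omega>)\<^sup>2))"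
  proof (induction n)
    case 0
    show ?case by (simp add: T_def)
  next
    case (Suc n)
    have Ta_info: "(\<lambda>\<omega>. T n \<omega> * a n \<omega>) \<in> borel_measurable (info (steps {1..n}))"
      using T_info a(1) by simp
    have int_Ta: "integrable M (\<lambda>\<omega>. T n \<omega> * a n \<omega>)"
    proof (rule integrable_bounded)
      show "(\<lambda>\<omega>. T n \<omega> * a n \<omega>) \<in> borel_measurable M" using rv_T rv_a by simp
      show "norm (T n \<omega> * a n \<omega>) \<le> c n * 1" if "\<omega> \<in> space M" for \<omega>
        unfolding real_norm_def abs_mult
        using T_bd[OF that, of n] by (intro mult_mono a(2)) auto
    qed
    have disj: "steps {1..n} \<inter> steps {Suc n} = {}" by (rule steps_disjoint) simp
    have sub: "steps {1..n} \<subseteq> {1..} \<times> {..<3}" "steps {Suc n} \<subseteq> {1..} \<times> {..<3}"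
      by (rule steps_subset, simp)+
    note prod = info_product_expectation[OF sub disj Ta_info int_Ta \<zeta>_info int_\<zeta>]
    have \<zeta>2: "integrable M (\<lambda>\<omega>. (\<zeta> n \<omega>)\<^sup>2)"
    proof (rule integrable_bounded)
      show "(\<lambda>\<omega>. (\<zeta> n \<omega>)\<^sup>2) \<in> borel_measurable M" using rv_\<zeta> by simp
      show "norm ((\<zeta> n \<omega>)\<^sup>2) \<le> (B + \<bar>expectation (\<eta> n)\<bar>)\<^sup>2" if "\<omega> \<in> space M" for \<omega>
        using power_mono[OF \<zeta>_bd[OF that, of n], of 2] by simp
    qed
    have "expectation (\<lambda>\<omega>. (T (Suc n) \<omega>)\<^sup>2)
        \<le> expectation (\<lambda>\<omega>. (T n \<omega>)\<^sup>2 + 2 * (T n \<omega> * a n \<omega> * \<zeta> n \<omega>) + (\<zeta> n \<omega>)\<^sup>2)"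
    proof (rule integral_mono)
      show "integrable M (\<lambda>\<omega>. (T n \<omega>)\<^sup>2 + 2 * (T n \<omega> * a n \<omega> * \<zeta> n \<omega>) + (\<zeta> n \<omega>)\<^sup>2)"
        using int_T2 prod(2) \<zeta>2 by simp
      fix \<omega>
      have "(a n \<omega>)\<^sup>2 \<le> 1" using a(2)[of n \<omega>] by (simp add: abs_square_le_1)
      then have "(a n \<omega>)\<^sup>2 * (\<zeta> n \<omega>)\<^sup>2 \<le> 1 * (\<zeta> n \<omega>)\<^sup>2" by (rule mult_right_mono) simp
      moreover have "(T (Suc n) \<omega>)\<^sup>2 = (T n \<omega>)\<^sup>2 + 2 * (T n \<omega> * a n \<omega> * \<zeta> n \<omega>) + (a n \<omega>)\<^sup>2 * (\<zeta> n \<omega>)\<^sup>2"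
        unfolding T_def \<zeta>_def by (simp add: power2_eq_square algebra_simps)
      ultimately show "(T (Suc n) \<omega>)\<^sup>2 \<le> (T n \<omega>)\<^sup>2 + 2 * (T n \<omega> * a n \<omega> * \<zeta> n \<omega>) + (\<zeta> n \<omega>)\<^sup>2" by simp
    qed (rule int_T2)
    also have "\<dots> = expectation (\<lambda>\<omega>. (T n \<omega>)\<^sup>2) + expectation (\<lambda>\<omega>. (\<zeta> n \<omega>)\<^sup>2)"
      using int_T2 prod \<zeta>2 E\<zeta> by simp
    also have "\<dots> \<le> (\<Sum>i<Suc n. expectation (\<lambda>\<omega>. (\<eta> i \<omega>)\<^sup>2))"
      using Suc E\<zeta>2[of n] by simp
    finally show ?case .
  qed
qed

lemma abs_le_square: "0 < \<delta> \<Longrightarrow> \<bar>x\<bar> \<le> \<delta> * x\<^sup>2 + 1 / (4 * \<delta> :: real)"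
proof -
  assume d: "0 < \<delta>"
  have "0 \<le> (2 * \<delta> * \<bar>x\<bar> - 1)\<^sup>2 / (4 * \<delta>)" using d by simp
  also have "\<dots> = \<delta> * x\<^sup>2 - \<bar>x\<bar> + 1 / (4 * \<delta>)"
    using d by (simp add: power2_eq_square field_simps flip: abs_mult)
  finally show ?thesis by simp
qed

lemma excited_expectation:
  "expectation (excited i) = p (Suc i)"
proof -
  have U: "U (Suc i) \<in> borel_measurable M" by (rule U_rv) simp
  have p01: "0 \<le> p (Suc i)" "p (Suc i) \<le> 1" using p_range[of "Suc i"] by auto
  have d: "distr M borel (U (Suc i)) = uniform_measure lborel {0..1}"
  proof -
    have "distr M borel (U (Suc i)) = distr M borel (U 1)"
      by (rule iid_U[unfolded iid_def, THEN conjunct2, rule_format]) simp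
    then show ?thesis by (simp only: uniform_U)
  qed
  have "expectation (excited i) = expectation (indicator {\<omega>\<in>space M. U (Suc i) \<omega> \<le> p (Suc i)})"
    by (rule Bochner_Integration.integral_cong) (auto simp: excited_def indicator_def)
  also have "\<dots> = prob {\<omega>\<in>space M. U (Suc i) \<omega> \<le> p (Suc i)}"
    using U by simp
  also have "{\<omega>\<in>space M. U (Suc i) \<omega> \<le> p (Suc i)} = U (Suc i) -` {..p (Suc i)} \<inter> space M"
    by auto
  also have "prob \<dots> = measure (distr M borel (U (Suc i))) {..p (Suc i)}"
    using U by (simp add: measure_distr)
  also have "\<dots> = measure lborel ({0..1} \<inter> {..p (Suc i)}) / measure lborel {0..1::real}"
    unfolding d by (rule measure_uniform_measure) auto
  also have "{0..1} \<inter> {..p (Suc i)} = {0..p (Suc i)}" using p01 by auto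
  finally show ?thesis using p01 by simp
qed

end

section \<open>The range\<close>

text \<open>Counting sites at their last visits, and not at their first ones, replaces freshness, which concerns
  the past of the walk, by an event that concerns its future.\<close>

lemma card_image_le_last_visits:
  fixes f :: "nat \<Rightarrow> 'b"
  shows "card (f ` {..<n}) \<le> card {k\<in>{..<n}. \<forall>j. k < j \<and> j < n \<longrightarrow> f j \<noteq> f k}"
proof -
  let ?S = "{k\<in>{..<n}. \<forall>j. k < j \<and> j < n \<longrightarrow> f j \<noteq> f k}"
  have "f ` {..<n} \<subseteq> f ` ?S"
  proof
    fix y assume "y \<in> f ` {..<n}"
    then have ne: "{k\<in>{..<n}. f k = y} \<noteq> {}" by blast
    define k where "k = Max {k\<in>{..<n}. f k = y}"
    have fin: "finite {k\<in>{..<n}. f k = y}" by simp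
    have k: "k < n" "f k = y" using Max_in[OF fin ne] by (auto simp: k_def)
    have "f j \<noteq> f k" if j: "k < j" "j < n" for j
    proof
      assume "f j = f k"
      then have "j \<in> {k\<in>{..<n}. f k = y}" using j k by simp
      from Max_ge[OF fin this] j show False by (simp add: k_def)
    qed
    with k show "y \<in> f ` ?S" by blast
  qed
  then have "card (f ` {..<n}) \<le> card (f ` ?S)" by (intro card_mono) auto
  also have "\<dots> \<le> card ?S" by (rule card_image_le) simp
  finally show ?thesis .
qed

lemma (in prob_space) indep_vars_inj_reindex:
  assumes Z: "indep_vars (\<lambda>_. N) Z J" and f: "inj f" "f ` I \<subseteq> J"
  shows "indep_vars (\<lambda>_. N) (\<lambda>i. Z (f i)) I"
  unfolding indep_vars_def2 indep_sets_def
proof (intro conjI ballI allI impI)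
  note Z' = Z[unfolded indep_vars_def2]
  show "Z (f i) \<in> measurable M N" if "i \<in> I" for i
    using Z' f(2) that by blast
  then show "{Z (f i) -` A \<inter> space M |A. A \<in> sets N} \<subseteq> events" if "i \<in> I" for i
    using that by (auto intro: measurable_sets)
  fix K A assume K: "K \<subseteq> I" "K \<noteq> {}" "finite K"
    and A: "A \<in> (\<Pi> i\<in>K. {Z (f i) -` A \<inter> space M |A. A \<in> sets N})"
  let ?A = "\<lambda>j. A (inv f j)"
  have "prob (\<Inter>j\<in>f ` K. ?A j) = (\<Prod>j\<in>f ` K. prob (?A j))"
  proof (rule indep_setsD[OF conjunct2[OF Z']])
    show "\<forall>j\<in>f ` K. ?A j \<in> {Z j -` A \<inter> space M |A. A \<in> sets N}"
      using A f(1) by (auto simp: Pi_iff)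
  qed (use K f in auto)
  then show "prob (\<Inter>j\<in>K. A j) = (\<Prod>j\<in>K. prob (A j))"
    using f(1) by (simp add: prod.reindex inj_on_def inj_def image_image)
qed

context excited_random_walk
begin

definition fresh_count :: "nat \<Rightarrow> 'w \<Rightarrow> real" where
  "fresh_count n \<omega> = (\<Sum>i<n. fresh_ind i \<omega>)"

lemma fresh_count_rv: "fresh_count n \<in> borel_measurable M"
  unfolding fresh_count_def by (rule borel_measurable_sum) (rule fresh_ind_rv)

lemma fresh_count_bounds: "0 \<le> fresh_count n \<omega>" "fresh_count n \<omega> \<le> real n"
proof -
  show "0 \<le> fresh_count n \<omega>" unfolding fresh_count_def by (rule sum_nonneg) (rule fresh_ind_bounds)
  have "fresh_count n \<omega> \<le> (\<Sum>i<n. 1)" unfolding fresh_count_def by (rule sum_mono) (rule fresh_ind_bounds)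
  then show "fresh_count n \<omega> \<le> real n" by simp
qed

lemma fresh_count_integrable: "integrable M (fresh_count n)"
  by (rule integrable_bounded[OF fresh_count_rv, of n "real n"]) (use fresh_count_bounds in simp)

lemma fresh_count_eq_card: "fresh_count n \<omega> = real (card ((\<lambda>k. X k \<omega>) ` {..<n}))"
proof (induction n)
  case 0
  show ?case by (simp add: fresh_count_def)
next
  case (Suc n)
  have "fresh n \<omega> \<longleftrightarrow> X n \<omega> \<notin> (\<lambda>k. X k \<omega>) ` {..<n}"
    unfolding fresh_def image_iff Bex_def lessThan_iff by metis
  moreover have "card ((\<lambda>k. X k \<omega>) ` {..<Suc n}) = card ((\<lambda>k. X k \<omega>) ` {..<n})
      + (if X n \<omega> \<in> (\<lambda>k. X k \<omega>) ` {..<n} then 0 else 1)"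
    by (simp add: lessThan_Suc insert_absorb)
  moreover have "fresh_count (Suc n) \<omega> = fresh_count n \<omega> + of_bool (fresh n \<omega>)"
    by (simp only: fresh_count_def fresh_ind_def sum.lessThan_Suc)
  ultimately show ?case
    using Suc by simp
qed

lemma card_walk_range: "real (card (walk_range X n \<omega>)) = fresh_count (Suc n) \<omega>"
proof -
  have "{0..n} = {..<Suc n}" by auto
  then show ?thesis by (simp only: walk_range_def fresh_count_eq_card)
qed

definition no_return_upto :: "nat \<Rightarrow> real" where
  "no_return_upto m = prob {\<omega>\<in>space M. \<forall>j\<in>{1..m}. (\<Sum>i\<in>{1..j}. \<xi> i \<omega>) \<noteq> 0}"

lemma \<xi>_partial_sum_rv: "(\<lambda>\<omega>. \<Sum>i\<in>{1..j}. \<xi> (k + i) \<omega>) \<in> borel_measurable M"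
  by (rule borel_measurable_sum) (rule \<xi>_rv, simp)

lemma no_return_window_event:
  "{\<omega>\<in>space M. \<forall>j\<in>{1..m}. (\<Sum>i\<in>{1..j}. \<xi> (k + i) \<omega>) \<noteq> 0} \<in> events"
proof (rule sets.sets_Collect_finite_All)
  fix j
  note [measurable] = \<xi>_partial_sum_rv[of k j]
  show "{\<omega>\<in>space M. (\<Sum>i\<in>{1..j}. \<xi> (k + i) \<omega>) \<noteq> 0} \<in> events" by measurable
qed simp

text \<open>A block of \<open>m\<close> i.i.d. steps has the same law wherever it starts.\<close>

lemma no_return_window:
  assumes "1 \<le> m"
  shows "prob {\<omega>\<in>space M. \<forall>j\<in>{1..m}. (\<Sum>i\<in>{1..j}. \<xi> (k + i) \<omega>) \<noteq> 0} = no_return_upto m"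
proof -
  let ?P = "PiM {1..m} (\<lambda>_. borel :: (real^'d) measure)"
  let ?V = "\<lambda>k \<omega>. \<lambda>i\<in>{1..m}. \<xi> (k + i) \<omega>"
  let ?A = "{z\<in>space ?P. \<forall>j\<in>{1..m}. (\<Sum>i\<in>{1..j}. z i) \<noteq> 0}"
  have A: "?A \<in> sets ?P"
  proof (rule sets.sets_Collect_finite_All)
    fix j assume "j \<in> {1..m}"
    then have "(\<lambda>z. \<Sum>i\<in>{1..j}. z i) \<in> borel_measurable ?P"
      by (intro borel_measurable_sum measurable_component_singleton) auto
    then have [measurable]: "(\<lambda>z. \<Sum>i\<in>{1..j}. z i) \<in> borel_measurable ?P" .
    show "{z\<in>space ?P. (\<Sum>i\<in>{1..j}. z i) \<noteq> 0} \<in> sets ?P" by measurable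
  qed simp
  have law: "distr M ?P (?V k) = PiM {1..m} (\<lambda>_. distr M borel (\<xi> 1))" for k
  proof -
    have ind: "indep_vars (\<lambda>_. borel) (\<lambda>i. \<xi> (k + i)) {1..m}"
      by (rule indep_vars_inj_reindex[OF indep_\<xi>]) (auto simp: inj_def)
    have "distr M ?P (?V k) = PiM {1..m} (\<lambda>i. distr M borel (\<xi> (k + i)))"
      by (rule iffD1[OF indep_vars_iff_distr_eq_PiM' ind]) (use assms \<xi>_rv in auto)
    also have "\<dots> = PiM {1..m} (\<lambda>_. distr M borel (\<xi> 1))"
    proof (rule PiM_cong)
      fix i assume "i \<in> {1..m}"
      then show "distr M borel (\<xi> (k + i)) = distr M borel (\<xi> 1)"
        by (intro iid_\<xi>[unfolded iid_def, THEN conjunct2, rule_format]) simp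
    qed simp
    finally show ?thesis .
  qed
  have "prob {\<omega>\<in>space M. \<forall>j\<in>{1..m}. (\<Sum>i\<in>{1..j}. \<xi> (k + i) \<omega>) \<noteq> 0} = measure (distr M ?P (?V k)) ?A" for k
  proof -
    have V: "?V k \<in> measurable M ?P" by (rule measurable_restrict) (rule \<xi>_rv, simp)
    have "?V k -` ?A \<inter> space M = {\<omega>\<in>space M. \<forall>j\<in>{1..m}. (\<Sum>i\<in>{1..j}. \<xi> (k + i) \<omega>) \<noteq> 0}"
    proof -
      have "(\<Sum>i\<in>{1..j}. ?V k \<omega> i) = (\<Sum>i\<in>{1..j}. \<xi> (k + i) \<omega>)" if "j \<in> {1..m}" for j \<omega>
        using that by (intro sum.cong) auto
      then show ?thesis using measurable_space[OF V] by auto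
    qed
    then show ?thesis by (simp only: measure_distr[OF V A])
  qed
  from this[of k] this[of 0] show ?thesis
    unfolding law no_return_upto_def by (simp only: add_0)
qed

lemma no_return_upto_tendsto: "no_return_upto \<longlonglongrightarrow> no_return_prob M \<xi>"
proof -
  let ?A = "\<lambda>m. {\<omega>\<in>space M. \<forall>j\<in>{1..m}. (\<Sum>i\<in>{1..j}. \<xi> i \<omega>) \<noteq> 0}"
  have ev: "?A m \<in> events" for m
    using no_return_window_event[of m 0] by (simp only: add_0)
  have "(\<lambda>m. prob (?A m)) \<longlonglongrightarrow> prob (\<Inter>m. ?A m)"
    by (rule finite_Lim_measure_decseq) (use ev in \<open>auto simp: decseq_def\<close>)
  moreover have "(\<Inter>m. ?A m) = {\<omega>\<in>space M. \<forall>n\<ge>1. (\<Sum>i=1..n. \<xi> i \<omega>) \<noteq> 0}"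
    by force
  ultimately show ?thesis
    by (simp add: no_return_prob_def no_return_upto_def[abs_def])
qed

lemma no_return_prob_bounds: "0 \<le> no_return_prob M \<xi>" "no_return_prob M \<xi> \<le> 1"
  by (simp_all add: no_return_prob_def)

text \<open>The hypothesis is on the coins alone and leaves aside whether sites are fresh, so the probability that
  it fails does not involve the path.\<close>

lemma X_window:
  assumes "\<omega> \<in> space M" "\<And>i. i < j \<Longrightarrow> p (Suc (k + i)) < U (Suc (k + i)) \<omega>"
  shows "X (k + j) \<omega> = X k \<omega> + (\<Sum>i\<in>{1..j}. \<xi> (k + i) \<omega>)"
  using assms(2)
proof (induction j)
  case (Suc j)
  have "p (Suc (k + j)) < U (Suc (k + j)) \<omega>" by (rule Suc.prems) simp
  then have "X (k + Suc j) \<omega> = X (k + j) \<omega> + \<xi> (k + Suc j) \<omega>"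
    using X_Suc[OF assms(1), of "k + j"] by simp
  then show ?case using Suc by simp
qed simp

text \<open>A site visited for the last time at \<open>k\<close> is not visited during the next \<open>m\<close> steps, unless \<open>k\<close> is one
  of the last \<open>m\<close> times. If none of the next \<open>m\<close> coins succeeds, this is an event for the walk with
  steps \<open>\<xi>\<close>; the coins contribute at most \<open>m\<close> times \<open>p (k + 1)\<close> as \<open>p\<close> decreases.\<close>

lemma fresh_count_expectation_le:
  assumes m: "1 \<le> m" and anti: "\<And>i j. 1 \<le> i \<Longrightarrow> i \<le> j \<Longrightarrow> p j \<le> p i"
  shows "expectation (fresh_count n) \<le> real n * no_return_upto m + real m * (\<Sum>k<n. p (Suc k)) + real m"
proof -
  define L where "L = (\<lambda>k. {\<omega>\<in>space M. \<forall>j\<in>{1..m}. X (k + j) \<omega> \<noteq> X k \<omega>})"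
  have L: "L k \<in> events" for k
    unfolding L_def
  proof (rule sets.sets_Collect_finite_All)
    fix j
    note [measurable] = X_rv[of "k + j"] X_rv[of k]
    show "{\<omega>\<in>space M. X (k + j) \<omega> \<noteq> X k \<omega>} \<in> events" by measurable
  qed simp
  have path: "fresh_count n \<omega> \<le> real m + (\<Sum>k<n. indicator (L k) \<omega>)" if \<omega>: "\<omega> \<in> space M" for \<omega>
  proof -
    let ?f = "\<lambda>k. X k \<omega>"
    \<comment> \<open>The condition in \<open>L k\<close> covers the next \<open>m\<close> steps in full only if these end before \<open>n\<close>.\<close>
    have "{k\<in>{..<n}. \<forall>j. k < j \<and> j < n \<longrightarrow> ?f j \<noteq> ?f k} \<subseteq> {n - m..<n} \<union> {k\<in>{..<n}. \<omega> \<in> L k}"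
    proof
      fix k assume k: "k \<in> {k\<in>{..<n}. \<forall>j. k < j \<and> j < n \<longrightarrow> ?f j \<noteq> ?f k}"
      show "k \<in> {n - m..<n} \<union> {k\<in>{..<n}. \<omega> \<in> L k}"
      proof (cases "k + m < n")
        case True
        then have "\<omega> \<in> L k" using k \<omega> by (auto simp: L_def)
        then show ?thesis using k by simp
      next
        case False
        then show ?thesis using k by auto
      qed
    qed
    then have "card {k\<in>{..<n}. \<forall>j. k < j \<and> j < n \<longrightarrow> ?f j \<noteq> ?f k} \<le> card ({n - m..<n} \<union> {k\<in>{..<n}. \<omega> \<in> L k})"
      by (rule card_mono[rotated]) simp
    also have "\<dots> \<le> card {n - m..<n} + card {k\<in>{..<n}. \<omega> \<in> L k}" by (rule card_Un_le)
    also have "\<dots> \<le> m + card {k\<in>{..<n}. \<omega> \<in> L k}" by simp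
    finally have "card (?f ` {..<n}) \<le> m + card {k\<in>{..<n}. \<omega> \<in> L k}"
      using card_image_le_last_visits[of ?f n] by linarith
    moreover have "real (card {k\<in>{..<n}. \<omega> \<in> L k}) = (\<Sum>k<n. indicator (L k) \<omega>)"
    proof -
      have "{..<n} \<inter> {k. \<omega> \<in> L k} = {k\<in>{..<n}. \<omega> \<in> L k}" by auto
      then show ?thesis
        using sum_indicator_eq_card[of "{..<n}" "{k. \<omega> \<in> L k}"] by (simp add: indicator_def sum.If_cases)
    qed
    ultimately show ?thesis unfolding fresh_count_eq_card by linarith
  qed
  have prob_L: "prob (L k) \<le> no_return_upto m + real m * p (Suc k)" for k
  proof -
    define B where "B = (\<lambda>i. {\<omega>\<in>space M. U (Suc (k + i)) \<omega> \<le> p (Suc (k + i))})"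
    let ?W = "{\<omega>\<in>space M. \<forall>j\<in>{1..m}. (\<Sum>i\<in>{1..j}. \<xi> (k + i) \<omega>) \<noteq> 0}"
    have U: "U (Suc (k + i)) \<in> borel_measurable M" for i by (rule U_rv) simp
    have B: "B i \<in> events" for i
    proof -
      note [measurable] = U[of i]
      show ?thesis unfolding B_def by measurable
    qed
    have prob_B: "prob (B i) \<le> p (Suc k)" for i
    proof -
      have "prob (B i) = expectation (indicator (B i))" using B by simp
      also have "\<dots> = expectation (excited (k + i))"
        by (rule Bochner_Integration.integral_cong) (auto simp: B_def excited_def indicator_def)
      also have "\<dots> = p (Suc (k + i))" by (rule excited_expectation)
      also have "\<dots> \<le> p (Suc k)" by (rule anti) auto
      finally show ?thesis .
    qed
    have "L k \<subseteq> ?W \<union> (\<Union>i\<in>{..<m}. B i)"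
    proof
      fix \<omega> assume \<omega>: "\<omega> \<in> L k"
      then have sp: "\<omega> \<in> space M" by (simp add: L_def)
      show "\<omega> \<in> ?W \<union> (\<Union>i\<in>{..<m}. B i)"
      proof (cases "\<exists>i<m. \<omega> \<in> B i")
        case True
        then show ?thesis by blast
      next
        case False
        have "X (k + j) \<omega> = X k \<omega> + (\<Sum>i\<in>{1..j}. \<xi> (k + i) \<omega>)" if "j \<in> {1..m}" for j
        proof (rule X_window[OF sp])
          show "p (Suc (k + i)) < U (Suc (k + i)) \<omega>" if i: "i < j" for i
          proof -
            have "i < m" using i \<open>j \<in> {1..m}\<close> by simp
            then have "\<omega> \<notin> B i" using False by blast
            then show ?thesis using sp by (simp add: B_def not_le)
          qed
        qed
        then have "(\<Sum>i\<in>{1..j}. \<xi> (k + i) \<omega>) \<noteq> 0" if "j \<in> {1..m}" for j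
          using \<omega> that by (fastforce simp: L_def)
        then show ?thesis using sp by blast
      qed
    qed
    then have "prob (L k) \<le> prob (?W \<union> (\<Union>i\<in>{..<m}. B i))"
      by (rule finite_measure_mono) (use no_return_window_event B in auto)
    also have "\<dots> \<le> prob ?W + prob (\<Union>i\<in>{..<m}. B i)"
      by (rule measure_Un_le) (use no_return_window_event B in auto)
    also have "prob (\<Union>i\<in>{..<m}. B i) \<le> (\<Sum>i<m. prob (B i))"
      by (rule finite_measure_subadditive_finite) (use B in auto)
    also have "\<dots> \<le> (\<Sum>i<m. p (Suc k))" by (rule sum_mono) (rule prob_B)
    finally show ?thesis unfolding no_return_window[OF m] by simp
  qed
  have L_int: "integrable M (indicator (L k) :: 'w \<Rightarrow> real)" for k
    using L[of k] by (intro integrable_real_indicator) (auto simp: emeasure_eq_measure)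
  have "expectation (fresh_count n) \<le> expectation (\<lambda>\<omega>. real m + (\<Sum>k<n. indicator (L k) \<omega>))"
  proof (rule integral_mono[OF fresh_count_integrable _ path])
    show "integrable M (\<lambda>\<omega>. real m + (\<Sum>k<n. indicator (L k) \<omega>))"
      by (rule Bochner_Integration.integrable_add[OF _ Bochner_Integration.integrable_sum[OF L_int]]) simp
  qed
  also have "\<dots> = real m + (\<Sum>k<n. prob (L k))"
  proof -
    have "expectation (\<lambda>\<omega>. real m + (\<Sum>k<n. indicator (L k) \<omega> :: real))
        = expectation (\<lambda>\<omega>. real m) + expectation (\<lambda>\<omega>. \<Sum>k<n. indicator (L k) \<omega>)"
      by (rule Bochner_Integration.integral_add[OF _ Bochner_Integration.integrable_sum[OF L_int]]) simp
    also have "expectation (\<lambda>\<omega>. \<Sum>k<n. indicator (L k) \<omega>) = (\<Sum>k<n. expectation (indicator (L k)) :: real)"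
      by (rule Bochner_Integration.integral_sum[OF L_int])
    finally show ?thesis using L by (simp add: prob_space)
  qed
  also have "\<dots> \<le> real m + (\<Sum>k<n. no_return_upto m + real m * p (Suc k))"
    by (intro add_left_mono sum_mono prob_L)
  also have "\<dots> = real n * no_return_upto m + real m * (\<Sum>k<n. p (Suc k)) + real m"
    by (simp add: sum.distrib sum_distrib_left)
  finally show ?thesis .
qed

text \<open>The positive part of \<open>\<pi>\<close> minus the range divided by \<open>n\<close> tends to \<open>0\<close> almost surely and is bounded,
  hence its mean tends to \<open>0\<close>. The range at time \<open>n\<close> consists of \<open>n + 1\<close> values and is
  \<open>fresh_count (n + 1)\<close>, which is at most one more than \<open>fresh_count n\<close>.\<close>

lemma fresh_count_deficit:
  assumes range: "AE \<omega> in M. liminf (\<lambda>n. ereal (real (card (walk_range X n \<omega>)) / real n))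
      \<ge> ereal (no_return_prob M \<xi>)" and e: "0 < e"
  shows "\<exists>A. \<forall>n. expectation (\<lambda>\<omega>. max 0 (no_return_prob M \<xi> * real n - fresh_count n \<omega>)) \<le> e * real n + A"
proof -
  let ?\<pi> = "no_return_prob M \<xi>"
  define d where "d = (\<lambda>n \<omega>. max 0 (?\<pi> - fresh_count (Suc n) \<omega> / real n))"
  have d_rv: "d n \<in> borel_measurable M" for n
    unfolding d_def using fresh_count_rv[of "Suc n"] by measurable
  have d_bd: "0 \<le> d n \<omega>" "d n \<omega> \<le> 1" for n \<omega>
  proof -
    have "0 \<le> fresh_count (Suc n) \<omega> / real n" using fresh_count_bounds(1)[of "Suc n" \<omega>] by simp
    then show "d n \<omega> \<le> 1" using no_return_prob_bounds unfolding d_def by linarith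
  qed (simp add: d_def)
  have "(\<lambda>n. expectation (d n)) \<longlonglongrightarrow> expectation (\<lambda>_. 0)"
  proof (rule integral_dominated_convergence[where w = "\<lambda>_. 1"])
    show "AE \<omega> in M. (\<lambda>n. d n \<omega>) \<longlonglongrightarrow> 0"
      using range
    proof eventually_elim
      case (elim \<omega>)
      show ?case
      proof (rule tendstoI)
        fix \<delta> :: real assume \<delta>: "0 < \<delta>"
        have "ereal (?\<pi> - \<delta>) < ereal ?\<pi>" using \<delta> by simp
        then have "ereal (?\<pi> - \<delta>) < liminf (\<lambda>n. ereal (real (card (walk_range X n \<omega>)) / real n))"
          using elim by (rule less_le_trans)
        then have "\<forall>\<^sub>F n in sequentially. ereal (?\<pi> - \<delta>) < ereal (real (card (walk_range X n \<omega>)) / real n)"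
          by (rule less_LiminfD)
        then show "\<forall>\<^sub>F n in sequentially. dist (d n \<omega>) 0 < \<delta>"
        proof eventually_elim
          case (elim n)
          then have "?\<pi> - fresh_count (Suc n) \<omega> / real n < \<delta>" by (simp add: card_walk_range)
          then show ?case using \<delta> by (simp add: d_def)
        qed
      qed
    qed
    show "AE \<omega> in M. norm (d n \<omega>) \<le> 1" for n using d_bd by simp
  qed (use d_rv in auto)
  then have "(\<lambda>n. expectation (d n)) \<longlonglongrightarrow> 0" by simp
  from order_tendstoD(2)[OF this e] obtain n0 where n0: "\<And>n. n0 \<le> n \<Longrightarrow> expectation (d n) < e"
    by (auto simp: eventually_sequentially)
  have int_d: "integrable M (d n)" for n
    by (rule integrable_bounded[OF d_rv, of n 1]) (use d_bd in simp)
  let ?D = "\<lambda>n \<omega>. max 0 (?\<pi> * real n - fresh_count n \<omega>)"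
  have int_D: "integrable M (?D n)" for n
  proof (rule integrable_bounded)
    show "?D n \<in> borel_measurable M" using fresh_count_rv[of n] by measurable
    show "norm (?D n \<omega>) \<le> real n" for \<omega>
    proof -
      have "?\<pi> * real n \<le> 1 * real n" using no_return_prob_bounds by (intro mult_right_mono) auto
      then show ?thesis using fresh_count_bounds(1)[of n \<omega>] by simp
    qed
  qed
  have D_le: "?D n \<omega> \<le> real n * d n \<omega> + 1" for n \<omega>
  proof (cases "n = 0")
    case True
    then show ?thesis using fresh_count_bounds[of 0 \<omega>] by simp
  next
    case False
    have "fresh_count (Suc n) \<omega> \<le> fresh_count n \<omega> + 1"
      using fresh_ind_bounds(2)[of n \<omega>] by (simp add: fresh_count_def)
    moreover have "real n * (?\<pi> - fresh_count (Suc n) \<omega> / real n) = ?\<pi> * real n - fresh_count (Suc n) \<omega>"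
      using False by (simp add: algebra_simps)
    moreover have "real n * (?\<pi> - fresh_count (Suc n) \<omega> / real n) \<le> real n * d n \<omega>"
      unfolding d_def by (intro mult_left_mono) auto
    moreover have "0 \<le> real n * d n \<omega>" using d_bd by simp
    ultimately show ?thesis by linarith
  qed
  have "expectation (?D n) \<le> e * real n + (real n0 + 1)" for n
  proof -
    have "expectation (?D n) \<le> expectation (\<lambda>\<omega>. real n * d n \<omega> + 1)"
      by (rule integral_mono[OF int_D _ D_le]) (use int_d in simp)
    also have "\<dots> = real n * expectation (d n) + 1" using int_d by (simp add: prob_space)
    also have "\<dots> \<le> e * real n + (real n0 + 1)"
    proof (cases "n0 \<le> n")
      case True
      have "real n * expectation (d n) \<le> real n * e"
        using n0[OF True] by (intro mult_left_mono) auto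
      then show ?thesis by (simp add: mult.commute)
    next
      case False
      have "expectation (d n) \<le> expectation (\<lambda>_. 1)"
        by (rule integral_mono[OF int_d]) (use d_bd in auto)
      then have "real n * expectation (d n) \<le> real n * 1"
        by (intro mult_left_mono) (simp_all add: prob_space)
      moreover have "real n \<le> real n0" using False by simp
      moreover have "0 \<le> e * real n" using e by simp
      ultimately show ?thesis by linarith
    qed
    finally show ?thesis .
  qed
  then show ?thesis by blast
qed

end

section \<open>Errors that are small compared with a scale\<close>

text \<open>The bounds on expected errors hold up to an arbitrarily small multiple of the scale \<open>g\<close> and an
  additive constant. Unlike an error of order \<open>o(g n)\<close>, such a bound holds for all \<open>n\<close>, which is
  convenient for summation by parts.\<close>

definition small_vs :: "(nat \<Rightarrow> real) \<Rightarrow> (nat \<Rightarrow> real) \<Rightarrow> bool" where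
  "small_vs g f \<longleftrightarrow> (\<forall>e>0. \<exists>A. \<forall>n. f n \<le> e * g n + A)"

lemma small_vsD:
  assumes "small_vs g f" "0 < e"
  obtains A where "0 \<le> A" "\<And>n. f n \<le> e * g n + A"
proof -
  obtain A where "\<And>n. f n \<le> e * g n + A" using assms by (auto simp: small_vs_def)
  then have "f n \<le> e * g n + max A 0" for n
    by (meson add_left_mono max.cobounded1 order_trans)
  then show ?thesis using that[of "max A 0"] by simp
qed

lemma small_vs_mono: "small_vs g f \<Longrightarrow> (\<And>n. f' n \<le> f n) \<Longrightarrow> small_vs g f'"
  unfolding small_vs_def by (meson order_trans)

lemma small_vs_add:
  assumes "small_vs g f" "small_vs g f'"
  shows "small_vs g (\<lambda>n. f n + f' n)"
  unfolding small_vs_def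
proof (intro allI impI)
  fix e :: real assume "0 < e"
  then have e: "0 < e / 2" by simp
  obtain A A' where "\<And>n. f n \<le> e / 2 * g n + A" "\<And>n. f' n \<le> e / 2 * g n + A'"
    using small_vsD[OF assms(1) e] small_vsD[OF assms(2) e] by metis
  then have "f n + f' n \<le> e * g n + (A + A')" for n
    using add_mono[of "f n" "e / 2 * g n + A" "f' n" "e / 2 * g n + A'"] by (simp add: algebra_simps)
  then show "\<exists>A. \<forall>n. f n + f' n \<le> e * g n + A" by blast
qed

lemma small_vs_const:
  assumes "\<And>n. 0 \<le> g n"
  shows "small_vs g (\<lambda>_. c)"
  unfolding small_vs_def using assms by (intro allI impI exI[of _ c]) simp

lemma small_vs_cmult:
  assumes f: "small_vs g f" and g: "\<And>n. 0 \<le> g n" and c: "0 \<le> c"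
  shows "small_vs g (\<lambda>n. c * f n)"
proof (cases "c = 0")
  case True
  then show ?thesis using small_vs_const[OF g, where c = 0] by simp
next
  case False
  with c have c: "0 < c" by simp
  show ?thesis
    unfolding small_vs_def
  proof (intro allI impI)
    fix e :: real assume "0 < e"
    then have e: "0 < e / c" using c by simp
    obtain A where A: "\<And>n. f n \<le> e / c * g n + A" using small_vsD[OF f e] by metis
    have "c * f n \<le> e * g n + c * A" for n
      using mult_left_mono[OF A[of n], of c] c by (simp add: distrib_left)
    then show "\<exists>A. \<forall>n. c * f n \<le> e * g n + A" by blast
  qed
qed

lemma small_vs_sum:
  assumes "finite I" "\<And>n. 0 \<le> g n" "\<And>i. i \<in> I \<Longrightarrow> small_vs g (f i)"
  shows "small_vs g (\<lambda>n. \<Sum>i\<in>I. f i n)"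
  using assms(1,3)
proof (induction I rule: finite_induct)
  case empty
  show ?case using small_vs_const[OF assms(2), where c = 0] by simp
next
  case (insert i I)
  have "small_vs g (\<lambda>n. f i n + (\<Sum>i\<in>I. f i n))"
    by (rule small_vs_add) (use insert in auto)
  then show ?case using insert by simp
qed

text \<open>In \<open>(\<surd>(x+1) - \<surd>x) (\<surd>(x+1) + \<surd>x) = 1\<close> the second factor lies between \<open>2 \<surd>x\<close> and \<open>2 \<surd>(x+1)\<close>.\<close>

lemma sqrt_increment:
  fixes x :: real
  assumes "0 \<le> x"
  shows "1 / sqrt (x + 1) \<le> 2 * (sqrt (x + 1) - sqrt x)"
    and "0 < x \<Longrightarrow> 2 * (sqrt (x + 1) - sqrt x) \<le> 1 / sqrt x"
proof -
  define a where "a = sqrt x"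
  define b where "b = sqrt (x + 1)"
  have a: "0 \<le> a" "a\<^sup>2 = x" and b: "0 < b" "b\<^sup>2 = x + 1" using assms by (auto simp: a_def b_def)
  have *: "0 \<le> (b - a)\<^sup>2" by simp
  have "1 \<le> 2 * (b - a) * b" using * a b by (simp add: power2_eq_square algebra_simps)
  then show "1 / sqrt (x + 1) \<le> 2 * (sqrt (x + 1) - sqrt x)"
    unfolding a_def[symmetric] b_def[symmetric] using b(1) by (simp add: divide_le_eq)
  assume "0 < x"
  then have a': "0 < a" by (simp add: a_def)
  have "2 * (b - a) * a \<le> 1" using * a b by (simp add: power2_eq_square algebra_simps)
  then show "2 * (sqrt (x + 1) - sqrt x) \<le> 1 / sqrt x"
    unfolding a_def[symmetric] b_def[symmetric] using a' by (simp add: le_divide_eq)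
qed

lemma summation_by_parts:
  fixes r q :: "nat \<Rightarrow> real"
  assumes "r 0 = 0"
  shows "(\<Sum>i<n. (r (Suc i) - r i) * q i) = r n * q n + (\<Sum>i<n. r (Suc i) * (q i - q (Suc i)))"
  using assms by (induction n) (simp_all add: algebra_simps)

text \<open>Decreasing weights have nonnegative differences, so the upper bound on \<open>r\<close> may be inserted after
  summation by parts; undoing the summation for the bound leaves a boundary term only.\<close>

lemma summation_by_parts_bound:
  fixes r q :: "nat \<Rightarrow> real"
  assumes r: "\<And>k. r k \<le> e * real k + A" and q: "\<And>i. 0 \<le> q i" "\<And>i. q (Suc i) \<le> q i"
  shows "r n * q n + (\<Sum>i<n. r (Suc i) * (q i - q (Suc i))) \<le> e * (\<Sum>i<n. q i) + A * q 0"
proof -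
  have "r n * q n + (\<Sum>i<n. r (Suc i) * (q i - q (Suc i)))
      \<le> (e * real n + A) * q n + (\<Sum>i<n. (e * real (Suc i) + A) * (q i - q (Suc i)))"
    by (intro add_mono sum_mono mult_right_mono r) (use q in auto)
  also have "\<dots> = e * (\<Sum>i<n. q i) + A * q 0"
    by (induction n) (simp_all add: algebra_simps)
  finally show ?thesis .
qed

section \<open>The drift at the critical rate\<close>

locale critical_erw = excited_random_walk M F \<xi> \<gamma> U p l X
  for M :: "'w measure" and F and \<xi> \<gamma> :: "nat \<Rightarrow> 'w \<Rightarrow> real^'d" and U p l X +
  fixes C :: real
  assumes C_pos: "0 < C"
    and p_eq: "\<And>n. 1 \<le> n \<Longrightarrow> p n = min (C / sqrt (real n)) 1"
    and range_liminf: "AE \<omega> in M. liminf (\<lambda>n. ereal (real (card (walk_range X n \<omega>)) / real n))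
      \<ge> ereal (no_return_prob M \<xi>)"
begin

definition p_sum :: "nat \<Rightarrow> real" where
  "p_sum n = (\<Sum>i<n. p (Suc i))"

lemma p_nonneg: "0 \<le> p (Suc i)"
  using p_range[of "Suc i"] by simp

lemma p_antitone: "1 \<le> i \<Longrightarrow> i \<le> j \<Longrightarrow> p j \<le> p i"
proof -
  assume ij: "1 \<le> i" "i \<le> j"
  have "C / sqrt (real j) \<le> C / sqrt (real i)"
    by (rule divide_left_mono) (use ij C_pos in auto)
  then show ?thesis using ij by (simp add: p_eq min.coboundedI1 min.mono)
qed

lemma p_sum_nonneg: "0 \<le> p_sum n"
  unfolding p_sum_def by (rule sum_nonneg) (rule p_nonneg)

lemma p_sum_le: "p_sum n \<le> 2 * C * sqrt (real n)"
proof (induction n)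
  case (Suc n)
  have "p (Suc n) \<le> C * (1 / sqrt (real n + 1))" using p_eq[of "Suc n"] by (simp add: add.commute)
  also have "\<dots> \<le> C * (2 * (sqrt (real n + 1) - sqrt (real n)))"
    by (intro mult_left_mono sqrt_increment) (use C_pos in auto)
  finally show ?case using Suc by (simp add: p_sum_def algebra_simps)
qed (simp add: p_sum_def)

text \<open>As soon as \<open>C\<^sup>2 \<le> n\<close> the minimum with \<open>1\<close> is inactive, and from there on the difference of \<open>p_sum n\<close> and
  \<open>2 C \<surd>(n+1)\<close> is nondecreasing. The index \<open>n + 1\<close> under the root makes this work.\<close>

lemma p_sum_asymp: "\<exists>A. \<forall>n. \<bar>p_sum n - 2 * C * sqrt (real n)\<bar> \<le> A"
proof -
  obtain i0 :: nat where i0: "C\<^sup>2 \<le> real i0" using real_arch_simple by blast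
  let ?A = "2 * C * sqrt (real i0 + 1)"
  have *: "2 * C * sqrt (real n + 1) - ?A \<le> p_sum n" for n
  proof (induction n)
    case 0
    have "sqrt (real 0 + 1) \<le> sqrt (real i0 + 1)" by simp
    then have "2 * C * sqrt (real 0 + 1) \<le> ?A" by (rule mult_left_mono) (use C_pos in simp)
    then show ?case by (simp add: p_sum_def)
  next
    case (Suc n)
    show ?case
    proof (cases "i0 \<le> n")
      case True
      then have "C\<^sup>2 \<le> real n + 1" using i0 by simp
      then have "C \<le> sqrt (real n + 1)" by (rule real_le_rsqrt)
      then have "C / sqrt (real n + 1) \<le> 1" by (simp add: divide_le_eq)
      then have "p (Suc n) = C * (1 / sqrt (real n + 1))" using p_eq[of "Suc n"] by (simp add: add.commute)
      moreover have "C * (2 * (sqrt (real n + 1 + 1) - sqrt (real n + 1))) \<le> C * (1 / sqrt (real n + 1))"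
        by (intro mult_left_mono sqrt_increment) (use C_pos in auto)
      moreover have "p_sum (Suc n) = p_sum n + p (Suc n)" by (simp add: p_sum_def)
      moreover have "real (Suc n) + 1 = real n + 1 + 1" by simp
      ultimately show ?thesis using Suc by (simp only: right_diff_distrib)
    next
      case False
      then have "real (Suc n) \<le> real i0" by simp
      then have "sqrt (real (Suc n) + 1) \<le> sqrt (real i0 + 1)" by simp
      then have "2 * C * sqrt (real (Suc n) + 1) \<le> ?A" by (rule mult_left_mono) (use C_pos in simp)
      then show ?thesis using p_sum_nonneg[of "Suc n"] by linarith
    qed
  qed
  have "\<bar>p_sum n - 2 * C * sqrt (real n)\<bar> \<le> ?A" for n
  proof -
    have "2 * C * sqrt (real n) \<le> 2 * C * sqrt (real n + 1)"
      by (rule mult_left_mono) (use C_pos in auto)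
    moreover have "0 \<le> ?A" using C_pos by simp
    ultimately show ?thesis using *[of n] p_sum_le[of n] by linarith
  qed
  then show ?thesis by blast
qed

text \<open>The upper bound on the expected range is the classical one, because excited steps are rare; the
  lower bound is the hypothesis on the range. Together they give a law of large numbers in mean.\<close>

lemma fresh_count_L1:
  "small_vs real (\<lambda>n. expectation (\<lambda>\<omega>. \<bar>fresh_count n \<omega> - no_return_prob M \<xi> * real n\<bar>))"
  unfolding small_vs_def
proof (intro allI impI)
  fix e :: real assume e: "0 < e"
  let ?\<pi> = "no_return_prob M \<xi>"
  let ?D = "\<lambda>n \<omega>. max 0 (?\<pi> * real n - fresh_count n \<omega>)"
  obtain A where A: "\<And>n. expectation (?D n) \<le> e / 4 * real n + A"
    using fresh_count_deficit[OF range_liminf, of "e / 4"] e by auto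
  have "\<forall>\<^sub>F m in sequentially. no_return_upto m < ?\<pi> + e / 4 \<and> 1 \<le> m"
    by (intro eventually_conj order_tendstoD(2)[OF no_return_upto_tendsto] eventually_ge_at_top) (use e in simp)
  then obtain m where m: "no_return_upto m \<le> ?\<pi> + e / 4" "1 \<le> m"
    using eventually_happens'[OF sequentially_bot] by (metis (mono_tags, lifting) less_imp_le)
  \<comment> \<open>Of the error \<open>e n\<close>, one quarter goes to the choice of \<open>m\<close>, one to the coins, two to the deficit.\<close>
  define c where "c = 2 * C * real m"
  have c: "0 < c" using C_pos m by (simp add: c_def)
  define \<delta> where "\<delta> = e / (4 * c)"
  have \<delta>: "0 < \<delta>" "c * \<delta> = e / 4" using c e by (auto simp: \<delta>_def)
  have "expectation (\<lambda>\<omega>. \<bar>fresh_count n \<omega> - ?\<pi> * real n\<bar>) \<le> e * real n + (c * (1 / (4 * \<delta>)) + real m + 2 * A)" for n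
  proof -
    have D_rv: "?D n \<in> borel_measurable M" using fresh_count_rv[of n] by measurable
    have int_D: "integrable M (?D n)"
    proof (rule integrable_bounded[OF D_rv])
      show "norm (?D n \<omega>) \<le> real n" for \<omega>
      proof -
        have "?\<pi> * real n \<le> 1 * real n" using no_return_prob_bounds by (intro mult_right_mono) auto
        then show ?thesis using fresh_count_bounds(1)[of n \<omega>] by simp
      qed
    qed
    have "expectation (\<lambda>\<omega>. \<bar>fresh_count n \<omega> - ?\<pi> * real n\<bar>)
        = expectation (\<lambda>\<omega>. (fresh_count n \<omega> - ?\<pi> * real n) + 2 * ?D n \<omega>)"
      by (rule Bochner_Integration.integral_cong) (auto simp: max_def)
    also have "\<dots> = expectation (\<lambda>\<omega>. fresh_count n \<omega> - ?\<pi> * real n) + expectation (\<lambda>\<omega>. 2 * ?D n \<omega>)"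
      by (rule Bochner_Integration.integral_add)
         (use fresh_count_integrable[of n] int_D in \<open>auto intro: Bochner_Integration.integrable_diff\<close>)
    also have "expectation (\<lambda>\<omega>. fresh_count n \<omega> - ?\<pi> * real n) = expectation (fresh_count n) - ?\<pi> * real n"
      using fresh_count_integrable[of n] by (simp add: prob_space)
    also have "expectation (\<lambda>\<omega>. 2 * ?D n \<omega>) = 2 * expectation (?D n)" by simp
    finally have eq: "expectation (\<lambda>\<omega>. \<bar>fresh_count n \<omega> - ?\<pi> * real n\<bar>)
        = expectation (fresh_count n) - ?\<pi> * real n + 2 * expectation (?D n)" .
    have "expectation (fresh_count n) \<le> real n * no_return_upto m + real m * p_sum n + real m"
      using fresh_count_expectation_le[OF m(2) p_antitone, of n] by (simp add: p_sum_def)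
    moreover have "real n * no_return_upto m \<le> real n * (?\<pi> + e / 4)"
      by (intro mult_left_mono m) simp
    moreover have "real m * p_sum n \<le> c * \<bar>sqrt (real n)\<bar>"
      using mult_left_mono[OF p_sum_le[of n], of "real m"] by (simp add: c_def algebra_simps)
    moreover have "c * \<bar>sqrt (real n)\<bar> \<le> c * (\<delta> * (sqrt (real n))\<^sup>2 + 1 / (4 * \<delta>))"
      using c by (intro mult_left_mono abs_le_square \<delta>) simp
    moreover have "c * (\<delta> * (sqrt (real n))\<^sup>2 + 1 / (4 * \<delta>)) = e / 4 * real n + c * (1 / (4 * \<delta>))"
      by (simp add: distrib_left mult.assoc[symmetric] \<delta>(2))
    moreover have "real n * (?\<pi> + e / 4) = ?\<pi> * real n + e / 4 * real n" by (simp add: algebra_simps)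
    ultimately show ?thesis using A[of n] unfolding eq by linarith
  qed
  then show "\<exists>A. \<forall>n. expectation (\<lambda>\<omega>. \<bar>fresh_count n \<omega> - ?\<pi> * real n\<bar>) \<le> e * real n + A" by blast
qed

text \<open>Summation by parts against the weights \<open>p i\<close> turns the law of large numbers at scale \<open>n\<close> into one at
  scale \<open>\<surd>n\<close>: an error \<open>e n\<close> becomes \<open>e p_sum n\<close>.\<close>

lemma fresh_weighted_L1:
  "small_vs (\<lambda>n. sqrt (real n)) (\<lambda>n. expectation (\<lambda>\<omega>.
     \<bar>(\<Sum>i<n. fresh_ind i \<omega> * p (Suc i)) - no_return_prob M \<xi> * p_sum n\<bar>))"
  unfolding small_vs_def
proof (intro allI impI)
  fix e :: real assume e: "0 < e"
  let ?\<pi> = "no_return_prob M \<xi>" and ?q = "\<lambda>i. p (Suc i)"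
  define r where "r = (\<lambda>n \<omega>. fresh_count n \<omega> - ?\<pi> * real n)"
  define e' where "e' = e / (2 * C)"
  have e': "0 < e'" "e' * (2 * C) = e" using e C_pos by (auto simp: e'_def)
  obtain A where A: "\<And>n. expectation (\<lambda>\<omega>. \<bar>r n \<omega>\<bar>) \<le> e' * real n + A"
    using small_vsD[OF fresh_count_L1 e'(1)] unfolding r_def by metis
  have r_int: "integrable M (\<lambda>\<omega>. \<bar>r n \<omega>\<bar>)" for n
    using fresh_count_integrable[of n] unfolding r_def by auto
  have q_dec: "?q (Suc i) \<le> ?q i" for i by (rule p_antitone) auto
  have "expectation (\<lambda>\<omega>. \<bar>(\<Sum>i<n. fresh_ind i \<omega> * p (Suc i)) - ?\<pi> * p_sum n\<bar>) \<le> e * sqrt (real n) + A * ?q 0" for n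
  proof -
    have "expectation (\<lambda>\<omega>. \<bar>(\<Sum>i<n. fresh_ind i \<omega> * p (Suc i)) - ?\<pi> * p_sum n\<bar>)
        \<le> expectation (\<lambda>\<omega>. \<bar>r n \<omega>\<bar> * ?q n + (\<Sum>i<n. \<bar>r (Suc i) \<omega>\<bar> * (?q i - ?q (Suc i))))"
    proof (rule integral_mono)
      show "integrable M (\<lambda>\<omega>. \<bar>(\<Sum>i<n. fresh_ind i \<omega> * p (Suc i)) - ?\<pi> * p_sum n\<bar>)"
      proof (rule integrable_bounded)
        show "(\<lambda>\<omega>. \<bar>(\<Sum>i<n. fresh_ind i \<omega> * p (Suc i)) - ?\<pi> * p_sum n\<bar>) \<in> borel_measurable M"
          using fresh_ind_rv by measurable
        show "norm \<bar>(\<Sum>i<n. fresh_ind i \<omega> * p (Suc i)) - ?\<pi> * p_sum n\<bar> \<le> p_sum n" for \<omega>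
        proof -
          have "(\<Sum>i<n. fresh_ind i \<omega> * p (Suc i)) \<le> (\<Sum>i<n. 1 * p (Suc i))"
            by (intro sum_mono mult_right_mono fresh_ind_bounds p_nonneg)
          moreover have "0 \<le> (\<Sum>i<n. fresh_ind i \<omega> * p (Suc i))"
            by (intro sum_nonneg mult_nonneg_nonneg fresh_ind_bounds p_nonneg)
          moreover have "?\<pi> * p_sum n \<le> 1 * p_sum n"
            by (intro mult_right_mono no_return_prob_bounds p_sum_nonneg)
          moreover have "0 \<le> ?\<pi> * p_sum n"
            by (intro mult_nonneg_nonneg no_return_prob_bounds p_sum_nonneg)
          ultimately show ?thesis by (simp add: p_sum_def)
        qed
      qed
      show "integrable M (\<lambda>\<omega>. \<bar>r n \<omega>\<bar> * ?q n + (\<Sum>i<n. \<bar>r (Suc i) \<omega>\<bar> * (?q i - ?q (Suc i))))"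
        using r_int by (intro Bochner_Integration.integrable_add Bochner_Integration.integrable_sum integrable_mult_left) auto
      fix \<omega>
      have "(\<Sum>i<n. fresh_ind i \<omega> * p (Suc i)) - ?\<pi> * p_sum n = (\<Sum>i<n. (r (Suc i) \<omega> - r i \<omega>) * ?q i)"
        by (simp add: p_sum_def sum_distrib_left sum_subtractf[symmetric] r_def fresh_count_def algebra_simps)
      also have "\<dots> = r n \<omega> * ?q n + (\<Sum>i<n. r (Suc i) \<omega> * (?q i - ?q (Suc i)))"
        by (rule summation_by_parts) (simp add: r_def fresh_count_def)
      finally have eq: "(\<Sum>i<n. fresh_ind i \<omega> * p (Suc i)) - ?\<pi> * p_sum n
          = r n \<omega> * ?q n + (\<Sum>i<n. r (Suc i) \<omega> * (?q i - ?q (Suc i)))" .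
      have "\<bar>r n \<omega> * ?q n\<bar> = \<bar>r n \<omega>\<bar> * ?q n" using p_nonneg[of n] by (simp add: abs_mult)
      moreover have "\<bar>\<Sum>i<n. r (Suc i) \<omega> * (?q i - ?q (Suc i))\<bar> \<le> (\<Sum>i<n. \<bar>r (Suc i) \<omega>\<bar> * (?q i - ?q (Suc i)))"
        by (rule order_trans[OF sum_abs]) (use q_dec in \<open>auto simp: abs_mult intro!: sum_mono\<close>)
      ultimately show "\<bar>(\<Sum>i<n. fresh_ind i \<omega> * p (Suc i)) - ?\<pi> * p_sum n\<bar>
          \<le> \<bar>r n \<omega>\<bar> * ?q n + (\<Sum>i<n. \<bar>r (Suc i) \<omega>\<bar> * (?q i - ?q (Suc i)))"
        unfolding eq by linarith
    qed
    also have "\<dots> = expectation (\<lambda>\<omega>. \<bar>r n \<omega>\<bar>) * ?q n + (\<Sum>i<n. expectation (\<lambda>\<omega>. \<bar>r (Suc i) \<omega>\<bar>) * (?q i - ?q (Suc i)))"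
      using r_int by simp
    also have "\<dots> \<le> e' * (\<Sum>i<n. ?q i) + A * ?q 0"
      by (rule summation_by_parts_bound[where q = ?q and r = "\<lambda>k. expectation (\<lambda>\<omega>. \<bar>r k \<omega>\<bar>)"]) (rule A p_nonneg q_dec)+
    also have "e' * (\<Sum>i<n. ?q i) \<le> e' * (2 * C * sqrt (real n))"
      using p_sum_le[of n] e' by (intro mult_left_mono) (auto simp: p_sum_def)
    also have "\<dots> = e * sqrt (real n)" by (simp only: mult.assoc[symmetric] e'(2)) (simp add: mult.assoc e'(2)[symmetric])
    finally show ?thesis by simp
  qed
  then show "\<exists>A. \<forall>n. expectation (\<lambda>\<omega>. \<bar>(\<Sum>i<n. fresh_ind i \<omega> * p (Suc i)) - ?\<pi> * p_sum n\<bar>)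
      \<le> e * sqrt (real n) + A" by blast
qed

end

lemma sqrt_diff_le:
  fixes x y :: real
  assumes "0 \<le> x" "x \<le> y"
  shows "sqrt y - sqrt x \<le> sqrt (y - x)"
  using sqrt_add_le_add_sqrt[of x "y - x"] assms by simp

context critical_erw
begin

lemma excited_info:
  "excited i \<in> borel_measurable (info {(Suc i, 2)})" "excited i \<in> borel_measurable (info (steps {Suc i}))"
proof -
  have [measurable]: "noise (Suc i, 2) \<in> borel_measurable (info {(Suc i, 2)})" by (rule noise_info) simp
  have "l \<bullet> l = 1" using direction by (simp add: dot_square_norm)
  then have eq: "excited i = (\<lambda>\<omega>. if noise (Suc i, 2) \<omega> \<bullet> l \<le> p (Suc i) then 1 else 0)"
    by (auto simp: excited_def noise_def fun_eq_iff)
  show 1: "excited i \<in> borel_measurable (info {(Suc i, 2)})" unfolding eq by measurable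
  show "excited i \<in> borel_measurable (info (steps {Suc i}))"
    by (rule info_mono[OF _ 1]) (auto simp: steps_def)
qed

lemma excited_integrable: "integrable M (excited i)"
proof (rule integrable_bounded)
  show "excited i \<in> borel_measurable M"
    by (rule info_le_events[OF steps_subset excited_info(2)]) simp
  show "norm (excited i \<omega>) \<le> 1" for \<omega> using excited_bounds[of i \<omega>] by simp
qed

text \<open>Replacing each variable \<open>\<eta> i\<close> by its mean costs a martingale whose variance is at most a constant
  times \<open>\<surd>n\<close>, so that the martingale itself is of order \<open>n\<close> to the power \<open>1/4\<close>.\<close>

lemma excited_sum_L1:
  fixes a \<eta> :: "nat \<Rightarrow> 'w \<Rightarrow> real"
  assumes a: "\<And>i. a i \<in> borel_measurable (info (steps {1..i}))" "\<And>i \<omega>. 0 \<le> a i \<omega>" "\<And>i \<omega>. a i \<omega> \<le> 1"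
    and \<eta>: "\<And>i. \<eta> i \<in> borel_measurable (info (steps {Suc i}))"
      "\<And>i \<omega>. \<omega> \<in> space M \<Longrightarrow> \<bar>\<eta> i \<omega>\<bar> \<le> B * excited i \<omega>" "\<And>i. expectation (\<eta> i) = p (Suc i) * \<mu>"
    and B: "0 \<le> B"
    and avg: "small_vs (\<lambda>n. sqrt (real n)) (\<lambda>n. expectation (\<lambda>\<omega>. \<bar>(\<Sum>i<n. a i \<omega> * p (Suc i)) - \<kappa> * p_sum n\<bar>))"
  shows "small_vs (\<lambda>n. sqrt (real n))
    (\<lambda>n. expectation (\<lambda>\<omega>. \<bar>(\<Sum>i<n. a i \<omega> * \<eta> i \<omega>) - 2 * C * \<kappa> * \<mu> * sqrt (real n)\<bar>))"
proof -
  define T where "T = (\<lambda>n \<omega>. \<Sum>i<n. a i \<omega> * (\<eta> i \<omega> - expectation (\<eta> i)))"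
  define V where "V = (\<lambda>n \<omega>. (\<Sum>i<n. a i \<omega> * p (Suc i)) - \<kappa> * p_sum n)"
  have a_rv: "a i \<in> borel_measurable M" for i by (rule info_le_events[OF steps_subset a(1)]) auto
  have \<eta>_rv: "\<eta> i \<in> borel_measurable M" for i by (rule info_le_events[OF steps_subset \<eta>(1)]) auto
  have a_abs: "\<bar>a i \<omega>\<bar> \<le> 1" for i \<omega> using a(2,3)[of i \<omega>] by simp
  have \<eta>_bd: "\<bar>\<eta> i \<omega>\<bar> \<le> B" if "\<omega> \<in> space M" for i \<omega>
  proof -
    have "B * excited i \<omega> \<le> B * 1" by (intro mult_left_mono excited_bounds B)
    then show ?thesis using \<eta>(2)[OF that, of i] by simp
  qed
  have T2: "integrable M (\<lambda>\<omega>. (T n \<omega>)\<^sup>2)"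
    "expectation (\<lambda>\<omega>. (T n \<omega>)\<^sup>2) \<le> (\<Sum>i<n. expectation (\<lambda>\<omega>. (\<eta> i \<omega>)\<^sup>2))" for n
    unfolding T_def by (rule martingale_second_moment[where B = B] a(1) a_abs \<eta>(1) \<eta>_bd, assumption?)+
  have \<eta>2_le: "expectation (\<lambda>\<omega>. (\<eta> i \<omega>)\<^sup>2) \<le> B\<^sup>2 * p (Suc i)" for i
  proof -
    have "expectation (\<lambda>\<omega>. (\<eta> i \<omega>)\<^sup>2) \<le> expectation (\<lambda>\<omega>. B\<^sup>2 * excited i \<omega>)"
    proof (rule integral_mono)
      show "integrable M (\<lambda>\<omega>. (\<eta> i \<omega>)\<^sup>2)"
      proof (rule integrable_bounded)
        show "(\<lambda>\<omega>. (\<eta> i \<omega>)\<^sup>2) \<in> borel_measurable M" using \<eta>_rv by simp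
        show "norm ((\<eta> i \<omega>)\<^sup>2) \<le> B\<^sup>2" if "\<omega> \<in> space M" for \<omega>
          using power_mono[OF \<eta>_bd[OF that, of i], of 2] by simp
      qed
      show "integrable M (\<lambda>\<omega>. B\<^sup>2 * excited i \<omega>)" using excited_integrable by simp
      fix \<omega> assume "\<omega> \<in> space M"
      then have "\<bar>\<eta> i \<omega>\<bar>\<^sup>2 \<le> (B * excited i \<omega>)\<^sup>2" by (intro power_mono \<eta>(2)) auto
      then show "(\<eta> i \<omega>)\<^sup>2 \<le> B\<^sup>2 * excited i \<omega>"
        by (cases "U (Suc i) \<omega> \<le> p (Suc i)") (simp_all add: excited_def)
    qed
    then show ?thesis by (simp add: excited_expectation)
  qed
  have T2_le: "expectation (\<lambda>\<omega>. (T n \<omega>)\<^sup>2) \<le> B\<^sup>2 * (2 * C * sqrt (real n))" for n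
  proof -
    have "expectation (\<lambda>\<omega>. (T n \<omega>)\<^sup>2) \<le> (\<Sum>i<n. B\<^sup>2 * p (Suc i))"
      by (rule order_trans[OF T2(2)]) (intro sum_mono \<eta>2_le)
    also have "\<dots> = B\<^sup>2 * p_sum n" by (simp add: p_sum_def sum_distrib_left)
    also have "\<dots> \<le> B\<^sup>2 * (2 * C * sqrt (real n))" by (intro mult_left_mono p_sum_le) simp
    finally show ?thesis .
  qed
  have T_rv: "T n \<in> borel_measurable M" for n
    unfolding T_def using a_rv \<eta>_rv by (intro borel_measurable_sum borel_measurable_times borel_measurable_diff) auto
  have V_rv: "V n \<in> borel_measurable M" for n
    unfolding V_def using a_rv by (intro borel_measurable_sum borel_measurable_times borel_measurable_diff) auto
  have V_int: "integrable M (V n)" for n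
  proof -
    have "integrable M (a i)" for i
      by (rule integrable_bounded[OF a_rv]) (use a_abs in simp)
    then show ?thesis unfolding V_def by simp
  qed
  have T_small: "small_vs (\<lambda>n. sqrt (real n)) (\<lambda>n. expectation (\<lambda>\<omega>. \<bar>T n \<omega>\<bar>))"
    unfolding small_vs_def
  proof (intro allI impI)
    fix e :: real assume e: "0 < e"
    define c where "c = B\<^sup>2 * (2 * C) + 1"
    have c: "0 < c" using C_pos by (simp add: c_def add_nonneg_pos)
    define \<delta> where "\<delta> = e / c"
    have \<delta>: "0 < \<delta>" using c e by (simp add: \<delta>_def)
    have "expectation (\<lambda>\<omega>. \<bar>T n \<omega>\<bar>) \<le> e * sqrt (real n) + 1 / (4 * \<delta>)" for n
    proof -
      have "expectation (\<lambda>\<omega>. \<bar>T n \<omega>\<bar>) \<le> expectation (\<lambda>\<omega>. \<delta> * (T n \<omega>)\<^sup>2 + 1 / (4 * \<delta>))"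
      proof (rule integral_mono')
        show "integrable M (\<lambda>\<omega>. \<delta> * (T n \<omega>)\<^sup>2 + 1 / (4 * \<delta>))" using T2(1) by simp
        show "0 \<le> \<delta> * (T n \<omega>)\<^sup>2 + 1 / (4 * \<delta>)" for \<omega> using \<delta> by simp
      qed (rule abs_le_square[OF \<delta>])
      also have "\<dots> = \<delta> * expectation (\<lambda>\<omega>. (T n \<omega>)\<^sup>2) + 1 / (4 * \<delta>)" using T2(1) by (simp add: prob_space)
      also have "\<delta> * expectation (\<lambda>\<omega>. (T n \<omega>)\<^sup>2) \<le> \<delta> * (c * sqrt (real n))"
      proof (rule mult_left_mono)
        have "B\<^sup>2 * (2 * C * sqrt (real n)) \<le> c * sqrt (real n)" by (simp add: c_def algebra_simps)
        then show "expectation (\<lambda>\<omega>. (T n \<omega>)\<^sup>2) \<le> c * sqrt (real n)" using T2_le[of n] by linarith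
      qed (use \<delta> in simp)
      also have "\<delta> * (c * sqrt (real n)) = e * sqrt (real n)" using c by (simp add: \<delta>_def)
      finally show ?thesis by simp
    qed
    then show "\<exists>A. \<forall>n. expectation (\<lambda>\<omega>. \<bar>T n \<omega>\<bar>) \<le> e * sqrt (real n) + A" by blast
  qed
  obtain A where A: "\<And>n. \<bar>p_sum n - 2 * C * sqrt (real n)\<bar> \<le> A" using p_sum_asymp by blast
  have V_small: "small_vs (\<lambda>n. sqrt (real n)) (\<lambda>n. expectation (\<lambda>\<omega>. \<bar>V n \<omega>\<bar>))"
    unfolding V_def by (rule avg)
  have "small_vs (\<lambda>n. sqrt (real n))
      (\<lambda>n. expectation (\<lambda>\<omega>. \<bar>T n \<omega>\<bar>) + (\<bar>\<mu>\<bar> * expectation (\<lambda>\<omega>. \<bar>V n \<omega>\<bar>) + \<bar>\<mu> * \<kappa>\<bar> * A))"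
    by (intro small_vs_add T_small small_vs_cmult[OF V_small] small_vs_const) auto
  then show ?thesis
  proof (rule small_vs_mono)
    fix n
    have T_int: "integrable M (T n)"
      using square_integrable_imp_integrable[OF T_rv] T2(1)[of n] by simp
    have "(\<Sum>i<n. a i \<omega> * \<eta> i \<omega>) - 2 * C * \<kappa> * \<mu> * sqrt (real n)
        = T n \<omega> + \<mu> * V n \<omega> + \<mu> * \<kappa> * (p_sum n - 2 * C * sqrt (real n))" for \<omega>
      unfolding T_def V_def \<eta>(3)
      by (simp add: algebra_simps sum_subtractf sum_distrib_left)
    moreover have "\<bar>T n \<omega> + \<mu> * V n \<omega> + \<mu> * \<kappa> * (p_sum n - 2 * C * sqrt (real n))\<bar>
        \<le> \<bar>T n \<omega>\<bar> + (\<bar>\<mu>\<bar> * \<bar>V n \<omega>\<bar> + \<bar>\<mu> * \<kappa>\<bar> * A)" for \<omega>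
    proof -
      have "\<bar>\<mu> * \<kappa> * (p_sum n - 2 * C * sqrt (real n))\<bar> \<le> \<bar>\<mu> * \<kappa>\<bar> * A"
        unfolding abs_mult[of "\<mu> * \<kappa>"] by (rule mult_left_mono[OF A]) simp
      moreover have "\<bar>\<mu> * V n \<omega>\<bar> = \<bar>\<mu>\<bar> * \<bar>V n \<omega>\<bar>" by (rule abs_mult)
      ultimately show ?thesis by linarith
    qed
    ultimately have le: "\<bar>(\<Sum>i<n. a i \<omega> * \<eta> i \<omega>) - 2 * C * \<kappa> * \<mu> * sqrt (real n)\<bar>
        \<le> \<bar>T n \<omega>\<bar> + (\<bar>\<mu>\<bar> * \<bar>V n \<omega>\<bar> + \<bar>\<mu> * \<kappa>\<bar> * A)" for \<omega> by simp
    have "expectation (\<lambda>\<omega>. \<bar>(\<Sum>i<n. a i \<omega> * \<eta> i \<omega>) - 2 * C * \<kappa> * \<mu> * sqrt (real n)\<bar>)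
        \<le> expectation (\<lambda>\<omega>. \<bar>T n \<omega>\<bar> + (\<bar>\<mu>\<bar> * \<bar>V n \<omega>\<bar> + \<bar>\<mu> * \<kappa>\<bar> * A))"
    proof (rule integral_mono')
      show "integrable M (\<lambda>\<omega>. \<bar>T n \<omega>\<bar> + (\<bar>\<mu>\<bar> * \<bar>V n \<omega>\<bar> + \<bar>\<mu> * \<kappa>\<bar> * A))"
        using T_int V_int by simp
      show "0 \<le> \<bar>T n \<omega>\<bar> + (\<bar>\<mu>\<bar> * \<bar>V n \<omega>\<bar> + \<bar>\<mu> * \<kappa>\<bar> * A)" for \<omega>
        by (rule order_trans[OF abs_ge_zero le])
    qed (rule le)
    also have "\<dots> = expectation (\<lambda>\<omega>. \<bar>T n \<omega>\<bar>) + (\<bar>\<mu>\<bar> * expectation (\<lambda>\<omega>. \<bar>V n \<omega>\<bar>) + \<bar>\<mu> * \<kappa>\<bar> * A)"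
      using T_int V_int by (simp add: prob_space)
    finally show "expectation (\<lambda>\<omega>. \<bar>(\<Sum>i<n. a i \<omega> * \<eta> i \<omega>) - 2 * C * \<kappa> * \<mu> * sqrt (real n)\<bar>)
        \<le> expectation (\<lambda>\<omega>. \<bar>T n \<omega>\<bar>) + (\<bar>\<mu>\<bar> * expectation (\<lambda>\<omega>. \<bar>V n \<omega>\<bar>) + \<bar>\<mu> * \<kappa>\<bar> * A)" .
  qed
qed

definition drift_coeff :: "real^'d" where
  "drift_coeff = (2 * C * no_return_prob M \<xi>) *\<^sub>R expectation (\<gamma> 1)"

lemma excess_rv: "excess n \<in> borel_measurable M"
proof -
  have "(\<lambda>\<omega>. X n \<omega> - base_sum n \<omega>) \<in> borel_measurable M"
    unfolding base_sum_def using X_rv \<xi>_rv by (intro borel_measurable_diff borel_measurable_sum) auto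
  then show ?thesis
    by (rule measurable_cong[THEN iffD1, rotated]) (simp add: X_decomposition)
qed

lemma step_increment_expectation:
  "expectation (\<lambda>\<omega>. b \<bullet> (\<gamma> (Suc i) \<omega> - \<xi> (Suc i) \<omega>)) = b \<bullet> expectation (\<gamma> 1)"
    "integrable M (\<lambda>\<omega>. b \<bullet> (\<gamma> (Suc i) \<omega> - \<xi> (Suc i) \<omega>))"
proof -
  obtain K where K: "\<And>\<omega> n. \<omega> \<in> space M \<Longrightarrow> 1 \<le> n \<Longrightarrow> norm (\<gamma> n \<omega>) \<le> K"
    using bounded_steps by blast
  have i\<gamma>: "integrable M (\<gamma> (Suc i))"
    by (rule integrable_bounded[OF \<gamma>_rv]) (use K in auto)
  have i\<xi>: "integrable M (\<xi> (Suc i))" "expectation (\<xi> (Suc i)) = 0"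
    using mean_\<xi>[of "Suc i"] by auto
  have d: "distr M borel (\<gamma> (Suc i)) = distr M borel (\<gamma> 1)"
    by (rule iid_\<gamma>[unfolded iid_def, THEN conjunct2, rule_format]) simp
  have "expectation (\<gamma> (Suc i)) = (\<integral>x. x \<partial>distr M borel (\<gamma> (Suc i)))"
    by (rule integral_distr[symmetric]) (auto intro: \<gamma>_rv)
  also have "\<dots> = expectation (\<gamma> 1)"
    unfolding d by (rule integral_distr) (auto intro: \<gamma>_rv)
  finally have E: "expectation (\<gamma> (Suc i)) = expectation (\<gamma> 1)" .
  have int: "integrable M (\<lambda>\<omega>. \<gamma> (Suc i) \<omega> - \<xi> (Suc i) \<omega>)" using i\<gamma> i\<xi>(1) by (rule Bochner_Integration.integrable_diff)
  show "integrable M (\<lambda>\<omega>. b \<bullet> (\<gamma> (Suc i) \<omega> - \<xi> (Suc i) \<omega>))" by (rule integrable_inner_right) (rule int)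
  have "expectation (\<lambda>\<omega>. b \<bullet> (\<gamma> (Suc i) \<omega> - \<xi> (Suc i) \<omega>)) = b \<bullet> expectation (\<lambda>\<omega>. \<gamma> (Suc i) \<omega> - \<xi> (Suc i) \<omega>)"
    by (rule integral_inner_right) (rule int)
  also have "expectation (\<lambda>\<omega>. \<gamma> (Suc i) \<omega> - \<xi> (Suc i) \<omega>) = expectation (\<gamma> (Suc i)) - expectation (\<xi> (Suc i))"
    by (rule Bochner_Integration.integral_diff[OF i\<gamma> i\<xi>(1)])
  finally show "expectation (\<lambda>\<omega>. b \<bullet> (\<gamma> (Suc i) \<omega> - \<xi> (Suc i) \<omega>)) = b \<bullet> expectation (\<gamma> 1)"
    by (simp only: E i\<xi>(2) diff_zero)
qed

text \<open>The mean of the excess step is \<open>E \<gamma> 1\<close>, as the coin is independent of \<open>\<gamma>\<close> and \<open>\<xi>\<close>, and \<open>\<xi>\<close> is centered.\<close>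

lemma excess_component_L1:
  assumes b: "b \<in> Basis"
  shows "small_vs (\<lambda>n. sqrt (real n))
    (\<lambda>n. expectation (\<lambda>\<omega>. \<bar>b \<bullet> (excess n \<omega> - sqrt (real n) *\<^sub>R drift_coeff)\<bar>))"
proof -
  obtain K where K: "0 < K" "\<And>\<omega> n. \<omega> \<in> space M \<Longrightarrow> 1 \<le> n \<Longrightarrow> norm (\<xi> n \<omega>) \<le> K \<and> norm (\<gamma> n \<omega>) \<le> K"
    using bounded_steps by blast
  let ?g = "\<lambda>i \<omega>. b \<bullet> (\<gamma> (Suc i) \<omega> - \<xi> (Suc i) \<omega>)"
  have "small_vs (\<lambda>n. sqrt (real n)) (\<lambda>n. expectation (\<lambda>\<omega>. \<bar>(\<Sum>i<n. fresh_ind i \<omega> * (excited i \<omega> * ?g i \<omega>))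
      - 2 * C * no_return_prob M \<xi> * (b \<bullet> expectation (\<gamma> 1)) * sqrt (real n)\<bar>))"
  proof (rule excited_sum_L1[where B = "2 * K"])
    show "fresh_ind i \<in> borel_measurable (info (steps {1..i}))" for i by (rule fresh_ind_info)
    show "0 \<le> fresh_ind i \<omega>" "fresh_ind i \<omega> \<le> 1" for i \<omega> by (rule fresh_ind_bounds)+
    have g_info: "?g i \<in> borel_measurable (info {(Suc i, 0), (Suc i, 1)})" for i
    proof -
      have "noise (Suc i, 0) \<in> borel_measurable (info {(Suc i, 0), (Suc i, 1)})"
        "noise (Suc i, 1) \<in> borel_measurable (info {(Suc i, 0), (Suc i, 1)})"
        by (rule noise_info, simp)+
      then have [measurable]: "\<xi> (Suc i) \<in> borel_measurable (info {(Suc i, 0), (Suc i, 1)})"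
        "\<gamma> (Suc i) \<in> borel_measurable (info {(Suc i, 0), (Suc i, 1)})"
        by (simp_all add: noise_def)
      show ?thesis by measurable
    qed
    show "(\<lambda>\<omega>. excited i \<omega> * ?g i \<omega>) \<in> borel_measurable (info (steps {Suc i}))" for i
    proof (rule borel_measurable_times[OF excited_info(2)])
      show "?g i \<in> borel_measurable (info (steps {Suc i}))"
        by (rule info_mono[OF _ g_info]) (auto simp: steps_def)
    qed
    show "\<bar>excited i \<omega> * ?g i \<omega>\<bar> \<le> 2 * K * excited i \<omega>" if "\<omega> \<in> space M" for i \<omega>
    proof -
      have "\<bar>?g i \<omega>\<bar> \<le> norm (\<gamma> (Suc i) \<omega> - \<xi> (Suc i) \<omega>)"
        unfolding inner_commute[of b] by (rule Basis_le_norm[OF b])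
      also have "\<dots> \<le> 2 * K"
        using norm_triangle_ineq4[of "\<gamma> (Suc i) \<omega>" "\<xi> (Suc i) \<omega>"] K(2)[OF that, of "Suc i"] by simp
      finally have "excited i \<omega> * \<bar>?g i \<omega>\<bar> \<le> excited i \<omega> * (2 * K)"
        by (rule mult_left_mono) (rule excited_bounds)
      then show ?thesis using excited_bounds(1)[of i \<omega>] by (simp add: abs_mult mult.commute)
    qed
    show "expectation (\<lambda>\<omega>. excited i \<omega> * ?g i \<omega>) = p (Suc i) * (b \<bullet> expectation (\<gamma> 1))" for i
    proof -
      have "expectation (\<lambda>\<omega>. excited i \<omega> * ?g i \<omega>) = expectation (excited i) * expectation (?g i)"
        by (rule info_product_expectation(1)[OF _ _ _ excited_info(1) excited_integrable g_info
              step_increment_expectation(2)]) auto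
      then show ?thesis by (simp only: excited_expectation step_increment_expectation(1))
    qed
  qed (use K(1) fresh_weighted_L1 in auto)
  moreover have "b \<bullet> (excess n \<omega> - sqrt (real n) *\<^sub>R drift_coeff)
      = (\<Sum>i<n. fresh_ind i \<omega> * (excited i \<omega> * ?g i \<omega>))
      - 2 * C * no_return_prob M \<xi> * (b \<bullet> expectation (\<gamma> 1)) * sqrt (real n)" for n \<omega>
    by (simp add: excess_def drift_coeff_def inner_diff_right inner_sum_right mult.assoc mult.left_commute)
  ultimately show ?thesis by simp
qed

lemma excess_L1:
  "small_vs (\<lambda>n. sqrt (real n)) (\<lambda>n. expectation (\<lambda>\<omega>. norm (excess n \<omega> - sqrt (real n) *\<^sub>R drift_coeff)))"
  "integrable M (\<lambda>\<omega>. norm (excess n \<omega> - sqrt (real n) *\<^sub>R drift_coeff))"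
proof -
  obtain K where K: "0 < K" "\<And>\<omega> n. \<omega> \<in> space M \<Longrightarrow> 1 \<le> n \<Longrightarrow> norm (\<xi> n \<omega>) \<le> K \<and> norm (\<gamma> n \<omega>) \<le> K"
    using bounded_steps by blast
  have int: "integrable M (\<lambda>\<omega>. excess n \<omega> - sqrt (real n) *\<^sub>R drift_coeff)" for n
  proof (rule Bochner_Integration.integrable_diff)
    show "integrable M (excess n)"
    proof (rule integrable_bounded[OF excess_rv])
      fix \<omega> assume \<omega>: "\<omega> \<in> space M"
      show "norm (excess n \<omega>) \<le> (\<Sum>i<n. 2 * K)"
        unfolding excess_def
      proof (rule order_trans[OF norm_sum], rule sum_mono)
        fix i
        have "norm (\<gamma> (Suc i) \<omega> - \<xi> (Suc i) \<omega>) \<le> 2 * K"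
          using norm_triangle_ineq4[of "\<gamma> (Suc i) \<omega>" "\<xi> (Suc i) \<omega>"] K(2)[OF \<omega>, of "Suc i"] by simp
        then show "norm ((fresh_ind i \<omega> * excited i \<omega>) *\<^sub>R (\<gamma> (Suc i) \<omega> - \<xi> (Suc i) \<omega>)) \<le> 2 * K"
          using K(1) by (simp add: fresh_ind_def excited_def)
      qed
    qed
  qed simp
  then show "integrable M (\<lambda>\<omega>. norm (excess n \<omega> - sqrt (real n) *\<^sub>R drift_coeff))" for n by (rule integrable_norm)
  have "small_vs (\<lambda>n. sqrt (real n))
    (\<lambda>n. \<Sum>b\<in>Basis. expectation (\<lambda>\<omega>. \<bar>b \<bullet> (excess n \<omega> - sqrt (real n) *\<^sub>R drift_coeff)\<bar>))"
    by (rule small_vs_sum) (use excess_component_L1 in auto)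
  then show "small_vs (\<lambda>n. sqrt (real n)) (\<lambda>n. expectation (\<lambda>\<omega>. norm (excess n \<omega> - sqrt (real n) *\<^sub>R drift_coeff)))"
  proof (rule small_vs_mono)
    fix n
    have ib: "integrable M (\<lambda>\<omega>. \<bar>b \<bullet> (excess n \<omega> - sqrt (real n) *\<^sub>R drift_coeff)\<bar>)" for b
      by (rule integrable_abs, rule integrable_inner_right) (rule int)
    have "expectation (\<lambda>\<omega>. norm (excess n \<omega> - sqrt (real n) *\<^sub>R drift_coeff))
        \<le> expectation (\<lambda>\<omega>. \<Sum>b\<in>Basis. \<bar>b \<bullet> (excess n \<omega> - sqrt (real n) *\<^sub>R drift_coeff)\<bar>)"
    proof (rule integral_mono)
      show "integrable M (\<lambda>\<omega>. norm (excess n \<omega> - sqrt (real n) *\<^sub>R drift_coeff))"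
        using int by (rule integrable_norm)
      show "integrable M (\<lambda>\<omega>. \<Sum>b\<in>Basis. \<bar>b \<bullet> (excess n \<omega> - sqrt (real n) *\<^sub>R drift_coeff)\<bar>)"
        using ib by (rule Bochner_Integration.integrable_sum)
    qed (unfold inner_commute[of _ "excess _ _ - _"], rule norm_le_l1)
    also have "\<dots> = (\<Sum>b\<in>Basis. expectation (\<lambda>\<omega>. \<bar>b \<bullet> (excess n \<omega> - sqrt (real n) *\<^sub>R drift_coeff)\<bar>))"
      by (rule Bochner_Integration.integral_sum) (rule ib)
    finally show "expectation (\<lambda>\<omega>. norm (excess n \<omega> - sqrt (real n) *\<^sub>R drift_coeff))
        \<le> (\<Sum>b\<in>Basis. expectation (\<lambda>\<omega>. \<bar>b \<bullet> (excess n \<omega> - sqrt (real n) *\<^sub>R drift_coeff)\<bar>))" .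
  qed
qed

definition coin_sum :: "nat \<Rightarrow> 'w \<Rightarrow> real" where
  "coin_sum n \<omega> = (\<Sum>i<n. excited i \<omega>)"

lemma coin_sum_integrable: "integrable M (coin_sum n)"
  unfolding coin_sum_def by (rule Bochner_Integration.integrable_sum) (rule excited_integrable)

lemma coin_sum_L1:
  "small_vs (\<lambda>n. sqrt (real n)) (\<lambda>n. expectation (\<lambda>\<omega>. \<bar>coin_sum n \<omega> - 2 * C * sqrt (real n)\<bar>))"
proof -
  have "small_vs (\<lambda>n. sqrt (real n)) (\<lambda>n. expectation (\<lambda>\<omega>. \<bar>(\<Sum>i<n. 1 * excited i \<omega>) - 2 * C * 1 * 1 * sqrt (real n)\<bar>))"
  proof (rule excited_sum_L1[where a = "\<lambda>_ _. 1" and B = 1])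
    show "small_vs (\<lambda>n. sqrt (real n)) (\<lambda>n. expectation (\<lambda>\<omega>. \<bar>(\<Sum>i<n. 1 * p (Suc i)) - 1 * p_sum n\<bar>))"
      using small_vs_const[of "\<lambda>n. sqrt (real n)" 0] by (simp add: p_sum_def)
  qed (use excited_info(2) excited_bounds excited_expectation in auto)
  then show ?thesis by (simp add: coin_sum_def)
qed

text \<open>The excess is not monotone, but its variation is controlled by the number of successful coins, which
  is.\<close>

lemma excess_increment:
  assumes K: "\<And>n. 1 \<le> n \<Longrightarrow> norm (\<xi> n \<omega>) \<le> K \<and> norm (\<gamma> n \<omega>) \<le> K" and mk: "m \<le> k" "k \<le> m'"
  shows "norm (excess k \<omega> - excess m \<omega>) \<le> 2 * K * (coin_sum m' \<omega> - coin_sum m \<omega>)"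
proof -
  have K0: "0 \<le> K" using K[of 1] norm_ge_zero[of "\<xi> 1 \<omega>"] by linarith
  have "excess k \<omega> - excess m \<omega> = (\<Sum>i=m..<k. (fresh_ind i \<omega> * excited i \<omega>) *\<^sub>R (\<gamma> (Suc i) \<omega> - \<xi> (Suc i) \<omega>))"
    unfolding excess_def using sum_diff_nat_ivl[of 0 m k "\<lambda>i. (fresh_ind i \<omega> * excited i \<omega>) *\<^sub>R (\<gamma> (Suc i) \<omega> - \<xi> (Suc i) \<omega>)"] mk
    by (simp add: atLeast0LessThan)
  then have "norm (excess k \<omega> - excess m \<omega>)
      \<le> (\<Sum>i=m..<k. norm ((fresh_ind i \<omega> * excited i \<omega>) *\<^sub>R (\<gamma> (Suc i) \<omega> - \<xi> (Suc i) \<omega>)))"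
    by (simp only: norm_sum)
  also have "\<dots> \<le> (\<Sum>i=m..<k. 2 * K * excited i \<omega>)"
  proof (rule sum_mono)
    fix i
    have "norm (\<gamma> (Suc i) \<omega> - \<xi> (Suc i) \<omega>) \<le> 2 * K"
      using norm_triangle_ineq4[of "\<gamma> (Suc i) \<omega>" "\<xi> (Suc i) \<omega>"] K[of "Suc i"] by simp
    then show "norm ((fresh_ind i \<omega> * excited i \<omega>) *\<^sub>R (\<gamma> (Suc i) \<omega> - \<xi> (Suc i) \<omega>)) \<le> 2 * K * excited i \<omega>"
      using K0 by (simp add: fresh_ind_def excited_def)
  qed
  also have "\<dots> \<le> (\<Sum>i=m..<m'. 2 * K * excited i \<omega>)"
    using mk K0 by (intro sum_mono2 mult_nonneg_nonneg excited_bounds) auto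
  also have "\<dots> = 2 * K * (coin_sum m' \<omega> - coin_sum m \<omega>)"
    unfolding coin_sum_def sum_distrib_left[symmetric]
    using sum_diff_nat_ivl[of 0 m m' "\<lambda>i. excited i \<omega>"] mk by (simp add: atLeast0LessThan)
  finally show ?thesis .
qed

text \<open>A grid of mesh \<open>n / L\<close> makes the bounds in mean uniform: by Markov's inequality they hold with
  high probability at the finitely many grid points, and between two of them both the excess and its
  limit move little, since the coin counter is monotone.\<close>

lemma excess_close:
  assumes e: "0 < e"
  shows "\<exists>n0. \<forall>n\<ge>n0. \<exists>E\<in>events. prob E \<le> e \<and>
    (\<forall>\<omega>\<in>space M - E. \<forall>k\<le>n * H. norm (excess k \<omega> - sqrt (real k) *\<^sub>R drift_coeff) \<le> e * sqrt (real n))"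
proof -
  obtain K where K: "0 < K" "\<And>\<omega> n. \<omega> \<in> space M \<Longrightarrow> 1 \<le> n \<Longrightarrow> norm (\<xi> n \<omega>) \<le> K \<and> norm (\<gamma> n \<omega>) \<le> K"
    using bounded_steps by blast
  define G where "G = (\<lambda>k \<omega>. norm (excess k \<omega> - sqrt (real k) *\<^sub>R drift_coeff) + \<bar>coin_sum k \<omega> - 2 * C * sqrt (real k)\<bar>)"
  have G0: "0 \<le> G k \<omega>" for k \<omega> by (simp add: G_def)
  have coin_int: "integrable M (\<lambda>\<omega>. \<bar>coin_sum k \<omega> - 2 * C * sqrt (real k)\<bar>)" for k
    using coin_sum_integrable by simp
  have G_int: "integrable M (G k)" for k
    unfolding G_def by (rule Bochner_Integration.integrable_add[OF excess_L1(2) coin_int])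
  have G_rv: "G k \<in> borel_measurable M" for k using G_int by (rule borel_measurable_integrable)
  have G_small: "small_vs (\<lambda>n. sqrt (real n)) (\<lambda>n. expectation (G n))"
    using small_vs_add[OF excess_L1(1) coin_sum_L1]
    unfolding G_def by (simp only: Bochner_Integration.integral_add[OF excess_L1(2) coin_int])
  define D where "D = 4 * K * C + norm drift_coeff"
  have D: "0 \<le> D" using K(1) C_pos by (simp add: D_def)
  \<comment> \<open>Between two grid points the excess moves by \<open>2 K\<close> times the increment of the coin counter. This costs
    \<open>4 K\<close> errors \<open>\<theta>\<close> of the counter at the two end points and \<open>4 K C\<close> times the increment of the square root,
    to which the limit adds the norm of the drift; the grid is so fine that this part is below \<open>e / 2\<close>.\<close>
  define \<theta> where "\<theta> = (e / 2) / (1 + 4 * K)"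
  have \<theta>: "0 < \<theta>" "\<theta> * (1 + 4 * K) = e / 2"
  proof -
    have "0 < 1 + 4 * K" using K(1) by simp
    then show "0 < \<theta>" "\<theta> * (1 + 4 * K) = e / 2"
      using e nonzero_eq_divide_eq[of "1 + 4 * K" \<theta> "e / 2"] by (simp_all add: \<theta>_def)
  qed
  obtain L0 :: nat where "8 * D\<^sup>2 / e\<^sup>2 \<le> real L0" using real_arch_simple by blast
  moreover define L where "L = Suc L0"
  ultimately have L: "1 \<le> L" "8 * D\<^sup>2 / e\<^sup>2 \<le> real L" by auto
  \<comment> \<open>The nodes \<open>j = 0, \<dots>, H L + 1\<close>: a time \<open>k \<le> n H\<close> may be the node \<open>H L\<close> itself, and its right neighbour is
    needed, too.\<close>
  define J where "J = H * L + 2"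
  define h where "h = sqrt (real (H + 1))"
  have h: "0 < h" by (simp add: h_def)
  have J: "0 < real J" unfolding of_nat_0_less_iff by (simp add: J_def)
  define \<delta> where "\<delta> = e * \<theta> / (2 * real J * h)"
  have \<delta>: "0 < \<delta>" "real J * (\<delta> * h) = e * \<theta> / 2" using e \<theta> h J by (auto simp: \<delta>_def)
  obtain A where A: "0 \<le> A" "\<And>n. expectation (G n) \<le> \<delta> * sqrt (real n) + A"
    using small_vsD[OF G_small \<delta>(1)] by metis
  obtain n1 :: nat where n1: "(2 * real J * A / (e * \<theta>))\<^sup>2 \<le> real n1" using real_arch_simple by blast
  show ?thesis
  proof (intro exI[of _ "max L n1"] allI impI)
    fix n assume n: "max L n1 \<le> n"
    define s where "s = sqrt (real n)"
    have s: "0 < s" "s\<^sup>2 = real n" "1 \<le> n" using n L(1) by (auto simp: s_def)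
    define node where "node = (\<lambda>j. n * j div L)"
    define E where "E = (\<Union>j\<in>{..<J}. {\<omega>\<in>space M. \<theta> * s \<le> G (node j) \<omega>})"
    have ev: "{\<omega>\<in>space M. \<theta> * s \<le> G (node j) \<omega>} \<in> events" for j
    proof -
      note [measurable] = G_rv[of "node j"]
      show ?thesis by measurable
    qed
    have EG: "expectation (G (node j)) \<le> \<delta> * h * s + A" if j: "j < J" for j
    proof -
      have "n * j \<le> n * (H * L + 1)" by (rule mult_le_mono2) (use j in \<open>simp add: J_def\<close>)
      also have "\<dots> \<le> n * (H + 1) * L" using L(1) by (simp add: algebra_simps)
      finally have "node j \<le> n * (H + 1) * L div L" unfolding node_def by (rule div_le_mono)
      then have "node j \<le> n * (H + 1)" using L(1) by simp
      then have "real (node j) \<le> real (n * (H + 1))" by (rule of_nat_mono)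
      then have "sqrt (real (node j)) \<le> sqrt (real n * real (H + 1))"
        by (simp only: real_sqrt_le_iff of_nat_mult)
      then have "\<delta> * sqrt (real (node j)) \<le> \<delta> * (s * h)"
        using \<delta>(1) by (intro mult_left_mono) (auto simp: s_def h_def real_sqrt_mult)
      then show ?thesis using A(2)[of "node j"] by (simp add: algebra_simps)
    qed
    have "prob E \<le> (\<Sum>j<J. prob {\<omega>\<in>space M. \<theta> * s \<le> G (node j) \<omega>})"
      unfolding E_def by (rule finite_measure_subadditive_finite) (use ev in auto)
    also have "\<dots> \<le> (\<Sum>j<J. (\<delta> * h * s + A) / (\<theta> * s))"
    proof (rule sum_mono)
      fix j assume "j \<in> {..<J}"
      have "prob {\<omega>\<in>space M. \<theta> * s \<le> G (node j) \<omega>} \<le> expectation (G (node j)) / (\<theta> * s)"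
        by (rule integral_Markov_inequality_measure[where A = "{}"]) (use G_int G0 \<theta>(1) s(1) in auto)
      also have "\<dots> \<le> (\<delta> * h * s + A) / (\<theta> * s)"
        by (rule divide_right_mono[OF EG]) (use \<open>j \<in> {..<J}\<close> \<theta>(1) s(1) in auto)
      finally show "prob {\<omega>\<in>space M. \<theta> * s \<le> G (node j) \<omega>} \<le> (\<delta> * h * s + A) / (\<theta> * s)" .
    qed
    also have "\<dots> = (real J * (\<delta> * h) * s + real J * A) / (\<theta> * s)" by (simp add: algebra_simps)
    also have "\<dots> \<le> e"
    proof -
      have "(2 * real J * A / (e * \<theta>))\<^sup>2 \<le> real n" using n1 n by linarith
      then have "2 * real J * A / (e * \<theta>) \<le> s" unfolding s_def by (rule real_le_rsqrt)
      then have "real J * A \<le> e * \<theta> / 2 * s" using e \<theta>(1) by (simp add: field_simps)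
      then have "real J * (\<delta> * h) * s + real J * A \<le> e * (\<theta> * s)" unfolding \<delta>(2) by (simp add: algebra_simps)
      then show ?thesis using \<theta>(1) s(1) by (simp add: divide_le_eq)
    qed
    finally have probE: "prob E \<le> e" .
    have close: "norm (excess k \<omega> - sqrt (real k) *\<^sub>R drift_coeff) \<le> e * s"
      if \<omega>: "\<omega> \<in> space M - E" and k: "k \<le> n * H" for \<omega> k
    proof -
      define j where "j = k * L div n"
      have "j \<le> n * H * L div n" unfolding j_def using k by (intro div_le_mono) simp
      then have jJ: "j < J" "Suc j < J" using s(3) by (auto simp: J_def mult.assoc)
      have jn: "n * j \<le> k * L" "k * L < n * (j + 1)"
        unfolding j_def using s(3) by (simp_all add: dividend_less_times_div)
      define m where "m = node j"
      define m' where "m' = node (Suc j)"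
      have "m \<le> k * L div L" unfolding m_def node_def by (rule div_le_mono[OF jn(1)])
      then have mk: "m \<le> k" using L(1) by simp
      have "k * L div L \<le> m'" unfolding m'_def node_def by (rule div_le_mono) (use jn(2) in simp)
      then have km': "k \<le> m'" using L(1) by simp
      have gap: "real m' - real m \<le> 2 * real n / real L"
      proof -
        have "real m' \<le> real (n * Suc j) / real L" unfolding m'_def node_def by (rule of_nat_div_le_of_nat)
        moreover have "real (n * j) / real L - 1 \<le> real m"
        proof -
          have "n * j \<le> m * L + L" unfolding m_def node_def
            using div_mult_mod_eq[of "n * j" L] mod_less_divisor[of L "n * j"] L(1) by linarith
          then have "real (n * j) \<le> real (m * L + L)" by (rule of_nat_mono)
          then have "real (n * j) / real L \<le> real m + 1" using L(1) by (simp add: divide_le_eq algebra_simps)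
          then show ?thesis by simp
        qed
        moreover have "real (n * Suc j) / real L - real (n * j) / real L = real n / real L"
          by (simp add: diff_divide_distrib[symmetric] algebra_simps)
        moreover have "1 \<le> real n / real L"
        proof -
          have "real L \<le> real n" using n by simp
          then show ?thesis using L(1) by simp
        qed
        moreover have "2 * real n / real L = real n / real L + real n / real L" by simp
        ultimately show ?thesis by linarith
      qed
      define w where "w = sqrt (2 * real n / real L)"
      have w0: "0 \<le> w" by (simp add: w_def)
      have Dw: "D * w \<le> e / 2 * s"
      proof -
        have "8 * D\<^sup>2 \<le> real L * e\<^sup>2" using L(2) e by (simp add: divide_le_eq)
        then have "8 * D\<^sup>2 * real n \<le> real L * e\<^sup>2 * real n" by (rule mult_right_mono) simp
        then have "D\<^sup>2 * (2 * real n / real L) \<le> (e / 2)\<^sup>2 * real n"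
          using L(1) by (simp add: field_simps power2_eq_square)
        then have "sqrt (D\<^sup>2 * (2 * real n / real L)) \<le> sqrt ((e / 2)\<^sup>2 * real n)" by (simp only: real_sqrt_le_iff)
        then show ?thesis
          using D e unfolding real_sqrt_mult[of "D\<^sup>2"] real_sqrt_mult[of "(e / 2)\<^sup>2"] w_def s_def
          by (simp only: real_sqrt_abs)
      qed
      have sq1: "sqrt (real m') - sqrt (real m) \<le> w"
      proof -
        have "sqrt (real m') - sqrt (real m) \<le> sqrt (real m' - real m)"
          by (rule sqrt_diff_le) (use mk km' in auto)
        also have "\<dots> \<le> w" unfolding w_def by (simp only: real_sqrt_le_iff gap)
        finally show ?thesis .
      qed
      have sq2: "0 \<le> sqrt (real k) - sqrt (real m)" "sqrt (real k) - sqrt (real m) \<le> w"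
      proof -
        show "0 \<le> sqrt (real k) - sqrt (real m)" using mk by simp
        have "sqrt (real k) \<le> sqrt (real m')" using km' by simp
        then show "sqrt (real k) - sqrt (real m) \<le> w" using sq1 by linarith
      qed
      have "G m \<omega> < \<theta> * s" "G m' \<omega> < \<theta> * s"
        using \<omega> jJ unfolding E_def m_def m'_def by (auto simp: not_le)
      then have g: "norm (excess m \<omega> - sqrt (real m) *\<^sub>R drift_coeff) \<le> \<theta> * s"
        "\<bar>coin_sum m \<omega> - 2 * C * sqrt (real m)\<bar> \<le> \<theta> * s" "\<bar>coin_sum m' \<omega> - 2 * C * sqrt (real m')\<bar> \<le> \<theta> * s"
        unfolding G_def by (smt (verit) norm_ge_zero abs_ge_zero)+
      have "2 * C * (sqrt (real m') - sqrt (real m)) \<le> 2 * C * w"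
        by (rule mult_left_mono[OF sq1]) (use C_pos in simp)
      then have "coin_sum m' \<omega> - coin_sum m \<omega> \<le> 2 * (\<theta> * s) + 2 * C * w"
        using g(2,3) by (simp add: right_diff_distrib)
      then have "2 * K * (coin_sum m' \<omega> - coin_sum m \<omega>) \<le> 2 * K * (2 * (\<theta> * s) + 2 * C * w)"
        by (rule mult_left_mono) (use K(1) in simp)
      moreover have "norm (excess k \<omega> - excess m \<omega>) \<le> 2 * K * (coin_sum m' \<omega> - coin_sum m \<omega>)"
        by (rule excess_increment[OF K(2) mk km']) (use \<omega> in auto)
      moreover have "norm ((sqrt (real k) - sqrt (real m)) *\<^sub>R drift_coeff) \<le> w * norm drift_coeff"
        using sq2 by (simp add: mult_right_mono)
      moreover have "norm (excess k \<omega> - sqrt (real k) *\<^sub>R drift_coeff)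
          \<le> norm (excess k \<omega> - excess m \<omega>) + norm (excess m \<omega> - sqrt (real m) *\<^sub>R drift_coeff)
          + norm ((sqrt (real k) - sqrt (real m)) *\<^sub>R drift_coeff)"
      proof -
        have "excess k \<omega> - sqrt (real k) *\<^sub>R drift_coeff = (excess k \<omega> - excess m \<omega>)
            + (excess m \<omega> - sqrt (real m) *\<^sub>R drift_coeff) - (sqrt (real k) - sqrt (real m)) *\<^sub>R drift_coeff"
          by (simp add: algebra_simps)
        then show ?thesis
          by (metis (no_types, lifting) norm_triangle_ineq norm_triangle_ineq4 add_right_mono order_trans)
      qed
      ultimately have "norm (excess k \<omega> - sqrt (real k) *\<^sub>R drift_coeff)
          \<le> 2 * K * (2 * (\<theta> * s) + 2 * C * w) + \<theta> * s + w * norm drift_coeff"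
        using g(1) by linarith
      also have "\<dots> = \<theta> * (1 + 4 * K) * s + D * w" by (simp add: D_def algebra_simps)
      also have "\<dots> \<le> e / 2 * s + e / 2 * s" unfolding \<theta>(2) using Dw by simp
      finally show ?thesis by (simp add: field_simps)
    qed
    show "\<exists>E\<in>events. prob E \<le> e \<and>
        (\<forall>\<omega>\<in>space M - E. \<forall>k\<le>n * H. norm (excess k \<omega> - sqrt (real k) *\<^sub>R drift_coeff) \<le> e * sqrt (real n))"
    proof (intro bexI conjI ballI allI impI)
      show "E \<in> events" unfolding E_def using ev by blast
      show "prob E \<le> e" by (rule probE)
    qed (use close in \<open>simp add: s_def\<close>)
  qed
qed

end

section \<open>The invariance principle\<close>

text \<open>At the nodes next to time \<open>t\<close> the step number is within \<open>1\<close> of \<open>n t\<close>, and the square root does not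
  increase differences of size at most \<open>1\<close> beyond \<open>1\<close>; this gives the term \<open>norm c / sqrt n\<close>. Times after
  \<open>H\<close> account for the last term.\<close>

lemma polygon_close_to_translate:
  fixes x y z :: "nat \<Rightarrow> 'a::real_normed_vector"
  assumes n: "1 \<le> n" and d: "0 \<le> d" and x: "\<And>k. x k = y k + z k"
    and close: "\<And>k. k \<le> n * Suc H \<Longrightarrow> norm (z k - sqrt (real k) *\<^sub>R c) \<le> d * sqrt (real n)"
  shows "dist (polygon (real n) (\<lambda>k. x k /\<^sub>R sqrt (real n)))
      (translate (\<lambda>t. sqrt t *\<^sub>R c) (polygon (real n) (\<lambda>k. y k /\<^sub>R sqrt (real n))))
    \<le> d + norm c / sqrt (real n) + (1 / 2) ^ H"
proof (rule cpath_dist_le)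
  let ?s = "sqrt (real n)"
  have s: "0 < ?s" using n by simp
  show "0 \<le> d + norm c / ?s" using d by simp
  fix t assume t: "0 \<le> t" "t \<le> real H"
  have cont: "continuous_on {0..} (\<lambda>t. sqrt t *\<^sub>R c)" by (intro continuous_intros)
  have nt: "0 \<le> real n * t" "real n * t \<le> real (n * H)" using t by (auto intro: mult_left_mono)
  have node: "norm (z k /\<^sub>R ?s - sqrt t *\<^sub>R c) \<le> d + norm c / ?s"
    if k: "\<bar>real k - real n * t\<bar> \<le> 1" for k
  proof -
    have "real k \<le> real (n * H) + 1" using k nt by linarith
    then have "real k \<le> real (n * H + 1)" by simp
    then have "k \<le> n * H + 1" by (simp only: of_nat_le_iff)
    then have kH: "k \<le> n * Suc H" using n by simp
    have sq: "\<bar>sqrt (real k) - sqrt (real n * t)\<bar> \<le> 1"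
    proof (cases "real k \<le> real n * t")
      case True
      have "sqrt (real n * t) - sqrt (real k) \<le> sqrt (real n * t - real k)"
        by (rule sqrt_diff_le) (use True in auto)
      also have "\<dots> \<le> 1" using k True by (intro real_le_lsqrt) auto
      finally show ?thesis using True by simp
    next
      case False
      have "sqrt (real k) - sqrt (real n * t) \<le> sqrt (real k - real n * t)"
        by (rule sqrt_diff_le) (use False nt in auto)
      also have "\<dots> \<le> 1" using k False by (intro real_le_lsqrt) auto
      finally show ?thesis using False by simp
    qed
    have "z k - (?s * sqrt t) *\<^sub>R c = (z k - sqrt (real k) *\<^sub>R c) + (sqrt (real k) - sqrt (real n * t)) *\<^sub>R c"
      by (simp add: algebra_simps real_sqrt_mult)
    also have "norm \<dots> \<le> d * ?s + 1 * norm c"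
      using close[OF kH] mult_right_mono[OF sq, of "norm c"]
      by (intro order_trans[OF norm_triangle_ineq] add_mono) simp_all
    finally have "norm (z k - (?s * sqrt t) *\<^sub>R c) / ?s \<le> (d * ?s + norm c) / ?s"
      using s by (intro divide_right_mono) auto
    moreover have "norm (z k /\<^sub>R ?s - sqrt t *\<^sub>R c) = norm (z k - (?s * sqrt t) *\<^sub>R c) / ?s"
    proof -
      have "z k /\<^sub>R ?s - sqrt t *\<^sub>R c = (z k - (?s * sqrt t) *\<^sub>R c) /\<^sub>R ?s"
        using s by (simp add: scaleR_diff_right)
      then show ?thesis using s by (simp add: divide_inverse mult.commute)
    qed
    moreover have "(d * ?s + norm c) / ?s = d + norm c / ?s" using s by (simp add: add_divide_distrib)
    ultimately show ?thesis by simp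
  qed
  have fl: "of_int \<lfloor>real n * t\<rfloor> \<le> real n * t" "real n * t < of_int \<lfloor>real n * t\<rfloor> + 1" by linarith+
  have rn: "real (nat \<lfloor>real n * t\<rfloor>) = of_int \<lfloor>real n * t\<rfloor>" using nt(1) by simp
  have "norm (interpolate (\<lambda>k. z k /\<^sub>R ?s) (real n * t) - sqrt t *\<^sub>R c) \<le> d + norm c / ?s"
  proof (rule interpolate_dist_le[OF nt(1)])
    show "norm (z (nat \<lfloor>real n * t\<rfloor>) /\<^sub>R ?s - sqrt t *\<^sub>R c) \<le> d + norm c / ?s"
      by (rule node) (unfold rn, use fl in linarith)
    show "norm (z (nat \<lfloor>real n * t\<rfloor> + 1) /\<^sub>R ?s - sqrt t *\<^sub>R c) \<le> d + norm c / ?s"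
      by (rule node) (unfold of_nat_add rn, use fl in linarith)
  qed
  moreover have "interpolate (\<lambda>k. x k /\<^sub>R ?s) (real n * t)
      = interpolate (\<lambda>k. y k /\<^sub>R ?s) (real n * t) + interpolate (\<lambda>k. z k /\<^sub>R ?s) (real n * t)"
    unfolding interpolate_add[symmetric] by (simp only: x scaleR_add_right)
  ultimately show "dist (path_apply (polygon (real n) (\<lambda>k. x k /\<^sub>R ?s)) t)
      (path_apply (translate (\<lambda>t. sqrt t *\<^sub>R c) (polygon (real n) (\<lambda>k. y k /\<^sub>R ?s))) t) \<le> d + norm c / ?s"
    using t(1) by (simp add: path_apply_translate[OF cont] path_apply_polygon dist_norm algebra_simps)
qed

context critical_erw
begin

definition step_covariance :: "real^'d^'d" where
  "step_covariance = (\<chi> i j. expectation (\<lambda>\<omega>. \<xi> 1 \<omega> $ i * \<xi> 1 \<omega> $ j))"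

lemma step_covariance_form: "expectation (\<lambda>\<omega>. (u \<bullet> \<xi> 1 \<omega>)\<^sup>2) = u \<bullet> (step_covariance *v u)"
proof -
  have int: "integrable M (\<lambda>\<omega>. \<xi> 1 \<omega> $ i * \<xi> 1 \<omega> $ j)" for i j by (rule finite_covariance_\<xi>) simp
  have "(u \<bullet> \<xi> 1 \<omega>)\<^sup>2 = (\<Sum>i\<in>UNIV. \<Sum>j\<in>UNIV. (u $ i * u $ j) * (\<xi> 1 \<omega> $ i * \<xi> 1 \<omega> $ j))" for \<omega>
    by (simp add: inner_vec_def power2_eq_square sum_product mult_ac)
  then have "expectation (\<lambda>\<omega>. (u \<bullet> \<xi> 1 \<omega>)\<^sup>2)
      = (\<Sum>i\<in>UNIV. \<Sum>j\<in>UNIV. (u $ i * u $ j) * expectation (\<lambda>\<omega>. \<xi> 1 \<omega> $ i * \<xi> 1 \<omega> $ j))"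
    using int by simp
  also have "\<dots> = u \<bullet> (step_covariance *v u)"
    by (simp add: step_covariance_def inner_vec_def matrix_vector_mult_def sum_distrib_left mult_ac)
  finally show ?thesis .
qed

lemma covariance_matrix_step_covariance: "covariance_matrix step_covariance"
  unfolding covariance_matrix_def
proof (intro conjI allI)
  show "transpose step_covariance = step_covariance"
    by (simp add: transpose_def step_covariance_def vec_eq_iff mult.commute)
  show "0 \<le> u \<bullet> (step_covariance *v u)" for u
    unfolding step_covariance_form[symmetric] by simp
qed

text \<open>The polygon of \<open>X\<close> is close to that of the walk with steps \<open>\<xi>\<close>, translated by the drift, and Donsker's
  theorem applies to the latter with the test function composed with the translation.\<close>

theorem invariance_principle:
  "\<exists>(N :: (real^'d) cpath measure) S W. brownian_motion N S W \<and>
     converges_in_distribution M (\<lambda>n \<omega>. mk_cpath (rescaled X n \<omega>))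
       N (\<lambda>\<omega>. mk_cpath (\<lambda>t. W t \<omega> + sqrt t *\<^sub>R drift_coeff))"
proof -
  obtain K where K: "0 < K" "\<And>\<omega> n. \<omega> \<in> space M \<Longrightarrow> 1 \<le> n \<Longrightarrow> norm (\<xi> n \<omega>) \<le> K \<and> norm (\<gamma> n \<omega>) \<le> K"
    using bounded_steps by blast
  obtain N :: "(real^'d) cpath measure" and W where W: "brownian_motion N step_covariance W"
    by (rule brownian_motion_exists[OF covariance_matrix_step_covariance])
  interpret N: prob_space N using W by (simp add: brownian_motion_def)
  have W_rv: "W t \<in> borel_measurable N" if "0 \<le> t" for t
    using W that by (simp add: brownian_motion_def)
  have W_cont: "continuous_on {0..} (\<lambda>t. W t \<omega>)" if "\<omega> \<in> space N" for \<omega>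
    using W that by (simp add: brownian_motion_def)
  interpret walk: centered_walk M "\<lambda>i. \<xi> (Suc i)" K
  proof
    show "indep_vars (\<lambda>_. borel) (\<lambda>i. \<xi> (Suc i)) UNIV"
      by (rule indep_vars_inj_reindex[OF indep_\<xi>]) auto
    show "distr M borel (\<xi> (Suc i)) = distr M borel (\<xi> (Suc 0))" for i
    proof -
      have "distr M borel (\<xi> (Suc i)) = distr M borel (\<xi> 1)"
        by (rule iid_\<xi>[unfolded iid_def, THEN conjunct2, rule_format]) simp
      then show ?thesis by (simp only: One_nat_def)
    qed
    show "norm (\<xi> (Suc i) \<omega>) \<le> K" if "\<omega> \<in> space M" for i \<omega>
      using K(2)[OF that, of "Suc i"] by simp
    show "(\<integral>\<omega>. u \<bullet> \<xi> (Suc 0) \<omega> \<partial>M) = 0" for u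
    proof -
      have "integrable M (\<xi> (Suc 0))" "expectation (\<xi> (Suc 0)) = 0" using mean_\<xi>[of "Suc 0"] by auto
      then show ?thesis by (simp only: integral_inner_right inner_zero_right)
    qed
  qed
  define e where "e = (\<lambda>t. sqrt t *\<^sub>R drift_coeff)"
  have e: "continuous_on {0..} e" unfolding e_def by (intro continuous_intros)
  define Z where "Z = (\<lambda>n \<omega>. mk_cpath (rescaled X n \<omega>))"
  define B where "B = (\<lambda>n \<omega>. translate e (walk.walk_path n \<omega>))"
  define Y where "Y = (\<lambda>\<omega>. mk_cpath (\<lambda>t. W t \<omega> + e t))"
  have Y_apply: "path_apply (Y \<omega>) t = W t \<omega> + e t" if "\<omega> \<in> space N" "0 \<le> t" for \<omega> t
    unfolding Y_def by (rule path_apply_mk_cpath[OF continuous_on_add[OF W_cont e]]) (use that in auto)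
  have Y_eq: "Y \<omega> = translate e (mk_cpath (\<lambda>t. W t \<omega>))" if "\<omega> \<in> space N" for \<omega>
    by (rule cpath_eqI) (simp add: Y_apply[OF that] path_apply_translate[OF e] path_apply_mk_cpath[OF W_cont[OF that]])
  have Z_rv: "Z n \<in> borel_measurable M" for n
    unfolding Z_def mk_cpath_rescaled by (rule measurable_polygon) (use X_rv in auto)
  have B_rv: "B n \<in> borel_measurable M" for n
    unfolding B_def
    by (rule measurable_compose[OF walk.walk_path_measurable borel_measurable_continuous_onI[OF continuous_on_translate[OF e]]])
  have Y_rv: "Y \<in> borel_measurable N"
  proof (rule cpath_measurableI)
    fix t :: real assume t: "0 \<le> t"
    have "(\<lambda>\<omega>. W t \<omega> + e t) \<in> borel_measurable N" using W_rv[OF t] by simp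
    then show "(\<lambda>\<omega>. path_apply (Y \<omega>) t) \<in> borel_measurable N"
      by (rule measurable_cong[THEN iffD1, rotated]) (simp add: Y_apply t)
  qed
  have "converges_in_distribution M Z N Y"
  proof (rule converges_in_distributionI_lipschitz[OF prob_space_axioms N.prob_space_axioms Z_rv Y_rv])
    fix h :: "(real^'d) cpath \<Rightarrow> real" and lam c
    assume h: "lam-lipschitz_on UNIV h" "\<And>x. \<bar>h x\<bar> \<le> c"
    have lam: "0 \<le> lam" by (rule lipschitz_on_nonneg[OF h(1)])
    have c: "0 \<le> c" using h(2)[of undefined] by linarith
    have "(\<lambda>n. \<integral>\<omega>. h (translate e (walk.walk_path n \<omega>)) \<partial>M)
        \<longlonglongrightarrow> (\<integral>\<omega>. h (translate e (mk_cpath (\<lambda>t. W t \<omega>))) \<partial>N)"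
    proof (rule walk.donsker[OF W, where h = "\<lambda>f. h (translate e f)"])
      show "lam-lipschitz_on UNIV (\<lambda>f. h (translate e f))"
      proof (rule lipschitz_onI[OF _ lam])
        show "dist (h (translate e f)) (h (translate e g)) \<le> lam * dist f g" for f g
          using lipschitz_onD[OF h(1), of "translate e f" "translate e g"] by (simp only: dist_translate[OF e] UNIV_I)
      qed
      show "(\<integral>\<omega>. (u \<bullet> \<xi> (Suc 0) \<omega>)\<^sup>2 \<partial>M) = u \<bullet> (step_covariance *v u)" for u
        using step_covariance_form[of u] by (simp only: One_nat_def)
    qed (rule h)
    moreover have "(\<integral>\<omega>. h (translate e (mk_cpath (\<lambda>t. W t \<omega>))) \<partial>N) = (\<integral>\<omega>. h (Y \<omega>) \<partial>N)"
      by (rule Bochner_Integration.integral_cong) (simp_all add: Y_eq)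
    ultimately have lim: "(\<lambda>n. \<integral>\<omega>. h (B n \<omega>) \<partial>M) \<longlonglongrightarrow> (\<integral>\<omega>. h (Y \<omega>) \<partial>N)"
      by (simp only: B_def)
    have "(\<lambda>n. (\<integral>\<omega>. h (Z n \<omega>) \<partial>M) - (\<integral>\<omega>. h (B n \<omega>) \<partial>M)) \<longlonglongrightarrow> 0"
    proof (rule tendstoI)
      fix \<epsilon> :: real assume \<epsilon>: "0 < \<epsilon>"
      \<comment> \<open>Three errors \<open>d\<close> in the path metric, and the exceptional event of probability \<open>d\<close>.\<close>
      define b where "b = lam * 3 + 2 * c + 1"
      have b: "0 < b" using lam c by (simp add: b_def)
      define d where "d = \<epsilon> / b"
      have d: "0 < d" "b * d = \<epsilon>" using b \<epsilon> by (simp_all add: d_def)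
      obtain H where H: "(1 / 2 :: real) ^ H < d"
        using real_arch_pow_inv[of d "1 / 2"] d(1) by auto
      obtain n0 where n0: "\<And>n. n0 \<le> n \<Longrightarrow> \<exists>E\<in>events. prob E \<le> d \<and>
          (\<forall>\<omega>\<in>space M - E. \<forall>k\<le>n * Suc H. norm (excess k \<omega> - sqrt (real k) *\<^sub>R drift_coeff) \<le> d * sqrt (real n))"
        using excess_close[OF d(1), of "Suc H"] by blast
      have "(\<lambda>n. norm drift_coeff / sqrt (real n)) \<longlonglongrightarrow> 0"
        by (intro tendsto_divide_0[OF tendsto_const] filterlim_at_top_imp_at_infinity
            filterlim_compose[OF sqrt_at_top filterlim_real_sequentially])
      then have "\<forall>\<^sub>F n in sequentially. norm drift_coeff / sqrt (real n) < d"
        by (rule order_tendstoD(2)) (rule d(1))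
      then have "\<forall>\<^sub>F n in sequentially. norm drift_coeff / sqrt (real n) < d \<and> max n0 1 \<le> n"
        by (rule eventually_conj[OF _ eventually_ge_at_top])
      then show "\<forall>\<^sub>F n in sequentially. dist ((\<integral>\<omega>. h (Z n \<omega>) \<partial>M) - (\<integral>\<omega>. h (B n \<omega>) \<partial>M)) 0 < \<epsilon>"
      proof eventually_elim
        case (elim n)
        then have n: "n0 \<le> n" "1 \<le> n" "norm drift_coeff / sqrt (real n) \<le> d" by auto
        obtain E where E: "E \<in> events" "prob E \<le> d"
          "\<And>\<omega> k. \<omega> \<in> space M \<Longrightarrow> \<omega> \<notin> E \<Longrightarrow> k \<le> n * Suc H \<Longrightarrow>
             norm (excess k \<omega> - sqrt (real k) *\<^sub>R drift_coeff) \<le> d * sqrt (real n)"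
          using n0[OF n(1)] by blast
        have dist_le: "dist (Z n \<omega>) (B n \<omega>) \<le> 3 * d" if \<omega>: "\<omega> \<in> space M" "\<omega> \<notin> E" for \<omega>
        proof -
          have "dist (Z n \<omega>) (B n \<omega>) \<le> d + norm drift_coeff / sqrt (real n) + (1 / 2) ^ H"
            unfolding Z_def B_def mk_cpath_rescaled walk.walk_path_def e_def
          proof (rule polygon_close_to_translate[OF n(2)])
            show "X k \<omega> = walk.walk_sum k \<omega> + excess k \<omega>" for k
              using X_decomposition[OF \<omega>(1), of k] by (simp only: base_sum_def walk.walk_sum_def)
            show "norm (excess k \<omega> - sqrt (real k) *\<^sub>R drift_coeff) \<le> d * sqrt (real n)" if "k \<le> n * Suc H" for k
              by (rule E(3)[OF \<omega> that])
          qed (use d(1) in simp)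
          then show ?thesis using n(3) H by linarith
        qed
        have "\<bar>(\<integral>\<omega>. h (Z n \<omega>) \<partial>M) - (\<integral>\<omega>. h (B n \<omega>) \<partial>M)\<bar> \<le> lam * (3 * d) + 2 * c * prob E"
          by (rule integral_lipschitz_diff_le[OF Z_rv B_rv h E(1) _ dist_le]) (use d(1) in auto)
        also have "\<dots> \<le> lam * (3 * d) + 2 * c * d"
          by (intro add_left_mono mult_left_mono E(2)) (use c in simp)
        also have "\<dots> < b * d" using d(1) by (simp add: b_def algebra_simps)
        finally show ?case by (simp add: dist_real_def d(2))
      qed
    qed
    with lim show "(\<lambda>n. \<integral>\<omega>. h (Z n \<omega>) \<partial>M) \<longlonglongrightarrow> (\<integral>\<omega>. h (Y \<omega>) \<partial>N)"
      by (rule Lim_transform)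
  qed
  with W have "brownian_motion N step_covariance W \<and> converges_in_distribution M Z N Y" by (rule conjI)
  then show ?thesis unfolding Z_def Y_def e_def by (intro exI)
qed

end

theorem theorem2p3:
  fixes M :: "'w measure" and F :: "nat \<Rightarrow> 'w measure"
    and \<xi> \<gamma> X :: "nat \<Rightarrow> 'w \<Rightarrow> real^'d" and U :: "nat \<Rightarrow> 'w \<Rightarrow> real"
    and l :: "real^'d" and C :: real
  assumes "CARD('d) \<ge> 2"
    and "C > 0"
    and "excited_random_walk M F \<xi> \<gamma> U (\<lambda>n. min (C * real n powr (- 1 / 2)) 1) l X"
    and "AE \<omega> in M. liminf (\<lambda>n. ereal (real (card (walk_range X n \<omega>)) / real n))
           \<ge> ereal (no_return_prob M \<xi>)"
  shows "\<exists>(N :: (real^'d) cpath measure) S W.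
           brownian_motion N S W \<and>
           converges_in_distribution
             M (\<lambda>n \<omega>. mk_cpath (rescaled X n \<omega>))
             N (\<lambda>\<omega>. mk_cpath (\<lambda>t. W t \<omega> +
                  (2 * C * no_return_prob M \<xi> * sqrt t) *\<^sub>R prob_space.expectation M (\<gamma> 1)))"
proof -
  interpret critical_erw M F \<xi> \<gamma> U "\<lambda>n. min (C * real n powr (- 1 / 2)) 1" l X C
  proof (rule critical_erw.intro[OF assms(3)], rule critical_erw_axioms.intro)
    fix n :: nat assume "1 \<le> n"
    then have "real n powr (- 1 / 2) = inverse (sqrt (real n))"
      using powr_minus[of "real n" "1 / 2"] by (simp add: powr_half_sqrt)
    then show "min (C * real n powr (- 1 / 2)) 1 = min (C / sqrt (real n)) 1"
      by (simp only: divide_inverse)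
  qed (rule assms)+
  have eq: "sqrt t *\<^sub>R drift_coeff = (2 * C * no_return_prob M \<xi> * sqrt t) *\<^sub>R expectation (\<gamma> 1)" for t
    unfolding drift_coeff_def scaleR_scaleR by (simp only: mult.commute)
  show ?thesis using invariance_principle unfolding eq .
qed

end
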